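(* Let $a_1<a_2<a_3<a_4$ be real numbers, let $\delta>0$ be a small fixed number, and let $H_T$, $L_S$, $K_-$, $K_+$ and the singular system $\{f_n,g_n;\sigma_n\}_{n\in\mathbb{Z}}$ of $H_T$, with $L_S f_n=\lambda_n f_n$, be as in the context. Let the eigenvalues $\lambda_n$ of $L_S$ be enumerated such that $\lambda_n\to+\infty$ as $n\to+\infty$, $\lambda_n\to-\infty$ as $n\to-\infty$, and $$\sqrt{\lambda_n}=\frac{n\pi}{K_-}+\mathcal{O}\big(n^{-1/2+\delta}\big),\qquad n\in\mathbb{N},\ n\to\infty .$$ Then the singular values $\sigma_n$ of $H_T$ that accumulate at zero behave asymptotically like $$\sigma_n = 2\,e^{-n\pi K_+/K_-}\,\big(1+\mathcal{O}(n^{-1/2+\delta})\big),\qquad n\to\infty .$$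
   Context: Fix real numbers $a_1<a_2<a_3<a_4$. The truncated Hilbert transform with overlap is the operator $H_T:L^2([a_2,a_4])\to L^2([a_1,a_3])$, $$(H_Tf)(x)=\frac1\pi\,\mathrm{p.v.}\!\int_{a_2}^{a_4}\frac{f(y)}{y-x}\,dy,\qquad x\in(a_1,a_3),$$ where p.v. denotes the principal value. Put $P(x)=\prod_{j=1}^4 (x-a_j)$, $\sigma=\frac14\sum_{j=1}^4 a_j$, and $$K_-=\int_{a_1}^{a_2}\frac{dx}{\sqrt{-P(x)}},\qquad K_+=\int_{a_2}^{a_3}\frac{dx}{\sqrt{P(x)}} .$$ Let $L\psi(x) = (P(x)\psi'(x))' + 2(x-\sigma)^2\psi(x)$. Let $D_{\max}$ be the set of functions $\psi:(a_2,a_3)\cup(a_3,a_4)\to\mathbb{C}$ such that on each of the intervals $(a_2,a_3)$ and $(a_3,a_4)$ the functions $\psi$ and $P\psi'$ are locally absolutely continuous, and $\psi, L\psi\in L^2([a_2,a_4])$. Define the Lagrange form $[u,v]=uP\overline{v}'-\overline{v}Pu'$; $[u,v](a_j^{\pm})$ denotes the one-sided limit at $a_j$ from the right ($+$) or left ($-$). Let $u(y)=1$ and $v(y)=\sum_{i=1}^4\prod_{j\neq i}\frac{1}{a_i-a_j}\ln|y-a_i|$ (with $j\in\{1,\dots,4\}$). The operator $L_S$ acts by $L_S\psi=L\psi$ on $$D(L_S)=\{\psi\in D_{\max}:\ [\psi,u](a_2^+)=[\psi,u](a_4^-)=0,\ [\psi,u](a_3^-)=[\psi,u](a_3^+),\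 [\psi,v](a_3^-)=[\psi,v](a_3^+)\}.$$ Known facts: $L_S$ is self-adjoint on $L^2([a_2,a_4])$ with purely discrete real spectrum, unbounded above and below. There is a singular value decomposition $\{f_n,g_n;\sigma_n\}_{n\in\mathbb{Z}}$ of $H_T$, i.e. $H_Tf_n=\sigma_n g_n$, $H_T^*g_n=\sigma_n f_n$, $\sigma_n>0$, with $\|f_n\|_{L^2([a_2,a_4])}=\|g_n\|_{L^2([a_1,a_3])}=1$, in which the $f_n$ are eigenfunctions of $L_S$, $L_Sf_n=\lambda_nf_n$, and form an orthonormal basis of $L^2([a_2,a_4])$. The singular values accumulate exactly at $0$ and $1$; the indexing convention is $\sigma_n\to0$ as $n\to+\infty$ and $\sigma_n\to1$ as $n\to-\infty$. An enumeration of the eigenvalues with the asymptotics required in the claim can be chosen. The implied constants in $\mathcal{O}$ may depend on $a_1,\dots,a_4$ and $\delta$. *)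

theory Defs
  imports "HOL-Analysis.Analysis" "HOL-Library.Landau_Symbols"
begin

text \<open>Elements of $L^2(S)$ are represented by functions, so equality in $L^2(S)$ is equality
  almost everywhere on \<open>S\<close>; the values of a representative outside \<open>S\<close> are irrelevant.\<close>

definition L2_on :: "real set \<Rightarrow> (real \<Rightarrow> complex) set" where
  "L2_on S = {f. f \<in> borel_measurable (lebesgue_on S) \<and>
                 integrable (lebesgue_on S) (\<lambda>x. (norm (f x))\<^sup>2)}"

definition L2_inner_on :: "real set \<Rightarrow> (real \<Rightarrow> complex) \<Rightarrow> (real \<Rightarrow> complex) \<Rightarrow> complex" where
  "L2_inner_on S f g = (LINT x | lebesgue_on S. f x * cnj (g x))"

definition L2_norm_on :: "real set \<Rightarrow> (real \<Rightarrow> complex) \<Rightarrow> real" where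
  "L2_norm_on S f = sqrt (LINT x | lebesgue_on S. (norm (f x))\<^sup>2)"

definition L2_eq_on :: "real set \<Rightarrow> (real \<Rightarrow> complex) \<Rightarrow> (real \<Rightarrow> complex) \<Rightarrow> bool" where
  "L2_eq_on S f g \<longleftrightarrow> (AE x in lebesgue_on S. f x = g x)"

definition L2_orthonormal_basis :: "real set \<Rightarrow> (int \<Rightarrow> real \<Rightarrow> complex) \<Rightarrow> bool" where
  "L2_orthonormal_basis S f \<longleftrightarrow>
     (\<forall>n. f n \<in> L2_on S) \<and>
     (\<forall>m n. L2_inner_on S (f m) (f n) = (if m = n then 1 else 0)) \<and>
     (\<forall>h \<in> L2_on S. \<forall>e > 0. \<exists>N c. finite N \<and>
        L2_norm_on S (\<lambda>x. h x - (\<Sum>n\<in>N. c n * f n x)) < e)"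

text \<open>\<open>L2_adjoint_eq A B T g h\<close> says that $T^* g = h$ for an operator
  $T : L^2(A) \to L^2(B)$.\<close>

definition L2_adjoint_eq ::
  "real set \<Rightarrow> real set \<Rightarrow> ((real \<Rightarrow> complex) \<Rightarrow> (real \<Rightarrow> complex)) \<Rightarrow>
     (real \<Rightarrow> complex) \<Rightarrow> (real \<Rightarrow> complex) \<Rightarrow> bool" where
  "L2_adjoint_eq A B T g h \<longleftrightarrow> g \<in> L2_on B \<and> h \<in> L2_on A \<and>
     (\<forall>f \<in> L2_on A. L2_inner_on B (T f) g = L2_inner_on A f h)"

text \<open>The four points are \<open>a 1 < a 2 < a 3 < a 4\<close>; other values of \<open>a\<close> are never used.
  For $f \in L^2([a_2,a_4])$ the principal value exists for almost every \<open>x\<close>; on the remaining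
  null set \<^const>\<open>Lim\<close> returns an unspecified value.\<close>

definition HT :: "(nat \<Rightarrow> real) \<Rightarrow> (real \<Rightarrow> complex) \<Rightarrow> real \<Rightarrow> complex" where
  "HT a f x = of_real (1 / pi) *
     Lim (at_right 0)
       (\<lambda>e. LINT y : {y \<in> {a 2..a 4}. \<bar>y - x\<bar> > e} | lebesgue. f y / of_real (y - x))"

definition HT_singular_system ::
  "(nat \<Rightarrow> real) \<Rightarrow> (int \<Rightarrow> real \<Rightarrow> complex) \<Rightarrow> (int \<Rightarrow> real \<Rightarrow> complex) \<Rightarrow> (int \<Rightarrow> real) \<Rightarrow> bool" where
  "HT_singular_system a f g s \<longleftrightarrow>
     L2_orthonormal_basis {a 2..a 4} f \<and>
     (\<forall>n. g n \<in> L2_on {a 1..a 3} \<and> L2_norm_on {a 1..a 3} (g n) = 1 \<and> s n > 0 \<and>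
        L2_eq_on {a 1..a 3} (HT a (f n)) (\<lambda>x. of_real (s n) * g n x) \<and>
        L2_adjoint_eq {a 2..a 4} {a 1..a 3} (HT a) (g n) (\<lambda>y. of_real (s n) * f n y))"

definition PP :: "(nat \<Rightarrow> real) \<Rightarrow> real \<Rightarrow> real" where
  "PP a x = (\<Prod>j\<in>{1..4}. x - a j)"

definition mean4 :: "(nat \<Rightarrow> real) \<Rightarrow> real" where
  "mean4 a = (\<Sum>j\<in>{1..4}. a j) / 4"

definition K_minus :: "(nat \<Rightarrow> real) \<Rightarrow> real" where
  "K_minus a = (LINT x : {a 1..a 2} | lebesgue. 1 / sqrt (- PP a x))"

definition K_plus :: "(nat \<Rightarrow> real) \<Rightarrow> real" where
  "K_plus a = (LINT x : {a 2..a 3} | lebesgue. 1 / sqrt (PP a x))"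

definition abs_cont_on :: "real \<Rightarrow> real \<Rightarrow> (real \<Rightarrow> complex) \<Rightarrow> bool" where
  "abs_cont_on c d f \<longleftrightarrow>
     (\<forall>e > 0. \<exists>\<eta> > 0. \<forall>D :: (real \<times> real) set.
        finite D \<and> (\<forall>(x, y) \<in> D. c \<le> x \<and> x \<le> y \<and> y \<le> d) \<and>
        pairwise (\<lambda>p q. {fst p<..<snd p} \<inter> {fst q<..<snd q} = {}) D \<and>
        (\<Sum>(x, y) \<in> D. y - x) < \<eta>
        \<longrightarrow> (\<Sum>(x, y) \<in> D. norm (f y - f x)) < e)"

definition loc_abs_cont_on :: "real \<Rightarrow> real \<Rightarrow> (real \<Rightarrow> complex) \<Rightarrow> bool" where
  "loc_abs_cont_on l r f \<longleftrightarrow> (\<forall>c d. l < c \<and> c \<le> d \<and> d < r \<longrightarrow> abs_cont_on c d f)"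

definition vderiv :: "(real \<Rightarrow> complex) \<Rightarrow> real \<Rightarrow> complex" where
  "vderiv \<psi> x = vector_derivative \<psi> (at x)"

definition quasi_deriv :: "(nat \<Rightarrow> real) \<Rightarrow> (real \<Rightarrow> complex) \<Rightarrow> real \<Rightarrow> complex" where
  "quasi_deriv a \<psi> x = of_real (PP a x) * vderiv \<psi> x"

definition Lop :: "(nat \<Rightarrow> real) \<Rightarrow> (real \<Rightarrow> complex) \<Rightarrow> real \<Rightarrow> complex" where
  "Lop a \<psi> x = vderiv (quasi_deriv a \<psi>) x + of_real (2 * (x - mean4 a)\<^sup>2) * \<psi> x"

text \<open>Local absolute continuity of $P\psi'$ presupposes that $\psi'$ exists at every point of the
  open interval. As \<^const>\<open>vector_derivative\<close> is total, this has to be said explicitly. Since \<open>P\<close>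
  has no zeros there, reading $\psi'$ in the almost-everywhere sense gives the same class. The outer
  derivative in \<^const>\<open>Lop\<close> exists only almost everywhere.\<close>

definition D_max :: "(nat \<Rightarrow> real) \<Rightarrow> (real \<Rightarrow> complex) set" where
  "D_max a = {\<psi>.
     (\<forall>(l, r) \<in> {(a 2, a 3), (a 3, a 4)}.
        loc_abs_cont_on l r \<psi> \<and>
        (\<forall>x \<in> {l<..<r}. \<psi> differentiable (at x)) \<and>
        loc_abs_cont_on l r (quasi_deriv a \<psi>)) \<and>
     \<psi> \<in> L2_on {a 2..a 4} \<and> Lop a \<psi> \<in> L2_on {a 2..a 4}}"

definition lagrange :: "(nat \<Rightarrow> real) \<Rightarrow> (real \<Rightarrow> complex) \<Rightarrow> (real \<Rightarrow> complex) \<Rightarrow> real \<Rightarrow> complex" where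
  "lagrange a u v x = u x * of_real (PP a x) * vderiv (\<lambda>t. cnj (v t)) x
                      - cnj (v x) * of_real (PP a x) * vderiv u x"

definition u_bc :: "real \<Rightarrow> complex" where
  "u_bc y = 1"

definition v_bc :: "(nat \<Rightarrow> real) \<Rightarrow> real \<Rightarrow> complex" where
  "v_bc a y = of_real (\<Sum>i\<in>{1..4}. (\<Prod>j\<in>{1..4} - {i}. 1 / (a i - a j)) * ln \<bar>y - a i\<bar>)"

definition D_LS :: "(nat \<Rightarrow> real) \<Rightarrow> (real \<Rightarrow> complex) set" where
  "D_LS a = {\<psi> \<in> D_max a.
     (lagrange a \<psi> u_bc \<longlongrightarrow> 0) (at_right (a 2)) \<and>
     (lagrange a \<psi> u_bc \<longlongrightarrow> 0) (at_left (a 4)) \<and>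
     (\<exists>l. (lagrange a \<psi> u_bc \<longlongrightarrow> l) (at_left (a 3)) \<and>
          (lagrange a \<psi> u_bc \<longlongrightarrow> l) (at_right (a 3))) \<and>
     (\<exists>l. (lagrange a \<psi> (v_bc a) \<longlongrightarrow> l) (at_left (a 3)) \<and>
          (lagrange a \<psi> (v_bc a) \<longlongrightarrow> l) (at_right (a 3)))}"

definition LS_eigenfunction :: "(nat \<Rightarrow> real) \<Rightarrow> real \<Rightarrow> (real \<Rightarrow> complex) \<Rightarrow> bool" where
  "LS_eigenfunction a \<mu> \<psi> \<longleftrightarrow>
     \<psi> \<in> D_LS a \<and> \<not> L2_eq_on {a 2..a 4} \<psi> (\<lambda>_. 0) \<and>
     L2_eq_on {a 2..a 4} (Lop a \<psi>) (\<lambda>x. of_real \<mu> * \<psi> x)"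

end

theory Submission
  imports Defs "HOL-Probability.Distributions" "HOL-Real_Asymp.Real_Asymp"
begin

text \<open>
  Let \<open>f\<close> be an eigenfunction with eigenvalue $\Lambda$, and let $q = P f'$. At $a_2$ the function
  has a limit $f_2$ and $q$ tends to zero; at $a_3$ it has a logarithmic singularity with the same
  expansion $f \approx (q_3/P'(a_3)) \ln|y - a_3| + c$ on both sides. The proof computes the ratio
  $q_3/f_2$ in two ways.

  The first way uses the Hilbert transform. The Cauchy transform of \<open>f\<close> satisfies the differential
  equation of \<open>f\<close> off the real axis (\<open>cauchy_ode\<close>). Pairing it with \<open>f\<close> across $(a_2,a_3)$ gives a
  conserved quantity, and its values at the two ends are compared in \<open>product_identity\<close>:
  $h_3 q_3 = f_2^2 P'(a_2)/\pi$, where $h_3$ is the limit of $H_T f$ at $a_3$ from the left. A second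
  relation, $h_3 = -\pi\sigma^2 q_3/P'(a_3)$, comes from the adjoint tested on short intervals to the
  right of $a_3$ (\<open>dual_boundary_value\<close>). Together they give
  $\pi^2\sigma^2 q_3^2 = -P'(a_2)P'(a_3) f_2^2$.

  The second way uses the equation on $(a_2,a_3)$ alone. For large $\Lambda$ it has no turning points
  there, and the solution with $f_2 = 1$ grows like a modified Bessel function of the travel time
  $\int P^{-1/2}$. Comparison with explicit model solutions at both ends gives
  $2\pi e^{-\sqrt\Lambda K_+} q_3 = \sqrt{-P'(a_2)P'(a_3)}\,(1 + O(\Lambda^{-1/4}))$
  (\<open>connection_asymptotics\<close>).

  Hence $\sigma = 2 e^{-\sqrt\Lambda K_+}(1 + O(\Lambda^{-1/4}))$, and inserting the asymptotics of the
  eigenvalues finishes the proof. The exceptional case $f_2 = q_3 = 0$ is excluded because it makes the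
  eigenfunction vanish.
\<close>

section \<open>Absolutely continuous functions and exceptional null sets\<close>

lemma lmeasurable_open_cover:
 fixes S :: "real set"
 assumes S: "S \<in> lmeasurable" and e: "0 < e"
 obtains T where "open T" "S \<subseteq> T" "T \<in> lmeasurable" "measure lebesgue T < measure lebesgue S + e"
proof -
 obtain T where T: "open T" "S \<subseteq> T" "T - S \<in> lmeasurable" "emeasure lebesgue (T - S) < ennreal e"
 using sets_lebesgue_outer_open[of S e] S e by (auto dest: fmeasurableD)
 have "T = S \<union> (T - S)" using T by auto
 then have Tm: "T \<in> lmeasurable" using S T(3) fmeasurable.Un by metis
 have "measure lebesgue (T - S) < e"
 using T(3,4) e by (simp add: emeasure_eq_measure2 ennreal_less_iff)
 moreover have "measure lebesgue (T - S) = measure lebesgue T - measure lebesgue S"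
 using T S Tm by (intro measurable_measure_Diff) (auto simp: fmeasurableD)
 ultimately show thesis using T Tm by (intro that[of T]) auto
qed

text \<open>A disjoint Vitali family covers the set up to a null set, and every ball of it
  contains a hole of comparable size that misses the set. Removing the holes shrinks the cover by
  a definite factor.\<close>

lemma porous_cover_shrinks:
 fixes S :: "real set"
 assumes por: "!!x d. x \<in> S ==> 0 < d ==>
 \<exists>r w rh. 0 < r & r < d & ka * r <= rh & ball w rh \<subseteq> ball x r & ball w rh \<inter> S = {}"
 and k: "0 < ka" "ka <= 1" and T: "open T" "S \<subseteq> T" "T \<in> lmeasurable"
 shows "\<exists>U. S \<subseteq> U & U \<in> lmeasurable & measure lebesgue U <= (1 - ka) * measure lebesgue T"
proof -
 let ?\<mu> = "measure (lebesgue :: real measure)"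
 let ?K = "{(x,r). ball x r \<subseteq> T & 0 < r & (\<exists>w rh. ka * r <= rh & ball w rh \<subseteq> ball x r & ball w rh \<inter> S = {})}"
 obtain C where C: "countable C" "C \<subseteq> ?K"
 and pw: "pairwise (%i j. disjnt (ball (fst i) (snd i)) (ball (fst j) (snd j))) C"
 and neg: "negligible (S - (\<Union>i \<in> C. ball (fst i) (snd i)))"
 proof (rule Vitali_covering_theorem_balls [of S ?K fst snd])
 fix x d :: real assume x: "x \<in> S" and d: "0 < d"
 obtain e where e: "0 < e" "ball x e \<subseteq> T" using T x by (meson openE subsetD)
 obtain r w rh where "0 < r" "r < min d e" "ka * r <= rh" "ball w rh \<subseteq> ball x r" "ball w rh \<inter> S = {}"
 using por[OF x, of "min d e"] d e by auto
 moreover have "ball x r \<subseteq> T" using e \<open>r < min d e\<close> by auto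
 ultimately show "\<exists>i. i \<in> ?K & x \<in> ball (fst i) (snd i) & snd i < d"
 by (intro exI[of _ "(x,r)"]) auto
 qed
 have "\<forall>i. \<exists>w rh. i \<in> C --> ka * snd i <= rh & ball w rh \<subseteq> ball (fst i) (snd i) & ball w rh \<inter> S = {}"
 using C(2) by fastforce
 then obtain w rh where w: "!!i. i \<in> C ==> ka * snd i <= rh i & ball (w i) (rh i) \<subseteq> ball (fst i) (snd i) & ball (w i) (rh i) \<inter> S = {}"
 by metis
 have pos: "0 < snd i" "ball (fst i) (snd i) \<subseteq> T" if "i \<in> C" for i using that C(2) by (auto dest!: subsetD)
 define U where "U i = ball (fst i) (snd i) - ball (w i) (rh i)" for i
 have Um: "U i \<in> lmeasurable" for i unfolding U_def by (simp add: fmeasurable.Diff)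
 have mU: "?\<mu> (U i) <= (1 - ka) * ?\<mu> (ball (fst i) (snd i))" if "i \<in> C" for i
 proof -
 have "0 <= rh i" using w[OF that] pos[OF that] k by (meson less_imp_le mult_nonneg_nonneg order_trans)
 have "?\<mu> (U i) = ?\<mu> (ball (fst i) (snd i)) - ?\<mu> (ball (w i) (rh i))"
 unfolding U_def using w[OF that] by (intro measurable_measure_Diff) auto
 also have "... = 2 * snd i - 2 * rh i"
 using pos[OF that] \<open>0 <= rh i\<close> by (simp add: ball_eq_greaterThanLessThan)
 also have "... <= (1 - ka)*(2 * snd i)" using w[OF that] by (simp add: algebra_simps)
 also have "2 * snd i = ?\<mu> (ball (fst i) (snd i))" using pos[OF that] by (simp add: ball_eq_greaterThanLessThan)
 finally show ?thesis .
 qed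
 have fin: "?\<mu> (\<Union>i\<in>I. U i) <= (1 - ka) * ?\<mu> T" if "I \<subseteq> C" "finite I" for I
 proof -
 have "?\<mu> (\<Union>i\<in>I. U i) <= (\<Sum>i\<in>I. ?\<mu> (U i))"
 using that Um by (intro measure_UNION_le) (auto simp: fmeasurableD)
 also have "... <= (\<Sum>i\<in>I. (1 - ka) * ?\<mu> (ball (fst i) (snd i)))"
 using that mU by (intro sum_mono) auto
 also have "... = (1 - ka)*(\<Sum>i\<in>I. ?\<mu> (ball (fst i) (snd i)))" by (simp add: sum_distrib_left)
 also have "(\<Sum>i\<in>I. ?\<mu> (ball (fst i) (snd i))) = ?\<mu> (\<Union>i\<in>I. ball (fst i) (snd i))"
 using that pw by (subst measure_UNION') (auto elim: pairwise_mono)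
 also have "(1 - ka) * ... <= (1 - ka) * ?\<mu> T"
 proof (rule mult_left_mono)
 show "?\<mu> (\<Union>i\<in>I. ball (fst i) (snd i)) <= ?\<mu> T"
 using that pos T(3) by (intro measure_mono_fmeasurable) (force simp: sets.finite_UN)+
 qed (use k in auto)
 finally show ?thesis .
 qed
 have UU: "\<Union>(U ` C) \<in> lmeasurable" "?\<mu> (\<Union>(U ` C)) <= (1 - ka) * ?\<mu> T"
 using Um fin k by (auto intro!: fmeasurable_UN_bound [OF C(1)] measure_UN_bound [OF C(1)])
 let ?V = "(S - (\<Union>i \<in> C. ball (fst i) (snd i))) \<union> \<Union>(U ` C)"
 have "S \<subseteq> ?V" using w unfolding U_def by fastforce
 moreover have "?\<mu> ?V = ?\<mu> (\<Union>(U ` C))"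
 by (rule measure_negligible_symdiff [OF UU(1)]) (force intro!: negligible_subset [OF neg])
 ultimately show ?thesis using UU neg
 by (intro exI[of _ ?V]) (simp_all add: fmeasurable.Un negligible_imp_measurable)
qed

text \<open>Starting again from an open set slightly larger than the shrunken cover, one obtains
  covers of arbitrarily small measure. Porosity takes the place of the Lebesgue density
  theorem.\<close>

lemma porous_negligible:
 fixes S :: "real set"
 assumes por: "!!x d. x \<in> S ==> 0 < d ==>
 \<exists>r w rh. 0 < r & r < d & ka * r <= rh & ball w rh \<subseteq> ball x r & ball w rh \<inter> S = {}"
 and k: "0 < ka" "ka <= 1" and S: "bounded S"
 shows "negligible S"
proof -
 let ?\<mu> = "measure (lebesgue :: real measure)"
 obtain T0 :: "real set" where T0: "S \<subseteq> T0" "open T0" "T0 \<in> lmeasurable"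
 using bounded_subset_ballD[OF S, of 0] by auto
 define M where "M = ?\<mu> T0 + 1"
 have M: "0 < M" unfolding M_def using measure_nonneg[of lebesgue T0] by linarith
 define tht where "tht = 1 - ka/2"
 have th: "0 < tht" "tht < 1" using k by (auto simp: tht_def)
 have "\<exists>T. S \<subseteq> T & open T & T \<in> lmeasurable & ?\<mu> T <= tht ^ n * M" for n
 proof (induction n)
 case 0 then show ?case using T0 by (auto simp: M_def)
 next
 case (Suc n)
 then obtain T where T: "S \<subseteq> T" "open T" "T \<in> lmeasurable" "?\<mu> T <= tht ^ n * M" by blast
 obtain U where U: "S \<subseteq> U" "U \<in> lmeasurable" "?\<mu> U <= (1 - ka) * ?\<mu> T"
 using porous_cover_shrinks[OF por k T(2) T(1) T(3)] by blast
 let ?e = "ka/2*(tht ^ n * M)"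
 have e: "?e > 0" using k th M by simp
 obtain T' where T': "open T'" "U \<subseteq> T'" "T' \<in> lmeasurable" "?\<mu> T' < ?\<mu> U + ?e"
 using lmeasurable_open_cover[OF U(2) e] by blast
 have "?\<mu> T' <= ?\<mu> U + ?e" using T' by simp
 also have "... <= (1 - ka)*(tht ^ n * M) + ?e"
 using U(3) T'(4) mult_left_mono[OF T(4), of "1 - ka"] k by simp
 also have "... = tht ^ Suc n * M" by (simp add: tht_def algebra_simps)
 finally show ?case using T' U by (intro exI[of _ T']) auto
 qed
 then obtain T where T: "!!n. S \<subseteq> T n & T n \<in> lmeasurable & ?\<mu> (T n) <= tht ^ n * M" by metis
 show ?thesis unfolding negligible_outer_le
 proof (intro allI impI)
 fix e :: real assume "e > 0"
 obtain n where "tht ^ n < e/M" using real_arch_pow_inv[of "e/M" tht] th M \<open>e > 0\<close> by auto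
 then have "tht ^ n * M <= e" using M by (simp add: field_simps)
 then show "\<exists>T. S \<subseteq> T & T \<in> lmeasurable & ?\<mu> T <= e" using T[of n] by (intro exI[of _ "T n"]) auto
 qed
qed

text \<open>Take a tagged division that is fine for a suitable gauge: intervals tagged in the null
  set lie in an open set of small measure, where absolute continuity controls the increments; on
  the others the bound on the derivative does.\<close>

lemma abs_cont_on_increment_le:
 fixes y :: "real => complex"
 assumes ac: "abs_cont_on c d y" and cd: "c <= d" and Z: "negligible Z" and M: "0 <= M"
 and der: "!!x. c < x ==> x < d ==> x \<notin> Z ==> \<exists>D. (y has_vector_derivative D) (at x) & norm D <= M"
 shows "norm (y d - y c) <= M*(d - c)"
proof (rule field_le_epsilon)
 fix e0 :: real assume e0: "e0 > 0"
 define e where "e = e0/(1 + (d - c))"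
 have e: "e > 0" using e0 cd by (simp add: e_def)
 define Z' where "Z' = Z \<union> {c, d}"
 have Z': "negligible Z'" using Z by (simp add: Z'_def)
 obtain et where et: "et > 0" and ac': "!!D :: (real \<times> real) set. finite D ==> (\<forall>(x, y) \<in> D. c <= x & x <= y & y <= d) ==>
 pairwise (%p q. {fst p<..<snd p} \<inter> {fst q<..<snd q} = {}) D ==>
 (\<Sum>(x, y) \<in> D. y - x) < et ==> (\<Sum>(x, z) \<in> D. norm (y z - y x)) < e"
 using ac e unfolding abs_cont_on_def by meson
 obtain U where U: "open U" "Z' \<subseteq> U" "U \<in> lmeasurable" "measure lebesgue U < et"
 using lmeasurable_open_cover[OF negligible_imp_measurable[OF Z'] et] negligible_imp_measure0[OF Z']
 by (metis add_0)
 have "\<forall>x. \<exists>r>0. if x \<in> Z' then ball x r \<subseteq> U else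
 (c < x & x < d --> (\<forall>z. \<bar>z - x\<bar> < r --> norm (y z - y x) <= (M + e) * \<bar>z - x\<bar>))"
 proof
 fix x
 show "\<exists>r>0. if x \<in> Z' then ball x r \<subseteq> U else
 (c < x & x < d --> (\<forall>z. \<bar>z - x\<bar> < r --> norm (y z - y x) <= (M + e) * \<bar>z - x\<bar>))"
 proof (cases "x \<in> Z' \<or> \<not> (c < x & x < d)")
 case True
 show ?thesis
 proof (cases "x \<in> Z'")
 case True
 then have "x \<in> U" using U(2) by blast
 then obtain r where "r > 0" "ball x r \<subseteq> U" using U(1) openE by blast
 then show ?thesis using True by auto
 next
 case False
 then have "\<not> (c < x & x < d)" using True by blast
 then show ?thesis using False by (intro exI[of _ 1]) auto
 qed
 next
 case False
 then obtain D where D: "(y has_vector_derivative D) (at x)" "norm D <= M"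
 using der[of x] by (auto simp: Z'_def)
 then obtain r where r: "r > 0" "!!z. norm (z - x) < r ==> norm (y z - y x - (z - x) *\<^sub>R D) <= e * norm (z - x)"
 using e unfolding has_vector_derivative_def has_derivative_at_alt by blast
 have "norm (y z - y x) <= (M + e) * \<bar>z - x\<bar>" if "\<bar>z - x\<bar> < r" for z
 proof -
 have "norm (y z - y x) <= norm (y z - y x - (z - x) *\<^sub>R D) + norm ((z - x) *\<^sub>R D)"
 using norm_triangle_ineq[of "y z - y x - (z - x) *\<^sub>R D" "(z - x) *\<^sub>R D"] by simp
 also have "... <= e * \<bar>z - x\<bar> + \<bar>z - x\<bar> * M" using r(2)[of z] that D(2)
 by (auto intro!: add_mono mult_left_mono)
 finally show ?thesis by (simp add: algebra_simps)
 qed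
 then show ?thesis using False r by (intro exI[of _ r]) auto
 qed
 qed
 then obtain r where r: "!!x. r x > 0" "!!x. x \<in> Z' ==> ball x (r x) \<subseteq> U"
 "!!x z. x \<notin> Z' ==> c < x ==> x < d ==> \<bar>z - x\<bar> < r x ==> norm (y z - y x) <= (M + e) * \<bar>z - x\<bar>"
 by metis
 have "gauge (%x. ball x (r x))" using r(1) by (intro gauge_ball_dependent) auto
 then obtain p where p: "p tagged_division_of {c..d}" "(%x. ball x (r x)) fine p"
 by (rule fine_division_exists_real)
 have fp: "finite p" using p by auto
 have K: "\<exists>u v. K = {u..v} & u <= x & x <= v & c <= u & v <= d & K \<subseteq> ball x (r x)" if "(x, K) \<in> p" for x K
 proof -
 note xK = that
 obtain u v where "K = {u..v}" using tagged_division_ofD(4)[OF p(1) xK] by auto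
 moreover have "x \<in> K" "K \<subseteq> {c..d}" using tagged_division_ofD(2,3)[OF p(1) xK] by auto
 moreover have "K \<subseteq> ball x (r x)" using p(2) xK by (auto dest: fineD)
 ultimately show ?thesis by (intro exI[of _ u] exI[of _ v]) auto
 qed
 define pz where "pz = {t \<in> p. fst t \<in> Z'}"
 define pn where "pn = {t \<in> p. fst t \<notin> Z'}"
 have pu: "p = pz \<union> pn" "pz \<inter> pn = {}" "finite pz" "finite pn" using fp by (auto simp: pz_def pn_def)
 have tel: "y d - y c = (\<Sum>(x,K)\<in>p. y (Sup K) - y (Inf K))"
 using additive_tagged_division_1[OF cd p(1), of y] by simp
 have tel1: "d - c = (\<Sum>(x,K)\<in>p. Sup K - Inf K)"
 using additive_tagged_division_1[OF cd p(1), of "%x. x"] by simp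
 have n1: "norm (\<Sum>(x,K)\<in>pn. y (Sup K) - y (Inf K)) <= (M + e)*(\<Sum>(x,K)\<in>pn. Sup K - Inf K)"
 unfolding sum_distrib_left
 proof (rule sum_norm_le, clarify)
 fix x K assume t: "(x, K) \<in> pn"
 then have tp: "(x,K) \<in> p" "x \<notin> Z'" by (auto simp: pn_def)
 obtain u v where uv: "K = {u..v}" "u <= x" "x <= v" "c <= u" "v <= d" "K \<subseteq> ball x (r x)" using K[OF tp(1)] by blast
 have x: "c < x" "x < d" using tp uv by (auto simp: Z'_def less_le)
 have "u \<in> K" "v \<in> K" using uv by auto
 then have "u \<in> ball x (r x)" "v \<in> ball x (r x)" using uv(6) by blast+
 then have u: "\<bar>u - x\<bar> < r x" "\<bar>v - x\<bar> < r x" by (auto simp: dist_real_def)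
 have "norm (y v - y u) <= norm (y v - y x) + norm (y u - y x)"
 using norm_triangle_ineq4[of "y v - y x" "y u - y x"] by simp
 also have "... <= (M + e) * \<bar>v - x\<bar> + (M + e) * \<bar>u - x\<bar>" using r(3)[OF tp(2) x] u by (intro add_mono) auto
 also have "... = (M + e)*(v - u)" using uv by (simp add: algebra_simps)
 finally show "norm (y (Sup K) - y (Inf K)) <= (M + e)*(Sup K - Inf K)" using uv by simp
 qed
 have nonneg: "0 <= Sup K - Inf K" if "(x,K) \<in> p" for x K using K[OF that] by force
 have le: "(\<Sum>(x,K)\<in>pn. Sup K - Inf K) <= d - c"
 unfolding tel1 using pu nonneg by (intro sum_mono2) (auto simp: fp pn_def)
 define g where "g = (%t::real \<times> real set. (Inf (snd t), Sup (snd t)))"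
 define pz' where "pz' = {t \<in> pz. Inf (snd t) < Sup (snd t)}"
 have disj: "interior K \<inter> interior L = {}" if "(x,K) \<in> p" "(z,L) \<in> p" "(x,K) ~= (z,L)" for x z K L
 using tagged_division_ofD(5)[OF p(1) that] .
 have pd: "{Inf (snd s)<..<Sup (snd s)} \<inter> {Inf (snd t)<..<Sup (snd t)} = {}" if st: "s \<in> p" "t \<in> p" "s ~= t" for s t
 proof -
 obtain x K z L where s: "s = (x,K)" "t = (z,L)" by (metis surj_pair)
 then obtain u v u' v' where "K = {u..v}" "u <= v" "L = {u'..v'}" "u' <= v'" using K st by (metis order_trans)
 then show ?thesis using disj[of x K z L] st s by simp
 qed
 have fpz': "finite pz'" using pu(3) by (simp add: pz'_def)
 have inj: "inj_on g pz'"
 proof (rule inj_onI, rule ccontr)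
 fix s t assume a: "s \<in> pz'" "t \<in> pz'" "g s = g t" "s ~= t"
 then have "{Inf (snd s)<..<Sup (snd s)} \<inter> {Inf (snd t)<..<Sup (snd t)} = {}" using pd by (auto simp: pz'_def pz_def)
 then show False using a by (auto simp: g_def pz'_def)
 qed
 have szero: "(\<Sum>(x,K)\<in>pz. norm (y (Sup K) - y (Inf K))) = (\<Sum>(x,K)\<in>pz'. norm (y (Sup K) - y (Inf K)))"
 proof (rule sum.mono_neutral_right)
 show "\<forall>i\<in>pz - pz'. (case i of (x, K) => norm (y (Sup K) - y (Inf K))) = 0"
 proof clarify
 fix x K assume t: "(x,K) \<in> pz" "(x,K) \<notin> pz'"
 then have "(x,K) \<in> p" by (auto simp: pz_def)
 from nonneg[OF this] t have "Sup K = Inf K" by (auto simp: pz'_def)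
 then show "norm (y (Sup K) - y (Inf K)) = 0" by simp
 qed
 qed (use pu in \<open>auto simp: pz'_def\<close>)
 have sumU: "(\<Sum>t\<in>pz'. Sup (snd t) - Inf (snd t)) < et"
 proof -
 have "(\<Sum>t\<in>pz'. Sup (snd t) - Inf (snd t)) = (\<Sum>t\<in>pz'. measure lebesgue {Inf (snd t)<..<Sup (snd t)})"
 by (intro sum.cong) (auto simp: pz'_def)
 also have "... = measure lebesgue (\<Union>t\<in>pz'. {Inf (snd t)<..<Sup (snd t)})"
 using fpz' pd by (subst measure_UNION') (auto simp: pz'_def pz_def pairwise_def disjnt_def)
 also have "... <= measure lebesgue U"
 proof (rule measure_mono_fmeasurable)
 show "(\<Union>t\<in>pz'. {Inf (snd t)<..<Sup (snd t)}) \<subseteq> U"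
 proof
 fix w assume "w \<in> (\<Union>t\<in>pz'. {Inf (snd t)<..<Sup (snd t)})"
 then obtain x L where t: "(x,L) \<in> pz'" "Inf L < w" "w < Sup L" by auto
 then have "(x,L) \<in> p" "x \<in> Z'" by (auto simp: pz'_def pz_def)
 from K[OF this(1)] t r(2)[OF this(2)] show "w \<in> U" by fastforce
 qed
 qed (use fpz' U in auto)
 finally show ?thesis using U by simp
 qed
 have n2: "(\<Sum>(x,K)\<in>pz'. norm (y (Sup K) - y (Inf K))) < e"
 proof -
 have "(\<Sum>(x,K)\<in>pz'. norm (y (Sup K) - y (Inf K))) = (\<Sum>(u,v)\<in>g ` pz'. norm (y v - y u))"
 by (subst sum.reindex[OF inj]) (auto simp: g_def case_prod_unfold)
 also have "... < e"
 proof (rule ac')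
 show "finite (g ` pz')" using pu by (auto simp: pz'_def)
 show "\<forall>(x, y)\<in>g ` pz'. c <= x & x <= y & y <= d"
 proof (clarsimp simp: g_def)
 fix x u v L assume t: "(x,L) \<in> pz'"
 then have "(x,L) \<in> p" by (auto simp: pz'_def pz_def)
 from K[OF this] show "c <= Inf L & Inf L <= Sup L & Sup L <= d" by force
 qed
 show "pairwise (%p q. {fst p<..<snd p} \<inter> {fst q<..<snd q} = {}) (g ` pz')"
 unfolding pairwise_image using pd by (auto simp: pairwise_def g_def pz'_def pz_def)
 have "(\<Sum>(x, y)\<in>g ` pz'. y - x) = (\<Sum>t\<in>pz'. Sup (snd t) - Inf (snd t))"
 by (subst sum.reindex[OF inj]) (auto simp: g_def case_prod_unfold)
 then show "(\<Sum>(x, y)\<in>g ` pz'. y - x) < et" using sumU by simp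
 qed
 finally show ?thesis .
 qed
 have "norm (y d - y c) = norm ((\<Sum>(x,K)\<in>pz. y (Sup K) - y (Inf K)) + (\<Sum>(x,K)\<in>pn. y (Sup K) - y (Inf K)))"
 unfolding tel using pu by (subst pu(1), subst sum.union_disjoint) auto
 also have "... <= norm (\<Sum>(x,K)\<in>pz. y (Sup K) - y (Inf K)) + norm (\<Sum>(x,K)\<in>pn. y (Sup K) - y (Inf K))"
 by (rule norm_triangle_ineq)
 also have "norm (\<Sum>(x,K)\<in>pz. y (Sup K) - y (Inf K)) <= (\<Sum>(x,K)\<in>pz. norm (y (Sup K) - y (Inf K)))"
 by (rule sum_norm_le) auto
 also have "... <= e" using n2 szero by simp
 also have "norm (\<Sum>(x,K)\<in>pn. y (Sup K) - y (Inf K)) <= (M + e)*(d - c)"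
 using n1 mult_left_mono[OF le, of "M + e"] M e by linarith
 finally have "norm (y d - y c) <= M*(d - c) + e*(1 + (d - c))" by (simp add: algebra_simps)
 also have "e*(1 + (d - c)) = e0" using cd by (simp add: e_def)
 finally show "norm (y d - y c) <= M*(d - c) + e0" .
qed

lemma abs_cont_on_minus_Lipschitz:
 fixes q u :: "real => complex"
 assumes ac: "abs_cont_on c d q" and lip: "!!x y. c <= x ==> x <= y ==> y <= d ==> norm (u y - u x) <= B*(y - x)"
 and B: "0 <= B"
 shows "abs_cont_on c d (%x. q x - u x)"
 unfolding abs_cont_on_def
proof (intro allI impI)
 fix e :: real assume e: "e > 0"
 obtain et where et: "et > 0" and ac': "!!D :: (real \<times> real) set. finite D ==> (\<forall>(x, y) \<in> D. c <= x & x <= y & y <= d) ==>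
 pairwise (%p q. {fst p<..<snd p} \<inter> {fst q<..<snd q} = {}) D ==>
 (\<Sum>(x, y) \<in> D. y - x) < et ==> (\<Sum>(x, z) \<in> D. norm (q z - q x)) < e/2"
 using ac half_gt_zero[OF e] unfolding abs_cont_on_def by meson
 define et' where "et' = min et (e/(2*(B + 1)))"
 have "et' > 0" using et e B by (simp add: et'_def)
 moreover have "(\<Sum>(x, y)\<in>D. norm ((q y - u y) - (q x - u x))) < e"
 if D: "finite D" "\<forall>(x, y)\<in>D. c <= x & x <= y & y <= d"
 "pairwise (%p q. {fst p<..<snd p} \<inter> {fst q<..<snd q} = {}) D" "(\<Sum>(x, y)\<in>D. y - x) < et'" for D
 proof -
 have "(\<Sum>(x, y)\<in>D. norm ((q y - u y) - (q x - u x))) <= (\<Sum>(x, y)\<in>D. norm (q y - q x) + B*(y - x))"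
 proof (rule sum_mono, clarify)
 fix x y assume "(x, y) \<in> D"
 then have "norm (u y - u x) <= B*(y - x)" using D lip by blast
 moreover have "norm ((q y - u y) - (q x - u x)) <= norm (q y - q x) + norm (u y - u x)"
 using norm_triangle_ineq4[of "q y - q x" "u y - u x"] by (simp add: algebra_simps)
 ultimately show "norm ((q y - u y) - (q x - u x)) <= norm (q y - q x) + B*(y - x)" by simp
 qed
 also have "... = (\<Sum>(x, y)\<in>D. norm (q y - q x)) + B*(\<Sum>(x, y)\<in>D. y - x)"
 by (simp add: case_prod_unfold sum.distrib sum_distrib_left)
 also have "... < e/2 + e/2"
 proof (rule add_less_le_mono)
 show "(\<Sum>(x, y)\<in>D. norm (q y - q x)) < e/2" using D by (intro ac') (auto simp: et'_def)
 have "B*(\<Sum>(x, y)\<in>D. y - x) <= B*(e/(2*(B + 1)))"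
 using D(4) B by (intro mult_left_mono) (auto simp: et'_def)
 also have "... <= e/2" using B e by (simp add: field_simps)
 finally show "B*(\<Sum>(x, y)\<in>D. y - x) <= e/2" .
 qed
 finally show ?thesis by simp
 qed
 ultimately show "\<exists>et>0. \<forall>D. finite D & (\<forall>(x, y)\<in>D. c <= x & x <= y & y <= d) &
 pairwise (%p q. {fst p<..<snd p} \<inter> {fst q<..<snd q} = {}) D & (\<Sum>(x, y)\<in>D. y - x) < et -->
 (\<Sum>(x, y)\<in>D. norm (q y - u y - (q x - u x))) < e"
 by blast
qed

lemma abs_cont_on_subinterval:
 assumes ac: "abs_cont_on c d f" and sub: "c <= c'" "d' <= d"
 shows "abs_cont_on c' d' f"
 unfolding abs_cont_on_def
proof (intro allI impI)
 fix e :: real assume e: "e > 0"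
 obtain et where et: "et > 0" and ac': "!!D :: (real \<times> real) set. finite D ==> (\<forall>(x, y) \<in> D. c <= x & x <= y & y <= d) ==>
 pairwise (%p q. {fst p<..<snd p} \<inter> {fst q<..<snd q} = {}) D ==>
 (\<Sum>(x, y) \<in> D. y - x) < et ==> (\<Sum>(x, y) \<in> D. norm (f y - f x)) < e"
 using ac e unfolding abs_cont_on_def by meson
 show "\<exists>et>0. \<forall>D. finite D & (\<forall>(x, y)\<in>D. c' <= x & x <= y & y <= d') &
 pairwise (%p q. {fst p<..<snd p} \<inter> {fst q<..<snd q} = {}) D & (\<Sum>(x, y)\<in>D. y - x) < et -->
 (\<Sum>(x, y)\<in>D. norm (f y - f x)) < e"
 proof (intro exI[of _ et] conjI allI impI et)
 fix D :: "(real \<times> real) set"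
 assume D: "finite D & (\<forall>(x, y)\<in>D. c' <= x & x <= y & y <= d') &
 pairwise (%p q. {fst p<..<snd p} \<inter> {fst q<..<snd q} = {}) D & (\<Sum>(x, y)\<in>D. y - x) < et"
 then have "\<forall>(x, y)\<in>D. c <= x & x <= y & y <= d" using sub by fastforce
 with D show "(\<Sum>(x, y)\<in>D. norm (f y - f x)) < e" by (intro ac') auto
 qed
qed

lemma Lipschitz_of_vector_derivative:
 fixes u :: "real => complex"
 assumes "!!x. x \<in> {c..d} ==> (u has_vector_derivative u' x) (at x within {c..d})"
 and "!!x. x \<in> {c..d} ==> norm (u' x) <= B" and "c <= x" "x <= y" "y <= d"
 shows "norm (u y - u x) <= B*(y - x)"
proof -
 have "norm (u y - u x) <= B * norm (y - x)"
 proof (rule differentiable_bound[of "{c..d}"])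
 show "!!x. x \<in> {c..d} ==> (u has_derivative (%h. h *\<^sub>R u' x)) (at x within {c..d})"
 using assms(1) by (simp add: has_vector_derivative_def)
 fix x assume "x \<in> {c..d}"
 then show "onorm (%h. h *\<^sub>R u' x) <= B" using assms(2)
 by (intro onorm_le) (metis mult.commute mult_right_mono norm_ge_zero norm_scaleR real_norm_def)
 qed (use assms in auto)
 then show ?thesis using assms by simp
qed

lemma continuous_on_Icc_bound:
 fixes H :: "real => 'a::real_normed_vector"
 assumes "continuous_on {c..d} H"
 obtains B where "0 <= B" "!!x. x \<in> {c..d} ==> norm (H x) <= B"
proof -
 have "bounded (H ` {c..d})" by (intro compact_imp_bounded compact_continuous_image assms compact_Icc)
 then obtain B where "0 < B" "!!y. y \<in> H ` {c..d} ==> norm y <= B" unfolding bounded_pos by blast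
 then show thesis by (intro that[of B]) auto
qed

lemma isolated_points_negligible:
 fixes E :: "real set"
 assumes bE: "bounded E"
 shows "negligible {x \<in> E. \<not> x islimpt E}"
proof -
 define I where "I = {x \<in> E. \<not> x islimpt E}"
 have por: "\<exists>r w rh. 0 < r & r < d & 1/2 * r <= rh & ball w rh \<subseteq> ball x r & ball w rh \<inter> I = {}"
 if x: "x \<in> I" and d: "0 < d" for x d
 proof -
 obtain e where e: "e > 0" "!!y. y \<in> E ==> y ~= x ==> e <= dist y x"
 using x unfolding I_def islimpt_approachable by (auto simp: not_less)
 define r where "r = min d e/2"
 have r: "0 < r" "r < d" "r < e" using d e by (auto simp: r_def)
 have "y \<notin> I" if y: "y \<in> ball (x + r/2) (r/2)" for y
 proof
 assume "y \<in> I"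
 have "0 < y - x & y - x < r" using y unfolding mem_ball dist_real_def by linarith
 moreover from this have "e <= \<bar>y - x\<bar>" using e(2)[of y] \<open>y \<in> I\<close> by (auto simp: dist_real_def I_def)
 ultimately show False using r by linarith
 qed
 then have "ball (x + r/2) (r/2) \<inter> I = {}" by blast
 moreover have "ball (x + r/2) (r/2) \<subseteq> ball x r"
 proof
 fix y assume "y \<in> ball (x + r/2) (r/2)"
 then show "y \<in> ball x r" using r unfolding mem_ball dist_real_def by linarith
 qed
 ultimately show ?thesis using r
 by (intro exI[of _ r] exI[of _ "x + r/2"] exI[of _ "r/2"]) simp
 qed
 have "bounded I" using bE by (rule bounded_subset) (auto simp: I_def)
 then show ?thesis using porous_negligible[of I "1/2", OF por] unfolding I_def[symmetric] by simp
qed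

text \<open>Where the quasi-derivative \<open>q\<close> is not differentiable,
  \<^const>\<open>vderiv\<close> has an arbitrary fixed value, so the eigenvalue equation
  prescribes the value of \<open>f\<close>: it agrees with a fixed smooth function
  \<open>e\<close>. At a limit point of the set of coincidence the derivatives agree as well, so
  \<open>q\<close> and \<open>pe\<close> do. Elsewhere their difference is at most a constant
  times the distance to these limit points. If it is not differentiable at such a point, the limit
  points leave comparable gaps near it, so the exceptional set is a countable union of porous
  sets.\<close>

lemma nondifferentiability_negligible:
 fixes f q e pe k0 H :: "real => complex" and p :: "real => real"
 assumes cd: "c < d"
 and f: "!!x. x \<in> {c..d} ==> (f has_vector_derivative q x/of_real (p x)) (at x)"
 and p: "!!x. x \<in> {c..d} ==> p x ~= 0"
 and e: "!!x. x \<in> {c..d} ==> (e has_vector_derivative pe x/of_real (p x)) (at x)"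
 and pe: "!!x. x \<in> {c..d} ==> (pe has_vector_derivative k0 x) (at x)"
 and k0: "continuous_on {c..d} k0" and H: "continuous_on {c..d} H"
 and ac: "abs_cont_on c d q" and Z: "negligible Z"
 and dq: "!!x. x \<in> {c..d} ==> x \<notin> Z ==> q differentiable (at x) ==> (q has_vector_derivative H x) (at x)"
 and nq: "!!x. x \<in> {c..d} ==> x \<notin> Z ==> \<not> q differentiable (at x) ==> f x = e x"
 shows "negligible {x \<in> {c<..<d}. x \<notin> Z & \<not> q differentiable (at x)}"
proof -
 define E where "E = {t \<in> {c..d}. f t = e t}"
 define E' where "E' = {t. t islimpt E}"
 define I where "I = {x \<in> E. \<not> x islimpt E}"
 define y0 where "y0 = (%x. q x - pe x)"
 have contf: "continuous_on {c..d} f" "continuous_on {c..d} e"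
 by (rule continuous_on_vector_derivative[OF has_vector_derivative_at_within[OF f]], simp)
 (rule continuous_on_vector_derivative[OF has_vector_derivative_at_within[OF e]], simp)
 have "E = {c..d} \<inter> (%t. f t - e t) -` {0}" by (auto simp: E_def)
 then have "closed E"
 using continuous_closed_preimage[OF continuous_on_diff[OF contf] closed_atLeastAtMost, of "{0}"] by simp
 have E'E: "E' \<subseteq> E" using \<open>closed E\<close> unfolding E'_def closed_limpt by blast
 have clE': "closed E'" unfolding E'_def by (rule closed_limpts)
 have bE: "bounded E" unfolding E_def by (rule bounded_subset[of "{c..d}"]) auto
 have Ineg: "negligible I" unfolding I_def by (rule isolated_points_negligible[OF bE])
 have y0E: "y0 x = 0" if "x \<in> E'" for x
 proof -
 have x: "x \<in> {c..d}" "x \<in> E" using that E'E by (auto simp: E_def)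
 have "((%t. f t - e t) has_vector_derivative (q x/of_real (p x) - pe x/of_real (p x))) (at x within E)"
 by (intro has_vector_derivative_diff has_vector_derivative_at_within[OF f] has_vector_derivative_at_within[OF e] x)
 moreover have "((%t. f t - e t) has_vector_derivative 0) (at x within E)"
 by (rule has_vector_derivative_transform[OF x(2) _ has_vector_derivative_const[of 0]]) (auto simp: E_def)
 moreover have "at x within E ~= bot" using that by (simp add: E'_def trivial_limit_within)
 ultimately have "q x/of_real (p x) - pe x/of_real (p x) = 0"
 using vector_derivative_unique_within by blast
 then show ?thesis using p[OF x(1)] by (simp add: y0_def field_simps)
 qed
 obtain M0 where M0: "!!x. x \<in> {c..d} ==> norm (H x - k0 x) <= M0"
 using continuous_on_Icc_bound[OF continuous_on_diff[OF H k0]] by blast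
 define M where "M = max M0 1"
 have M: "!!x. x \<in> {c..d} ==> norm (H x - k0 x) <= M" "M \<ge> 1" using M0 by (auto simp: M_def intro: max.coboundedI1)
 obtain B where B0: "0 <= B" and B: "!!x. x \<in> {c..d} ==> norm (k0 x) <= B"
 using continuous_on_Icc_bound[OF k0] by blast
 have acy: "abs_cont_on u v y0" if "c <= u" "v <= d" for u v
 proof -
 have "abs_cont_on c d y0" unfolding y0_def
 by (rule abs_cont_on_minus_Lipschitz[OF ac _ B0])
 (auto intro!: Lipschitz_of_vector_derivative[where u' = k0] B has_vector_derivative_at_within pe)
 then show ?thesis using that by (rule abs_cont_on_subinterval)
 qed
 have der: "\<exists>D. (y0 has_vector_derivative D) (at x) & norm D <= M" if "c < x" "x < d" "x \<notin> Z \<union> I" "x \<notin> E'" for x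
 proof -
 have x: "x \<in> {c..d}" "x \<notin> Z" using that by auto
 have "f x ~= e x" using that by (auto simp: E'_def I_def E_def)
 then have "q differentiable (at x)" using nq x by blast
 then have "(y0 has_vector_derivative H x - k0 x) (at x)" unfolding y0_def
 by (intro has_vector_derivative_diff dq pe x)
 then show ?thesis using M x by blast
 qed
 have ZI: "negligible (Z \<union> I)" using Z Ineg by simp
 have gap: "norm (y0 b) <= M * dist b s" if b: "b \<in> {c..d}" "s \<in> E'" and gap: "!!t. t \<in> E' ==> dist b s <= dist b t" for b s
 proof -
 have s: "s \<in> {c..d}" "y0 s = 0" using b y0E E'E by (auto simp: E_def)
 show ?thesis
 proof (cases "s <= b")
 case True
 have "norm (y0 b - y0 s) <= M*(b - s)"
 proof (rule abs_cont_on_increment_le[OF acy True ZI])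
 fix x assume x: "s < x" "x < b" "x \<notin> Z \<union> I"
 then have "x \<notin> E'" using gap[of x] by (auto simp: dist_real_def)
 then show "\<exists>D. (y0 has_vector_derivative D) (at x) & cmod D <= M" using der[of x] x s b by auto
 qed (use s b M in auto)
 then show ?thesis using s True by (simp add: dist_real_def)
 next
 case False
 then have bs: "b <= s" by simp
 have "norm (y0 s - y0 b) <= M*(s - b)"
 proof (rule abs_cont_on_increment_le[OF acy bs ZI])
 fix x assume x: "b < x" "x < s" "x \<notin> Z \<union> I"
 then have "x \<notin> E'" using gap[of x] by (auto simp: dist_real_def)
 then show "\<exists>D. (y0 has_vector_derivative D) (at x) & cmod D <= M" using der[of x] x s b by auto
 qed (use s b M in auto)
 then show ?thesis using s bs by (simp add: dist_real_def)
 qed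
 qed
 define N where "N k = {x \<in> E'. \<forall>dl>0. \<exists>b\<in>{c..d}. 0 < \<bar>b - x\<bar> & \<bar>b - x\<bar> < dl & norm (y0 b) > \<bar>b - x\<bar> / real (Suc k)}" for k
 have Nneg: "negligible (N k)" for k
 proof -
 let ?ka = "1/(2 * real (Suc k) * M)"
 have k1: "1 <= real (Suc k) * M" using mult_mono[of 1 "real (Suc k)" 1 M] M by simp
 show ?thesis
 proof (rule porous_negligible[where ka = ?ka])
 show "0 < ?ka" using M by simp
 have "1 <= 2 * real (Suc k) * M" using k1 by linarith
 then show "?ka <= 1" using divide_le_eq_1_pos[of "2 * real (Suc k) * M" 1] by linarith
 show "bounded (N k)" using bE E'E by (auto simp: N_def intro: bounded_subset)
 fix x dl :: real assume x: "x \<in> N k" and dl: "0 < dl"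
 then obtain b where b: "b \<in> {c..d}" "0 < \<bar>b - x\<bar>" "\<bar>b - x\<bar> < dl/2" "norm (y0 b) > \<bar>b - x\<bar> / real (Suc k)"
 unfolding N_def by (auto dest!: spec[of _ "dl/2"])
 define rh where "rh = \<bar>b - x\<bar> / (real (Suc k) * M)"
 have rho: "0 < rh" "rh <= \<bar>b - x\<bar>" using b M k1 by (auto simp: rh_def divide_simps mult_le_cancel_left1)
 obtain s where s: "s \<in> E'" "!!t. t \<in> E' ==> dist b s <= dist b t"
 using distance_attains_inf[OF clE', of b] x by (auto simp: N_def)
 have "rh < dist b s"
 proof -
 have "\<bar>b - x\<bar> / real (Suc k) < M * dist b s" using b(4) gap[OF b(1) s(1) s(2)] by linarith
 then have "\<bar>b - x\<bar> < dist b s*(real (Suc k) * M)" by (simp add: divide_less_eq mult_ac)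
 then show ?thesis using k1 unfolding rh_def by (subst divide_less_eq) auto
 qed
 then have "ball b rh \<inter> N k = {}" using s(2) by (force simp: N_def)
 moreover have "ball b rh \<subseteq> ball x (2 * \<bar>b - x\<bar>)"
 proof
 fix y assume "y \<in> ball b rh"
 then show "y \<in> ball x (2 * \<bar>b - x\<bar>)"
 using rho dist_triangle[of x y b] by (simp add: dist_real_def abs_minus_commute)
 qed
 moreover have kar: "?ka*(2 * \<bar>b - x\<bar>) <= rh"
 using mult_divide_mult_cancel_left[of 2 "\<bar>b - x\<bar>" "real (Suc k) * M"]
 unfolding rh_def by (simp only: mult.assoc times_divide_eq_left mult_1_left)
 ultimately have "0 < 2 * \<bar>b - x\<bar> & 2 * \<bar>b - x\<bar> < dl & ?ka*(2 * \<bar>b - x\<bar>) <= rh &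
 ball b rh \<subseteq> ball x (2 * \<bar>b - x\<bar>) & ball b rh \<inter> N k = {}"
 using b by simp
 then show "\<exists>r w rh. 0 < r & r < dl & ?ka * r <= rh & ball w rh \<subseteq> ball x r & ball w rh \<inter> N k = {}"
 by blast
 qed
 qed
 have "{x \<in> {c<..<d}. x \<notin> Z & \<not> q differentiable (at x)} \<subseteq> I \<union> (\<Union>k. N k)"
 proof
 fix x assume x: "x \<in> {x \<in> {c<..<d}. x \<notin> Z & \<not> q differentiable (at x)}"
 then have xcd: "x \<in> {c..d}" "c < x" "x < d" by auto
 have xE: "x \<in> E" using nq[of x] x xcd by (auto simp: E_def)
 show "x \<in> I \<union> (\<Union>k. N k)"
 proof (rule ccontr)
 assume a: "x \<notin> I \<union> (\<Union>k. N k)"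
 then have xE': "x \<in> E'" using xE by (auto simp: I_def E'_def)
 have "(y0 has_vector_derivative 0) (at x)"
 unfolding has_vector_derivative_def has_derivative_at_alt
 proof (intro conjI allI impI)
 fix e :: real assume e: "e > 0"
 obtain k where k: "1/real (Suc k) < e" using nat_approx_posE[OF e] by (metis)
 have "x \<notin> N k" using a by auto
 then have "\<not> (\<forall>dl>0. \<exists>b\<in>{c..d}. 0 < \<bar>b - x\<bar> & \<bar>b - x\<bar> < dl & norm (y0 b) > \<bar>b - x\<bar> / real (Suc k))"
 using xE' by (simp add: N_def)
 then obtain dl where dl0: "dl > 0" "\<not> (\<exists>b\<in>{c..d}. 0 < \<bar>b - x\<bar> & \<bar>b - x\<bar> < dl & norm (y0 b) > \<bar>b - x\<bar> / real (Suc k))"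
 by blast
 have dl: "dl > 0" "!!b. b \<in> {c..d} ==> 0 < \<bar>b - x\<bar> ==> \<bar>b - x\<bar> < dl ==> norm (y0 b) <= \<bar>b - x\<bar> / real (Suc k)"
 using dl0 by (auto simp only: linorder_not_less[symmetric])
 show "\<exists>dl>0. \<forall>y. norm (y - x) < dl --> norm (y0 y - y0 x - (y - x) *\<^sub>R 0) <= e * norm (y - x)"
 proof (intro exI[of _ "min dl (min (x - c) (d - x))"] conjI allI impI)
 show "0 < min dl (min (x - c) (d - x))" using dl xcd by auto
 fix b assume b: "norm (b - x) < min dl (min (x - c) (d - x))"
 show "norm (y0 b - y0 x - (b - x) *\<^sub>R 0) <= e * norm (b - x)"
 proof (cases "b = x")
 case False
 then have "norm (y0 b) <= \<bar>b - x\<bar> / real (Suc k)" using b by (intro dl(2)) (auto simp: abs_if split: if_splits)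
 also have "... <= e * \<bar>b - x\<bar>" using mult_right_mono[OF less_imp_le[OF k], of "\<bar>b - x\<bar>"] by simp
 finally show ?thesis using y0E[OF xE'] by simp
 qed (use e in auto)
 qed
 qed (simp add: bounded_linear_zero)
 then have "((%t. y0 t + pe t) has_vector_derivative 0 + k0 x) (at x)"
 by (intro has_vector_derivative_add pe xcd)
 then have "q differentiable (at x)" by (auto simp: y0_def differentiableI_vector)
 then show False using x by auto
 qed
 qed
 moreover have "negligible (I \<union> (\<Union>k. N k))" using Ineg Nneg by (intro negligible_Un negligible_countable_Union) auto
 ultimately show ?thesis using negligible_subset by blast
qed

text \<open>The difference of the function and an antiderivative of the continuous right-hand side
  is absolutely continuous with zero derivative off a null set, hence constant.\<close>

lemma abs_cont_ae_derivative_imp_derivative: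
 fixes q H :: "real => complex"
 assumes ac: "abs_cont_on c d q" and Z: "negligible Z" and H: "continuous_on {c..d} H"
 and dq: "!!x. c < x ==> x < d ==> x \<notin> Z ==> (q has_vector_derivative H x) (at x)"
 and x: "c < x" "x < d"
 shows "(q has_vector_derivative H x) (at x)"
proof -
 define G where "G = (%x. integral {c..x} H)"
 have G: "(G has_vector_derivative H t) (at t within {c..d})" if "t \<in> {c..d}" for t
 unfolding G_def using integral_has_vector_derivative[OF H that] .
 obtain B where B0: "0 <= B" and B: "!!x. x \<in> {c..d} ==> norm (H x) <= B"
 using continuous_on_Icc_bound[OF H] by blast
 have ac': "abs_cont_on c d (%x. q x - G x)"
 by (rule abs_cont_on_minus_Lipschitz[OF ac _ B0]) (auto intro!: Lipschitz_of_vector_derivative[where u' = H] B G)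
 have const: "q t - G t = q c - G c" if t: "c <= t" "t <= d" for t
 proof -
 have act: "abs_cont_on c t (%x. q x - G x)"
 using abs_cont_on_subinterval[OF ac' order_refl t(2)] .
 have "norm ((q t - G t) - (q c - G c)) <= 0*(t - c)"
 proof (rule abs_cont_on_increment_le[OF act t(1) Z])
 fix s assume s: "c < s" "s < t" "s \<notin> Z"
 have "(G has_vector_derivative H s) (at s)" using G[of s] s t at_within_Icc_at[of c s d] by auto
 then have "((%x. q x - G x) has_vector_derivative H s - H s) (at s)"
 using dq[of s] s t by (intro has_vector_derivative_diff) auto
 then show "\<exists>D. ((%x. q x - G x) has_vector_derivative D) (at s) & cmod D <= 0" by auto
 qed auto
 then show ?thesis by simp
 qed
 have "(G has_vector_derivative H x) (at x)" using G[of x] x at_within_Icc_at[of c x d] by auto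
 then have "((%t. G t + (q c - G c)) has_vector_derivative H x) (at x)"
 by (auto intro!: derivative_eq_intros)
 then show ?thesis
 by (rule has_vector_derivative_transform_within_open[of _ _ _ "{c<..<d}"]) (use x const in \<open>auto simp: algebra_simps\<close>)
qed

section \<open>Modified Bessel functions\<close>

text \<open>The modified Bessel functions of orders zero and one, in their integral representation.\<close>

definition bessel0 :: "real => real" where
 "bessel0 s = integral {0..pi} (%tht. exp (s * cos tht))/pi"

definition bessel1 :: "real => real" where
 "bessel1 s = integral {0..pi} (%tht. cos tht * exp (s * cos tht))/pi"

lemma integral_cos_power_exp_deriv:
 "((%s. integral {0..pi} (%tht. cos tht ^ k * exp (s * cos tht))) has_field_derivative
 integral {0..pi} (%tht. cos tht ^ Suc k * exp (s * cos tht))) (at s)"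
proof -
 have "((%s. integral (cbox 0 pi) (%tht. cos tht ^ k * exp (s * cos tht))) has_field_derivative
 integral (cbox 0 pi) (%tht. cos tht ^ Suc k * exp (s * cos tht))) (at s within UNIV)"
 proof (rule leibniz_rule_field_derivative)
 show "continuous_on (UNIV \<times> cbox 0 pi) (%(s, tht). cos tht ^ Suc k * exp (s * cos tht))"
 by (auto intro!: continuous_intros simp: case_prod_unfold)
 show "(%tht. cos tht ^ k * exp (s * cos tht)) integrable_on cbox 0 pi" for s
 by (intro integrable_continuous continuous_intros)
 qed (auto intro!: derivative_eq_intros)
 then show ?thesis by simp
qed

lemma bessel0_deriv [derivative_intros]: "(bessel0 has_real_derivative bessel1 s) (at s)"
 using DERIV_cdivide[OF integral_cos_power_exp_deriv[of 0 s], of pi]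
 unfolding bessel0_def bessel1_def by simp

lemma bessel1_deriv:
 assumes "s ~= 0"
 shows "(bessel1 has_real_derivative bessel0 s - bessel1 s/s) (at s)"
proof -
 have "((%tht. s*(sin tht ^ 2 * exp (s * cos tht)) - cos tht * exp (s * cos tht)) has_integral
 - sin pi * exp (s * cos pi) - (- sin 0 * exp (s * cos 0))) {0..pi}"
 by (rule fundamental_theorem_of_calculus)
 (auto intro!: derivative_eq_intros simp: has_real_derivative_iff_has_vector_derivative[symmetric] algebra_simps power2_eq_square)
 then have "((%tht. s*(sin tht ^ 2 * exp (s * cos tht)) - cos tht * exp (s * cos tht)) has_integral 0) {0..pi}"
 by simp
 from integral_unique[OF this]
 have "integral {0..pi} (%tht. s*(sin tht ^ 2 * exp (s * cos tht))) = integral {0..pi} (%tht. cos tht * exp (s * cos tht))"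
 by (subst (asm) integral_diff) (auto intro!: integrable_continuous_real continuous_intros)
 then have sin2: "s * integral {0..pi} (%tht. sin tht ^ 2 * exp (s * cos tht)) = pi * bessel1 s"
 by (simp add: bessel1_def)
 have "integral {0..pi} (%tht. cos tht ^ Suc 1 * exp (s * cos tht))
 = integral {0..pi} (%tht. exp (s * cos tht) - sin tht ^ 2 * exp (s * cos tht))"
 by (intro integral_cong) (auto simp: cos_squared_eq algebra_simps power2_eq_square[symmetric] simp flip: power2_eq_square)
 also have "... = integral {0..pi} (%tht. exp (s * cos tht)) - integral {0..pi} (%tht. sin tht ^ 2 * exp (s * cos tht))"
 by (rule integral_diff) (auto intro!: integrable_continuous_real continuous_intros)
 finally have "integral {0..pi} (%tht. cos tht ^ Suc 1 * exp (s * cos tht)) =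
 integral {0..pi} (%tht. exp (s * cos tht)) - integral {0..pi} (%tht. sin tht ^ 2 * exp (s * cos tht))" .
 then have "integral {0..pi} (%tht. cos tht ^ Suc 1 * exp (s * cos tht))/pi = bessel0 s - bessel1 s/s"
 proof -
 assume A: "integral {0..pi} (%tht. cos tht ^ Suc 1 * exp (s * cos tht)) =
 integral {0..pi} (%tht. exp (s * cos tht)) - integral {0..pi} (%tht. sin tht ^ 2 * exp (s * cos tht))"
 have "integral {0..pi} (%tht. sin tht ^ 2 * exp (s * cos tht)) = pi * bessel1 s/s"
 using sin2 assms by (simp add: eq_divide_eq mult.commute)
 then show ?thesis unfolding A by (simp add: bessel0_def diff_divide_distrib)
 qed
 then show ?thesis
 using DERIV_cdivide[OF integral_cos_power_exp_deriv[of 1 s], of pi]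
 unfolding bessel1_def by simp
qed

lemma bessel0_pos: "0 < bessel0 s"
proof -
 have "integral {0..pi} (%tht. exp (- (abs s))) <= integral {0..pi} (%tht. exp (s * cos tht))"
 proof (rule integral_le)
 fix tht :: real
 have "\<bar>s * cos tht\<bar> <= (abs s)*1" unfolding abs_mult by (intro mult_left_mono) auto
 then show "exp (- (abs s)) <= exp (s * cos tht)" by (simp add: abs_le_iff)
 qed (auto intro!: integrable_continuous_real continuous_intros)
 then show ?thesis unfolding bessel0_def by (simp add: divide_pos_pos less_le_trans[rotated])
qed

lemma bessel1_nonneg:
 assumes "0 <= s" shows "0 <= bessel1 s"
proof -
 have "((%tht. cos tht) has_integral (sin pi - sin 0)) {0..pi}"
 by (rule fundamental_theorem_of_calculus)
 (auto intro!: derivative_eq_intros simp: has_real_derivative_iff_has_vector_derivative[symmetric])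
 then have "bessel1 0 = 0" by (simp add: bessel1_def integral_unique)
 moreover have "bessel1 0 <= bessel1 s"
 proof (rule DERIV_nonneg_imp_nondecreasing[OF assms])
 fix x
 have "(bessel1 has_real_derivative integral {0..pi} (%tht. cos tht ^ Suc 1 * exp (x * cos tht))/pi) (at x)"
 using DERIV_cdivide[OF integral_cos_power_exp_deriv[of 1 x], of pi] unfolding bessel1_def by simp
 moreover have "0 <= integral {0..pi} (%tht. cos tht ^ Suc 1 * exp (x * cos tht))"
 by (intro integral_nonneg integrable_continuous_real continuous_intros) auto
 ultimately show "\<exists>y. (bessel1 has_real_derivative y) (at x) & 0 <= y" by (auto intro!: exI)
 qed
 ultimately show ?thesis by simp
qed

lemma gaussian_finite_integral:
 assumes s: "s > 0"
 shows "sqrt (pi/(2 * s)) - 1/s <= integral {0..2} (%z. exp (- s * z\<^sup>2/2))"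
 and "integral {0..2} (%z. exp (- s * z\<^sup>2/2)) <= sqrt (pi/(2 * s))"
proof -
 define W where "W = sqrt (2 * s)"
 have W: "W > 0" "W\<^sup>2 = 2 * s" using s by (auto simp: W_def)
 have hb: "has_bochner_integral lborel (%x. indicator {0..} x *\<^sub>R exp (- x\<^sup>2)) (sqrt pi/2)"
 by (rule gaussian_moment_0)
 have G: "((%x. exp (- x\<^sup>2)) has_integral (sqrt pi/2)) {0::real..}"
 proof -
 have "((%x::real. indicator {0..} x *\<^sub>R exp (- x\<^sup>2)) has_integral (sqrt pi/2)) UNIV"
 proof -
 have i: "integrable lborel (%x::real. indicator {0..} x *\<^sub>R exp (- x\<^sup>2))"
 and v: "(LBINT x. indicator {0::real..} x *\<^sub>R exp (- x\<^sup>2)) = sqrt pi/2"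
 using hb by (simp_all only: has_bochner_integral_iff)
 show ?thesis using has_integral_integral_lborel[OF i] unfolding v .
 qed
 then show ?thesis
 by (subst has_integral_restrict_UNIV[symmetric]) (elim has_integral_eq[rotated], auto)
 qed
 define J where "J = integral {0..W} (%x. exp (- x\<^sup>2))"
 have J: "((%x. exp (- x\<^sup>2)) has_integral J) {0..W}"
 unfolding J_def by (intro integrable_integral integrable_continuous_real continuous_intros)
 have up: "J <= sqrt pi/2"
 by (rule has_integral_subset_le[OF _ J G]) auto
 have inv: "((%x::real. x powr -2) has_integral - (W powr (-2 + 1))/(-2 + 1)) {W..}"
 using has_integral_powr_to_inf[of "-2" W] W by simp
 have lo: "sqrt pi/2 - J <= 1/W"
 proof -
 have "((%x. exp (- x\<^sup>2)) has_integral (sqrt pi/2 - J)) ({0..} - {0..W})"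
 using has_integral_diff[OF G[THEN has_integral_restrict_UNIV[THEN iffD2]] J[THEN has_integral_restrict_UNIV[THEN iffD2]]]
 by (subst has_integral_restrict_UNIV[symmetric])
 (elim has_integral_eq[rotated], auto)
 moreover have "(%x. exp (- x\<^sup>2)) x <= x powr -2" if "x > 0" for x :: real
 proof -
 have "1 + x\<^sup>2 <= exp (x\<^sup>2)" by (rule exp_ge_add_one_self)
 then have "x\<^sup>2 <= exp (x\<^sup>2)" by linarith
 then have "inverse (exp (x\<^sup>2)) <= inverse (x\<^sup>2)" using that by (intro le_imp_inverse_le) auto
 then show ?thesis using that by (simp add: exp_minus powr_minus powr_realpow)
 qed
 ultimately have "sqrt pi/2 - J <= - (W powr (-2 + 1))/(-2 + 1)"
 using W by (intro has_integral_le[OF _ inv[THEN has_integral_restrict_UNIV[THEN iffD2]],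
 of "%x. if x \<in> {0..} - {0..W} then exp (- x\<^sup>2) else 0"]) (auto simp only: has_integral_restrict_UNIV, auto)
 then show ?thesis using W by (simp add: powr_minus divide_simps)
 qed
 have "((%z. exp (- ((W/2) * z + 0)\<^sup>2)) has_integral (1/\<bar>W/2\<bar>) *\<^sub>R J) ((%x. (1/(W/2)) *\<^sub>R x + - ((1/(W/2)) *\<^sub>R 0)) ` {0..W})"
 using has_integral_affinity[of "%x. exp (- x\<^sup>2)" J 0 W "W/2" 0] J W by (simp add: cbox_interval)
 moreover have "(%x. (1/(W/2)) *\<^sub>R x + - ((1/(W/2)) *\<^sub>R 0)) ` {0..W} = {0..2}"
 using W image_mult_atLeastAtMost[of "2/W" 0 W] by simp
 moreover have "- ((W/2) * z + 0)\<^sup>2 = - s * z\<^sup>2/2" for z using W by (simp add: power_mult_distrib power_divide)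
 ultimately have "((%z. exp (- s * z\<^sup>2/2)) has_integral 2/W * J) {0..2}"
 using W by (simp only:) simp
 then have eq: "integral {0..2} (%z. exp (- s * z\<^sup>2/2)) = 2/W * J"
 by (rule integral_unique)
 have c: "2/W*(sqrt pi/2) = sqrt (pi/(2 * s))" unfolding W_def using s by (simp add: real_sqrt_divide)
 show "integral {0..2} (%z. exp (- s * z\<^sup>2/2)) <= sqrt (pi/(2 * s))"
 unfolding eq c[symmetric] using up W by (intro mult_left_mono) auto
 have "2/W*(sqrt pi/2 - J) <= 2/W*(1/W)" using lo W by (intro mult_left_mono) auto
 also have "... = 1/s" using W by (simp add: power2_eq_square[symmetric])
 finally show "sqrt (pi/(2 * s)) - 1/s <= integral {0..2} (%z. exp (- s * z\<^sup>2/2))"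
 unfolding eq c[symmetric] by (simp add: algebra_simps)
qed

text \<open>The substitution by twice the sine of the half angle turns the Laplace integral into a
  Gaussian one.\<close>

lemma half_angle_gaussian:
 "integral {0..pi} (%tht. cos (tht/2) * exp (- s*(1 - cos tht))) = integral {0..2} (%z. exp (- s * z\<^sup>2/2))"
proof -
 have "((%tht. cos (tht/2) *\<^sub>R exp (- s*(2 * sin (tht/2))\<^sup>2/2)) has_integral
 integral {2 * sin (0/2)..2 * sin (pi/2)} (%z. exp (- s * z\<^sup>2/2))) {0..pi}"
 proof (rule has_integral_substitution[where c = 0 and d = 2])
 show "(%tht. 2 * sin (tht/2)) ` {0..pi} \<subseteq> {0..2}"
 by (auto intro!: sin_ge_zero)
 qed (auto intro!: continuous_intros derivative_eq_intros simp: has_real_derivative_iff_has_vector_derivative[symmetric])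
 moreover have "- s*(2 * sin (tht/2))\<^sup>2/2 = - s*(1 - cos tht)" for tht :: real
 proof -
 have "(2 * sin (tht/2))\<^sup>2/2 = 1 - cos tht" using cos_double_sin[of "tht/2"] by (simp add: power_mult_distrib)
 then show ?thesis by (metis times_divide_eq_right)
 qed
 ultimately have "((%tht. cos (tht/2) * exp (- s*(1 - cos tht))) has_integral
 integral {0..2} (%z. exp (- s * z\<^sup>2/2))) {0..pi}" by (simp only: real_scaleR_def) simp
 then show ?thesis by (rule integral_unique)
qed

definition laplace0 :: "real => real" where
 "laplace0 s = integral {0..pi} (%tht. exp (- s*(1 - cos tht)))"

definition laplace1 :: "real => real" where
 "laplace1 s = integral {0..pi} (%tht. (1 - cos tht) * exp (- s*(1 - cos tht)))"

lemma laplace1_bounds: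
 assumes s: "s > 0"
 shows "0 <= laplace1 s" "laplace1 s <= 2/s * laplace0 (s/2)"
proof -
 show "0 <= laplace1 s" unfolding laplace1_def
 by (intro integral_nonneg integrable_continuous_real continuous_intros) auto
 have "laplace1 s <= integral {0..pi} (%tht. 2/s * exp (- (s/2)*(1 - cos tht)))"
 unfolding laplace1_def
 proof (rule integral_le)
 fix tht :: real
 define x where "x = 1 - cos tht"
 have "s/2 * x <= exp (s/2 * x)" using exp_ge_add_one_self[of "s/2*x"] by linarith
 then have "x <= 2/s * exp (s/2 * x)" using s by (simp add: field_simps)
 then have "x * exp (- s * x) <= 2/s * exp (s/2 * x) * exp (- s * x)" by (intro mult_right_mono) auto
 also have "... = 2/s * exp (- (s/2) * x)" by (simp add: mult.assoc mult_exp_exp)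
 finally show "(1 - cos tht) * exp (- s*(1 - cos tht)) <= 2/s * exp (- (s/2)*(1 - cos tht))" by (simp add: x_def)
 qed (use s in \<open>auto intro!: integrable_continuous_real continuous_intros\<close>)
 then show "laplace1 s <= 2/s * laplace0 (s/2)" by (simp add: laplace0_def)
qed

lemma laplace0_le_pi: "0 <= s ==> laplace0 s <= pi"
proof -
 assume s: "0 <= s"
 have "laplace0 s <= integral {0..pi} (%tht. 1)" unfolding laplace0_def
 using s by (intro integral_le integrable_continuous_real continuous_intros) auto
 then show ?thesis by simp
qed

lemma laplace1_le: "0 < s ==> laplace1 s <= 2/s * pi"
 using laplace1_bounds(2)[of s] mult_left_mono[OF laplace0_le_pi[of "s/2"], of "2/s"] by simp

lemma laplace0_bounds:
 assumes s: "s > 0"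
 shows "sqrt (pi/(2 * s)) - 1/s <= laplace0 s" "laplace0 s <= sqrt (pi/(2 * s)) + pi/s"
proof -
 have "integral {0..pi} (%tht. cos (tht/2) * exp (- s*(1 - cos tht))) <= laplace0 s"
 unfolding laplace0_def by (intro integral_le integrable_continuous_real continuous_intros) auto
 then show "sqrt (pi/(2 * s)) - 1/s <= laplace0 s"
 using gaussian_finite_integral(1)[OF s] half_angle_gaussian[of s] by simp
 have "laplace0 s <= integral {0..pi} (%tht. cos (tht/2) * exp (- s*(1 - cos tht)) + (1 - cos tht) * exp (- s*(1 - cos tht))/2)"
 unfolding laplace0_def
 proof (rule integral_le)
 fix tht :: real assume th: "tht \<in> {0..pi}"
 have c: "0 <= cos (tht/2)" using th by (intro cos_ge_zero) auto
 have "(cos (tht/2))\<^sup>2 <= cos (tht/2)" using c mult_left_mono[of "cos (tht/2)" 1 "cos (tht/2)"] by (simp add: power2_eq_square)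
 moreover have "cos tht = 2*(cos (tht/2))\<^sup>2 - 1" using cos_double_cos[of "tht/2"] by simp
 ultimately have "1 <= cos (tht/2) + (1 - cos tht)/2" by (simp only: diff_divide_distrib)
 from mult_right_mono[OF this, of "exp (- s*(1 - cos tht))"]
 show "exp (- s*(1 - cos tht)) <= cos (tht/2) * exp (- s*(1 - cos tht)) + (1 - cos tht) * exp (- s*(1 - cos tht))/2"
 by (simp add: algebra_simps)
 qed (auto intro!: integrable_continuous_real continuous_intros)
 also have "... = integral {0..2} (%z. exp (- s * z\<^sup>2/2)) + laplace1 s/2"
 unfolding laplace1_def half_angle_gaussian[symmetric]
 by (subst integral_add) (auto intro!: integrable_continuous_real continuous_intros)
 also have "... <= sqrt (pi/(2 * s)) + pi/s"
 proof -
 have "laplace1 s <= 2/s * pi"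
 using laplace1_le[OF s] .
 then show ?thesis using gaussian_finite_integral(2)[OF s] by simp
 qed
 finally show "laplace0 s <= sqrt (pi/(2 * s)) + pi/s" .
qed

lemma bessel_laplace:
 "bessel0 s = exp s * laplace0 s/pi" "bessel1 s = exp s*(laplace0 s - laplace1 s)/pi"
proof -
 have e: "exp (- s*(1 - cos tht)) = exp (- s) * exp (s * cos tht)" for tht by (simp add: mult_exp_exp algebra_simps)
 show 0: "bessel0 s = exp s * laplace0 s/pi"
 unfolding bessel0_def laplace0_def e by (simp add: exp_minus)
 have "laplace0 s - laplace1 s = integral {0..pi} (%tht. cos tht * exp (- s*(1 - cos tht)))"
 unfolding laplace0_def laplace1_def
 by (subst integral_diff[symmetric]) (auto intro!: integrable_continuous_real continuous_intros simp: algebra_simps)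
 also have "... = exp (- s) * integral {0..pi} (%tht. cos tht * exp (s * cos tht))"
 unfolding e by (subst integral_mult_right[symmetric]) (simp add: mult.left_commute)
 finally show "bessel1 s = exp s*(laplace0 s - laplace1 s)/pi"
 unfolding bessel1_def by (simp add: exp_minus)
qed

text \<open>Laplace's method at the angle zero. The error of relative order $s^{-1/2}$ is not
  optimal, but it is below the accuracy of the eigenvalue asymptotics.\<close>

lemma bessel_asymptotics:
 "(%s. sqrt (2 * pi * s) * exp (- s) * bessel0 s - 1) \<in> O(%s. s powr (-1/2))"
 "(%s. sqrt (2 * pi * s) * exp (- s) * bessel1 s - 1) \<in> O(%s. s powr (-1/2))"
proof -
 have k: "sqrt (2 * pi * s)/pi * sqrt (pi/(2 * s)) = 1" if "s > 0" for s
 using that by (simp add: real_sqrt_mult real_sqrt_divide field_simps)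
 have c: "sqrt (2 * pi * s)/pi*(pi/s) = sqrt (2 * pi) * s powr (-1/2)" if "s > 0" for s
 using that by (simp add: real_sqrt_mult powr_minus powr_half_sqrt field_simps)
 have b0: "\<bar>sqrt (2 * pi * s)/pi * laplace0 s - 1\<bar> <= sqrt (2 * pi) * s powr (-1/2)" if s: "s > 0" for s
 proof -
 have "\<bar>laplace0 s - sqrt (pi/(2 * s))\<bar> <= pi/s"
 using laplace0_bounds[OF s] divide_right_mono[of 1 pi s] pi_gt3 s by (auto simp: abs_le_iff)
 then have "sqrt (2 * pi * s)/pi * \<bar>laplace0 s - sqrt (pi/(2 * s))\<bar> <= sqrt (2 * pi * s)/pi*(pi/s)"
 using s by (intro mult_left_mono) auto
 moreover have "sqrt (2 * pi * s)/pi * \<bar>laplace0 s - sqrt (pi/(2 * s))\<bar>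
 = \<bar>sqrt (2 * pi * s)/pi*(laplace0 s - sqrt (pi/(2 * s)))\<bar>"
 using s by (simp add: abs_mult)
 moreover have "sqrt (2 * pi * s)/pi*(laplace0 s - sqrt (pi/(2 * s))) = sqrt (2 * pi * s)/pi * laplace0 s - 1"
 using k[OF s] by (simp only: right_diff_distrib)
 ultimately show ?thesis using c[OF s] by linarith
 qed
 have b1: "\<bar>sqrt (2 * pi * s)/pi * laplace1 s\<bar> <= 2 * sqrt (2 * pi) * s powr (-1/2)" if s: "s > 0" for s
 proof -
 have "laplace1 s <= 2/s * pi"
 using laplace1_le[OF s] .
 then have "sqrt (2 * pi * s)/pi * laplace1 s <= sqrt (2 * pi * s)/pi*(2/s * pi)"
 using s by (intro mult_left_mono) auto
 also have "... = 2 * sqrt (2 * pi) * s powr (-1/2)" using c[OF s] by (simp add: mult_ac)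
 finally show ?thesis using laplace1_bounds(1)[OF s] s by (simp add: abs_mult)
 qed
 show "(%s. sqrt (2 * pi * s) * exp (- s) * bessel0 s - 1) \<in> O(%s. s powr (-1/2))"
 proof (rule bigoI[where c = "sqrt (2 * pi)"])
 show "\<forall>\<^sub>F s in at_top. norm (sqrt (2 * pi * s) * exp (- s) * bessel0 s - 1) <= sqrt (2 * pi) * norm (s powr (-1/2))"
 using eventually_gt_at_top[of 0]
 proof eventually_elim
 case (elim s)
 have "sqrt (2 * pi * s) * exp (- s) * bessel0 s = sqrt (2 * pi * s)/pi * laplace0 s"
 unfolding bessel_laplace by (simp add: exp_minus)
 then show ?case using b0[OF elim] by simp
 qed
 qed
 show "(%s. sqrt (2 * pi * s) * exp (- s) * bessel1 s - 1) \<in> O(%s. s powr (-1/2))"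
 proof (rule bigoI[where c = "3 * sqrt (2 * pi)"])
 show "\<forall>\<^sub>F s in at_top. norm (sqrt (2 * pi * s) * exp (- s) * bessel1 s - 1) <= 3 * sqrt (2 * pi) * norm (s powr (-1/2))"
 using eventually_gt_at_top[of 0]
 proof eventually_elim
 case (elim s)
 have "sqrt (2 * pi * s) * exp (- s) * bessel1 s - 1
 = (sqrt (2 * pi * s)/pi * laplace0 s - 1) - sqrt (2 * pi * s)/pi * laplace1 s"
 proof -
 have "exp (- s)*(exp s * X) = X" for X by (simp add: exp_minus)
 then have "sqrt (2 * pi * s) * exp (- s) * bessel1 s = sqrt (2 * pi * s)/pi*(laplace0 s - laplace1 s)"
 unfolding bessel_laplace by (simp only: mult.assoc times_divide_eq_right times_divide_eq_left)
 then show ?thesis by (simp only: right_diff_distrib)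
 qed
 then show ?case
 using b0[OF elim] b1[OF elim]
 abs_triangle_ineq4[of "sqrt (2 * pi * s)/pi * laplace0 s - 1" "sqrt (2 * pi * s)/pi * laplace1 s"]
 unfolding real_norm_def abs_of_nonneg[OF powr_ge_zero] by linarith
 qed
 qed
qed

section \<open>Comparison functions at a simple turning point\<close>

lemma right_limit_le:
 fixes h :: "real => real"
 assumes lim: "(h \<longlongrightarrow> L) (at_right l)" and ls: "l < s"
 and der: "!!x. l < x ==> x <= s ==> \<exists>D. (h has_real_derivative D) (at x) & 0 <= D"
 shows "L <= h s"
proof (rule tendsto_upperbound[OF lim])
 show "\<forall>\<^sub>F x in at_right l. h x <= h s"
 unfolding eventually_at_right[OF ls]
 proof (intro exI[of _ s] conjI ls allI impI)
 fix x assume x: "l < x" "x < s"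
 show "h x <= h s" by (rule DERIV_nonneg_imp_nondecreasing) (use x der in auto)
 qed
qed simp

lemma isCont_imp_at_right:
 fixes f :: "real => real"
 shows "isCont f x ==> (f \<longlongrightarrow> f x) (at_right x)"
 by (simp add: isCont_def filterlim_at_split)

text \<open>A solution of $Y'' = (\kappa^2 - 1/(4t^2)) Y$, regular at $0$: the model equation at
  an endpoint where the leading coefficient has a simple zero, in the travel-time
  variable.\<close>

definition wkb_Y :: "real => real => real" where
 "wkb_Y ka t = sqrt t * bessel0 (ka * t)"

definition wkb_Y' :: "real => real => real" where
 "wkb_Y' ka t = bessel0 (ka * t)/(2 * sqrt t) + sqrt t * ka * bessel1 (ka * t)"

lemma bessel_scaled_deriv:
 "((%t. bessel0 (ka * t)) has_real_derivative ka * bessel1 (ka * t)) (at t)"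
 "ka * t ~= 0 ==> ((%t. bessel1 (ka * t)) has_real_derivative
 ka*(bessel0 (ka * t) - bessel1 (ka * t)/(ka * t))) (at t)"
 using DERIV_chain2[where f = bessel0 and g = "%t. ka * t", OF bessel0_deriv DERIV_cmult_Id[of ka t]]
 DERIV_chain2[where f = bessel1 and g = "%t. ka * t", OF bessel1_deriv DERIV_cmult_Id[of ka t]]
 by (simp_all add: mult.commute)

lemma wkb_Y_deriv:
 assumes "0 < t" shows "(wkb_Y ka has_real_derivative wkb_Y' ka t) (at t)"
 using DERIV_mult[OF DERIV_real_sqrt[OF assms] bessel_scaled_deriv(1)[of ka t]] assms
 unfolding wkb_Y_def[abs_def] wkb_Y'_def by (simp add: field_simps)

lemma wkb_Y'_deriv:
 assumes t: "0 < t" and k: "0 < ka"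
 shows "(wkb_Y' ka has_real_derivative (ka\<^sup>2 - 1/(4 * t\<^sup>2)) * wkb_Y ka t) (at t)"
proof -
 have kt: "ka * t ~= 0" using t k by simp
 define z where "z = sqrt t"
 have z: "z > 0" "t = z\<^sup>2" using t by (auto simp: z_def)
 note ds = DERIV_real_sqrt[OF t]
 have "((%t. bessel0 (ka * t)/(2 * sqrt t) + sqrt t * ka * bessel1 (ka * t)) has_real_derivative
 (ka * bessel1 (ka * t)*(2 * sqrt t) - bessel0 (ka * t)*(2*(inverse (sqrt t)/2)))/(2 * sqrt t*(2 * sqrt t))
 + (inverse (sqrt t)/2 * ka * bessel1 (ka * t) + ka*(bessel0 (ka * t) - bessel1 (ka * t)/(ka * t))*(sqrt t * ka))) (at t)"
 using t by (intro DERIV_add DERIV_divide DERIV_mult DERIV_cmult DERIV_cmult_right bessel_scaled_deriv kt ds) auto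
 also have "(ka * bessel1 (ka * t)*(2 * sqrt t) - bessel0 (ka * t)*(2*(inverse (sqrt t)/2)))/(2 * sqrt t*(2 * sqrt t))
 + (inverse (sqrt t)/2 * ka * bessel1 (ka * t) + ka*(bessel0 (ka * t) - bessel1 (ka * t)/(ka * t))*(sqrt t * ka))
 = (ka\<^sup>2 - 1/(4 * t\<^sup>2)) * wkb_Y ka t"
 proof -
 define X Y where "X = bessel0 (ka * t)" and "Y = bessel1 (ka * t)"
 show ?thesis
 unfolding wkb_Y_def X_def[symmetric] Y_def[symmetric] z_def[symmetric] using z k
 by (simp add: divide_simps power2_eq_square) (simp add: algebra_simps)
 qed
 finally show ?thesis unfolding wkb_Y'_def[abs_def] .
qed

lemma wkb_Y_pos: "0 < t ==> 0 < wkb_Y ka t"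
 by (simp add: wkb_Y_def bessel0_pos)

lemma wkb_Y'_pos: "0 < t ==> 0 < ka ==> 0 < wkb_Y' ka t"
 unfolding wkb_Y'_def by (intro add_pos_nonneg divide_pos_pos mult_nonneg_nonneg bessel0_pos bessel1_nonneg) auto

text \<open>A coefficient $p(s) = s R(s)$ with a simple zero at $0$, and its travel time $T = \int
  p^{-1/2}$.\<close>

locale wkb_endpoint =
 fixes R R1 R2 T :: "real => real" and m :: real
 assumes m: "0 < m" and Rpos: "!!s. 0 <= s ==> s <= m ==> 0 < R s"
 and R: "!!s. (R has_real_derivative R1 s) (at s)" and R1: "!!s. (R1 has_real_derivative R2 s) (at s)"
 and R2: "continuous_on {0..m} R2"
 and T: "!!s. 0 < s ==> s <= m ==> (T has_real_derivative 1/sqrt (s * R s)) (at s)"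
 and T0: "(T \<longlongrightarrow> 0) (at_right 0)"
begin

lemma R_bounds:
 obtains r0 r1 where "0 < r0" "!!s. 0 <= s ==> s <= m ==> r0 <= R s" "!!s. 0 <= s ==> s <= m ==> R s <= r1"
proof -
 have c: "continuous_on {0..m} R" by (rule DERIV_continuous_on, rule has_field_derivative_at_within, rule R)
 obtain x where x: "x \<in> {0..m}" "!!y. y \<in> {0..m} ==> R x <= R y"
 using continuous_attains_inf[OF compact_Icc _ c] m by auto
 obtain z where z: "z \<in> {0..m}" "!!y. y \<in> {0..m} ==> R y <= R z"
 using continuous_attains_sup[OF compact_Icc _ c] m by auto
 show thesis using x z Rpos by (intro that[of "R x" "R z"]) auto
qed

lemma T_approx:
 obtains C where "0 <= C" "!!s. 0 < s ==> s <= m ==> \<bar>T s - 2 * sqrt (s/R s)\<bar> <= C*(s * sqrt s)"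
proof -
 obtain r0 r1 where r: "0 < r0" "!!s. 0 <= s ==> s <= m ==> r0 <= R s" "!!s. 0 <= s ==> s <= m ==> R s <= r1"
 using R_bounds by blast
 have c: "continuous_on {0..m} R1" by (rule DERIV_continuous_on, rule has_field_derivative_at_within, rule R1)
 obtain B where B: "0 <= B" "!!s. s \<in> {0..m} ==> norm (R1 s) <= B"
 by (rule bounded_normE[OF compact_imp_bounded[OF compact_continuous_image[OF c compact_Icc]]]) (metis image_eqI norm_ge_zero order_trans m less_imp_le atLeastAtMost_iff order_refl)
 define C where "C = B/(r0 * sqrt r0)"
 have C: "0 <= C" using B r by (simp add: C_def)
 define g where "g = (%s. T s - 2 * sqrt (s/R s))"
 have g: "(g has_real_derivative R1 s * sqrt s/(R s * sqrt (R s))) (at s)" if s: "0 < s" "s <= m" for s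
 proof -
 have Rs: "0 < R s" using Rpos s by simp
 define y z where "y = sqrt s" and "z = sqrt (R s)"
 have yz: "y > 0" "z > 0" "s = y\<^sup>2" "R s = z\<^sup>2" using s Rs by (auto simp: y_def z_def)
 have "((%s. s/R s) has_real_derivative (1 * R s - s * R1 s)/(R s * R s)) (at s)"
 using Rs by (intro DERIV_divide DERIV_ident R) auto
 from DERIV_diff[OF T[OF s] DERIV_cmult[OF DERIV_chain2[OF DERIV_real_sqrt this], of 2]]
 have "(g has_real_derivative 1/sqrt (s * R s) - 2*(inverse (sqrt (s/R s))/2*((1 * R s - s * R1 s)/(R s * R s)))) (at s)"
 unfolding g_def using s Rs by simp
 also have "1/sqrt (s * R s) - 2*(inverse (sqrt (s/R s))/2*((1 * R s - s * R1 s)/(R s * R s)))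
 = R1 s * sqrt s/(R s * sqrt (R s))"
 unfolding real_sqrt_mult real_sqrt_divide y_def[symmetric] z_def[symmetric] using yz
 by (simp add: divide_simps) (simp add: algebra_simps power2_eq_square power4_eq_xxxx)
 finally show ?thesis .
 qed
 have g': "\<bar>R1 s * sqrt s/(R s * sqrt (R s))\<bar> <= C * sqrt s" if s: "0 < s" "s <= m" for s
 proof -
 have "0 < R s" using Rpos s by simp
 have "r0 * sqrt r0 <= R s * sqrt (R s)" using r s \<open>0 < R s\<close> by (intro mult_mono) auto
 then have "\<bar>R1 s\<bar> * sqrt s/(R s * sqrt (R s)) <= B * sqrt s/(r0 * sqrt r0)"
 using B(2)[of s] B(1) s r by (intro frac_le mult_right_mono) auto
 then show ?thesis using \<open>0 < R s\<close> s by (simp add: C_def abs_mult)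
 qed
 have "((%s. s/R s) \<longlongrightarrow> 0/R 0) (at_right 0)"
 using Rpos[of 0] m by (intro tendsto_divide tendsto_ident_at isCont_imp_at_right DERIV_isCont[OF R]) auto
 then have "((%s. 2 * sqrt (s/R s)) \<longlongrightarrow> 2 * sqrt 0) (at_right 0)"
 by (intro tendsto_intros) simp
 then have g0: "(g \<longlongrightarrow> 0) (at_right 0)" unfolding g_def using tendsto_diff[OF T0] by fastforce
 have sq0: "((%s. C*(s * sqrt s)) \<longlongrightarrow> 0) (at_right 0)"
 by (rule tendsto_eq_intros refl | simp)+
 have sqd: "((%s. C*(s * sqrt s)) has_real_derivative C*(3/2 * sqrt s)) (at s)" if "0 < s" for s
 proof -
 have "inverse (sqrt s)/2 * s = sqrt s/2" using that by (simp add: real_div_sqrt inverse_eq_divide)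
 then show ?thesis using DERIV_cmult[OF DERIV_mult[OF DERIV_ident DERIV_real_sqrt[OF that]], of C] by simp
 qed
 have "\<bar>g s\<bar> <= C*(s * sqrt s)" if s: "0 < s" "s <= m" for s
 proof -
 have "0 <= C*(s * sqrt s) - g s"
 proof (rule right_limit_le[OF _ s(1)])
 show "((%s. C*(s * sqrt s) - g s) \<longlongrightarrow> 0) (at_right 0)" using tendsto_diff[OF sq0 g0] by simp
 fix x assume x: "0 < x" "x <= s"
 show "\<exists>D. ((%s. C*(s * sqrt s) - g s) has_real_derivative D) (at x) & 0 <= D"
 proof (rule exI, rule conjI, rule DERIV_diff[OF sqd[OF x(1)] g])
 show "0 <= C*(3/2 * sqrt x) - R1 x * sqrt x/(R x * sqrt (R x))"
 using g'[of x] x s mult_nonneg_nonneg[OF C, of "sqrt x"] unfolding abs_le_iff by linarith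
 qed (use x s in auto)
 qed
 moreover have "0 <= C*(s * sqrt s) + g s"
 proof (rule right_limit_le[OF _ s(1)])
 show "((%s. C*(s * sqrt s) + g s) \<longlongrightarrow> 0) (at_right 0)" using tendsto_add[OF sq0 g0] by simp
 fix x assume x: "0 < x" "x <= s"
 show "\<exists>D. ((%s. C*(s * sqrt s) + g s) has_real_derivative D) (at x) & 0 <= D"
 proof (rule exI, rule conjI, rule DERIV_add[OF sqd[OF x(1)] g])
 show "0 <= C*(3/2 * sqrt x) + R1 x * sqrt x/(R x * sqrt (R x))"
 using g'[of x] x s mult_nonneg_nonneg[OF C, of "sqrt x"] unfolding abs_le_iff by linarith
 qed (use x s in auto)
 qed
 ultimately show ?thesis by (simp add: abs_le_iff)
 qed
 then show thesis using C that by (auto simp: g_def)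
qed

lemma T_lower:
 obtains c where "0 < c" "!!s. 0 < s ==> s <= m ==> c * sqrt s <= T s"
proof -
 obtain r0 r1 where r: "0 < r0" "!!s. 0 <= s ==> s <= m ==> r0 <= R s" "!!s. 0 <= s ==> s <= m ==> R s <= r1"
 using R_bounds by blast
 have r1: "0 < r1" using r(1) r(2)[of 0] r(3)[of 0] m by simp
 define c where "c = 2/sqrt r1"
 have c: "0 < c" using r1 by (simp add: c_def)
 have "c * sqrt s <= T s" if s: "0 < s" "s <= m" for s
 proof -
 have "0 <= T s - c * sqrt s"
 proof (rule right_limit_le[OF _ s(1)])
 show "((%s. T s - c * sqrt s) \<longlongrightarrow> 0) (at_right 0)"
 by (rule tendsto_eq_intros T0 refl | simp)+
 fix x assume x: "0 < x" "x <= s"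
 have Rx: "0 < R x" "R x <= r1" using x s Rpos r by auto
 have "1/sqrt x*(1/sqrt r1) <= 1/sqrt x*(1/sqrt (R x))"
 using Rx r1 x by (intro mult_left_mono) (auto simp: frac_le)
 then have "0 <= 1/sqrt (x * R x) - c*(inverse (sqrt x)/2)"
 by (simp add: c_def real_sqrt_mult inverse_eq_divide mult.commute)
 moreover have "((%s. T s - c * sqrt s) has_real_derivative 1/sqrt (x * R x) - c*(inverse (sqrt x)/2)) (at x)"
 by (rule derivative_eq_intros T refl | use x s in simp)+
 ultimately show "\<exists>D. ((%s. T s - c * sqrt s) has_real_derivative D) (at x) & 0 <= D" by blast
 qed
 then show ?thesis by simp
 qed
 then show thesis using c that by blast
qed

lemma T_pos: "0 < s ==> s <= m ==> 0 < T s"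
proof -
 assume s: "0 < s" "s <= m"
 obtain c where "0 < c" "c * sqrt s <= T s" using T_lower s by metis
 then show ?thesis using s by (meson less_le_trans mult_pos_pos real_sqrt_gt_zero)
qed

definition p where "p s = s * R s"
definition p1 where "p1 s = R s + s * R1 s"
definition p2 where "p2 s = 2 * R1 s + s * R2 s"
definition E where "E s = 1/(4*(T s)\<^sup>2) - (p1 s)\<^sup>2/(16 * p s) + p2 s/4"

lemma p_pos: "0 < s ==> s <= m ==> 0 < p s" using Rpos by (simp add: p_def)

lemma p_deriv: "(p has_real_derivative p1 s) (at s)"
 unfolding p_def[abs_def] p1_def by (rule derivative_eq_intros R refl)+ (simp add: algebra_simps)

lemma p1_deriv: "(p1 has_real_derivative p2 s) (at s)"
 unfolding p1_def[abs_def] p2_def by (rule derivative_eq_intros R R1 refl)+ (simp add: algebra_simps)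

text \<open>Each of the two leading terms of the potential created by the change of variables is
  singular at the endpoint; the singularities cancel because the travel time is $2\sqrt{s/R(s)}$
  to leading order.\<close>

lemma E_bounded:
 obtains M where "0 <= M" "!!s. 0 < s ==> s <= m ==> \<bar>E s\<bar> <= M"
proof -
 obtain r0 r1 where r: "0 < r0" "!!s. 0 <= s ==> s <= m ==> r0 <= R s" "!!s. 0 <= s ==> s <= m ==> R s <= r1"
 using R_bounds by blast
 obtain C where C: "0 <= C" "!!s. 0 < s ==> s <= m ==> \<bar>T s - 2 * sqrt (s/R s)\<bar> <= C*(s * sqrt s)" using T_approx by blast
 obtain c where c: "0 < c" "!!s. 0 < s ==> s <= m ==> c * sqrt s <= T s" using T_lower by blast
 define F where "F = (%s. R1 s/8 + s*(R1 s)\<^sup>2/(16 * R s))"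
 have cR: "continuous_on {0..m} R" "continuous_on {0..m} R1"
 by (rule DERIV_continuous_on, rule has_field_derivative_at_within, rule R R1)+
 have "continuous_on {0..m} (%s. p2 s/4 - F s)"
 unfolding F_def p2_def[abs_def] using cR R2 Rpos by (intro continuous_intros) (auto simp: less_imp_neq[symmetric] dest: Rpos)
 then have "bounded ((%s. p2 s/4 - F s) ` {0..m})" by (intro compact_imp_bounded compact_continuous_image compact_Icc)
 then obtain B where B: "0 < B" "!!s. 0 < s ==> s <= m ==> \<bar>p2 s/4 - F s\<bar> <= B" unfolding bounded_pos by auto
 define D where "D = C*(C * m + 4/sqrt r0)/(4 * c\<^sup>2) * r1/4"
 have D: "\<bar>1/(4*(T s)\<^sup>2) - R s/(16 * s)\<bar> <= D" if s: "0 < s" "s <= m" for s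
 proof -
 define b where "b = 2 * sqrt (s/R s)"
 have Rs: "0 < R s" "r0 <= R s" "R s <= r1" using s r Rpos by auto
 have b: "0 < b" "b\<^sup>2 = 4 * s/R s" using s Rs by (auto simp: b_def power_mult_distrib)
 have Tp: "0 < T s" using T_pos s by simp
 have Tb: "\<bar>T s - b\<bar> <= C*(s * sqrt s)" using C s by (simp add: b_def)
 have sb: "sqrt (s/R s) <= sqrt s*(1/sqrt r0)"
 using Rs r s by (simp add: real_sqrt_divide frac_le)
 have "T s + b <= C*(s * sqrt s) + 2 * b" using Tb by linarith
 also have "... <= C*(m * sqrt s) + 4*(sqrt s*(1/sqrt r0))"
 using sb C s unfolding b_def by (intro add_mono mult_left_mono mult_right_mono) auto
 finally have sum: "T s + b <= sqrt s*(C * m + 4/sqrt r0)" by (simp add: algebra_simps)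
 have eq: "1/(4*(T s)\<^sup>2) - R s/(16 * s) = (b - T s)*(T s + b)/(4*(T s)\<^sup>2)*(R s/(4 * s))"
 proof -
 have "R s/(16 * s) = 1/(4 * b\<^sup>2)" "R s/(4 * s) = 1/b\<^sup>2" unfolding b(2) using s Rs by simp_all
 then show ?thesis using Tp b(1) by (simp add: divide_simps power2_eq_square) (simp add: algebra_simps)
 qed
 have T2: "c\<^sup>2 * s <= (T s)\<^sup>2"
 using power_mono[OF c(2)[OF s], of 2] c s by (simp add: power_mult_distrib)
 have "\<bar>1/(4*(T s)\<^sup>2) - R s/(16 * s)\<bar> = \<bar>T s - b\<bar> * (T s + b)/(4*(T s)\<^sup>2)*(R s/(4 * s))"
 unfolding eq using Tp b Rs s by (simp add: abs_mult abs_minus_commute)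
 also have "... <= (C*(s * sqrt s))*(sqrt s*(C * m + 4/sqrt r0))/(4*(c\<^sup>2 * s))*(r1/(4 * s))"
 proof (rule mult_mono)
 have K: "0 <= sqrt s*(C * m + 4/sqrt r0)" using sum Tp b by linarith
 have "\<bar>T s - b\<bar> * (T s + b) <= (C*(s * sqrt s))*(sqrt s*(C * m + 4/sqrt r0))"
 using Tb sum Tp b C s by (intro mult_mono) auto
 then show "\<bar>T s - b\<bar> * (T s + b)/(4*(T s)\<^sup>2) <= (C*(s * sqrt s))*(sqrt s*(C * m + 4/sqrt r0))/(4*(c\<^sup>2 * s))"
 using T2 c s K C by (intro frac_le) auto
 show "0 <= (C*(s * sqrt s))*(sqrt s*(C * m + 4/sqrt r0))/(4*(c\<^sup>2 * s))"
 using K C s c by simp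
 show "R s/(4 * s) <= r1/(4 * s)" using Rs s by (intro divide_right_mono) auto
 qed (use Rs s in auto)
 also have "... = C*(C * m + 4/sqrt r0)*((sqrt s * sqrt s) * s)/(4 * c\<^sup>2) * r1/(4*(s * s))"
 by (simp add: divide_simps)
 also have "... = D" using s c by (simp add: D_def divide_simps)
 finally show ?thesis .
 qed
 have "\<bar>E s\<bar> <= D + B" if s: "0 < s" "s <= m" for s
 proof -
 have Rs: "0 < R s" using s Rpos by auto
 have "(p1 s)\<^sup>2/(16 * p s) = R s/(16 * s) + F s"
 unfolding p1_def p_def F_def using s Rs by (simp add: divide_simps power2_eq_square) (simp add: algebra_simps)
 then have "E s = (1/(4*(T s)\<^sup>2) - R s/(16 * s)) + (p2 s/4 - F s)" unfolding E_def by simp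
 then show ?thesis using D[OF s] B(2)[OF s] by linarith
 qed
 then show thesis using that[of "\<bar>D + B\<bar>"] by (meson abs_ge_self abs_ge_zero order_trans)
qed

definition b where "b s = p s powr (1/4)"
definition psi where "psi ka s = wkb_Y ka (T s)/b s"
definition et where "et ka s = b s * wkb_Y' ka (T s) - p1 s * wkb_Y ka (T s)/(4 * b s)"

lemma b_facts:
 assumes s: "0 < s" "s <= m"
 shows "0 < b s" "b s ^ 4 = p s" "sqrt (p s) = b s ^ 2" "(b has_real_derivative p1 s/(4 * b s ^ 3)) (at s)"
proof -
 have ps: "0 < p s" using p_pos s by simp
 show b0: "0 < b s" using ps by (simp add: b_def)
 show b4: "b s ^ 4 = p s" using ps by (simp add: b_def powr_power)
 show "sqrt (p s) = b s ^ 2" by (rule real_sqrt_unique) (use b4 in \<open>simp_all add: power_mult[symmetric]\<close>)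
 have "b s ^ 3 = p s powr (3/4)" using ps by (simp add: b_def powr_power)
 then have e: "p s powr (1/4 - 1) = 1/b s ^ 3" using ps by (simp add: powr_minus_divide[symmetric])
 have "((%s. p s powr (1/4)) has_real_derivative 1/4 * p s powr (1/4 - 1) * p1 s) (at s)"
 using DERIV_chain2[OF has_real_derivative_powr[OF ps, of "1/4"] p_deriv[of s]] by simp
 then show "(b has_real_derivative p1 s/(4 * b s ^ 3)) (at s)"
 unfolding b_def[abs_def] e by (simp add: b_def)
qed

lemma psi_pos: "0 < s ==> s <= m ==> 0 < psi ka s"
 unfolding psi_def by (intro divide_pos_pos wkb_Y_pos T_pos b_facts)

lemma Y_T_deriv:
 assumes s: "0 < s" "s <= m" and k: "0 < ka"
 shows "((%s. wkb_Y ka (T s)) has_real_derivative wkb_Y' ka (T s)/b s ^ 2) (at s)"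
 "((%s. wkb_Y' ka (T s)) has_real_derivative (ka\<^sup>2 - 1/(4*(T s)\<^sup>2)) * wkb_Y ka (T s)/b s ^ 2) (at s)"
proof -
 have T': "(T has_real_derivative 1/b s ^ 2) (at s)"
 using T[OF s] b_facts(3)[OF s] by (simp add: p_def)
 show "((%s. wkb_Y ka (T s)) has_real_derivative wkb_Y' ka (T s)/b s ^ 2) (at s)"
 using DERIV_chain2[OF wkb_Y_deriv[OF T_pos[OF s]] T'] by simp
 show "((%s. wkb_Y' ka (T s)) has_real_derivative (ka\<^sup>2 - 1/(4*(T s)\<^sup>2)) * wkb_Y ka (T s)/b s ^ 2) (at s)"
 using DERIV_chain2[OF wkb_Y'_deriv[OF T_pos[OF s] k] T'] by simp
qed

lemma psi_deriv:
 assumes s: "0 < s" "s <= m" and k: "0 < ka"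
 shows "(psi ka has_real_derivative et ka s/p s) (at s)"
proof -
 note bf = b_facts[OF s]
 have "(psi ka has_real_derivative
 (wkb_Y' ka (T s)/b s ^ 2 * b s - wkb_Y ka (T s)*(p1 s/(4 * b s ^ 3)))/(b s * b s)) (at s)"
 unfolding psi_def[abs_def] using bf by (intro DERIV_divide Y_T_deriv s k) auto
 also have "(wkb_Y' ka (T s)/b s ^ 2 * b s - wkb_Y ka (T s)*(p1 s/(4 * b s ^ 3)))/(b s * b s) = et ka s/p s"
 unfolding et_def bf(2)[symmetric] using bf(1)
 by (simp add: divide_simps power2_eq_square power3_eq_cube power4_eq_xxxx)
 finally show ?thesis .
qed

lemma et_deriv:
 assumes s: "0 < s" "s <= m" and k: "0 < ka"
 shows "(et ka has_real_derivative (ka\<^sup>2 - E s) * psi ka s) (at s)"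
proof -
 note bf = b_facts[OF s]
 define Y Y1 B where "Y = wkb_Y ka (T s)" and "Y1 = wkb_Y' ka (T s)" and "B = b s"
 have B: "B > 0" using bf by (simp add: B_def)
 have Tp: "T s > 0" using T_pos s by simp
 have "(et ka has_real_derivative
 (p1 s/(4 * b s ^ 3) * Y1 + (ka\<^sup>2 - 1/(4*(T s)\<^sup>2)) * Y/b s ^ 2 * b s)
 - ((p2 s * Y + Y1/b s ^ 2 * p1 s)*(4 * b s) - p1 s * Y*(4*(p1 s/(4 * b s ^ 3))))/(4 * b s*(4 * b s))) (at s)"
 unfolding et_def[abs_def] Y_def Y1_def using bf
 by (intro DERIV_diff DERIV_divide DERIV_mult DERIV_cmult Y_T_deriv p1_deriv s k) auto
 also have "(p1 s/(4 * b s ^ 3) * Y1 + (ka\<^sup>2 - 1/(4*(T s)\<^sup>2)) * Y/b s ^ 2 * b s)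
 - ((p2 s * Y + Y1/b s ^ 2 * p1 s)*(4 * b s) - p1 s * Y*(4*(p1 s/(4 * b s ^ 3))))/(4 * b s*(4 * b s))
 = (ka\<^sup>2 - E s)*(Y/B)"
 unfolding E_def bf(2)[symmetric] B_def[symmetric] using B Tp
 by (simp add: divide_simps power2_eq_square power3_eq_cube power4_eq_xxxx) (simp add: algebra_simps)
 finally show ?thesis unfolding psi_def Y_def B_def .
qed

lemma T_over_sqrt_p: "((%s. T s/sqrt (p s)) \<longlongrightarrow> 2/R 0) (at_right 0)"
proof -
 obtain C where C: "0 <= C" "!!s. 0 < s ==> s <= m ==> \<bar>T s - 2 * sqrt (s/R s)\<bar> <= C*(s * sqrt s)" using T_approx by blast
 have "(R \<longlongrightarrow> R 0) (at_right 0)"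
 by (rule isCont_imp_at_right[OF DERIV_isCont[OF R]])
 then have R0: "((%s. 2/R s) \<longlongrightarrow> 2/R 0) (at_right 0)" "((%s. sqrt (R s)) \<longlongrightarrow> sqrt (R 0)) (at_right 0)"
 using Rpos[of 0] m by (auto intro!: tendsto_intros)
 have "((%s. C * s/sqrt (R s)) \<longlongrightarrow> C*0/sqrt (R 0)) (at_right 0)"
 using Rpos[of 0] m by (intro tendsto_intros R0) auto
 then have "((%s. C * s/sqrt (R s)) \<longlongrightarrow> 0) (at_right 0)" by simp
 moreover have "\<forall>\<^sub>F s in at_right 0. norm (T s/sqrt (p s) - 2/R s) <= C * s/sqrt (R s)"
 unfolding eventually_at_right[OF m]
 proof (intro exI[of _ m] conjI m allI impI)
 fix s assume s: "0 < s" "s < m"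
 have Rs: "0 < R s" using Rpos s by simp
 have sp: "sqrt (p s) = sqrt s * sqrt (R s)" by (simp add: p_def real_sqrt_mult)
 have "2/R s = 2 * sqrt (s/R s)/sqrt (p s)"
 unfolding sp real_sqrt_divide using s Rs by simp
 then have "T s/sqrt (p s) - 2/R s = (T s - 2 * sqrt (s/R s))/sqrt (p s)" by (simp add: diff_divide_distrib)
 then have "norm (T s/sqrt (p s) - 2/R s) = \<bar>T s - 2 * sqrt (s/R s)\<bar> / sqrt (p s)"
 using p_pos[of s] s by simp
 also have "... <= C*(s * sqrt s)/sqrt (p s)" using C(2)[of s] s p_pos[of s] by (intro divide_right_mono) auto
 also have "... = C * s/sqrt (R s)" unfolding sp using s by simp
 finally show "norm (T s/sqrt (p s) - 2/R s) <= C * s/sqrt (R s)" .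
 qed
 ultimately have "((%s. T s/sqrt (p s) - 2/R s) \<longlongrightarrow> 0) (at_right 0)" by (rule Lim_null_comparison[rotated])
 from tendsto_add[OF this R0(1)] show ?thesis by simp
qed

lemma bessel0_0: "bessel0 0 = 1" by (simp add: bessel0_def)

lemma bessel_T_limits:
 "((%s. bessel0 (ka * T s)) \<longlongrightarrow> 1) (at_right 0)"
 "((%s. bessel1 (ka * T s)) \<longlongrightarrow> bessel1 0) (at_right 0)"
proof -
 have l: "((%s. ka * T s) \<longlongrightarrow> 0) (at_right 0)" using tendsto_mult_left[OF T0, of ka] by simp
 have "(bessel1 has_real_derivative integral {0..pi} (%tht. cos tht ^ Suc 1 * exp (0 * cos tht))/pi) (at 0)"
 using DERIV_cdivide[OF integral_cos_power_exp_deriv[of 1 0], of pi] unfolding bessel1_def by simp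
 then have "isCont bessel1 0" "isCont bessel0 0" using bessel0_deriv by (auto intro: DERIV_isCont)
 then show "((%s. bessel0 (ka * T s)) \<longlongrightarrow> 1) (at_right 0)" "((%s. bessel1 (ka * T s)) \<longlongrightarrow> bessel1 0) (at_right 0)"
 using isCont_tendsto_compose[OF _ l] bessel0_0 by metis+
qed

lemma psi_limit: "(psi ka \<longlongrightarrow> sqrt (2/R 0)) (at_right 0)"
proof -
 have "((%s. sqrt (T s/sqrt (p s)) * bessel0 (ka * T s)) \<longlongrightarrow> sqrt (2/R 0)*1) (at_right 0)"
 by (intro tendsto_intros T_over_sqrt_p bessel_T_limits)
 moreover have "\<forall>\<^sub>F s in at_right 0. sqrt (T s/sqrt (p s)) * bessel0 (ka * T s) = psi ka s"
 unfolding eventually_at_right[OF m]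
 proof (intro exI[of _ m] conjI m allI impI)
 fix s assume s: "0 < s" "s < m"
 then show "sqrt (T s/sqrt (p s)) * bessel0 (ka * T s) = psi ka s"
 using b_facts[of s] by (simp add: psi_def wkb_Y_def real_sqrt_divide)
 qed
 ultimately show ?thesis by (simp add: tendsto_cong)
qed

lemma et_limit: "(et ka \<longlongrightarrow> 0) (at_right 0)"
proof -
 have R0: "0 < R 0" using Rpos[of 0] m by simp
 have l1: "((%s. bessel0 (ka * T s)/(2 * sqrt (T s/sqrt (p s)))) \<longlongrightarrow> 1/(2 * sqrt (2/R 0))) (at_right 0)"
 using R0 by (intro tendsto_intros T_over_sqrt_p bessel_T_limits) auto
 have p0: "(p \<longlongrightarrow> 0) (at_right 0)" "(p1 \<longlongrightarrow> R 0) (at_right 0)"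
 using isCont_imp_at_right[OF DERIV_isCont[OF p_deriv[of 0]]] isCont_imp_at_right[OF DERIV_isCont[OF p1_deriv[of 0]]]
 by (auto simp: p_def p1_def)
 have l2: "((%s. sqrt (sqrt (p s)) * sqrt (T s) * ka * bessel1 (ka * T s)) \<longlongrightarrow> sqrt (sqrt 0) * sqrt 0 * ka * bessel1 0) (at_right 0)"
 by (intro tendsto_intros p0 T0 bessel_T_limits)
 have l3: "((%s. p1 s/4 * psi ka s) \<longlongrightarrow> R 0/4 * sqrt (2/R 0)) (at_right 0)"
 by (intro tendsto_intros p0 psi_limit) auto
 have "((%s. bessel0 (ka * T s)/(2 * sqrt (T s/sqrt (p s))) + sqrt (sqrt (p s)) * sqrt (T s) * ka * bessel1 (ka * T s) - p1 s/4 * psi ka s)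
 \<longlongrightarrow> 1/(2 * sqrt (2/R 0)) + sqrt (sqrt 0) * sqrt 0 * ka * bessel1 0 - R 0/4 * sqrt (2/R 0)) (at_right 0)"
 by (intro tendsto_diff tendsto_add l1 l2 l3)
 also have "1/(2 * sqrt (2/R 0)) + sqrt (sqrt 0) * sqrt 0 * ka * bessel1 0 - R 0/4 * sqrt (2/R 0) = 0"
 proof -
 define z w where "z = sqrt (R 0)" and "w = sqrt (2::real)"
 have "z > 0" "R 0 = z * z" "w > 0" "w * w = 2" using R0 by (auto simp: z_def w_def)
 then show ?thesis unfolding real_sqrt_divide z_def[symmetric] w_def[symmetric]
 by (simp add: divide_simps)
 qed
 finally have "((%s. bessel0 (ka * T s)/(2 * sqrt (T s/sqrt (p s))) + sqrt (sqrt (p s)) * sqrt (T s) * ka * bessel1 (ka * T s) - p1 s/4 * psi ka s) \<longlongrightarrow> 0) (at_right 0)" .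
 moreover have "\<forall>\<^sub>F s in at_right 0. bessel0 (ka * T s)/(2 * sqrt (T s/sqrt (p s))) + sqrt (sqrt (p s)) * sqrt (T s) * ka * bessel1 (ka * T s) - p1 s/4 * psi ka s = et ka s"
 unfolding eventually_at_right[OF m]
 proof (intro exI[of _ m] conjI m allI impI)
 fix s assume s: "0 < s" "s < m"
 then show "bessel0 (ka * T s)/(2 * sqrt (T s/sqrt (p s))) + sqrt (sqrt (p s)) * sqrt (T s) * ka * bessel1 (ka * T s) - p1 s/4 * psi ka s = et ka s"
 using b_facts[of s] by (simp add: psi_def et_def wkb_Y_def wkb_Y'_def real_sqrt_divide distrib_left mult_ac)
 qed
 ultimately show ?thesis by (simp add: tendsto_cong)
qed

lemma psi_bounded:
 assumes "0 < ka"
 obtains B where "!!s. 0 < s ==> s <= m ==> psi ka s <= B"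
proof -
 define h where "h = (%s. if s <= 0 then sqrt (2/R 0) else psi ka s)"
 have "continuous_on {0..m} h"
 unfolding continuous_on_eq_continuous_within
 proof
 fix s assume s: "s \<in> {0..m}"
 show "continuous (at s within {0..m}) h"
 proof (cases "s = 0")
 case True
 have "(h \<longlongrightarrow> sqrt (2/R 0)) (at_right 0)"
 by (rule Lim_transform_eventually[OF psi_limit[of ka]]) (auto simp: h_def eventually_at_right_field intro: exI[of _ 1])
 moreover have "at 0 within {0..m} = at_right 0" using m by (simp add: at_within_Icc_at_right)
 ultimately show ?thesis using True by (simp add: continuous_within h_def)
 next
 case False
 then have s: "0 < s" "s <= m" using s by auto
 have "isCont (psi ka) s" using psi_deriv[OF s assms] by (rule DERIV_isCont)
 moreover have "\<forall>\<^sub>F x in nhds s. h x = psi ka x"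
 using eventually_nhds_in_open[of "{0<..}" s] s by (auto simp: h_def elim: eventually_mono)
 ultimately have "isCont h s" by (simp add: isCont_cong)
 then show ?thesis by (simp add: continuous_at_imp_continuous_at_within)
 qed
 qed
 then have "bounded (h ` {0..m})" by (intro compact_imp_bounded compact_continuous_image compact_Icc)
 then obtain B where B: "0 < B" "!!s. 0 <= s ==> s <= m ==> \<bar>h s\<bar> <= B" unfolding bounded_pos by auto
 show thesis
 proof (rule that[of B])
 fix s assume "0 < s" "s <= m" then show "psi ka s <= B" using B(2)[of s] by (auto simp: h_def)
 qed
qed

lemma et_linear_bound:
 assumes k: "0 < ka"
 obtains C where "0 <= C" "!!s. 0 < s ==> s <= m ==> \<bar>et ka s\<bar> <= C * s"
proof -
 obtain M where M: "0 <= M" "!!s. 0 < s ==> s <= m ==> \<bar>E s\<bar> <= M" using E_bounded by blast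
 obtain B where B: "!!s. 0 < s ==> s <= m ==> psi ka s <= B" using psi_bounded[OF k] by blast
 have B0: "0 <= B" using B[of m] psi_pos[of m ka] m by simp
 define C where "C = (ka\<^sup>2 + M) * B"
 have C: "0 <= C" using M B0 by (simp add: C_def)
 have d: "\<bar>(ka\<^sup>2 - E s) * psi ka s\<bar> <= C" if s: "0 < s" "s <= m" for s
 proof -
 have "\<bar>ka\<^sup>2 - E s\<bar> <= ka\<^sup>2 + M" using abs_triangle_ineq4[of "ka\<^sup>2" "E s"] M(2)[OF s] by simp
 then show ?thesis unfolding abs_mult C_def using B[OF s] psi_pos[OF s, of ka] M(1)
 by (intro mult_mono) auto
 qed
 have lin: "((%s. C * s) \<longlongrightarrow> 0) (at_right 0)" by (rule tendsto_eq_intros refl | simp)+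
 have "\<bar>et ka s\<bar> <= C * s" if s: "0 < s" "s <= m" for s
 proof -
 have "0 <= C * s - et ka s"
 proof (rule right_limit_le[OF _ s(1)])
 show "((%s. C * s - et ka s) \<longlongrightarrow> 0) (at_right 0)" using tendsto_diff[OF lin et_limit] by simp
 fix x assume x: "0 < x" "x <= s"
 show "\<exists>D. ((%s. C * s - et ka s) has_real_derivative D) (at x) & 0 <= D"
 proof (rule exI, rule conjI, rule DERIV_diff[OF DERIV_cmult_Id[of C x] et_deriv[OF _ _ k]])
 show "0 <= C - (ka\<^sup>2 - E x) * psi ka x" using d[of x] x s unfolding abs_le_iff by linarith
 qed (use x s in auto)
 qed
 moreover have "0 <= C * s + et ka s"
 proof (rule right_limit_le[OF _ s(1)])
 show "((%s. C * s + et ka s) \<longlongrightarrow> 0) (at_right 0)" using tendsto_add[OF lin et_limit] by simp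
 fix x assume x: "0 < x" "x <= s"
 show "\<exists>D. ((%s. C * s + et ka s) has_real_derivative D) (at x) & 0 <= D"
 proof (rule exI, rule conjI, rule DERIV_add[OF DERIV_cmult_Id[of C x] et_deriv[OF _ _ k]])
 show "0 <= C + (ka\<^sup>2 - E x) * psi ka x" using d[of x] x s unfolding abs_le_iff by linarith
 qed (use x s in auto)
 qed
 ultimately show ?thesis by (simp add: abs_le_iff)
 qed
 then show thesis using C that by blast
qed

text \<open>The Wronskian of a solution with the model function is monotone when the two
  potentials are ordered. Both orders are covered by the sign.\<close>

lemma wronskian_comparison:
 fixes ph q w :: "real => real" and ep :: real
 assumes ph: "!!s. 0 < s ==> s <= m ==> (ph has_real_derivative q s/p s) (at s)"
 and q: "!!s. 0 < s ==> s <= m ==> (q has_real_derivative w s * ph s) (at s)"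
 and pos: "!!s. 0 < s ==> s <= m ==> 0 < ph s" and k: "0 < ka"
 and sgn: "!!s. 0 < s ==> s <= m ==> 0 <= ep*(w s - (ka\<^sup>2 - E s))"
 and q0: "(q \<longlongrightarrow> Q0) (at_right 0)" and ph0: "((%s. s * ph s) \<longlongrightarrow> 0) (at_right 0)"
 and s: "0 < s" "s <= m"
 shows "ep*(Q0 * sqrt (2/R 0)) <= ep*(q s * psi ka s - ph s * et ka s)"
proof (rule right_limit_le[OF _ s(1)])
 obtain C where C: "0 <= C" "!!s. 0 < s ==> s <= m ==> \<bar>et ka s\<bar> <= C * s" using et_linear_bound[OF k] by blast
 have "((%s. ph s * et ka s) \<longlongrightarrow> 0) (at_right 0)"
 proof (rule tendsto_0_le[OF ph0, where K = C])
 show "\<forall>\<^sub>F s in at_right 0. norm (ph s * et ka s) <= norm (s * ph s) * C"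
 unfolding eventually_at_right[OF m]
 proof (intro exI[of _ m] conjI m allI impI)
 fix s assume s: "0 < s" "s < m"
 have "\<bar>ph s\<bar> * \<bar>et ka s\<bar> <= \<bar>ph s\<bar> * (C * s)" using C(2)[of s] s by (intro mult_left_mono) auto
 then show "norm (ph s * et ka s) <= norm (s * ph s) * C" using s by (simp add: abs_mult mult_ac)
 qed
 qed
 then have "((%s. ep*(q s * psi ka s - ph s * et ka s)) \<longlongrightarrow> ep*(Q0 * sqrt (2/R 0) - 0)) (at_right 0)"
 by (intro tendsto_intros q0 psi_limit)
 then show "((%s. ep*(q s * psi ka s - ph s * et ka s)) \<longlongrightarrow> ep*(Q0 * sqrt (2/R 0))) (at_right 0)" by simp
 fix x assume x: "0 < x" "x <= s"
 then have xm: "x <= m" using s by simp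
 have "((%s. ep*(q s * psi ka s - ph s * et ka s)) has_real_derivative
 ep*((w x * ph x * psi ka x + et ka x/p x * q x) - (q x/p x * et ka x + (ka\<^sup>2 - E x) * psi ka x * ph x))) (at x)"
 by (intro DERIV_cmult DERIV_diff DERIV_mult ph q psi_deriv et_deriv x xm k)
 also have "ep*((w x * ph x * psi ka x + et ka x/p x * q x) - (q x/p x * et ka x + (ka\<^sup>2 - E x) * psi ka x * ph x))
 = (ep*(w x - (ka\<^sup>2 - E x)))*(ph x * psi ka x)" by (simp add: algebra_simps)
 finally show "\<exists>D. ((%s. ep*(q s * psi ka s - ph s * et ka s)) has_real_derivative D) (at x) & 0 <= D"
 using mult_nonneg_nonneg[OF sgn[OF x(1) xm] less_imp_le[OF mult_pos_pos[OF pos[OF x(1) xm] psi_pos[OF x(1) xm, of ka]]]] by blast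
qed

lemma quotient_comparison:
 fixes ph q w :: "real => real" and ep :: real
 assumes ph: "!!s. 0 < s ==> s <= m ==> (ph has_real_derivative q s/p s) (at s)"
 and q: "!!s. 0 < s ==> s <= m ==> (q has_real_derivative w s * ph s) (at s)"
 and pos: "!!s. 0 < s ==> s <= m ==> 0 < ph s" and k: "0 < ka"
 and sgn: "!!s. 0 < s ==> s <= m ==> 0 <= ep*(w s - (ka\<^sup>2 - E s))"
 and q0: "(q \<longlongrightarrow> 0) (at_right 0)" and ph0: "(ph \<longlongrightarrow> 1) (at_right 0)"
 and s: "0 < s" "s <= m"
 shows "ep*(1/sqrt (2/R 0)) <= ep*(ph s/psi ka s)"
proof (rule right_limit_le[OF _ s(1)])
 have R0: "0 < R 0" using Rpos[of 0] m by simp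
 show "((%s. ep*(ph s/psi ka s)) \<longlongrightarrow> ep*(1/sqrt (2/R 0))) (at_right 0)"
 using R0 by (intro tendsto_intros ph0 psi_limit) auto
 have sph: "((%s. s * ph s) \<longlongrightarrow> 0) (at_right 0)"
 using tendsto_mult[OF tendsto_ident_at ph0] by simp
 fix x assume x: "0 < x" "x <= s"
 then have xm: "x <= m" using s by simp
 have pp: "0 < psi ka x" "0 < p x" using psi_pos p_pos x xm by auto
 have "0 <= ep*(q x * psi ka x - ph x * et ka x)"
 using wronskian_comparison[OF ph q pos k sgn q0 sph x(1) xm] by simp
 moreover have "((%s. ep*(ph s/psi ka s)) has_real_derivative
 ep*((q x/p x * psi ka x - ph x*(et ka x/p x))/(psi ka x * psi ka x))) (at x)"
 using pp by (intro DERIV_cmult DERIV_divide ph psi_deriv x xm k) auto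
 moreover have "ep*((q x/p x * psi ka x - ph x*(et ka x/p x))/(psi ka x * psi ka x))
 = ep*(q x * psi ka x - ph x * et ka x)/(p x*(psi ka x * psi ka x))" using pp by (simp add: divide_simps)
 ultimately show "\<exists>D. ((%s. ep*(ph s/psi ka s)) has_real_derivative D) (at x) & 0 <= D"
 using pp by (metis divide_nonneg_pos mult_pos_pos)
qed

end

section \<open>Exponential growth of the regular solution across the gap\<close>

definition wkb_wronskian :: "real => real => real => real" where
 "wkb_wronskian tL tR ka = wkb_Y' ka tL * wkb_Y ka tR + wkb_Y ka tL * wkb_Y' ka tR"

lemma bigo_const_mult:
 fixes f g :: "real => real"
 assumes "f \<in> O(g)" shows "(%x. c * f x) \<in> O(g)"
proof -
 have "(%x. c) \<in> O[at_top :: real filter](%_. 1::real)" by simp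
 from landau_o.big.mult[OF this assms] show ?thesis by simp
qed

text \<open>At the midpoint the growing model solutions from the two ends meet. The exponents add
  up to the full travel time and the algebraic prefactors cancel.\<close>

lemma wkb_wronskian_asymptotics:
 assumes t: "0 < tL" "0 < tR"
 shows "(%ka. pi * exp (- ka*(tL + tR)) * wkb_wronskian tL tR ka - 1) \<in> O(%ka. ka powr (-1/2))"
proof -
 define J where "J = (%s. sqrt (2 * pi * s) * exp (- s) * bessel0 s)"
 define J1 where "J1 = (%s. sqrt (2 * pi * s) * exp (- s) * bessel1 s)"
 have comp: "(%ka. h (ka * c) - 1) \<in> O(%ka. ka powr (-1/2))"
 if h: "(%s. h s - 1) \<in> O(%s. s powr (-1/2))" and c: "0 < c" for h :: "real => real" and c
 proof -
 have "filterlim (%ka. ka * c) at_top at_top" using c by real_asymp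
 from landau_o.big.compose[OF h this]
 have "(%ka. h (ka * c) - 1) \<in> O(%ka. (ka * c) powr (-1/2))" .
 also have "(%ka. (ka * c) powr (-1/2)) \<in> O(%ka. ka powr (-1/2))" using c by real_asymp
 finally show ?thesis .
 qed
 have one: "(%ka::real. 1::real) \<in> O(%ka. 1)" by simp
 have small: "(%ka::real. ka powr (-1/2)) \<in> O(%ka. 1::real)" by real_asymp
 have bdd: "h \<in> O(%ka. 1)" if "(%ka::real. h ka - 1) \<in> O(%ka. ka powr (-1/2))" for h :: "real => real"
 proof -
 have "(%ka. h ka - 1) \<in> O(%ka. 1)" using that small landau_o.big_trans by blast
 from sum_in_bigo(1)[OF this one] show ?thesis by simp
 qed
 have prod: "(%ka. h ka * k ka - 1) \<in> O(%ka. ka powr (-1/2))"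
 if h: "(%ka::real. h ka - 1) \<in> O(%ka. ka powr (-1/2))" and k: "(%ka. k ka - 1) \<in> O(%ka. ka powr (-1/2))"
 for h k :: "real => real"
 proof -
 have "(%ka. (h ka - 1) * k ka) \<in> O(%ka. ka powr (-1/2)*1)"
 by (intro landau_o.big.mult h bdd[OF k])
 then have "(%ka. (h ka - 1) * k ka) \<in> O(%ka. ka powr (-1/2))" by simp
 from sum_in_bigo(1)[OF this k] show ?thesis by (simp add: algebra_simps)
 qed
 note JL = comp[OF bessel_asymptotics(1) t(1), folded J_def] and JR = comp[OF bessel_asymptotics(1) t(2), folded J_def]
 and JL1 = comp[OF bessel_asymptotics(2) t(1), folded J1_def] and JR1 = comp[OF bessel_asymptotics(2) t(2), folded J1_def]
 have J': "(%ka. J (ka * c) - 1) \<in> O(%ka. ka powr (-1/2))" "(%ka. J1 (ka * c) - 1) \<in> O(%ka. ka powr (-1/2))" if "0 < c" for c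
 unfolding J_def J1_def using comp[OF bessel_asymptotics(1) that] comp[OF bessel_asymptotics(2) that] by simp_all
 have JJ: "(%ka. J (ka * tL) * J (ka * tR)) \<in> O(%ka. 1)" by (intro bdd prod J' t)
 have "(%ka. (J1 (ka * tL) * J (ka * tR) - 1)/2 + (J (ka * tL) * J1 (ka * tR) - 1)/2
 + (tL + tR)/(4 * tL * tR)/ka*(J (ka * tL) * J (ka * tR))) \<in> O(%ka. ka powr (-1/2))"
 proof (intro sum_in_bigo)
 show "(%ka. (J1 (ka * tL) * J (ka * tR) - 1)/2) \<in> O(%ka. ka powr (-1/2))"
 using prod[OF J'(2)[OF t(1)] J'(1)[OF t(2)]] by simp
 show "(%ka. (J (ka * tL) * J1 (ka * tR) - 1)/2) \<in> O(%ka. ka powr (-1/2))"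
 using prod[OF J'(1)[OF t(1)] J'(2)[OF t(2)]] by simp
 have "(%ka::real. 1/ka) \<in> O(%ka. ka powr (-1/2))" by real_asymp
 from bigo_const_mult[OF this, of "(tL + tR)/(4 * tL * tR)"]
 have "(%ka::real. (tL + tR)/(4 * tL * tR)/ka) \<in> O(%ka. ka powr (-1/2))" by simp
 from landau_o.big.mult[OF this JJ]
 show "(%ka. (tL + tR)/(4 * tL * tR)/ka*(J (ka * tL) * J (ka * tR))) \<in> O(%ka. ka powr (-1/2))" by simp
 qed
 moreover have "\<forall>\<^sub>F ka in at_top. (J1 (ka * tL) * J (ka * tR) - 1)/2 + (J (ka * tL) * J1 (ka * tR) - 1)/2
 + (tL + tR)/(4 * tL * tR)/ka*(J (ka * tL) * J (ka * tR)) = pi * exp (- ka*(tL + tR)) * wkb_wronskian tL tR ka - 1"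
 using eventually_gt_at_top[of 0]
 proof eventually_elim
 case (elim ka)
 define x y z w where "x = sqrt tL" and "y = sqrt tR" and "z = sqrt ka" and "w = sqrt (2 * pi)"
 have pos: "x > 0" "y > 0" "z > 0" "w > 0" and sq: "tL = x * x" "tR = y * y" "ka = z * z" "pi = w * w/2"
 using t elim by (auto simp: x_def y_def z_def w_def)
 have w: "sqrt (2 * pi*(ka * tL)) = w*(z * x)" "sqrt (2 * pi*(ka * tR)) = w*(z * y)"
 by (simp_all add: x_def y_def z_def w_def real_sqrt_mult)
 define e1 e2 where "e1 = exp (- (ka * tL))" and "e2 = exp (- (ka * tR))"
 have e: "exp (- ka*(tL + tR)) = e1 * e2" by (simp add: e1_def e2_def mult_exp_exp algebra_simps)
 define A A1 B B1 where "A = bessel0 (ka * tL)" and "A1 = bessel1 (ka * tL)" and "B = bessel0 (ka * tR)" and "B1 = bessel1 (ka * tR)"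
 have JJ: "J (ka * tL) = w*(z * x) * e1 * A" "J (ka * tR) = w*(z * y) * e2 * B"
 "J1 (ka * tL) = w*(z * x) * e1 * A1" "J1 (ka * tR) = w*(z * y) * e2 * B1"
 unfolding J_def J1_def w e1_def e2_def A_def A1_def B_def B1_def by simp_all
 have W: "wkb_wronskian tL tR ka = (A/(2 * x) + x * ka * A1)*(y * B) + x * A*(B/(2 * y) + y * ka * B1)"
 unfolding wkb_wronskian_def wkb_Y_def wkb_Y'_def x_def y_def A_def A1_def B_def B1_def by simp
 have "(x * x + y * y)/(4*(x * x)*(y * y))/(z * z)*((w*(z * x) * e1 * A)*(w*(z * y) * e2 * B))
 = w * w*(e1 * e2)*(A * B)*(y/(4 * x) + x/(4 * y))"
 using pos by (simp add: field_simps)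
 then show ?case unfolding JJ W e unfolding sq using pos
 by (simp add: field_simps)
 qed
 ultimately show ?thesis by (rule landau_o.big.in_cong[THEN iffD1, rotated])
qed

lemma integral_lower_limit_deriv:
 fixes f :: "real => real"
 assumes "f integrable_on {l..r}" "l < x" "x < r" "isCont f x"
 shows "((%x. integral {l..x} f) has_real_derivative f x) (at x)"
proof -
 have "((%x. integral {l..x} f) has_vector_derivative f x) (at x within {l..r})"
 using integral_has_vector_derivative_continuous_at[of f l r x "{}"] assms
 by (auto intro: continuous_at_imp_continuous_at_within)
 then show ?thesis
 using assms by (simp add: has_real_derivative_iff_has_vector_derivative at_within_Icc_at)
qed

locale four_points =
 fixes a :: "nat => real"
 assumes a12: "a 1 < a 2" and a23: "a 2 < a 3" and a34: "a 3 < a 4"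
begin

lemma PP_eq: "PP a x = (x - a 1)*(x - a 2)*(x - a 3)*(x - a 4)"
proof -
 have "{1..4::nat} = {1, 2, 3, 4}" by auto
 then show ?thesis by (simp add: PP_def)
qed

definition P' where "P' x = (x - a 2)*(x - a 3)*(x - a 4) + (x - a 1)*(x - a 3)*(x - a 4)
 + (x - a 1)*(x - a 2)*(x - a 4) + (x - a 1)*(x - a 2)*(x - a 3)"

lemma PP_deriv: "(PP a has_real_derivative P' x) (at x)"
 unfolding PP_eq[abs_def] P'_def by (auto intro!: derivative_eq_intros) (simp add: algebra_simps)

lemma PP_pos: "a 2 < x ==> x < a 3 ==> 0 < PP a x"
 unfolding PP_eq using a12 a34 by (intro mult_neg_neg mult_pos_neg mult_pos_pos) (simp_all only: diff_less_0_iff_less diff_gt_0_iff_gt)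

lemma P'_a2: "P' (a 2) = (a 2 - a 1)*(a 3 - a 2)*(a 4 - a 2)" and P'_a3: "P' (a 3) = - ((a 3 - a 1)*(a 3 - a 2)*(a 4 - a 3))"
 by (simp_all add: P'_def algebra_simps)

lemma P'_sign: "0 < P' (a 2)" "P' (a 3) < 0"
 unfolding P'_a2 P'_a3 using a12 a23 a34 by auto

lemma inv_sqrt_PP_integrable:
 "(%x. 1/sqrt (PP a x)) integrable_on {a 2..a 3}"
proof (rule measurable_bounded_by_integrable_imp_integrable_real)
 define c where "c = 1/(sqrt ((a 2 - a 1)*(a 4 - a 3)) * sqrt (a 3 - a 2))"
 define g where "g = (%x. c*(1/sqrt (x - a 2) + 1/sqrt (a 3 - x)))"
 have "((%x. c*(1/sqrt (x - a 2) + 1/sqrt (a 3 - x))) has_integral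
 c*(2 * sqrt (a 3 - a 2) - 2 * sqrt (a 3 - a 3)) - c*(2 * sqrt (a 2 - a 2) - 2 * sqrt (a 3 - a 2))) {a 2..a 3}"
 proof (rule fundamental_theorem_of_calculus_interior)
 fix x assume x: "x \<in> {a 2<..<a 3}"
 have "((%x. sqrt (x - a 2)) has_real_derivative inverse (sqrt (x - a 2))/2*(1 - 0)) (at x)"
 "((%x. sqrt (a 3 - x)) has_real_derivative inverse (sqrt (a 3 - x))/2*(0 - 1)) (at x)"
 using x by (intro DERIV_chain2[OF DERIV_real_sqrt] DERIV_diff DERIV_ident DERIV_const; simp)+
 from DERIV_cmult[OF DERIV_diff[OF DERIV_cmult[OF this(1), of 2] DERIV_cmult[OF this(2), of 2]], of c]
 show "((%x. c*(2 * sqrt (x - a 2) - 2 * sqrt (a 3 - x))) has_vector_derivative c*(1/sqrt (x - a 2) + 1/sqrt (a 3 - x))) (at x)"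
 unfolding has_real_derivative_iff_has_vector_derivative by (simp add: inverse_eq_divide)
 qed (use a23 in \<open>auto intro!: continuous_intros\<close>)
 then show "g integrable_on {a 2..a 3}" unfolding g_def by blast
 have nn: "0 <= 1/sqrt (PP a x)" if "x \<in> {a 2..a 3}" for x
 using that PP_pos[of x] by (cases "x = a 2 \<or> x = a 3") (auto simp: PP_eq less_le)
 have "1/sqrt (PP a x) <= g x" if x: "x \<in> {a 2..a 3}" for x
 proof (cases "x = a 2 \<or> x = a 3")
 case True
 have "0 <= g x" using x a12 a23 a34 by (auto simp: g_def c_def)
 then show ?thesis using True by (auto simp: PP_eq)
 next
 case False
 then have x: "a 2 < x" "x < a 3" using x by auto
 define u v where "u = x - a 2" and "v = a 3 - x"
 have uv: "0 < u" "0 < v" "u + v = a 3 - a 2" using x by (auto simp: u_def v_def)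
 define k where "k = (a 2 - a 1)*(a 4 - a 3)"
 have k: "0 < k" using a12 a34 by (simp add: k_def)
 have "k*(u * v) <= ((x - a 1)*(a 4 - x))*(u * v)"
 unfolding k_def using x a12 a34 uv by (intro mult_right_mono mult_mono) auto
 also have "... = PP a x" by (simp add: PP_eq u_def v_def algebra_simps)
 finally have kP: "k*(u * v) <= PP a x" .
 have "sqrt (a 3 - a 2) <= sqrt u + sqrt v" unfolding uv(3)[symmetric] using uv by (intro sqrt_add_le_add_sqrt) auto
 then have "sqrt (a 3 - a 2)/sqrt (u * v) <= (sqrt u + sqrt v)/sqrt (u * v)" using uv by (intro divide_right_mono) auto
 also have "... = 1/sqrt u + 1/sqrt v" using uv by (simp add: real_sqrt_mult field_simps)
 finally have s: "1/sqrt (u * v) <= (1/sqrt u + 1/sqrt v)/sqrt (a 3 - a 2)" using a23 by (simp add: field_simps)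
 have "1/sqrt (PP a x) <= 1/sqrt (k*(u * v))" using kP k uv mult_pos_pos[OF k mult_pos_pos[OF uv(1,2)]] by (intro divide_left_mono mult_pos_pos) (auto simp: less_le_trans[OF _ kP])
 also have "... = 1/sqrt k*(1/sqrt (u * v))" by (simp add: real_sqrt_mult)
 also have "... <= 1/sqrt k*((1/sqrt u + 1/sqrt v)/sqrt (a 3 - a 2))" using s k by (intro mult_left_mono) auto
 also have "... = g x" by (simp add: g_def c_def k_def u_def v_def)
 finally show ?thesis .
 qed
 then show "\<bar>1/sqrt (PP a x)\<bar> <= g x" if "x \<in> {a 2..a 3}" for x using nn[OF that] that by simp
 show "(%x. 1/sqrt (PP a x)) \<in> borel_measurable (lebesgue_on {a 2..a 3})"
 unfolding PP_eq by (intro borel_measurable_divide borel_measurable_const measurable_compose[OF _ borel_measurable_sqrt])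
 (auto intro!: continuous_imp_measurable_on_sets_lebesgue continuous_intros)
qed auto

definition travel_time where "travel_time x = integral {a 2..x} (%x. 1/sqrt (PP a x))"

lemma travel_time_deriv:
 assumes "a 2 < x" "x < a 3"
 shows "(travel_time has_real_derivative 1/sqrt (PP a x)) (at x)"
 unfolding travel_time_def[abs_def]
proof (rule integral_lower_limit_deriv[OF inv_sqrt_PP_integrable assms])
 have "isCont (%x. PP a x) x" using PP_deriv by (rule DERIV_isCont)
 then show "isCont (%x. 1/sqrt (PP a x)) x"
 using PP_pos[OF assms] by (intro continuous_intros) auto
qed

lemma travel_time_cont: "continuous_on {a 2..a 3} travel_time"
 unfolding travel_time_def[abs_def] by (rule indefinite_integral_continuous_1[OF inv_sqrt_PP_integrable])

lemma travel_time_K_plus: "travel_time (a 3) = K_plus a"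
proof -
 have nn: "0 <= 1/sqrt (PP a x)" if "x \<in> {a 2..a 3}" for x
 using that PP_pos[of x] by (cases "x = a 2 \<or> x = a 3") (auto simp: PP_eq less_le)
 have "(%x. 1/sqrt (PP a x)) absolutely_integrable_on {a 2..a 3}"
 using nonnegative_absolutely_integrable_1[OF inv_sqrt_PP_integrable nn] .
 then show ?thesis unfolding travel_time_def K_plus_def
 using set_lebesgue_integral_eq_integral(2) by metis
qed

end

definition cubic :: "real => real => real => real => real" where
 "cubic A L D s = (A + s)*(L - s)*(D - s)"

lemma wkb_endpoint_cubic:
 assumes "0 < A" "0 < m" "m < L" "m < D"
 and "!!s. 0 < s ==> s <= m ==> (T has_real_derivative 1/sqrt (s * cubic A L D s)) (at s)"
 and "(T \<longlongrightarrow> 0) (at_right 0)"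
 shows "wkb_endpoint (cubic A L D) (%s. (L - s)*(D - s) - (A + s)*(D - s) - (A + s)*(L - s))
 (%s. 2*(A + s) - 2*(D - s) - 2*(L - s)) T m"
proof
 show "0 < cubic A L D s" if "0 <= s" "s <= m" for s
 using assms that unfolding cubic_def by (intro mult_pos_pos) auto
 show "(cubic A L D has_real_derivative (L - s)*(D - s) - (A + s)*(D - s) - (A + s)*(L - s)) (at s)" for s
 unfolding cubic_def[abs_def] by (auto intro!: derivative_eq_intros simp: algebra_simps)
 show "((%s. (L - s)*(D - s) - (A + s)*(D - s) - (A + s)*(L - s)) has_real_derivative 2*(A + s) - 2*(D - s) - 2*(L - s)) (at s)" for s
 by (auto intro!: derivative_eq_intros simp: algebra_simps)
qed (use assms in \<open>auto intro!: continuous_intros\<close>)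

lemma filterlim_reflect_at_right: "filterlim (%s. c - s) (at_left c) (at_right (0::real))"
 by (rule filterlim_at_withinI) (auto simp: eventually_at_right_field intro!: exI[of _ 1] tendsto_eq_intros)

lemma filterlim_shift_at_right: "filterlim (%s. c + s) (at_right c) (at_right (0::real))"
 by (rule filterlim_at_withinI) (auto simp: eventually_at_right_field intro!: exI[of _ 1] tendsto_eq_intros)

context four_points
begin

definition V where "V x = 2*(x - mean4 a)\<^sup>2"

text \<open>The two model solutions are compared in the middle of the gap; any interior point
  would do.\<close>

definition half_gap where "half_gap = (a 3 - a 2)/2"
definition tL where "tL = travel_time (a 2 + half_gap)"
definition tR where "tR = travel_time (a 3) - travel_time (a 3 - half_gap)"

lemma half_gap: "0 < half_gap" "half_gap < a 3 - a 2" "a 2 + half_gap = a 3 - half_gap"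
 using a23 by (auto simp: half_gap_def field_simps)

definition RL where "RL = cubic (a 2 - a 1) (a 3 - a 2) (a 4 - a 2)"
definition RL1 where "RL1 s = (a 3 - a 2 - s)*(a 4 - a 2 - s) - (a 2 - a 1 + s)*(a 4 - a 2 - s) - (a 2 - a 1 + s)*(a 3 - a 2 - s)"
definition RL2 where "RL2 s = 2*(a 2 - a 1 + s) - 2*(a 4 - a 2 - s) - 2*(a 3 - a 2 - s)"
definition RR where "RR = cubic (a 4 - a 3) (a 3 - a 2) (a 3 - a 1)"
definition RR1 where "RR1 s = (a 3 - a 2 - s)*(a 3 - a 1 - s) - (a 4 - a 3 + s)*(a 3 - a 1 - s) - (a 4 - a 3 + s)*(a 3 - a 2 - s)"
definition RR2 where "RR2 s = 2*(a 4 - a 3 + s) - 2*(a 3 - a 1 - s) - 2*(a 3 - a 2 - s)"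

sublocale Left: wkb_endpoint RL RL1 RL2 "%s. travel_time (a 2 + s)" half_gap
 unfolding RL_def RL1_def[abs_def] RL2_def[abs_def]
proof (rule wkb_endpoint_cubic)
 fix s assume s: "0 < s" "s <= half_gap"
 have "s * cubic (a 2 - a 1) (a 3 - a 2) (a 4 - a 2) s = PP a (a 2 + s)"
 by (simp add: cubic_def PP_eq algebra_simps)
 moreover have "(travel_time has_real_derivative 1/sqrt (PP a (a 2 + s))) (at (a 2 + s))"
 using s half_gap by (intro travel_time_deriv) auto
 ultimately show "((%s. travel_time (a 2 + s)) has_real_derivative 1/sqrt (s * cubic (a 2 - a 1) (a 3 - a 2) (a 4 - a 2) s)) (at s)"
 by (simp add: DERIV_shift add.commute)
next
 have "(travel_time \<longlongrightarrow> travel_time (a 2)) (at (a 2) within {a 2..a 3})"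
 using travel_time_cont a23 by (auto simp: continuous_on_def)
 then have "(travel_time \<longlongrightarrow> 0) (at_right (a 2))"
 using a23 by (simp add: at_within_Icc_at_right travel_time_def)
 then show "((%s. travel_time (a 2 + s)) \<longlongrightarrow> 0) (at_right 0)"
 by (rule filterlim_compose[OF _ filterlim_shift_at_right])
qed (use a12 a23 a34 half_gap in auto)

sublocale Right: wkb_endpoint RR RR1 RR2 "%s. travel_time (a 3) - travel_time (a 3 - s)" half_gap
 unfolding RR_def RR1_def[abs_def] RR2_def[abs_def]
proof (rule wkb_endpoint_cubic)
 fix s assume s: "0 < s" "s <= half_gap"
 have "s * cubic (a 4 - a 3) (a 3 - a 2) (a 3 - a 1) s = PP a (a 3 - s)"
 by (simp add: cubic_def PP_eq algebra_simps)
 moreover have d: "(travel_time has_real_derivative 1/sqrt (PP a (a 3 - s))) (at (a 3 - s))"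
 using s half_gap by (intro travel_time_deriv) auto
 have "((%s. a 3 - s) has_real_derivative 0 - 1) (at s)"
 by (intro DERIV_diff DERIV_const DERIV_ident)
 from DERIV_diff[OF DERIV_const DERIV_chain2[OF d this], of "travel_time (a 3)"]
 have "((%s. travel_time (a 3) - travel_time (a 3 - s)) has_real_derivative 1/sqrt (PP a (a 3 - s))) (at s)" by simp
 ultimately show "((%s. travel_time (a 3) - travel_time (a 3 - s)) has_real_derivative
 1/sqrt (s * cubic (a 4 - a 3) (a 3 - a 2) (a 3 - a 1) s)) (at s)" by simp
next
 have "(travel_time \<longlongrightarrow> travel_time (a 3)) (at (a 3) within {a 2..a 3})"
 using travel_time_cont a23 by (auto simp: continuous_on_def)
 then have "(travel_time \<longlongrightarrow> travel_time (a 3)) (at_left (a 3))"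
 using a23 by (simp add: at_within_Icc_at_left)
 from tendsto_diff[OF tendsto_const filterlim_compose[OF this filterlim_reflect_at_right], of "travel_time (a 3)"]
 show "((%s. travel_time (a 3) - travel_time (a 3 - s)) \<longlongrightarrow> 0) (at_right 0)" by simp
qed (use a12 a23 a34 half_gap in auto)

lemma p_eq: "Left.p s = PP a (a 2 + s)" "Right.p s = PP a (a 3 - s)"
 unfolding Left.p_def Right.p_def by (simp_all add: RL_def RR_def cubic_def PP_eq algebra_simps)

lemma V_bounded: obtains B where "0 <= B" "!!x. a 2 <= x ==> x <= a 3 ==> V x <= B"
proof -
 have "continuous_on {a 2..a 3} V" unfolding V_def[abs_def] by (intro continuous_intros)
 from compact_imp_bounded[OF compact_continuous_image[OF this compact_Icc]]
 obtain B where "0 < B" "!!x. x \<in> {a 2..a 3} ==> \<bar>V x\<bar> <= B" unfolding bounded_pos by auto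
 then show thesis by (intro that[of B]) (auto simp: abs_le_iff)
qed

lemma V_nonneg: "0 <= V x" by (simp add: V_def)

lemma p1_mid: "Left.p1 half_gap = - Right.p1 half_gap"
proof -
 have "(Left.p has_real_derivative Left.p1 half_gap) (at (a 3 - a 2 - half_gap))"
 using Left.p_deriv[of half_gap] half_gap by (simp add: half_gap_def field_simps)
 moreover have "((%s. a 3 - a 2 - s) has_real_derivative 0 - 1) (at half_gap)"
 by (intro DERIV_diff DERIV_const DERIV_ident)
 ultimately have "((%s. Left.p (a 3 - a 2 - s)) has_real_derivative Left.p1 half_gap*(0 - 1)) (at half_gap)"
 by (rule DERIV_chain2)
 moreover have "(%s. Left.p (a 3 - a 2 - s)) = Right.p" by (simp add: p_eq fun_eq_iff)
 ultimately have "(Right.p has_real_derivative - Left.p1 half_gap) (at half_gap)" by simp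
 from DERIV_unique[OF this Right.p_deriv] show ?thesis by simp
qed

text \<open>Raising or lowering the spectral parameter by a constant dominates the bounded error
  potential. The Wronskian and the quotient of the solution with the model solutions are then
  monotone, and in the middle of the gap they bound the limit $W$ of the quasi-derivative from
  both sides.\<close>

lemma regular_connection_bounds:
 obtains C0 where "0 <= C0"
 "!!La ph q W ep. ep = 1 \<or> ep = - 1 ==> La - ep * C0 > 0 ==>
 (!!x. a 2 < x ==> x < a 3 ==> (ph has_real_derivative q x/PP a x) (at x)) ==>
 (!!x. a 2 < x ==> x < a 3 ==> (q has_real_derivative (La - V x) * ph x) (at x)) ==>
 (!!x. a 2 < x ==> x < a 3 ==> 0 < ph x) ==>
 (ph \<longlongrightarrow> 1) (at_right (a 2)) ==> (q \<longlongrightarrow> 0) (at_right (a 2)) ==>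
 (q \<longlongrightarrow> W) (at_left (a 3)) ==> ((%x. (a 3 - x) * ph x) \<longlongrightarrow> 0) (at_left (a 3)) ==>
 ep*(sqrt (P' (a 2) * - P' (a 3))/2 * wkb_wronskian tL tR (sqrt (La - ep * C0))) <= ep * W"
proof -
 obtain BL where BL: "0 <= BL" "!!s. 0 < s ==> s <= half_gap ==> \<bar>Left.E s\<bar> <= BL" using Left.E_bounded by blast
 obtain BR where BR: "0 <= BR" "!!s. 0 < s ==> s <= half_gap ==> \<bar>Right.E s\<bar> <= BR" using Right.E_bounded by blast
 obtain B where B: "0 <= B" "!!x. a 2 <= x ==> x <= a 3 ==> V x <= B" using V_bounded by blast
 define C0 where "C0 = BL + BR + B"
 show thesis
 proof (rule that[of C0])
 show "0 <= C0" using BL BR B by (simp add: C0_def)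
 fix La :: real and ph q :: "real => real" and W ep :: real
 assume eps: "ep = 1 \<or> ep = - 1" and pos: "La - ep * C0 > 0"
 and dph: "!!x. a 2 < x ==> x < a 3 ==> (ph has_real_derivative q x/PP a x) (at x)"
 and dq: "!!x. a 2 < x ==> x < a 3 ==> (q has_real_derivative (La - V x) * ph x) (at x)"
 and php: "!!x. a 2 < x ==> x < a 3 ==> 0 < ph x"
 and ph2: "(ph \<longlongrightarrow> 1) (at_right (a 2))" and q2: "(q \<longlongrightarrow> 0) (at_right (a 2))"
 and q3: "(q \<longlongrightarrow> W) (at_left (a 3))" and ph3: "((%x. (a 3 - x) * ph x) \<longlongrightarrow> 0) (at_left (a 3))"
 define ka where "ka = sqrt (La - ep * C0)"
 have k: "0 < ka" "ka\<^sup>2 = La - ep * C0" using pos by (auto simp: ka_def)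
 define h where "h = half_gap"
 have h: "0 < h" "h <= half_gap" using half_gap by (auto simp: h_def)
 have in1: "a 2 < a 2 + s" "a 2 + s < a 3" "a 2 < a 3 - s" "a 3 - s < a 3" if "0 < s" "s <= half_gap" for s
 using that half_gap by auto
 have sgnL: "0 <= ep*((La - V (a 2 + s)) - (ka\<^sup>2 - Left.E s))" if s: "0 < s" "s <= half_gap" for s
 using eps BL(2)[OF s] BR B(2)[of "a 2 + s"] V_nonneg[of "a 2 + s"] in1[OF s] B(1) BL(1) unfolding k(2) C0_def
 by (elim disjE) (auto simp: abs_le_iff)
 have sgnR: "0 <= ep*((La - V (a 3 - s)) - (ka\<^sup>2 - Right.E s))" if s: "0 < s" "s <= half_gap" for s
 using eps BR(2)[OF s] BL B(2)[of "a 3 - s"] V_nonneg[of "a 3 - s"] in1[OF s] B(1) BR(1) unfolding k(2) C0_def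
 by (elim disjE) (auto simp: abs_le_iff)
 have Lph: "((%s. ph (a 2 + s)) has_real_derivative q (a 2 + s)/Left.p s) (at s)" if s: "0 < s" "s <= half_gap" for s
 using dph[OF in1(1,2)[OF s]] by (simp add: p_eq DERIV_shift add.commute)
 have Lq: "((%s. q (a 2 + s)) has_real_derivative (La - V (a 2 + s)) * ph (a 2 + s)) (at s)" if s: "0 < s" "s <= half_gap" for s
 using dq[OF in1(1,2)[OF s]] by (simp add: DERIV_shift add.commute)
 have dr: "((%s. a 3 - s) has_real_derivative - 1) (at s)" for s
 using DERIV_diff[OF DERIV_const DERIV_ident, of "a 3" s] by simp
 have Rph: "((%s. ph (a 3 - s)) has_real_derivative - q (a 3 - s)/Right.p s) (at s)" if s: "0 < s" "s <= half_gap" for s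
 using DERIV_chain2[OF dph[OF in1(3,4)[OF s]] dr] by (simp add: p_eq)
 have Rq: "((%s. - q (a 3 - s)) has_real_derivative (La - V (a 3 - s)) * ph (a 3 - s)) (at s)" if s: "0 < s" "s <= half_gap" for s
 using DERIV_minus[OF DERIV_chain2[OF dq[OF in1(3,4)[OF s]] dr]] by simp
 have lim: "((%s. ph (a 2 + s)) \<longlongrightarrow> 1) (at_right 0)" "((%s. q (a 2 + s)) \<longlongrightarrow> 0) (at_right 0)"
 by (rule filterlim_compose[OF _ filterlim_shift_at_right] ph2 q2)+
 have limR: "((%s. - q (a 3 - s)) \<longlongrightarrow> - W) (at_right 0)"
 by (intro tendsto_minus filterlim_compose[OF q3 filterlim_reflect_at_right])
 have "((%s. (a 3 - (a 3 - s)) * ph (a 3 - s)) \<longlongrightarrow> 0) (at_right 0)"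
 by (rule filterlim_compose[OF ph3 filterlim_reflect_at_right])
 then have limR0: "((%s. s * ph (a 3 - s)) \<longlongrightarrow> 0) (at_right 0)" by simp
 have lim0: "((%s. s * ph (a 2 + s)) \<longlongrightarrow> 0) (at_right 0)"
 using tendsto_mult[OF tendsto_ident_at lim(1)] by simp
 have cL: "ep*(0 * sqrt (2/RL 0)) <= ep*(q (a 2 + h) * Left.psi ka h - ph (a 2 + h) * Left.et ka h)"
 using Left.wronskian_comparison[OF Lph Lq _ k(1) sgnL lim(2) lim0 h] php in1 by simp
 have cQ: "ep*(1/sqrt (2/RL 0)) <= ep*(ph (a 2 + h)/Left.psi ka h)"
 using Left.quotient_comparison[OF Lph Lq _ k(1) sgnL lim(2) lim(1) h] php in1 by simp
 have cR: "ep*(- W * sqrt (2/RR 0)) <= ep*(- q (a 3 - h) * Right.psi ka h - ph (a 3 - h) * Right.et ka h)"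
 using Right.wronskian_comparison[OF Rph Rq _ k(1) sgnR limR limR0 h] php in1 by simp
 define f0 q0 where "f0 = ph (a 2 + h)" and "q0 = q (a 2 + h)"
 have mid: "ph (a 3 - h) = f0" "q (a 3 - h) = q0" unfolding f0_def q0_def h_def half_gap(3) by (rule refl)+
 have f0: "0 < f0" using php in1[of h] h by (simp add: f0_def)
 define x y where "x = Left.psi ka h" and "y = Right.psi ka h"
 have xy: "0 < x" "0 < y" using Left.psi_pos[OF h] Right.psi_pos[OF h] by (simp_all add: x_def y_def)
 define X Y where "X = Left.et ka h" and "Y = Right.et ka h"
 define bb where "bb = Left.b h"
 have bb: "0 < bb" "Right.b h = bb"
 using Left.b_facts(1)[OF h] unfolding bb_def Left.b_def Right.b_def p_eq h_def half_gap(3) by simp_all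
 have tt: "tL = travel_time (a 2 + h)" "tR = travel_time (a 3) - travel_time (a 3 - h)"
 by (simp_all add: tL_def tR_def h_def)
 have G: "X * y + x * Y = wkb_wronskian tL tR ka"
 unfolding X_def Y_def x_def y_def Left.et_def Left.psi_def Right.et_def Right.psi_def bb(2) bb_def[symmetric]
 wkb_wronskian_def tt[symmetric] using p1_mid bb(1)
 by (simp add: h_def divide_simps) (simp add: algebra_simps)
 have tpos: "0 < tL" "0 < tR" using Left.T_pos[OF h] Right.T_pos[OF h] by (simp_all add: tt)
 have Gpos: "0 < wkb_wronskian tL tR ka"
 unfolding wkb_wronskian_def using tpos k(1) by (intro add_pos_pos mult_pos_pos wkb_Y_pos wkb_Y'_pos)
 define cl cr where "cl = sqrt (2/RL 0)"
 and "cr = sqrt (2/RR 0)"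
 have cub: "RL 0 = P' (a 2)" "RR 0 = - P' (a 3)"
 by (simp_all add: RL_def RR_def cubic_def P'_a2 P'_a3 algebra_simps)
 have cc: "0 < cl" "0 < cr" "1/(cl * cr) = sqrt (P' (a 2) * - P' (a 3))/2"
 proof -
 show "0 < cl" "0 < cr" unfolding cl_def cr_def cub using P'_sign by auto
 have "cl * cr = sqrt (2*2/(P' (a 2) * - P' (a 3)))"
 unfolding cl_def cr_def cub by (simp flip: real_sqrt_mult)
 also have "... = 2/sqrt (P' (a 2) * - P' (a 3))" by (simp only: real_sqrt_divide real_sqrt_abs2 abs_numeral)
 finally show "1/(cl * cr) = sqrt (P' (a 2) * - P' (a 3))/2" by simp
 qed
 have A: "ep*(f0 * X) <= ep*(q0 * x)" using cL by (simp add: f0_def q0_def x_def X_def algebra_simps)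
 have B': "ep*(1/cl) <= ep*(f0/x)" using cQ by (simp add: cl_def f0_def x_def)
 have C: "ep*(q0 * y + f0 * Y) <= ep*(W * cr)" using cR by (simp add: mid y_def Y_def cr_def algebra_simps)
 have "ep*(1/cl) * wkb_wronskian tL tR ka <= ep*(f0/x)*(X * y + x * Y)"
 unfolding G using B' Gpos by (intro mult_right_mono) auto
 also have "... = ep*(f0 * X)*(y/x) + ep*(f0 * Y)" using xy by (simp add: field_simps)
 also have "... <= ep*(q0 * x)*(y/x) + ep*(f0 * Y)" using A xy by (intro add_right_mono mult_right_mono) auto
 also have "... = ep*(q0 * y + f0 * Y)" using xy by (simp add: field_simps)
 also note C
 finally have "ep*(1/cl) * wkb_wronskian tL tR ka/cr <= ep*(W * cr)/cr" using cc by (intro divide_right_mono) auto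
 then have "ep*(1/(cl * cr) * wkb_wronskian tL tR ka) <= ep * W" using cc(1,2) by simp
 then show "ep*(sqrt (P' (a 2) * - P' (a 3))/2 * wkb_wronskian tL tR (sqrt (La - ep * C0))) <= ep * W"
 unfolding cc(3) ka_def .
 qed
qed

text \<open>The product of the solution and its quasi-derivative has the nonnegative derivative
  $q^2/P + (\Lambda - V)\varphi^2$.\<close>

lemma energy_nondecreasing:
 fixes ph q :: "real => real"
 assumes dph: "!!x. a 2 < x ==> x < a 3 ==> (ph has_real_derivative q x/PP a x) (at x)"
 and dq: "!!x. a 2 < x ==> x < a 3 ==> (q has_real_derivative (La - V x) * ph x) (at x)"
 and La: "!!x. a 2 < x ==> x < a 3 ==> V x <= La"
 and ph2: "(ph \<longlongrightarrow> F0) (at_right (a 2))" and q2: "(q \<longlongrightarrow> 0) (at_right (a 2))"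
 shows "!!x. a 2 < x ==> x < a 3 ==> 0 <= ph x * q x"
 "!!x. a 2 < x ==> x < a 3 ==> F0\<^sup>2 <= (ph x)\<^sup>2"
 "!!x y. a 2 < x ==> x <= y ==> y < a 3 ==> ph x * q x <= ph y * q y"
 "!!x y. a 2 < x ==> x <= y ==> y < a 3 ==> (ph x)\<^sup>2 <= (ph y)\<^sup>2"
proof -
 have d1: "\<exists>D. ((%x. ph x * q x) has_real_derivative D) (at x) & 0 <= D" if x: "a 2 < x" "x < a 3" for x
 proof (rule exI, rule conjI, rule DERIV_mult[OF dph[OF x] dq[OF x]])
 have "q x/PP a x * q x + (La - V x) * ph x * ph x = (q x)\<^sup>2/PP a x + (La - V x)*(ph x)\<^sup>2"
 by (simp add: power2_eq_square)
 also have "0 <= ..." using La[OF x] PP_pos[OF x] by (intro add_nonneg_nonneg) auto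
 finally show "0 <= q x/PP a x * q x + (La - V x) * ph x * ph x" .
 qed
 show nn: "0 <= ph x * q x" if x: "a 2 < x" "x < a 3" for x
 proof (rule right_limit_le[OF _ x(1)])
 show "((%x. ph x * q x) \<longlongrightarrow> 0) (at_right (a 2))" using tendsto_mult[OF ph2 q2] by simp
 qed (use d1 x in auto)
 have d2: "\<exists>D. ((%x. (ph x)\<^sup>2) has_real_derivative D) (at x) & 0 <= D" if x: "a 2 < x" "x < a 3" for x
 proof (rule exI, rule conjI, rule DERIV_power[OF dph[OF x]])
 have "real 2*(q x/PP a x * ph x ^ (2 - Suc 0)) = 2*(ph x * q x)/PP a x" by simp
 also have "0 <= ..." using nn[OF x] PP_pos[OF x] by simp
 finally show "0 <= real 2*(q x/PP a x * ph x ^ (2 - Suc 0))" .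
 qed
 show "F0\<^sup>2 <= (ph x)\<^sup>2" if x: "a 2 < x" "x < a 3" for x
 by (rule right_limit_le[OF tendsto_power[OF ph2] x(1)]) (use d2 x in auto)
 show "ph x * q x <= ph y * q y" if "a 2 < x" "x <= y" "y < a 3" for x y
 by (rule DERIV_nonneg_imp_nondecreasing[OF that(2)]) (use d1 that in auto)
 show "(ph x)\<^sup>2 <= (ph y)\<^sup>2" if "a 2 < x" "x <= y" "y < a 3" for x y
 by (rule DERIV_nonneg_imp_nondecreasing[OF that(2)]) (use d2 that in auto)
qed

lemma regular_solution_pos:
 fixes ph q :: "real => real"
 assumes dph: "!!x. a 2 < x ==> x < a 3 ==> (ph has_real_derivative q x/PP a x) (at x)"
 and dq: "!!x. a 2 < x ==> x < a 3 ==> (q has_real_derivative (La - V x) * ph x) (at x)"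
 and La: "!!x. a 2 < x ==> x < a 3 ==> V x <= La"
 and ph2: "(ph \<longlongrightarrow> 1) (at_right (a 2))" and q2: "(q \<longlongrightarrow> 0) (at_right (a 2))"
 and x: "a 2 < x" "x < a 3"
 shows "0 < ph x"
proof (rule ccontr)
 assume "\<not> 0 < ph x"
 have "\<forall>\<^sub>F y in at_right (a 2). 0 < ph y" using order_tendstoD(1)[OF ph2, of 0] by simp
 then obtain b where b: "a 2 < b" "!!y. a 2 < y ==> y < b ==> 0 < ph y"
 unfolding eventually_at_right[OF x(1)] by auto
 define y where "y = (a 2 + min b x)/2"
 have y: "a 2 < y" "y < b" "y < x" using b x by (auto simp: y_def field_simps min_def)
 have "\<exists>z\<ge>y. z <= x & ph z = 0"
 proof (rule IVT2)
 show "\<forall>z. y <= z & z <= x --> isCont ph z" using y x by (auto intro!: DERIV_isCont[OF dph])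
 qed (use y b(2)[of y] \<open>\<not> 0 < ph x\<close> in auto)
 then obtain z where z: "y <= z" "z <= x" "ph z = 0" by auto
 have "1\<^sup>2 <= (ph z)\<^sup>2" using energy_nondecreasing(2)[OF dph dq La ph2 q2, of z] y z x by simp
 then show False using z by simp
qed

lemma shifted_frequency_asymptotics:
 "(%La. pi * exp (- sqrt La*(tL + tR)) * wkb_wronskian tL tR (sqrt (La + c)) - 1) \<in> O(%La. La powr (-1/4))"
proof -
 define K where "K = tL + tR"
 have t: "0 < tL" "0 < tR" unfolding tL_def tR_def
 by (rule Left.T_pos[OF half_gap(1) order_refl] Right.T_pos[OF half_gap(1) order_refl])+
 define G where "G = (%ka. pi * exp (- ka*(tL + tR)) * wkb_wronskian tL tR ka)"
 define d where "d = (%La. (sqrt (La + c) - sqrt La) * K)"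
 have "filterlim (%La. sqrt (La + c)) at_top at_top" by real_asymp
 from landau_o.big.compose[OF wkb_wronskian_asymptotics[OF t] this]
 have "(%La. G (sqrt (La + c)) - 1) \<in> O(%La. sqrt (La + c) powr (-1/2))" by (simp add: G_def)
 also have "(%La. sqrt (La + c) powr (-1/2)) \<in> O(%La. La powr (-1/4))" by real_asymp
 finally have G: "(%La. G (sqrt (La + c)) - 1) \<in> O(%La. La powr (-1/4))" .
 have dbound: "\<forall>\<^sub>F La in at_top. \<bar>d La\<bar> <= \<bar>c * K\<bar> * La powr (-1/2)"
 using eventually_gt_at_top[of "max 0 (- c)"]
 proof eventually_elim
 case (elim La)
 then have L: "0 < La" "0 < La + c" by auto
 have "(sqrt (La + c) - sqrt La)*(sqrt (La + c) + sqrt La) = c"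
 using L by (simp add: algebra_simps flip: power2_eq_square)
 moreover have s: "0 < sqrt (La + c) + sqrt La" using L by (intro add_pos_pos) auto
 ultimately have "sqrt (La + c) - sqrt La = c/(sqrt (La + c) + sqrt La)" by (simp add: eq_divide_eq)
 then have "\<bar>d La\<bar> = \<bar>c * K\<bar> / (sqrt (La + c) + sqrt La)" using s by (simp add: d_def abs_mult)
 also have "... <= \<bar>c * K\<bar> / sqrt La" using L s by (intro divide_left_mono) auto
 also have "... = \<bar>c * K\<bar> * La powr (-1/2)" 
 proof -
 have "La powr (-1/2) = 1/sqrt La" using powr_minus_divide[of La "1/2"] powr_half_sqrt[of La] L by simp
 then show ?thesis by simp
 qed
 finally show ?case .
 qed
 have "((%La. \<bar>c * K\<bar> * La powr (-1/2)) \<longlongrightarrow> \<bar>c * K\<bar> * 0) at_top"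
 by (intro tendsto_mult tendsto_const) real_asymp
 then have "\<forall>\<^sub>F La in at_top. \<bar>c * K\<bar> * La powr (-1/2) < 1/2"
 by (rule order_tendstoD(2)) simp
 with dbound have "\<forall>\<^sub>F La in at_top. \<bar>exp (d La) - 1\<bar> <= 2 * \<bar>c * K\<bar> * La powr (-1/2)"
 proof eventually_elim
 case (elim La)
 then have h: "\<bar>d La\<bar> <= 1/2" by linarith
 have "exp (d La) <= 1 + 2 * \<bar>d La\<bar>" using exp_bound_lemma[of "d La"] h by simp
 moreover have "1 + d La <= exp (d La)" by (rule exp_ge_add_one_self)
 ultimately have "\<bar>exp (d La) - 1\<bar> <= 2 * \<bar>d La\<bar>" by linarith
 then show ?case using elim by linarith
 qed
 then have "(%La. exp (d La) - 1) \<in> O(%La. La powr (-1/2))"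
 by (intro bigoI[where c = "2 * \<bar>c * K\<bar>"]) simp
 also have "(%La::real. La powr (-1/2)) \<in> O(%La. La powr (-1/4))" by real_asymp
 finally have D: "(%La. exp (d La) - 1) \<in> O(%La. La powr (-1/4))" .
 have "(%La::real. La powr (-1/4)) \<in> O(%La. 1::real)" by real_asymp
 from landau_o.big_trans[OF D this] have "(%La. exp (d La) - 1) \<in> O(%La. 1)" .
 from sum_in_bigo(1)[OF this, of "%_. 1"] have D1: "(%La. exp (d La)) \<in> O(%La. 1)" by simp
 have "(%La. (G (sqrt (La + c)) - 1) * exp (d La)) \<in> O(%La. La powr (-1/4))"
 using landau_o.big.mult[OF G D1] by simp
 from sum_in_bigo(1)[OF this D]
 have "(%La. G (sqrt (La + c)) * exp (d La) - 1) \<in> O(%La. La powr (-1/4))" by (simp add: algebra_simps)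
 moreover have "G (sqrt (La + c)) * exp (d La) = pi * exp (- sqrt La*(tL + tR)) * wkb_wronskian tL tR (sqrt (La + c))" for La
 proof -
 have "exp (- sqrt (La + c) * K) * exp (d La) = exp (- sqrt La * K)" by (simp add: d_def mult_exp_exp algebra_simps)
 then show ?thesis unfolding G_def K_def[symmetric] by (metis mult.assoc mult.commute)
 qed
 ultimately show ?thesis by simp
qed

lemma travel_time_split: "tL + tR = K_plus a"
 unfolding tL_def tR_def half_gap(3) travel_time_K_plus[symmetric] by simp

text \<open>Up to a constant factor, $W$ is the coefficient of the logarithm that the solution
  regular at $a_2$ develops at $a_3$.\<close>

theorem connection_asymptotics:
 obtains C La0 where "0 < La0" "!!x. a 2 <= x ==> x <= a 3 ==> V x < La0"
 "!!La ph q W. La0 <= La ==>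
 (!!x. a 2 < x ==> x < a 3 ==> (ph has_real_derivative q x/PP a x) (at x)) ==>
 (!!x. a 2 < x ==> x < a 3 ==> (q has_real_derivative (La - V x) * ph x) (at x)) ==>
 (ph \<longlongrightarrow> 1) (at_right (a 2)) ==> (q \<longlongrightarrow> 0) (at_right (a 2)) ==>
 (q \<longlongrightarrow> W) (at_left (a 3)) ==> ((%x. (a 3 - x) * ph x) \<longlongrightarrow> 0) (at_left (a 3)) ==>
 \<bar>2 * pi * exp (- sqrt La * K_plus a) * W/sqrt (P' (a 2) * - P' (a 3)) - 1\<bar> <= C * La powr (-1/4)"
proof -
 obtain C0 where C0: "0 <= C0"
 "!!La ph q W ep. ep = 1 \<or> ep = - 1 ==> La - ep * C0 > 0 ==>
 (!!x. a 2 < x ==> x < a 3 ==> (ph has_real_derivative q x/PP a x) (at x)) ==>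
 (!!x. a 2 < x ==> x < a 3 ==> (q has_real_derivative (La - V x) * ph x) (at x)) ==>
 (!!x. a 2 < x ==> x < a 3 ==> 0 < ph x) ==>
 (ph \<longlongrightarrow> 1) (at_right (a 2)) ==> (q \<longlongrightarrow> 0) (at_right (a 2)) ==>
 (q \<longlongrightarrow> W) (at_left (a 3)) ==> ((%x. (a 3 - x) * ph x) \<longlongrightarrow> 0) (at_left (a 3)) ==>
 ep*(sqrt (P' (a 2) * - P' (a 3))/2 * wkb_wronskian tL tR (sqrt (La - ep * C0))) <= ep * W"
 using regular_connection_bounds by blast
 obtain B where B: "0 <= B" "!!x. a 2 <= x ==> x <= a 3 ==> V x <= B" using V_bounded by blast
 define H where "H = (%c La. pi * exp (- sqrt La * K_plus a) * wkb_wronskian tL tR (sqrt (La + c)))"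
 have Hb: "\<exists>C L. \<forall>La\<ge>L. \<bar>H c La - 1\<bar> <= C * La powr (-1/4)" for c
 proof -
 obtain C where "\<forall>\<^sub>F La in at_top. norm (H c La - 1) <= C * norm (La powr (-1/4))"
 using shifted_frequency_asymptotics[of c] unfolding travel_time_split H_def by (elim landau_o.bigE)
 then show ?thesis unfolding eventually_at_top_linorder by auto
 qed
 obtain C1 L1 where H1: "!!La. L1 <= La ==> \<bar>H (- C0) La - 1\<bar> <= C1 * La powr (-1/4)" using Hb[of "- C0"] by blast
 obtain C2 L2 where H2: "!!La. L2 <= La ==> \<bar>H C0 La - 1\<bar> <= C2 * La powr (-1/4)" using Hb[of C0] by blast
 define La0 where "La0 = max (max L1 L2) (max (C0 + 1) (B + 1))"
 show thesis
 proof (rule that[of La0 "C1 + C2"])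
 show "0 < La0" using C0(1) by (simp add: La0_def less_max_iff_disj)
 show "V x < La0" if "a 2 <= x" "x <= a 3" for x using B(2)[OF that] by (simp add: La0_def less_max_iff_disj)
 fix La ph q W
 assume La: "La0 <= La"
 and dph: "!!x. a 2 < x ==> x < a 3 ==> (ph has_real_derivative q x/PP a x) (at x)"
 and dq: "!!x. a 2 < x ==> x < a 3 ==> (q has_real_derivative (La - V x) * ph x) (at x)"
 and ph2: "(ph \<longlongrightarrow> 1) (at_right (a 2))" and q2: "(q \<longlongrightarrow> 0) (at_right (a 2))"
 and q3: "(q \<longlongrightarrow> W) (at_left (a 3))" and ph3: "((%x. (a 3 - x) * ph x) \<longlongrightarrow> 0) (at_left (a 3))"
 have L: "L1 <= La" "L2 <= La" "C0 < La" "B <= La" using La by (auto simp: La0_def)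
 have pos: "0 < ph x" if "a 2 < x" "x < a 3" for x
 proof (rule regular_solution_pos[OF dph dq _ ph2 q2 that])
 show "V x <= La" if "a 2 < x" "x < a 3" for x using B(2)[of x] that L by simp
 qed
 define S where "S = sqrt (P' (a 2) * - P' (a 3))"
 have S: "0 < S" using P'_sign by (simp add: S_def mult_pos_neg)
 define F where "F = 2 * pi * exp (- sqrt La * K_plus a)/S"
 have F: "0 < F" using S by (simp add: F_def)
 have lo: "S/2 * wkb_wronskian tL tR (sqrt (La + - C0)) <= W"
 using C0(2)[of 1 La, OF _ _ dph dq pos ph2 q2 q3 ph3] L by (simp add: S_def)
 have hi: "W <= S/2 * wkb_wronskian tL tR (sqrt (La + C0))"
 using C0(2)[of "- 1" La, OF _ _ dph dq pos ph2 q2 q3 ph3] L C0(1) by (simp add: S_def)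
 have FS: "F*(S/2 * w) = pi * exp (- sqrt La * K_plus a) * w" for w using S by (simp add: F_def)
 have "H (- C0) La <= F * W" using mult_left_mono[OF lo less_imp_le[OF F]] unfolding FS H_def .
 moreover have "F * W <= H C0 La" using mult_left_mono[OF hi less_imp_le[OF F]] unfolding FS H_def .
 ultimately have "\<bar>F * W - 1\<bar> <= \<bar>H (- C0) La - 1\<bar> + \<bar>H C0 La - 1\<bar>" by linarith
 also have "... <= (C1 + C2) * La powr (-1/4)" using H1[OF L(1)] H2[OF L(2)] by (simp add: algebra_simps)
 finally show "\<bar>2 * pi * exp (- sqrt La * K_plus a) * W/sqrt (P' (a 2) * - P' (a 3)) - 1\<bar> <= (C1 + C2) * La powr (-1/4)"
 by (simp add: F_def S_def)
 qed
qed

end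

section \<open>Eigenfunctions as classical solutions\<close>

lemma sets_AE_lebesgue_on_negligible:
 assumes "AE x in lebesgue_on S. Q x" "S \<in> sets lebesgue"
 shows "negligible {x \<in> S. \<not> Q x}"
proof -
 have "AE x in lebesgue. x \<in> S --> Q x" using assms by (simp add: AE_restrict_space_iff)
 then obtain N where N: "N \<in> null_sets lebesgue" "{x. \<not> (x \<in> S --> Q x)} \<subseteq> N"
 by (auto simp: eventually_ae_filter)
 have "negligible N" using N(1) by (simp only: negligible_iff_null_sets)
 moreover have "{x \<in> S. \<not> Q x} \<subseteq> N" using N(2) by blast
 ultimately show ?thesis by (rule negligible_subset)
qed

lemma vderiv_nondifferentiable: "\<not> psi differentiable (at x) ==> vderiv psi x = (SOME D. False)"
 unfolding vderiv_def vector_derivative_def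
 by (rule arg_cong[where f = Eps]) (auto simp: fun_eq_iff dest: differentiableI_vector)

lemma vderiv_works: "psi differentiable (at x) ==> (psi has_vector_derivative vderiv psi x) (at x)"
 unfolding vderiv_def by (simp add: vector_derivative_works)

locale eigenfunction = four_points +
 fixes f :: "real => complex" and La :: real
 assumes ef: "LS_eigenfunction a La f"
 and La: "!!x. a 2 <= x ==> x <= a 4 ==> V x < La"
begin

definition q where "q = quasi_deriv a f"

lemma PP_nonzero: "a 2 < x ==> x < a 4 ==> x ~= a 3 ==> PP a x ~= 0"
 unfolding PP_eq using a12 a23 a34 by auto

lemma in_D_max: "f \<in> D_max a" and f_L2: "f \<in> L2_on {a 2..a 4}"
 using ef by (auto simp: LS_eigenfunction_def D_LS_def D_max_def)

lemma V_deriv: "(V has_real_derivative 4*(x - mean4 a)) (at x)"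
 unfolding V_def[abs_def] by (auto intro!: derivative_eq_intros)

text \<open>The quasi-derivative is only absolutely continuous by hypothesis, but its derivative
  agrees almost everywhere with a continuous function, so the equation holds at every
  point.\<close>

lemma eigenfunction_ode:
 assumes x: "a 2 < x" "x < a 4" "x ~= a 3"
 shows "(f has_vector_derivative q x/of_real (PP a x)) (at x)"
 "(q has_vector_derivative of_real (La - V x) * f x) (at x)"
proof -
 obtain l r where lr: "(l, r) = (a 2, a 3) \<or> (l, r) = (a 3, a 4)" "l < x" "x < r"
 using x by (cases "x < a 3") auto
 have sub: "a 2 <= l" "r <= a 4" "!!y. l < y ==> y < r ==> PP a y ~= 0"
 using lr a12 a23 a34 PP_nonzero by auto
 have D: "loc_abs_cont_on l r f" "!!y. y \<in> {l<..<r} ==> f differentiable (at y)" "loc_abs_cont_on l r q"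
 using in_D_max lr(1) by (auto simp: D_max_def q_def)
 have df: "(f has_vector_derivative q y/of_real (PP a y)) (at y)" if "l < y" "y < r" for y
 proof -
 have "q y/of_real (PP a y) = vderiv f y" using sub(3)[OF that] by (simp add: q_def quasi_deriv_def)
 then show ?thesis using vderiv_works[OF D(2)] that by simp
 qed
 show "(f has_vector_derivative q x/of_real (PP a x)) (at x)" using df lr by blast
 define c d where "c = (l + x)/2" and "d = (x + r)/2"
 have cd: "l < c" "c < x" "x < d" "d < r" using lr by (auto simp: c_def d_def)
 define Z where "Z = {y \<in> {a 2..a 4}. \<not> Lop a f y = of_real La * f y}"
 have Z: "negligible Z" unfolding Z_def
 by (rule sets_AE_lebesgue_on_negligible) (use ef in \<open>auto simp: LS_eigenfunction_def L2_eq_on_def\<close>)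
 have Lop: "vderiv q y = of_real (La - V y) * f y" if "l < y" "y < r" "y \<notin> Z" for y
 proof -
 have "Lop a f y = of_real La * f y" using that sub by (auto simp: Z_def)
 then show ?thesis by (simp add: Lop_def q_def V_def algebra_simps)
 qed
 define H where "H = (%y. of_real (La - V y) * f y)"
 define c0 where "c0 = (SOME D::complex. False)"
 define W where "W = (%y. 1/(La - V y))"
 define e where "e = (%y. of_real (W y) * c0)"
 define pe where "pe = (%y. of_real (PP a y*(4*(y - mean4 a)*(W y)\<^sup>2)) * c0)"
 define k0 where "k0 = (%y. of_real (P' y*(4*(y - mean4 a)*(W y)\<^sup>2) + (4*(W y)\<^sup>2 + 2 * W y*(4*(y - mean4 a)*(W y)\<^sup>2)*(4*(y - mean4 a))) * PP a y) * c0)"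
 have VLa: "V y < La" if "l < y" "y < r" for y using La[of y] that sub by simp
 have dW: "(W has_real_derivative 4*(y - mean4 a)*(W y)\<^sup>2) (at y)" if "l < y" "y < r" for y
 proof -
 have "((%y. 1/(La - V y)) has_real_derivative (0*(La - V y) - 1*(0 - 4*(y - mean4 a)))/((La - V y)*(La - V y))) (at y)"
 using VLa[OF that] by (intro DERIV_divide DERIV_const DERIV_diff V_deriv) auto
 then show ?thesis unfolding W_def by (rule DERIV_cong) (simp add: power2_eq_square)
 qed
 have de: "(e has_vector_derivative pe y/of_real (PP a y)) (at y)" if "l < y" "y < r" for y
 proof -
 have "(e has_vector_derivative of_real (4*(y - mean4 a)*(W y)\<^sup>2) * c0) (at y)"
 unfolding e_def
 by (intro has_vector_derivative_mult_left has_vector_derivative_of_real dW that)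
 moreover have "pe y/of_real (PP a y) = of_real (4*(y - mean4 a)*(W y)\<^sup>2) * c0"
 using sub(3)[OF that] by (simp add: pe_def)
 ultimately show ?thesis by simp
 qed
 have dpe: "(pe has_vector_derivative k0 y) (at y)" if "l < y" "y < r" for y
 proof -
 have "((%y. PP a y*(4*(y - mean4 a)*(W y)\<^sup>2)) has_real_derivative
 P' y*(4*(y - mean4 a)*(W y)\<^sup>2) + (4*(W y)\<^sup>2 + 2 * W y*(4*(y - mean4 a)*(W y)\<^sup>2)*(4*(y - mean4 a))) * PP a y) (at y)"
 by (rule DERIV_mult[OF PP_deriv]) (auto intro!: derivative_eq_intros dW[OF that] simp: algebra_simps)
 then show ?thesis unfolding pe_def k0_def
 by (intro has_vector_derivative_mult_left has_vector_derivative_of_real)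
 qed
 have contW: "continuous_on {c..d} W"
 by (rule DERIV_continuous_on, rule has_field_derivative_at_within, rule dW) (use cd in auto)
 have contP: "continuous_on {c..d} (PP a)" "continuous_on {c..d} P'" "continuous_on {c..d} V"
 unfolding PP_eq[abs_def] P'_def[abs_def] V_def[abs_def] by (intro continuous_intros)+
 have contk: "continuous_on {c..d} k0"
 unfolding k0_def by (intro continuous_intros contW contP)
 have contf: "continuous_on {c..d} f"
 by (rule continuous_on_vector_derivative[OF has_vector_derivative_at_within[OF df]]) (use cd in auto)
 have contH: "continuous_on {c..d} H" unfolding H_def by (intro continuous_intros contf contP)
 have ac: "abs_cont_on c d q" using D(3) cd by (auto simp: loc_abs_cont_on_def)
 have neg: "negligible {y \<in> {c<..<d}. y \<notin> Z & \<not> q differentiable (at y)}"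
 proof (rule nondifferentiability_negligible[where f = f and q = q and p = "PP a" and e = e and pe = pe and ?k0.0 = k0 and H = H])
 show "c < d" using cd by simp
 fix y assume "y \<in> {c..d}"
 then have y: "l < y" "y < r" using cd by auto
 show "(f has_vector_derivative q y/of_real (PP a y)) (at y)" "PP a y ~= 0"
 "(e has_vector_derivative pe y/of_real (PP a y)) (at y)" "(pe has_vector_derivative k0 y) (at y)"
 using df[OF y] sub(3)[OF y] de[OF y] dpe[OF y] by auto
 assume yZ: "y \<notin> Z"
 show "(q has_vector_derivative H y) (at y)" if "q differentiable (at y)"
 using vderiv_works[OF that] Lop[OF y yZ] by (simp add: H_def)
 show "f y = e y" if "\<not> q differentiable (at y)"
 proof -
 have "c0 = of_real (La - V y) * f y" using vderiv_nondifferentiable[OF that] Lop[OF y yZ] by (simp add: c0_def)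
 moreover have "of_real (La - V y) ~= (0::complex)" using VLa[OF y] by (simp del: of_real_diff)
 ultimately show ?thesis by (simp add: e_def W_def divide_simps)
 qed
 qed (use contk contH ac Z in auto)
 have "(q has_vector_derivative H x) (at x)"
 proof (rule abs_cont_ae_derivative_imp_derivative[OF ac negligible_Un[OF Z neg] contH _ cd(2,3)])
 fix y assume y: "c < y" "y < d" "y \<notin> Z \<union> {y \<in> {c<..<d}. y \<notin> Z & \<not> q differentiable (at y)}"
 then have "q differentiable (at y)" by auto
 from vderiv_works[OF this] show "(q has_vector_derivative H y) (at y)"
 using Lop[of y] y cd by (simp add: H_def)
 qed
 then show "(q has_vector_derivative of_real (La - V x) * f x) (at x)" by (simp add: H_def)
qed

end

lemma Cauchy_at_right_limit:
 fixes r :: "real => complex"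
 assumes ta: "0 < ta" and inc: "!!s t. 0 < s ==> s <= t ==> t <= ta ==> norm (r t - r s) <= C*(sqrt t - sqrt s)"
 obtains R0 where "!!t. 0 < t ==> t <= ta ==> norm (r t - R0) <= C * sqrt t"
proof -
 define X where "X n = r (ta/real (Suc n))" for n
 define S where "S n = sqrt (ta/real (Suc n))" for n
 have pos: "0 < ta/real (Suc n)" "ta/real (Suc n) <= ta" for n using ta by (auto simp: divide_simps mult_le_cancel_left1)
 have C: "0 <= C"
 proof -
 have "0 <= C*(sqrt ta - sqrt (ta/4))" using order_trans[OF norm_ge_zero inc[of "ta/4" ta]] ta by simp
 moreover have "0 < sqrt ta - sqrt (ta/4)" using ta by simp
 ultimately show ?thesis by (simp add: zero_le_mult_iff)
 qed
 have dist: "norm (r s - r t) <= C * \<bar>sqrt s - sqrt t\<bar>" if "0 < s" "s <= ta" "0 < t" "t <= ta" for s t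
 using inc[of s t] inc[of t s] that by (cases "s <= t") (auto simp: norm_minus_commute abs_minus_commute)
 have "(%n. sqrt (ta * inverse (real (Suc n)))) \<longlonglongrightarrow> sqrt (ta*0)"
 by (intro tendsto_intros LIMSEQ_inverse_real_of_nat)
 then have S0: "S \<longlonglongrightarrow> 0" by (simp add: S_def[abs_def] divide_inverse)
 have "Cauchy (%n. C * S n)"
 using tendsto_mult[OF tendsto_const S0, of C] by (intro convergent_Cauchy) (auto simp: convergent_def)
 then have "Cauchy X"
 unfolding Cauchy_def
 proof (intro allI impI)
 assume A: "\<forall>e>0. \<exists>M. \<forall>m\<ge>M. \<forall>n\<ge>M. dist (C * S m) (C * S n) < e"
 fix e :: real assume "e > 0"
 then obtain M where M: "!!m n. m \<ge> M ==> n \<ge> M ==> dist (C * S m) (C * S n) < e" using A by blast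
 have "dist (X m) (X n) < e" if "m \<ge> M" "n \<ge> M" for m n
 proof -
 have "dist (X m) (X n) <= C * \<bar>S m - S n\<bar>" unfolding dist_norm X_def S_def using pos by (intro dist)
 also have "... = dist (C * S m) (C * S n)" using C by (simp add: dist_real_def abs_mult flip: right_diff_distrib)
 finally show ?thesis using M[OF that] by simp
 qed
 then show "\<exists>M. \<forall>m\<ge>M. \<forall>n\<ge>M. dist (X m) (X n) < e" by blast
 qed
 then obtain R0 where R0: "X \<longlonglongrightarrow> R0" using Cauchy_convergent_iff convergent_def by blast
 show thesis
 proof (rule that)
 fix t assume t: "0 < t" "t <= ta"
 have "(%n. norm (r t - X n)) \<longlonglongrightarrow> norm (r t - R0)" by (intro tendsto_intros R0)
 moreover have "(%n. C * \<bar>sqrt t - S n\<bar>) \<longlonglongrightarrow> C * \<bar>sqrt t - 0\<bar>" by (intro tendsto_intros S0)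
 moreover have "\<forall>n. norm (r t - X n) <= C * \<bar>sqrt t - S n\<bar>" unfolding X_def S_def using dist t pos by blast
 ultimately have "norm (r t - R0) <= C * \<bar>sqrt t - 0\<bar>" by (intro LIMSEQ_le) auto
 then show "norm (r t - R0) <= C * sqrt t" using t by simp
 qed
qed

text \<open>Square integrability of the function makes the quasi-derivative Hoelder continuous of
  order one half up to the endpoint, by the Cauchy-Schwarz inequality. Dividing by a simple zero
  leaves a logarithm and a remainder that is again Hoelder continuous.\<close>

lemma endpoint_expansion:
 fixes F Q :: "real => complex" and p w N :: "real => real"
 assumes ta: "0 < ta"
 and dF: "!!t. 0 < t ==> t <= ta ==> (F has_vector_derivative Q t/of_real (p t)) (at t)"
 and dQ: "!!t. 0 < t ==> t <= ta ==> (Q has_vector_derivative of_real (w t) * F t) (at t)"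
 and w: "!!t. 0 < t ==> t <= ta ==> \<bar>w t\<bar> <= M"
 and dN: "!!t. 0 < t ==> t <= ta ==> (N has_real_derivative (norm (F t))\<^sup>2) (at t)"
 and N: "!!s t. 0 < s ==> s <= t ==> t <= ta ==> N t - N s <= I"
 and Q0: "(Q \<longlongrightarrow> Q0) (at_right 0)"
 and p: "!!t. 0 < t ==> t <= ta ==> \<bar>1/p t - 1/(ka * t)\<bar> <= B"
 obtains C R0 where "0 <= C" "!!t. 0 < t ==> t <= ta ==> norm (Q t - Q0) <= C * sqrt t"
 "!!s t. 0 < s ==> s <= t ==> t <= ta ==>
 norm ((F t - Q0/of_real ka * of_real (ln t)) - (F s - Q0/of_real ka * of_real (ln s))) <= C*(sqrt t - sqrt s)"
 "!!t. 0 < t ==> t <= ta ==> norm ((F t - Q0/of_real ka * of_real (ln t)) - R0) <= C * sqrt t"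
proof -
 have M: "0 <= M" using w[of ta] ta by simp
 have B: "0 <= B" using p[of ta] ta by simp
 have I: "0 <= I" using N[of ta ta] ta by simp
 define C1 where "C1 = M/2*(I + 1)"
 have C1: "0 <= C1" using M I by (simp add: C1_def)
 have Qinc: "norm (Q t - Q s) <= C1 * sqrt t" if st: "0 < s" "s < t" "t <= ta" for s t
 proof -
 have t: "0 < t" "0 < sqrt t" using st by auto
 define ph where "ph x = M/2*(sqrt t * N x + x/sqrt t)" for x
 have "norm (Q t - Q s) <= ph t - ph s"
 proof (rule differentiable_bound_general[OF st(2)])
 show "continuous_on {s..t} ph" unfolding ph_def
 using st t by (intro continuous_intros DERIV_continuous_on[where D = "%x. (norm (F x))\<^sup>2"])
 (auto intro!: has_field_derivative_at_within[OF dN])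
 show "continuous_on {s..t} Q"
 by (rule continuous_on_vector_derivative[OF has_vector_derivative_at_within[OF dQ]]) (use st in auto)
 fix x assume x: "s < x" "x < t"
 have xx: "0 < x" "x <= ta" using x st by auto
 have "(ph has_real_derivative M/2*(sqrt t*(norm (F x))\<^sup>2 + 1/sqrt t)) (at x)"
 unfolding ph_def by (intro DERIV_cmult DERIV_add DERIV_cdivide DERIV_ident dN xx)
 then show "(ph has_vector_derivative M/2*(sqrt t*(norm (F x))\<^sup>2 + 1/sqrt t)) (at x)"
 by (simp add: has_real_derivative_iff_has_vector_derivative)
 show "(Q has_vector_derivative of_real (w x) * F x) (at x)" using dQ xx by blast
 define y where "y = norm (F x)"
 have "0 <= (sqrt t * y - 1)\<^sup>2" by simp
 then have "2*(sqrt t * y) <= (sqrt t * y)\<^sup>2 + 1" by (simp add: power2_diff)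
 then have "2*(sqrt t * y)/sqrt t <= ((sqrt t * y)\<^sup>2 + 1)/sqrt t" using t by (intro divide_right_mono) auto
 moreover have "2*(z * y)/z = 2 * y" "((z * y)\<^sup>2 + 1)/z = z * y\<^sup>2 + 1/z" if "0 < z" for z :: real
 using that by (simp_all add: field_simps power2_eq_square)
 ultimately have "2 * y <= sqrt t * y\<^sup>2 + 1/sqrt t" using t(2) by simp
 then have "M/2*(2 * y) <= M/2*(sqrt t * y\<^sup>2 + 1/sqrt t)" using M by (intro mult_left_mono) auto
 moreover have "norm (of_real (w x) * F x) <= M * y" unfolding norm_mult y_def using w[OF xx] by (intro mult_right_mono) auto
 ultimately show "norm (of_real (w x) * F x) <= M/2*(sqrt t*(norm (F x))\<^sup>2 + 1/sqrt t)" by (simp add: y_def)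
 qed
 also have "... = M/2*(sqrt t*(N t - N s) + (t - s)/sqrt t)" by (simp add: ph_def algebra_simps diff_divide_distrib)
 also have "... <= M/2*(sqrt t * I + t/sqrt t)"
 using M st t N[of s t] by (intro mult_left_mono add_mono divide_right_mono) auto
 also have "... = C1 * sqrt t" using t by (simp add: C1_def real_div_sqrt algebra_simps)
 finally show ?thesis .
 qed
 have QQ: "norm (Q t - Q0) <= C1 * sqrt t" if t: "0 < t" "t <= ta" for t
 proof (rule tendsto_upperbound)
 show "((%s. norm (Q t - Q s)) \<longlongrightarrow> norm (Q t - Q0)) (at_right 0)" by (intro tendsto_intros Q0)
 show "\<forall>\<^sub>F s in at_right 0. norm (Q t - Q s) <= C1 * sqrt t"
 unfolding eventually_at_right[OF t(1)] using Qinc t by (intro exI[of _ t]) auto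
 qed simp
 define C2 where "C2 = C1*(1/(abs ka) + B * ta) + norm Q0 * B * sqrt ta"
 have C2: "0 <= C2" using C1 B ta by (simp add: C2_def)
 define r where "r t = F t - Q0/of_real ka * of_real (ln t)" for t
 have rinc: "norm (r t - r s) <= 2 * C2*(sqrt t - sqrt s)" if st: "0 < s" "s <= t" "t <= ta" for s t
 proof (cases "s = t")
 case False
 then have st': "s < t" using st by simp
 have dr: "(r has_vector_derivative (Q x/of_real (p x) - Q0/of_real ka * of_real (1/x))) (at x)" if x: "0 < x" "x <= ta" for x
 unfolding r_def using x
 by (intro has_vector_derivative_diff dF has_vector_derivative_mult_right has_vector_derivative_of_real)
 (auto intro!: derivative_eq_intros)
 have "norm (r t - r s) <= 2 * C2 * sqrt t - 2 * C2 * sqrt s"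
 proof (rule differentiable_bound_general[OF st'])
 show "continuous_on {s..t} (%x. 2 * C2 * sqrt x)" by (intro continuous_intros)
 show "continuous_on {s..t} r"
 by (rule continuous_on_vector_derivative[OF has_vector_derivative_at_within[OF dr]]) (use st in auto)
 fix x assume x: "s < x" "x < t"
 have xx: "0 < x" "x <= ta" using x st by auto
 have "((%x. 2 * C2 * sqrt x) has_real_derivative 2 * C2*(inverse (sqrt x)/2)) (at x)"
 by (intro DERIV_cmult DERIV_real_sqrt xx)
 then have "((%x. 2 * C2 * sqrt x) has_real_derivative C2/sqrt x) (at x)"
 proof (rule DERIV_cong)
 have "2 * C2*(i/2) = C2 * i" for i by simp
 then show "2 * C2*(inverse (sqrt x)/2) = C2/sqrt x" by (simp only: divide_inverse)
 qed
 then show "((%x. 2 * C2 * sqrt x) has_vector_derivative C2/sqrt x) (at x)"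
 by (simp only: has_real_derivative_iff_has_vector_derivative)
 show "(r has_vector_derivative (Q x/of_real (p x) - Q0/of_real ka * of_real (1/x))) (at x)" using dr xx by blast
 have e: "Q x/of_real (p x) - Q0/of_real ka * of_real (1/x)
 = (Q x - Q0) * of_real (1/p x) + Q0 * of_real (1/p x - 1/(ka * x))"
 by (simp add: algebra_simps diff_divide_distrib)
 have "\<bar>1/p x\<bar> <= \<bar>1/(ka * x)\<bar> + B" using p[OF xx] by linarith
 also have "... = (1/(abs ka) + B * x)/x" using xx by (simp add: abs_mult field_simps)
 also have "... <= (1/(abs ka) + B * ta)/x" using xx B by (intro divide_right_mono add_left_mono mult_left_mono) auto
 finally have ip: "\<bar>1/p x\<bar> <= (1/(abs ka) + B * ta)/x" .
 have "norm (Q x - Q0) * \<bar>1/p x\<bar> <= C1 * sqrt x*((1/(abs ka) + B * ta)/x)"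
 using QQ[OF xx] ip C1 xx by (intro mult_mono) auto
 also have "... = C1*(1/(abs ka) + B * ta)*(sqrt x/x)" by simp
 also have "sqrt x/x = 1/sqrt x" using xx by (simp add: sqrt_divide_self_eq inverse_eq_divide)
 finally have n1: "norm (Q x - Q0) * \<bar>1/p x\<bar> <= C1*(1/(abs ka) + B * ta)*(1/sqrt x)" .
 have "1 <= sqrt ta/sqrt x" using xx by simp
 then have "norm Q0 * B*1 <= norm Q0 * B*(sqrt ta/sqrt x)" using B by (intro mult_left_mono) auto
 moreover have "norm Q0 * \<bar>1/p x - 1/(ka * x)\<bar> <= norm Q0 * B" using p[OF xx] by (intro mult_left_mono) auto
 ultimately have n2: "norm Q0 * \<bar>1/p x - 1/(ka * x)\<bar> <= norm Q0 * B * sqrt ta*(1/sqrt x)" by simp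
 have "norm (Q x/of_real (p x) - Q0/of_real ka * of_real (1/x))
 <= norm (Q x - Q0) * \<bar>1/p x\<bar> + norm Q0 * \<bar>1/p x - 1/(ka * x)\<bar>"
 unfolding e using norm_triangle_ineq[of "(Q x - Q0) * of_real (1/p x)" "Q0 * of_real (1/p x - 1/(ka * x))"]
 by (simp only: norm_mult norm_of_real)
 also have "... <= C1*(1/(abs ka) + B * ta)*(1/sqrt x) + norm Q0 * B * sqrt ta*(1/sqrt x)" using n1 n2 by linarith
 also have "... = C2/sqrt x" by (simp add: C2_def add_divide_distrib)
 finally show "norm (Q x/of_real (p x) - Q0/of_real ka * of_real (1/x)) <= C2/sqrt x" .
 qed
 then show ?thesis by (simp add: algebra_simps)
 qed simp
 obtain R0 where R0: "!!t. 0 < t ==> t <= ta ==> norm (r t - R0) <= 2 * C2 * sqrt t"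
 using Cauchy_at_right_limit[OF ta rinc] by blast
 show thesis
 proof (rule that[of "C1 + 2 * C2" R0])
 show "0 <= C1 + 2 * C2" using C1 C2 by simp
 fix t assume t: "0 < t" "t <= ta"
 show "norm (Q t - Q0) <= (C1 + 2 * C2) * sqrt t" using QQ[OF t] C2 t by (simp add: distrib_right add_increasing2)
 show "norm ((F t - Q0/of_real ka * of_real (ln t)) - R0) <= (C1 + 2 * C2) * sqrt t"
 using R0[OF t] C1 t by (simp add: r_def distrib_right add_increasing)
 next
 fix s t assume st: "0 < s" "s <= t" "t <= ta"
 have "0 <= C1*(sqrt t - sqrt s)" using C1 st by simp
 then show "norm ((F t - Q0/of_real ka * of_real (ln t)) - (F s - Q0/of_real ka * of_real (ln s))) <= (C1 + 2 * C2)*(sqrt t - sqrt s)"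
 using rinc[OF st] unfolding r_def by (simp only: distrib_right)
 qed
qed

section \<open>Behaviour at the singular points\<close>

lemma L2_on_abs_integrable:
 assumes "h \<in> L2_on {c..d}"
 shows "h absolutely_integrable_on {c..d}"
proof -
 have m: "h \<in> borel_measurable (lebesgue_on {c..d})"
 and i: "integrable (lebesgue_on {c..d}) (%x. (norm (h x))\<^sup>2)"
 using assms by (auto simp: L2_on_def)
 show ?thesis
 proof (rule measurable_bounded_by_integrable_imp_absolutely_integrable[OF m])
 have "(%x. (norm (h x))\<^sup>2) integrable_on {c..d}" using i by (simp add: integrable_on_lebesgue_on)
 from integrable_add[OF integrable_const_ivl this]
 show "(%x. 1 + (norm (h x))\<^sup>2) integrable_on {c..d}" .
 fix x
 have "0 <= (norm (h x) - 1)\<^sup>2" by simp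
 then have "2 * norm (h x) <= 1 + (norm (h x))\<^sup>2" by (simp add: power2_diff)
 then show "norm (h x) <= 1 + (norm (h x))\<^sup>2" using norm_ge_zero[of "h x"] by linarith
 qed auto
qed

lemma has_real_derivative_ln_abs:
 assumes "x ~= c" shows "((%y::real. ln \<bar>y - c\<bar>) has_real_derivative 1/(x - c)) (at x)"
proof (cases "c < x")
 case True
 have "((%y. ln (y - c)) has_real_derivative 1/(x - c)) (at x)"
 using True by (auto intro!: derivative_eq_intros)
 then show ?thesis
 by (rule has_field_derivative_transform_within_open[of _ _ _ "{c<..}"]) (use True in auto)
next
 case False
 then have x: "x < c" using assms by simp
 have "((%y. ln (c - y)) has_real_derivative 1/(x - c)) (at x)"
 using x by (auto intro!: derivative_eq_intros simp: divide_simps)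
 then show ?thesis
 by (rule has_field_derivative_transform_within_open[of _ _ _ "{..<c}"]) (use x in auto)
qed

lemma sqrt_diff_le: "0 <= s ==> s <= t ==> sqrt t - sqrt s <= sqrt (t - s)"
 using sqrt_add_le_add_sqrt[of s "t - s"] by simp

lemma tendsto_sqrt_ln_at_right: "((%t::real. C*(sqrt t * \<bar>ln t\<bar>)) \<longlongrightarrow> 0) (at_right 0)"
proof -
 have "((%t::real. sqrt t * \<bar>ln t\<bar>) \<longlongrightarrow> 0) (at_right 0)" by real_asymp
 from tendsto_mult_left[OF this, of C] show ?thesis by simp
qed

context four_points
begin

lemma near_root:
 assumes e: "PP a e = 0" "P' e ~= 0"
 obtains ta B where "0 < ta" "!!y. 0 < (abs y) ==> (abs y) <= ta ==> PP a (e + y) ~= 0"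
 "!!y. 0 < (abs y) ==> (abs y) <= ta ==> \<bar>1/PP a (e + y) - 1/(P' e * y)\<bar> <= B"
proof -
 define s3 where "s3 = (e - a 1) + (e - a 2) + (e - a 3) + (e - a 4)"
 define s2 where "s2 = (e - a 1)*(e - a 2) + (e - a 1)*(e - a 3) + (e - a 1)*(e - a 4)
 + (e - a 2)*(e - a 3) + (e - a 2)*(e - a 4) + (e - a 3)*(e - a 4)"
 define M where "M = (abs s2) + (abs s3) + 1"
 have M: "0 < M" by (simp add: M_def add_nonneg_pos)
 have ex: "PP a (e + y) = P' e * y + y\<^sup>2*(s2 + y * s3 + y\<^sup>2)" for y
 proof -
 have "PP a (e + y) = PP a e + P' e * y + y\<^sup>2*(s2 + y * s3 + y\<^sup>2)"
 unfolding PP_eq P'_def s2_def s3_def by (simp add: algebra_simps power2_eq_square)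
 then show ?thesis using e by simp
 qed
 define ta where "ta = min 1 (\<bar>P' e\<bar> / (2 * M))"
 have tau: "0 < ta" "ta <= 1" "ta * M <= \<bar>P' e\<bar> / 2" using e M by (auto simp: ta_def min_def field_simps)
 have est: "\<bar>PP a (e + y) - P' e * y\<bar> <= M * y\<^sup>2" "\<bar>P' e\<bar> * (abs y)/2 <= \<bar>PP a (e + y)\<bar>" if y: "(abs y) <= ta" for y
 proof -
 have y1: "(abs y) <= 1" using y tau by simp
 have "\<bar>s2 + y * s3 + y\<^sup>2\<bar> <= (abs s2) + (abs y)*(abs s3) + (abs y)*(abs y)"
 by (simp add: power2_eq_square abs_mult[symmetric] order_trans[OF abs_triangle_ineq] add_mono)
 also have "... <= M" unfolding M_def using y1 mult_right_mono[OF y1, of "(abs s3)"] mult_mono[OF y1 y1] by simp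
 finally have m: "\<bar>s2 + y * s3 + y\<^sup>2\<bar> <= M" .
 show 1: "\<bar>PP a (e + y) - P' e * y\<bar> <= M * y\<^sup>2"
 unfolding ex using mult_left_mono[OF m, of "y\<^sup>2"] by (simp add: abs_mult mult.commute)
 have "M * y\<^sup>2 = (M*(abs y))*(abs y)" by (simp add: power2_eq_square)
 also have "... <= (\<bar>P' e\<bar> / 2)*(abs y)"
 proof (rule mult_right_mono)
 have "M*(abs y) <= M * ta" using y M by (intro mult_left_mono) auto
 then show "M*(abs y) <= \<bar>P' e\<bar> / 2" using tau(3) by (simp add: mult.commute)
 qed simp
 finally have "\<bar>PP a (e + y) - P' e * y\<bar> <= \<bar>P' e * y\<bar> / 2" using 1 by (simp add: abs_mult)
 then show "\<bar>P' e\<bar> * (abs y)/2 <= \<bar>PP a (e + y)\<bar>" unfolding abs_mult[symmetric] by linarith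
 qed
 show thesis
 proof (rule that[of ta "2 * M/(P' e)\<^sup>2"])
 fix y assume y: "0 < (abs y)" "(abs y) <= ta"
 have low: "0 < \<bar>P' e\<bar> * (abs y)/2" using y e by simp
 then show nz: "PP a (e + y) ~= 0" using est(2)[OF y(2)] by auto
 have "1/PP a (e + y) - 1/(P' e * y) = (P' e * y - PP a (e + y))/(PP a (e + y)*(P' e * y))"
 using nz y e by (simp add: divide_simps)
 then have "\<bar>1/PP a (e + y) - 1/(P' e * y)\<bar> = \<bar>PP a (e + y) - P' e * y\<bar> / (\<bar>PP a (e + y)\<bar> * (\<bar>P' e\<bar> * (abs y)))"
 by (simp add: abs_mult abs_minus_commute)
 also have "... <= M * y\<^sup>2/((\<bar>P' e\<bar> * (abs y)/2)*(\<bar>P' e\<bar> * (abs y)))"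
 using est[OF y(2)] low y e M by (intro frac_le mult_right_mono mult_pos_pos) auto
 also have "... = 2 * M/(P' e)\<^sup>2"
 proof -
 have "M * z\<^sup>2/((p * z/2)*(p * z)) = 2 * M/p\<^sup>2" if "0 < p" "0 < z" for p z :: real
 using that by (simp add: power2_eq_square)
 from this[of "\<bar>P' e\<bar>" "(abs y)"] show ?thesis using y e by simp
 qed
 finally show "\<bar>1/PP a (e + y) - 1/(P' e * y)\<bar> <= 2 * M/(P' e)\<^sup>2" .
 qed (rule tau)
qed

lemma roots: "PP a (a 2) = 0" "PP a (a 3) = 0" "PP a (a 4) = 0" "P' (a 2) ~= 0" "P' (a 3) ~= 0" "P' (a 4) ~= 0"
 using a12 a23 a34 P'_sign by (auto simp: PP_eq P'_def)

end

context eigenfunction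
begin

lemma f_abs_integrable: "f absolutely_integrable_on {a 2..a 4}"
 and f_sq_integrable: "(%x. (norm (f x))\<^sup>2) integrable_on {a 2..a 4}"
 using L2_on_abs_integrable[OF f_L2] f_L2 by (auto simp: L2_on_def integrable_on_lebesgue_on)

lemma end_expansion:
 assumes tht: "tht = 1 \<or> tht = - 1" and e: "PP a e = 0" "P' e ~= 0" and ta1: "0 < ta1"
 and inside: "!!t. 0 < t ==> t <= ta1 ==> a 2 < e + tht * t & e + tht * t < a 4 & e + tht * t ~= a 3"
 and qlim: "((%t. q (e + tht * t)) \<longlongrightarrow> q0) (at_right 0)"
 obtains ta C R0 where "0 < ta" "ta <= ta1" "0 <= C" "!!t. 0 < t ==> t <= ta ==> norm (q (e + tht * t) - q0) <= C * sqrt t"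
 "!!s t. 0 < s ==> s <= t ==> t <= ta ==>
 norm ((f (e + tht * t) - q0/of_real (P' e) * of_real (ln t)) - (f (e + tht * s) - q0/of_real (P' e) * of_real (ln s))) <= C*(sqrt t - sqrt s)"
 "!!t. 0 < t ==> t <= ta ==> norm ((f (e + tht * t) - q0/of_real (P' e) * of_real (ln t)) - R0) <= C * sqrt t"
proof -
 obtain ta0 B where ta0: "0 < ta0"
 and B: "!!y. 0 < (abs y) ==> (abs y) <= ta0 ==> \<bar>1/PP a (e + y) - 1/(P' e * y)\<bar> <= B"
 using near_root[OF e] by metis
 define ta where "ta = min ta0 ta1"
 have ta: "0 < ta" "ta <= ta0" "ta <= ta1" using ta0 ta1 by (auto simp: ta_def)
 have tht2: "tht * tht = 1" "(abs tht) = 1" using tht by auto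
 have thtc: "of_real tht*(of_real tht * z) = z" for z :: complex
 using tht2(1) by (simp flip: of_real_mult mult.assoc)
 have ins: "a 2 < e + tht * t" "e + tht * t < a 4" "e + tht * t ~= a 3" if "0 < t" "t <= ta" for t
 using inside[of t] that ta by auto
 have shift: "((%t. e + tht * t) has_real_derivative tht) (at t)" for t
 by (auto intro!: derivative_eq_intros)
 have chain: "((%t. u (e + tht * t)) has_vector_derivative of_real tht * u') (at t)"
 if "(u has_vector_derivative u') (at (e + tht * t))" for u :: "real => complex" and u' t
 using vector_diff_chain_at[OF shift[unfolded has_real_derivative_iff_has_vector_derivative] that]
 by (simp add: o_def scaleR_conv_of_real)
 define F where "F t = f (e + tht * t)" for t
 define Q where "Q t = of_real tht * q (e + tht * t)" for t
 have dF: "(F has_vector_derivative Q t/of_real (PP a (e + tht * t))) (at t)" if t: "0 < t" "t <= ta" for t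
 using chain[OF eigenfunction_ode(1)[OF ins[OF t]]] by (simp add: F_def[abs_def] Q_def)
 have dQ: "(Q has_vector_derivative of_real (La - V (e + tht * t)) * F t) (at t)" if t: "0 < t" "t <= ta" for t
 using has_vector_derivative_mult_right[OF chain[OF eigenfunction_ode(2)[OF ins[OF t]]], of "of_real tht"]
 unfolding Q_def[abs_def] F_def thtc .
 define NN where "NN x = integral {a 2..x} (%x. (norm (f x))\<^sup>2)" for x
 have NN: "0 <= NN x" "NN x <= NN (a 4)" if x: "a 2 <= x" "x <= a 4" for x
 proof -
 have i: "(%x. (norm (f x))\<^sup>2) integrable_on {a 2..x}"
 by (rule integrable_on_subinterval[OF f_sq_integrable]) (use x in auto)
 show "0 <= NN x" unfolding NN_def by (intro integral_nonneg i) simp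
 show "NN x <= NN (a 4)" unfolding NN_def
 by (rule integral_subset_le[OF _ i f_sq_integrable]) (use x in auto)
 qed
 define N where "N t = tht * NN (e + tht * t)" for t
 have dN: "(N has_real_derivative (norm (F t))\<^sup>2) (at t)" if t: "0 < t" "t <= ta" for t
 proof -
 have "isCont f (e + tht * t)" using eigenfunction_ode(1)[OF ins[OF t]] by (rule has_vector_derivative_continuous)
 then have "isCont (%x. (norm (f x))\<^sup>2) (e + tht * t)" by (intro continuous_intros)
 from integral_lower_limit_deriv[OF f_sq_integrable ins(1,2)[OF t] this]
 have "(NN has_real_derivative (norm (f (e + tht * t)))\<^sup>2) (at (e + tht * t))" by (simp add: NN_def[abs_def])
 from DERIV_cmult[OF DERIV_chain2[OF this shift], of tht]
 show ?thesis unfolding N_def[abs_def] F_def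
 proof (rule DERIV_cong)
 have "tht*(z * tht) = z" for z using tht2(1) by (metis mult.assoc mult.commute mult_1)
 then show "tht*((norm (f (e + tht * t)))\<^sup>2 * tht) = (norm (f (e + tht * t)))\<^sup>2" .
 qed
 qed
 have Nd: "N t - N s <= NN (a 4)" if st: "0 < s" "s <= t" "t <= ta" for s t
 using NN[of "e + tht * t"] NN[of "e + tht * s"] ins[of t] ins[of s] st tht by (auto simp: N_def)
 have "continuous_on {a 2..a 4} (%x. La - V x)" unfolding V_def by (intro continuous_intros)
 then obtain M where M: "0 <= M" "!!x. x \<in> {a 2..a 4} ==> norm (La - V x) <= M" using continuous_on_Icc_bound by blast
 have w: "\<bar>La - V (e + tht * t)\<bar> <= M" if "0 < t" "t <= ta" for t using M(2)[of "e + tht * t"] ins[OF that] by simp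
 have Q0: "(Q \<longlongrightarrow> of_real tht * q0) (at_right 0)" unfolding Q_def by (intro tendsto_intros qlim)
 have p: "\<bar>1/PP a (e + tht * t) - 1/(tht * P' e * t)\<bar> <= B" if "0 < t" "t <= ta" for t
 using B[of "tht * t"] that ta tht2 by (simp add: abs_mult mult_ac)
 have ratio: "of_real tht * q0/of_real (tht * P' e) = q0/of_real (P' e)" using tht by auto
 obtain C R0 where C: "0 <= C" "!!t. 0 < t ==> t <= ta ==> norm (Q t - of_real tht * q0) <= C * sqrt t"
 "!!s t. 0 < s ==> s <= t ==> t <= ta ==>
 norm ((F t - q0/of_real (P' e) * of_real (ln t)) - (F s - q0/of_real (P' e) * of_real (ln s))) <= C*(sqrt t - sqrt s)"
 "!!t. 0 < t ==> t <= ta ==> norm ((F t - q0/of_real (P' e) * of_real (ln t)) - R0) <= C * sqrt t"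
 using endpoint_expansion[OF ta(1) dF dQ w dN Nd Q0 p] unfolding ratio by blast
 have nQ: "norm (Q t - of_real tht * q0) = norm (q (e + tht * t) - q0)" for t
 proof -
 have "Q t - of_real tht * q0 = of_real tht*(q (e + tht * t) - q0)" by (simp add: Q_def algebra_simps)
 then show ?thesis using tht2(2) by (simp add: norm_mult)
 qed
 show thesis by (rule that[OF ta(1,3) C(1)]) (use C(2-4) in \<open>simp_all add: nQ F_def\<close>)
qed

text \<open>So the boundary conditions with \<^const>\<open>u_bc\<close> say that the
  quasi-derivative vanishes at $a_2$ and $a_4$ and is continuous across $a_3$.\<close>

lemma lagrange_u: "lagrange a f u_bc x = - q x"
 by (simp add: lagrange_def u_bc_def vderiv_def q_def quasi_deriv_def)

lemma q_limits:
 shows "(q \<longlongrightarrow> 0) (at_right (a 2))" "(q \<longlongrightarrow> 0) (at_left (a 4))"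
 "\<exists>q3. (q \<longlongrightarrow> q3) (at_left (a 3)) & (q \<longlongrightarrow> q3) (at_right (a 3))"
proof -
 have D: "f \<in> D_LS a" using ef by (simp add: LS_eigenfunction_def)
 then have l: "((%x. - q x) \<longlongrightarrow> 0) (at_right (a 2))" "((%x. - q x) \<longlongrightarrow> 0) (at_left (a 4))"
 "\<exists>l. ((%x. - q x) \<longlongrightarrow> l) (at_left (a 3)) & ((%x. - q x) \<longlongrightarrow> l) (at_right (a 3))"
 unfolding D_LS_def lagrange_u[abs_def, symmetric] by (simp_all add: lagrange_u[abs_def, symmetric])
 show "(q \<longlongrightarrow> 0) (at_right (a 2))" "(q \<longlongrightarrow> 0) (at_left (a 4))" using tendsto_minus[OF l(1)] tendsto_minus[OF l(2)] by simp_all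
 obtain l where "((%x. - q x) \<longlongrightarrow> l) (at_left (a 3))" "((%x. - q x) \<longlongrightarrow> l) (at_right (a 3))" using l(3) by blast
 then have "((%x. - (- q x)) \<longlongrightarrow> - l) (at_left (a 3))" "((%x. - (- q x)) \<longlongrightarrow> - l) (at_right (a 3))"
 using tendsto_minus by blast+
 then show "\<exists>q3. (q \<longlongrightarrow> q3) (at_left (a 3)) & (q \<longlongrightarrow> q3) (at_right (a 3))" by auto
qed

definition q3 where "q3 = (SOME z. (q \<longlongrightarrow> z) (at_left (a 3)) & (q \<longlongrightarrow> z) (at_right (a 3)))"

lemma q3: "(q \<longlongrightarrow> q3) (at_left (a 3))" "(q \<longlongrightarrow> q3) (at_right (a 3))"
 using someI_ex[OF q_limits(3)] unfolding q3_def by auto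

definition d3 where "d3 = q3/of_real (P' (a 3))"

lemma expansion_a2:
 obtains ta C f2 where "0 < ta" "ta <= half_gap" "0 <= C" "!!t. 0 < t ==> t <= ta ==> norm (q (a 2 + t)) <= C * sqrt t"
 "!!s t. 0 < s ==> 0 < t ==> s <= ta ==> t <= ta ==> norm (f (a 2 + t) - f (a 2 + s)) <= C * sqrt \<bar>t - s\<bar>"
 "!!t. 0 < t ==> t <= ta ==> norm (f (a 2 + t) - f2) <= C * sqrt t"
proof -
 have ins: "a 2 < a 2 + 1 * t & a 2 + 1 * t < a 4 & a 2 + 1 * t ~= a 3" if "0 < t" "t <= half_gap" for t
 using that half_gap(2) a34 by auto
 have lim: "((%t. q (a 2 + 1 * t)) \<longlongrightarrow> 0) (at_right 0)"
 using filterlim_compose[OF q_limits(1) filterlim_shift_at_right] by simp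
 show thesis
 proof (rule end_expansion[OF disjI1[OF refl] roots(1,4) half_gap(1) ins lim])
 fix ta C R0 :: "real"
 fix R :: complex
 assume A: "0 < ta" "ta <= half_gap" "0 <= C" "!!t. 0 < t ==> t <= ta ==> norm (q (a 2 + 1 * t) - 0) <= C * sqrt t"
 "!!s t. 0 < s ==> s <= t ==> t <= ta ==>
 norm ((f (a 2 + 1 * t) - 0/of_real (P' (a 2)) * of_real (ln t)) - (f (a 2 + 1 * s) - 0/of_real (P' (a 2)) * of_real (ln s))) <= C*(sqrt t - sqrt s)"
 "!!t. 0 < t ==> t <= ta ==> norm ((f (a 2 + 1 * t) - 0/of_real (P' (a 2)) * of_real (ln t)) - R) <= C * sqrt t"
 have le: "norm (f (a 2 + t) - f (a 2 + s)) <= C * sqrt (t - s)" if "0 < s" "s <= t" "t <= ta" for s t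
 using A(5)[OF that] mult_left_mono[OF sqrt_diff_le[of s t] A(3)] that by simp
 have "norm (f (a 2 + t) - f (a 2 + s)) <= C * sqrt \<bar>t - s\<bar>" if "0 < s" "0 < t" "s <= ta" "t <= ta" for s t
 using le[of s t] le[of t s] that by (cases "s <= t") (auto simp: norm_minus_commute abs_minus_commute)
 then show thesis using A by (intro that[of ta C R]) simp_all
 qed
qed

lemma expansion_a4:
 obtains ta C where "0 < ta" "!!t. 0 < t ==> t <= ta ==> norm (f (a 4 - t)) <= C"
proof -
 have ins: "a 2 < a 4 + - 1 * t & a 4 + - 1 * t < a 4 & a 4 + - 1 * t ~= a 3" if "0 < t" "t <= (a 4 - a 3)/2" for t
 using that a23 a34 by (auto simp: field_simps)
 have lim: "((%t. q (a 4 + - 1 * t)) \<longlongrightarrow> 0) (at_right 0)"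
 using filterlim_compose[OF q_limits(2) filterlim_reflect_at_right] by simp
 have pos: "0 < (a 4 - a 3)/2" using a34 by simp
 show thesis
 proof (rule end_expansion[OF disjI2[OF refl] roots(3,6) pos ins lim])
 fix ta C :: "real" and R :: complex
 assume A: "0 < ta" "0 <= C"
 "!!t. 0 < t ==> t <= ta ==> norm ((f (a 4 + - 1 * t) - 0/of_real (P' (a 4)) * of_real (ln t)) - R) <= C * sqrt t"
 show thesis
 proof (rule that[of ta "C * sqrt ta + norm R"])
 fix t assume t: "0 < t" "t <= ta"
 have "norm (f (a 4 - t)) <= norm (f (a 4 - t) - R) + norm R" using norm_triangle_ineq[of "f (a 4 - t) - R" R] by simp
 also have "norm (f (a 4 - t) - R) <= C * sqrt t" using A(3)[OF t] by simp
 also have "... <= C * sqrt ta" using A(2) t by (intro mult_left_mono) auto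
 finally show "norm (f (a 4 - t)) <= C * sqrt ta + norm R" by simp
 qed (rule A)
 qed
qed

definition vc :: "nat => real" where "vc i = (\<Prod>j\<in>{1..4} - {i}. 1/(a i - a j))"

lemma vc_a3: "vc 3 * P' (a 3) = 1"
proof -
 have "{1..4::nat} - {3} = {1, 2, 4}" by auto
 then show ?thesis using a12 a23 a34 by (simp add: vc_def P'_def)
qed

definition vrest where "vrest y = vc 1 * ln \<bar>y - a 1\<bar> + vc 2 * ln \<bar>y - a 2\<bar> + vc 4 * ln \<bar>y - a 4\<bar>"
definition vpoly where "vpoly y = vc 1*((y - a 2)*(y - a 3)*(y - a 4)) + vc 2*((y - a 1)*(y - a 3)*(y - a 4))
 + vc 3*((y - a 1)*(y - a 2)*(y - a 4)) + vc 4*((y - a 1)*(y - a 2)*(y - a 3))"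

lemma v_bc_split: "v_bc a y = of_real (vc 3 * ln \<bar>y - a 3\<bar> + vrest y)"
proof -
 have "{1..4::nat} = {1, 2, 3, 4}" by auto
 then have "(\<Sum>i\<in>{1..4}. vc i * ln \<bar>y - a i\<bar>) = vc 3 * ln \<bar>y - a 3\<bar> + vrest y"
 by (simp add: vrest_def)
 then show ?thesis unfolding v_bc_def vc_def by simp
qed

lemma lagrange_v:
 assumes y: "a 2 < y" "y < a 4" "y ~= a 3"
 shows "lagrange a f (v_bc a) y = of_real (vpoly y) * f y - of_real (vc 3 * ln \<bar>y - a 3\<bar> + vrest y) * q y"
proof -
 have ne: "y ~= a 1" "y ~= a 2" "y ~= a 3" "y ~= a 4" using y a12 by auto
 have "((%y. vc 3 * ln \<bar>y - a 3\<bar> + (vc 1 * ln \<bar>y - a 1\<bar> + vc 2 * ln \<bar>y - a 2\<bar> + vc 4 * ln \<bar>y - a 4\<bar>)) has_real_derivative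
 vc 3*(1/(y - a 3)) + (vc 1*(1/(y - a 1)) + vc 2*(1/(y - a 2)) + vc 4*(1/(y - a 4)))) (at y)"
 by (intro DERIV_add DERIV_cmult has_real_derivative_ln_abs ne)
 from has_vector_derivative_of_real[OF this, where 'a = complex]
 have "((%t. cnj (v_bc a t)) has_vector_derivative
 of_real (vc 3*(1/(y - a 3)) + (vc 1*(1/(y - a 1)) + vc 2*(1/(y - a 2)) + vc 4*(1/(y - a 4))))) (at y)"
 unfolding v_bc_split vrest_def by simp
 then have vd: "vderiv (%t. cnj (v_bc a t)) y =
 of_real (vc 3*(1/(y - a 3)) + (vc 1*(1/(y - a 1)) + vc 2*(1/(y - a 2)) + vc 4*(1/(y - a 4))))"
 unfolding vderiv_def by (rule vector_derivative_at)
 have "PP a y*(vc 3*(1/(y - a 3)) + (vc 1*(1/(y - a 1)) + vc 2*(1/(y - a 2)) + vc 4*(1/(y - a 4)))) = vpoly y"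
 unfolding PP_eq vpoly_def using ne by (simp add: distrib_left mult_ac)
 then have "of_real (PP a y) * vderiv (%t. cnj (v_bc a t)) y = of_real (vpoly y)"
 unfolding vd by (simp only: of_real_mult[symmetric])
 then show ?thesis
 unfolding lagrange_def q_def quasi_deriv_def v_bc_split by (simp add: algebra_simps)
qed

text \<open>The second transmission condition identifies the constants in the expansions from the
  two sides. Hence the logarithmic coefficient and the constant are the same on both sides, and
  the remainder is Hoelder continuous across $a_3$.\<close>

lemma expansion_a3:
 obtains rh C c where "0 < rh" "rh < half_gap" "rh < a 4 - a 3" "0 <= C"
 "!!y. 0 < \<bar>y - a 3\<bar> ==> \<bar>y - a 3\<bar> <= rh ==> norm (q y - q3) <= C * sqrt \<bar>y - a 3\<bar>"
 "!!y. 0 < \<bar>y - a 3\<bar> ==> \<bar>y - a 3\<bar> <= rh ==> norm (f y - d3 * of_real (ln \<bar>y - a 3\<bar>) - c) <= C * sqrt \<bar>y - a 3\<bar>"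
 "!!x y. 0 < \<bar>x - a 3\<bar> ==> \<bar>x - a 3\<bar> <= rh ==> 0 < \<bar>y - a 3\<bar> ==> \<bar>y - a 3\<bar> <= rh ==>
 norm ((f y - d3 * of_real (ln \<bar>y - a 3\<bar>)) - (f x - d3 * of_real (ln \<bar>x - a 3\<bar>))) <= C * sqrt \<bar>y - x\<bar>"
proof -
 define g where "g y = f y - d3 * of_real (ln \<bar>y - a 3\<bar>)" for y
 define rh0 where "rh0 = min half_gap (a 4 - a 3)/2"
 have rh0: "0 < rh0" "rh0 < half_gap" "rh0 < a 4 - a 3" using half_gap(1) a34 by (auto simp: rh0_def)
 have ins: "a 2 < a 3 + tht * t & a 3 + tht * t < a 4 & a 3 + tht * t ~= a 3" if "0 < t" "t <= rh0" "tht = 1 \<or> tht = - 1" for t tht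
 using that rh0 half_gap(2) a23 a34 by auto
 have limq: "((%t. q (a 3 + tht * t)) \<longlongrightarrow> q3) (at_right 0)" if "tht = 1 \<or> tht = - 1" for tht
 using that filterlim_compose[OF q3(1) filterlim_reflect_at_right] filterlim_compose[OF q3(2) filterlim_shift_at_right] by auto
 obtain L where "(lagrange a f (v_bc a) \<longlongrightarrow> L) (at_left (a 3))" "(lagrange a f (v_bc a) \<longlongrightarrow> L) (at_right (a 3))"
 using ef by (auto simp: LS_eigenfunction_def D_LS_def)
 then have limL: "((%t. lagrange a f (v_bc a) (a 3 + tht * t)) \<longlongrightarrow> L) (at_right 0)" if "tht = 1 \<or> tht = - 1" for tht
 using that filterlim_compose[OF _ filterlim_reflect_at_right] filterlim_compose[OF _ filterlim_shift_at_right] by auto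
 define c where "c = L + of_real (vrest (a 3)) * q3"
 have main: "\<exists>ta C. 0 < ta & ta <= rh0 & 0 <= C & (\<forall>t. 0 < t & t <= ta --> norm (q (a 3 + tht * t) - q3) <= C * sqrt t)
 & (\<forall>s t. 0 < s & s <= t & t <= ta --> norm (g (a 3 + tht * t) - g (a 3 + tht * s)) <= C*(sqrt t - sqrt s))
 & (\<forall>t. 0 < t & t <= ta --> norm (g (a 3 + tht * t) - c) <= C * sqrt t)"
 if tht: "tht = 1 \<or> tht = - 1" for tht
 proof (rule end_expansion[OF tht roots(2,5) rh0(1) ins limq[OF tht]])
 fix ta C :: real and R0 :: complex
 assume ta: "0 < ta" "ta <= rh0" and C: "0 <= C"
 and eq: "!!t. 0 < t ==> t <= ta ==> norm (q (a 3 + tht * t) - q3) <= C * sqrt t"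
 and er: "!!s t. 0 < s ==> s <= t ==> t <= ta ==>
 norm ((f (a 3 + tht * t) - q3/of_real (P' (a 3)) * of_real (ln t)) - (f (a 3 + tht * s) - q3/of_real (P' (a 3)) * of_real (ln s))) <= C*(sqrt t - sqrt s)"
 and eR: "!!t. 0 < t ==> t <= ta ==> norm ((f (a 3 + tht * t) - q3/of_real (P' (a 3)) * of_real (ln t)) - R0) <= C * sqrt t"
 have gt: "g (a 3 + tht * t) = f (a 3 + tht * t) - q3/of_real (P' (a 3)) * of_real (ln t)" if "0 < t" for t
 using that tht by (auto simp: g_def d3_def abs_mult)
 define G where "G t = g (a 3 + tht * t)" for t
 have GR: "norm (G t - R0) <= C * sqrt t" if "0 < t" "t <= ta" for t using eR[OF that] gt[OF that(1)] by (simp add: G_def)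
 have Clim: "((%t. C * sqrt t) \<longlongrightarrow> C * sqrt 0) (at_right 0)" by (intro tendsto_intros)
 have "((%t. G t - R0) \<longlongrightarrow> 0) (at_right 0)"
 proof (rule Lim_null_comparison)
 show "\<forall>\<^sub>F t in at_right 0. norm (G t - R0) <= C * sqrt t"
 unfolding eventually_at_right[OF ta(1)] using GR by (intro exI[of _ ta]) (use ta in auto)
 qed (use Clim in simp)
 then have GR0: "(G \<longlongrightarrow> R0) (at_right 0)" by (simp add: LIM_zero_iff)
 \<comment> \<open>the limit of the Lagrange form identifies the constant\<close>
 have pc: "isCont vpoly (a 3)" "vpoly (a 3) = 1" "isCont vrest (a 3)"
 proof -
 show "isCont vpoly (a 3)" unfolding vpoly_def[abs_def] by (intro continuous_intros)
 show "vpoly (a 3) = 1" using vc_a3 by (simp add: vpoly_def P'_def)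
 show "isCont vrest (a 3)" unfolding vrest_def[abs_def] using a12 a23 a34 by (intro continuous_intros) auto
 qed
 have "\<exists>pd. (vpoly has_real_derivative pd) (at (a 3))"
 unfolding vpoly_def[abs_def] by (rule exI) (rule derivative_eq_intros refl)+
 then obtain pd where pd: "(vpoly has_real_derivative pd) (at (a 3))" by blast
 have to3: "((%t. a 3 + tht * t) \<longlongrightarrow> a 3) (at_right 0)"
 by (rule tendsto_eq_intros refl | simp)+
 have vr: "((%t. vrest (a 3 + tht * t)) \<longlongrightarrow> vrest (a 3)) (at_right 0)"
 by (rule isCont_tendsto_compose[OF pc(3) to3])
 have tf: "((%t. of_real (vpoly (a 3 + tht * t) - 1) * f (a 3 + tht * t)) \<longlongrightarrow> 0) (at_right 0)"
 proof -
 have "((%y. (vpoly y - vpoly (a 3))/(y - a 3)) \<longlongrightarrow> pd) (at (a 3))" using pd by (simp add: has_field_derivative_iff)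
 moreover have "filterlim (%t. a 3 + tht * t) (at (a 3)) (at_right 0)"
 using to3 tht by (auto simp: filterlim_at eventually_at_right_field intro!: exI[of _ 1])
 ultimately have "((%t. (vpoly (a 3 + tht * t) - vpoly (a 3))/((a 3 + tht * t) - a 3)) \<longlongrightarrow> pd) (at_right 0)"
 by (rule filterlim_compose)
 then have l1: "((%t. (vpoly (a 3 + tht * t) - 1)/(tht * t)) \<longlongrightarrow> pd) (at_right 0)" using pc(2) by simp
 have tln: "((%t::real. t * ln t) \<longlongrightarrow> 0) (at_right 0)" by real_asymp
 have "((%t. of_real (tht * t) * G t + d3 * of_real (tht*(t * ln t))) \<longlongrightarrow> of_real (tht*0) * R0 + d3 * of_real (tht*0)) (at_right 0)"
 by (intro tendsto_intros GR0 tln)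
 then have l2: "((%t. of_real (tht * t) * G t + d3 * of_real (tht*(t * ln t))) \<longlongrightarrow> 0) (at_right 0)" by simp
 have "((%t. of_real ((vpoly (a 3 + tht * t) - 1)/(tht * t))*(of_real (tht * t) * G t + d3 * of_real (tht*(t * ln t)))) \<longlongrightarrow> of_real pd*0) (at_right 0)"
 by (intro tendsto_intros l1 l2)
 moreover have "\<forall>\<^sub>F t in at_right 0. of_real ((vpoly (a 3 + tht * t) - 1)/(tht * t))*(of_real (tht * t) * G t + d3 * of_real (tht*(t * ln t)))
 = of_real (vpoly (a 3 + tht * t) - 1) * f (a 3 + tht * t)"
 unfolding eventually_at_right[OF ta(1)]
 proof (intro exI[of _ ta] conjI ta allI impI)
 fix t assume t: "0 < t" "t < ta"
 have nz: "tht * t ~= 0" using t tht by auto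
 have "of_real (tht * t) * G t + d3 * of_real (tht*(t * ln t)) = of_real (tht * t)*(G t + d3 * of_real (ln t))" by (simp add: algebra_simps)
 also have "G t + d3 * of_real (ln t) = f (a 3 + tht * t)" using gt[OF t(1)] by (simp add: G_def d3_def)
 finally have e1: "of_real (tht * t) * G t + d3 * of_real (tht*(t * ln t)) = of_real (tht * t) * f (a 3 + tht * t)" .
 have "of_real ((vpoly (a 3 + tht * t) - 1)/(tht * t))*(of_real (tht * t) * f (a 3 + tht * t)) = of_real ((vpoly (a 3 + tht * t) - 1)/(tht * t)*(tht * t)) * f (a 3 + tht * t)"
 by (simp only: of_real_mult mult.assoc)
 then show "of_real ((vpoly (a 3 + tht * t) - 1)/(tht * t))*(of_real (tht * t) * G t + d3 * of_real (tht*(t * ln t)))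
 = of_real (vpoly (a 3 + tht * t) - 1) * f (a 3 + tht * t)" unfolding e1 using nz by (simp only: nonzero_eq_divide_eq) simp
 qed
 ultimately show ?thesis by (simp add: tendsto_cong)
 qed
 have qln: "((%t. of_real (vc 3 * ln t)*(q3 - q (a 3 + tht * t))) \<longlongrightarrow> 0) (at_right 0)"
 proof (rule Lim_null_comparison[OF _ tendsto_sqrt_ln_at_right[of "\<bar>vc 3\<bar> * C"]])
 show "\<forall>\<^sub>F t in at_right 0. norm (of_real (vc 3 * ln t)*(q3 - q (a 3 + tht * t))) <= \<bar>vc 3\<bar> * C*(sqrt t * \<bar>ln t\<bar>)"
 unfolding eventually_at_right[OF ta(1)]
 proof (intro exI[of _ ta] conjI ta allI impI)
 fix t assume t: "0 < t" "t < ta"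
 have "norm (of_real (vc 3 * ln t)*(q3 - q (a 3 + tht * t))) = \<bar>vc 3\<bar> * \<bar>ln t\<bar> * norm (q (a 3 + tht * t) - q3)"
 by (simp add: norm_mult norm_minus_commute)
 also have "... <= \<bar>vc 3\<bar> * \<bar>ln t\<bar> * (C * sqrt t)" using eq[of t] t by (intro mult_left_mono) auto
 finally show "norm (of_real (vc 3 * ln t)*(q3 - q (a 3 + tht * t))) <= \<bar>vc 3\<bar> * C*(sqrt t * \<bar>ln t\<bar>)" by (simp add: mult_ac)
 qed
 qed
 have "((%t. G t + of_real (vc 3 * ln t)*(q3 - q (a 3 + tht * t)) + of_real (vpoly (a 3 + tht * t) - 1) * f (a 3 + tht * t) - of_real (vrest (a 3 + tht * t)) * q (a 3 + tht * t))
 \<longlongrightarrow> R0 + 0 + 0 - of_real (vrest (a 3)) * q3) (at_right 0)"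
 by (intro tendsto_intros GR0 qln tf vr limq[OF tht])
 moreover have "\<forall>\<^sub>F t in at_right 0. G t + of_real (vc 3 * ln t)*(q3 - q (a 3 + tht * t)) + of_real (vpoly (a 3 + tht * t) - 1) * f (a 3 + tht * t) - of_real (vrest (a 3 + tht * t)) * q (a 3 + tht * t)
 = lagrange a f (v_bc a) (a 3 + tht * t)"
 unfolding eventually_at_right[OF ta(1)]
 proof (intro exI[of _ ta] conjI ta allI impI)
 fix t assume t: "0 < t" "t < ta"
 have i: "a 2 < a 3 + tht * t" "a 3 + tht * t < a 4" "a 3 + tht * t ~= a 3" using ins[of t tht] t ta tht by auto
 have ab: "\<bar>a 3 + tht * t - a 3\<bar> = t" using t tht by auto
 have "q3/of_real (P' (a 3)) = of_real (vc 3) * q3"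
 proof -
 have "vc 3 = 1/P' (a 3)" using vc_a3 roots(5) by (simp add: field_simps)
 then show ?thesis by (simp add: field_simps)
 qed
 then have Gt: "G t = f (a 3 + tht * t) - of_real (vc 3) * q3 * of_real (ln t)" using gt[OF t(1)] by (simp add: G_def)
 show "G t + of_real (vc 3 * ln t)*(q3 - q (a 3 + tht * t)) + of_real (vpoly (a 3 + tht * t) - 1) * f (a 3 + tht * t) - of_real (vrest (a 3 + tht * t)) * q (a 3 + tht * t)
 = lagrange a f (v_bc a) (a 3 + tht * t)"
 unfolding lagrange_v[OF i] ab Gt by (simp add: algebra_simps)
 qed
 ultimately have "((%t. lagrange a f (v_bc a) (a 3 + tht * t)) \<longlongrightarrow> R0 - of_real (vrest (a 3)) * q3) (at_right 0)"
 by (simp add: tendsto_cong)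
 from tendsto_unique[OF _ this limL[OF tht]] have "R0 = c" by (simp add: c_def algebra_simps)
 then show ?thesis
 using ta C eq er gt GR by (intro exI[of _ ta] exI[of _ C]) (auto simp: G_def)
 qed (use tht in auto)
 obtain tap Cp where p: "0 < tap" "tap <= rh0" "0 <= Cp" "!!t. 0 < t ==> t <= tap ==> norm (q (a 3 + 1 * t) - q3) <= Cp * sqrt t"
 "!!s t. 0 < s ==> s <= t ==> t <= tap ==> norm (g (a 3 + 1 * t) - g (a 3 + 1 * s)) <= Cp*(sqrt t - sqrt s)"
 "!!t. 0 < t ==> t <= tap ==> norm (g (a 3 + 1 * t) - c) <= Cp * sqrt t"
 using main[of 1] by auto
 obtain tam Cm where m: "0 < tam" "tam <= rh0" "0 <= Cm" "!!t. 0 < t ==> t <= tam ==> norm (q (a 3 + - 1 * t) - q3) <= Cm * sqrt t"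
 "!!s t. 0 < s ==> s <= t ==> t <= tam ==> norm (g (a 3 + - 1 * t) - g (a 3 + - 1 * s)) <= Cm*(sqrt t - sqrt s)"
 "!!t. 0 < t ==> t <= tam ==> norm (g (a 3 + - 1 * t) - c) <= Cm * sqrt t"
 using main[of "- 1"] by auto
 define rh where "rh = min tap tam"
 define C where "C = max Cp Cm"
 have C: "Cp <= C" "Cm <= C" "0 <= C" using p(3) by (auto simp: C_def)
 have ge: "norm (g y - c) <= C * sqrt \<bar>y - a 3\<bar>" if y: "0 < \<bar>y - a 3\<bar>" "\<bar>y - a 3\<bar> <= rh" for y
 proof (cases "a 3 < y")
 case True
 then have "norm (g y - c) <= Cp * sqrt (y - a 3)" using p(6)[of "y - a 3"] y by (simp add: rh_def)
 also have "... <= C * sqrt (y - a 3)" using C True by (intro mult_right_mono) auto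
 finally show ?thesis using True by simp
 next
 case False
 then have y': "y < a 3" using y by auto
 then have "norm (g y - c) <= Cm * sqrt (a 3 - y)" using m(6)[of "a 3 - y"] y by (simp add: rh_def)
 also have "... <= C * sqrt (a 3 - y)" using C y' by (intro mult_right_mono) auto
 finally show ?thesis using y' by simp
 qed
 have same: "norm (g y - g x) <= C * sqrt \<bar>y - x\<bar>"
 if xy: "0 < \<bar>x - a 3\<bar>" "0 < \<bar>y - a 3\<bar>" "\<bar>x - a 3\<bar> <= \<bar>y - a 3\<bar>" "\<bar>y - a 3\<bar> <= rh" "a 3 < x \<longleftrightarrow> a 3 < y" for x y
 proof (cases "a 3 < x")
 case True
 then have y: "a 3 < y" "x <= y" using xy by auto
 have "norm (g y - g x) <= Cp*(sqrt (y - a 3) - sqrt (x - a 3))"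
 using p(5)[of "x - a 3" "y - a 3"] True y xy by (simp add: rh_def)
 also have "... <= C * sqrt ((y - a 3) - (x - a 3))"
 using C p(3) True y by (intro mult_mono sqrt_diff_le) auto
 finally show ?thesis using y by simp
 next
 case False
 then have y: "x < a 3" "y < a 3" "y <= x" using xy by auto
 have "norm (g y - g x) <= Cm*(sqrt (a 3 - y) - sqrt (a 3 - x))"
 using m(5)[of "a 3 - x" "a 3 - y"] y xy by (simp add: rh_def)
 also have "... <= C * sqrt ((a 3 - y) - (a 3 - x))"
 using C m(3) y by (intro mult_mono sqrt_diff_le) auto
 finally show ?thesis using y by simp
 qed
 have hold: "norm (g y - g x) <= 2 * C * sqrt \<bar>y - x\<bar>"
 if xy: "0 < \<bar>x - a 3\<bar>" "\<bar>x - a 3\<bar> <= rh" "0 < \<bar>y - a 3\<bar>" "\<bar>y - a 3\<bar> <= rh" for x y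
 proof (cases "a 3 < x \<longleftrightarrow> a 3 < y")
 case True
 have "norm (g y - g x) <= C * sqrt \<bar>y - x\<bar>"
 using same[of x y] same[of y x] xy True by (cases "\<bar>x - a 3\<bar> <= \<bar>y - a 3\<bar>") (auto simp: norm_minus_commute abs_minus_commute)
 also have "... <= 2 * C * sqrt \<bar>y - x\<bar>" using C by (intro mult_right_mono) auto
 finally show ?thesis .
 next
 case False
 then have le: "\<bar>y - a 3\<bar> <= \<bar>y - x\<bar>" "\<bar>x - a 3\<bar> <= \<bar>y - x\<bar>" using xy by auto
 have "norm (g y - g x) <= norm (g y - c) + norm (g x - c)" using norm_triangle_ineq4[of "g y - c" "g x - c"] by simp
 also have "... <= C * sqrt \<bar>y - a 3\<bar> + C * sqrt \<bar>x - a 3\<bar>" using ge xy by (intro add_mono) auto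
 also have "... <= C * sqrt \<bar>y - x\<bar> + C * sqrt \<bar>y - x\<bar>" using le C by (intro add_mono mult_left_mono) auto
 finally show ?thesis by simp
 qed
 have qe: "norm (q y - q3) <= C * sqrt \<bar>y - a 3\<bar>" if y: "0 < \<bar>y - a 3\<bar>" "\<bar>y - a 3\<bar> <= rh" for y
 proof (cases "a 3 < y")
 case True
 then have "norm (q y - q3) <= Cp * sqrt (y - a 3)" using p(4)[of "y - a 3"] y by (simp add: rh_def)
 also have "... <= C * sqrt (y - a 3)" using C True by (intro mult_right_mono) auto
 finally show ?thesis using True by simp
 next
 case False
 then have y': "y < a 3" using y by auto
 then have "norm (q y - q3) <= Cm * sqrt (a 3 - y)" using m(4)[of "a 3 - y"] y by (simp add: rh_def)
 also have "... <= C * sqrt (a 3 - y)" using C y' by (intro mult_right_mono) auto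
 finally show ?thesis using y' by simp
 qed
 have dbl: "C * sqrt z <= 2 * C * sqrt z" if "0 <= z" for z using C that by (intro mult_right_mono) auto
 show thesis
 proof (rule that[of rh "2 * C" c])
 show "0 < rh" "rh < half_gap" "rh < a 4 - a 3" using p m rh0 by (auto simp: rh_def)
 show "0 <= 2 * C" using C by simp
 fix y assume y: "0 < \<bar>y - a 3\<bar>" "\<bar>y - a 3\<bar> <= rh"
 show "norm (q y - q3) <= 2 * C * sqrt \<bar>y - a 3\<bar>"
 by (rule order_trans[OF qe[OF y] dbl]) simp
 show "norm (f y - d3 * of_real (ln \<bar>y - a 3\<bar>) - c) <= 2 * C * sqrt \<bar>y - a 3\<bar>"
 unfolding g_def[symmetric] by (rule order_trans[OF ge[OF y] dbl]) simp
 next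
 fix x y assume "0 < \<bar>x - a 3\<bar>" "\<bar>x - a 3\<bar> <= rh" "0 < \<bar>y - a 3\<bar>" "\<bar>y - a 3\<bar> <= rh"
 from hold[OF this] show "norm ((f y - d3 * of_real (ln \<bar>y - a 3\<bar>)) - (f x - d3 * of_real (ln \<bar>x - a 3\<bar>))) <= 2 * C * sqrt \<bar>y - x\<bar>"
 unfolding g_def .
 qed
qed

end

section \<open>Principal values and Cauchy transforms\<close>

lemma borel_measurable_imp_lebesgue_on:
 "k \<in> borel_measurable borel ==> k \<in> borel_measurable (lebesgue_on S)"
 by (intro measurable_restrict_space1 measurable_completion) simp

lemma truncated_reciprocal_integral:
 fixes al be x e :: real
 assumes e: "0 < e" "al < x - e" "x + e < be"
 shows "((%y. complex_of_real (if e < \<bar>y - x\<bar> then 1/(y - x) else 0)) has_integral of_real (ln ((be - x)/(x - al)))) {al..be}"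
proof -
 have d: "((%y. ln \<bar>y - x\<bar>) has_vector_derivative 1/(y - x)) (at y within S)" if "y ~= x" for y S
 using has_real_derivative_ln_abs[OF that] by (auto simp: has_real_derivative_iff_has_vector_derivative intro: has_vector_derivative_at_within)
 have 1: "((%y. 1/(y - x)) has_integral ln \<bar>(x - e) - x\<bar> - ln \<bar>al - x\<bar>) {al..x - e}"
 by (rule fundamental_theorem_of_calculus) (use e d in auto)
 have 3: "((%y. 1/(y - x)) has_integral ln \<bar>be - x\<bar> - ln \<bar>(x + e) - x\<bar>) {x + e..be}"
 by (rule fundamental_theorem_of_calculus) (use e d in auto)
 define k where "k y = (if e < \<bar>y - x\<bar> then 1/(y - x) else 0)" for y
 have 1: "(k has_integral ln e - ln (x - al)) {al..x - e}"
 by (rule has_integral_spike_interior[of _ _ "al" "x - e" k, OF _ _, simplified] ) (use e 1 in \<open>auto simp: k_def abs_minus_commute\<close>)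
 have 2: "(k has_integral 0) {x - e..x + e}"
 by (rule has_integral_is_0) (auto simp: k_def)
 have 3: "(k has_integral ln (be - x) - ln e) {x + e..be}"
 by (rule has_integral_spike_interior[of _ _ "x + e" "be" k, OF _ _, simplified]) (use e 3 in \<open>auto simp: k_def\<close>)
 have "(k has_integral (ln e - ln (x - al)) + 0 + (ln (be - x) - ln e)) {al..be}"
 by (rule has_integral_combine[where c = "x + e"], use e in simp, use e in simp,
 rule has_integral_combine[where c = "x - e"]) (use e 1 2 3 in auto)
 moreover have "(ln e - ln (x - al)) + 0 + (ln (be - x) - ln e) = ln ((be - x)/(x - al))"
 using e by (simp add: ln_div)
 ultimately have "(k has_integral ln ((be - x)/(x - al))) {al..be}" by simp
 then show ?thesis unfolding k_def by (rule has_integral_of_real)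
qed

lemma cauchy_kernel_integral:
 fixes al be x ep :: real
 assumes "ep ~= 0" "al <= be"
 shows "((%y. 1/(of_real (y - x) - \<i> * of_real ep)) has_integral
 of_real (ln ((be - x)\<^sup>2 + ep\<^sup>2)/2 - ln ((al - x)\<^sup>2 + ep\<^sup>2)/2)
 + \<i> * of_real (arctan ((be - x)/ep) - arctan ((al - x)/ep))) {al..be}"
proof -
 define G where "G y = of_real (ln ((y - x)\<^sup>2 + ep\<^sup>2)/2) + \<i> * of_real (arctan ((y - x)/ep))" for y
 have pos: "0 < (y - x)\<^sup>2 + ep\<^sup>2" for y using assms by (simp add: add_nonneg_pos)
 have "(G has_vector_derivative 1/(of_real (y - x) - \<i> * of_real ep)) (at y within {al..be})" for y
 proof -
 have d1: "((%y. ln ((y - x)\<^sup>2 + ep\<^sup>2)/2) has_real_derivative (y - x)/((y - x)\<^sup>2 + ep\<^sup>2)) (at y)"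
 proof -
 have "((%y. (y - x)\<^sup>2 + ep\<^sup>2) has_real_derivative 2*(y - x)) (at y)"
 by (auto intro!: derivative_eq_intros)
 from DERIV_cdivide[OF DERIV_chain2[OF DERIV_ln_divide[OF pos] this], of 2]
 moreover have "1/Q*(2 * z)/2 = z/Q" for Q z :: real by simp
 ultimately show ?thesis by (rule DERIV_cong)
 qed
 have "((%y. arctan ((y - x)/ep)) has_real_derivative 1/ep * inverse (1 + ((y - x)/ep)\<^sup>2)) (at y)"
 using assms by (auto intro!: derivative_eq_intros)
 moreover have "1/ep * inverse (1 + ((y - x)/ep)\<^sup>2) = ep/((y - x)\<^sup>2 + ep\<^sup>2)"
 proof -
 have "1 + ((y - x)/ep)\<^sup>2 = ((y - x)\<^sup>2 + ep\<^sup>2)/ep\<^sup>2" using assms by (simp add: power_divide add_divide_distrib)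
 then show ?thesis using assms by (simp add: inverse_eq_divide power2_eq_square)
 qed
 ultimately have d2: "((%y. arctan ((y - x)/ep)) has_real_derivative ep/((y - x)\<^sup>2 + ep\<^sup>2)) (at y)" by simp
 have "(G has_vector_derivative of_real ((y - x)/((y - x)\<^sup>2 + ep\<^sup>2)) + \<i> * of_real (ep/((y - x)\<^sup>2 + ep\<^sup>2))) (at y)"
 unfolding G_def
 by (intro has_vector_derivative_add has_vector_derivative_mult_right has_vector_derivative_of_real d1 d2)
 moreover have "of_real ((y - x)/((y - x)\<^sup>2 + ep\<^sup>2)) + \<i> * of_real (ep/((y - x)\<^sup>2 + ep\<^sup>2)) = 1/(of_real (y - x) - \<i> * of_real ep)"
 proof -
 have "z * Q/Q\<^sup>2 = z/Q" for z Q :: real by (simp add: power2_eq_square)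
 then show ?thesis using pos[of y] by (auto simp: complex_eq_iff Re_divide Im_divide)
 qed
 ultimately show ?thesis by (auto intro: has_vector_derivative_at_within)
 qed
 then have "((%y. 1/(of_real (y - x) - \<i> * of_real ep)) has_integral G be - G al) {al..be}"
 by (intro fundamental_theorem_of_calculus assms) auto
 then show ?thesis unfolding G_def by (simp add: algebra_simps)
qed

lemma cauchy_kernel_bound:
 assumes "ep ~= 0"
 shows "norm (1/(complex_of_real t - \<i> * of_real ep)) <= 1/(abs ep)" "norm (1/(complex_of_real t - \<i> * of_real ep))*(abs t) <= 1"
 "complex_of_real t - \<i> * of_real ep ~= 0"
proof -
 let ?z = "complex_of_real t - \<i> * of_real ep"
 have "(abs ep) <= norm ?z" using abs_Im_le_cmod[of ?z] by simp
 moreover have "(abs t) <= norm ?z" using abs_Re_le_cmod[of ?z] by simp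
 moreover have "0 < norm ?z" using calculation assms by linarith
 ultimately show "norm (1 / ?z) <= 1/(abs ep)" "norm (1 / ?z)*(abs t) <= 1" "?z ~= 0"
 using assms by (auto simp: norm_divide frac_le divide_simps)
qed

context eigenfunction
begin

lemma f_measurable: "f \<in> borel_measurable (lebesgue_on {a 2..a 4})"
 using f_L2 by (simp add: L2_on_def)

lemma f_kernel_abs_integrable:
 assumes k: "k \<in> borel_measurable borel" and B: "!!y. norm (k y) <= B"
 shows "(%y. f y * k y) absolutely_integrable_on {a 2..a 4}"
proof (rule measurable_bounded_by_integrable_imp_absolutely_integrable)
 show "(%y. f y * k y) \<in> borel_measurable (lebesgue_on {a 2..a 4})"
 by (intro borel_measurable_times f_measurable borel_measurable_imp_lebesgue_on k)
 have "(%y. norm (f y)) integrable_on {a 2..a 4}" using f_abs_integrable by (simp add: absolutely_integrable_on_def)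
 from integrable_on_cmult_left[OF this, of B]
 show "(%y. B * norm (f y)) integrable_on {a 2..a 4}" by simp
 show "norm (f y * k y) <= B * norm (f y)" for y
 using mult_right_mono[OF B[of y] norm_ge_zero[of "f y"]] by (simp add: norm_mult mult.commute)
qed auto

text \<open>The divided difference that remains of the integrand when the singularity at
  \<open>x\<close> is removed on an interval around \<open>x\<close>.\<close>

definition w where "w al be x y = (f y - (if al < y & y < be then f x else 0))/of_real (y - x)"

definition local_lipschitz where
 "local_lipschitz x dl M \<longleftrightarrow> 0 < dl & 0 <= M & (\<forall>y. \<bar>y - x\<bar> <= dl --> norm (f y - f x) <= M * \<bar>y - x\<bar>)"

lemma compact_local_lipschitz:
 assumes cd: "a 2 < c" "c <= d" "d < a 3"
 obtains dl M F where "0 < dl" "a 2 < c - dl" "d + dl < a 3" "!!x. c <= x ==> x <= d ==> local_lipschitz x dl M"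
 "0 <= F" "!!x. c <= x ==> x <= d ==> norm (f x) <= F"
proof -
 define dl where "dl = min (c - a 2) (a 3 - d)/2"
 have dl: "0 < dl" "a 2 < c - dl" "d + dl < a 3" using cd by (auto simp: dl_def min_def field_simps)
 define c' d' where "c' = c - dl" and "d' = d + dl"
 have cd': "c' <= d'" using cd dl by (simp add: c'_def d'_def)
 have ins: "a 2 < y" "y < a 4" "y ~= a 3" "y < a 3" if "y \<in> {c'..d'}" for y using that dl a34 by (auto simp: c'_def d'_def)
 have cont: "continuous_on {c'..d'} q" "continuous_on {c'..d'} f"
 by (rule continuous_on_vector_derivative[OF has_vector_derivative_at_within[OF eigenfunction_ode(2)[OF ins(1-3)]]], assumption+)
 (rule continuous_on_vector_derivative[OF has_vector_derivative_at_within[OF eigenfunction_ode(1)[OF ins(1-3)]]], assumption+)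
 have "continuous_on {c'..d'} (PP a)" unfolding PP_eq[abs_def] by (intro continuous_intros)
 then have "continuous_on {c'..d'} (%y. q y/of_real (PP a y))"
 using ins PP_nonzero by (intro continuous_intros cont) auto
 then obtain M where M: "0 <= M" "!!y. y \<in> {c'..d'} ==> norm (q y/of_real (PP a y)) <= M" using continuous_on_Icc_bound by blast
 obtain F where F: "0 <= F" "!!y. y \<in> {c'..d'} ==> norm (f y) <= F" using continuous_on_Icc_bound[OF cont(2)] by blast
 have lip: "norm (f y - f x) <= M*(y - x)" if "c' <= x" "x <= y" "y <= d'" for x y
 by (rule Lipschitz_of_vector_derivative[of c' d' f, OF has_vector_derivative_at_within[OF eigenfunction_ode(1)[OF ins(1-3)]] M(2)]) (use that in auto)
 have "local_lipschitz x dl M" if "c <= x" "x <= d" for x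
 unfolding local_lipschitz_def
 proof (intro conjI dl M allI impI)
 fix y assume y: "\<bar>y - x\<bar> <= dl"
 show "norm (f y - f x) <= M * \<bar>y - x\<bar>"
 using lip[of x y] lip[of y x] y that dl by (cases "x <= y") (auto simp: c'_def d'_def norm_minus_commute abs_le_iff)
 qed
 then show thesis using that[of dl M F] dl F by (auto simp: c'_def d'_def)
qed

lemma w_bound:
 assumes l: "local_lipschitz x dl M" and J: "al <= x - dl" "x + dl <= be" and F: "norm (f x) <= F"
 shows "norm (w al be x y) <= M + (norm (f y) + F)/dl"
proof (cases "\<bar>y - x\<bar> < dl")
 case True
 then have "al < y & y < be" using J by auto
 then have "norm (w al be x y) = norm (f y - f x)/\<bar>y - x\<bar>" by (simp add: w_def norm_divide flip: of_real_diff)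
 also have "... <= M" using l True by (cases "y = x") (auto simp: local_lipschitz_def divide_le_eq)
 also have "M <= M + (norm (f y) + F)/dl"
 using l order_trans[OF norm_ge_zero F] by (simp add: local_lipschitz_def)
 finally show ?thesis .
next
 case False
 have F0: "0 <= F" using order_trans[OF norm_ge_zero F] .
 have dl: "0 < dl" "0 <= M" using l by (auto simp: local_lipschitz_def)
 have "norm (f y - (if al < y & y < be then f x else 0)) <= norm (f y) + F"
 using norm_triangle_ineq4[of "f y" "f x"] F F0 by auto
 then have "norm (w al be x y) <= (norm (f y) + F)/dl"
 unfolding w_def norm_divide using False dl F0 by (intro frac_le) (auto simp flip: of_real_diff)
 then show ?thesis using dl by simp
qed

lemma w_bound_integrable: "(%y. M + (norm (f y) + F)/dl) integrable_on {a 2..a 4}"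
proof -
 have "(%y. norm (f y)) integrable_on {a 2..a 4}" using f_abs_integrable by (simp add: absolutely_integrable_on_def)
 moreover have c: "(%y. C) integrable_on {a 2..a 4}" for C :: real by (intro integrable_continuous_real continuous_intros)
 ultimately have "(%y. M + (norm (f y) + F)*(1/dl)) integrable_on {a 2..a 4}"
 using integrable_add[OF c[of M] integrable_on_mult_left[OF integrable_add[OF _ c[of F]], of _ "1/dl"]] by blast
 then show ?thesis by simp
qed

lemma w_measurable: "w al be x \<in> borel_measurable (lebesgue_on {a 2..a 4})"
 unfolding w_def[abs_def]
 by (intro borel_measurable_divide borel_measurable_diff f_measurable borel_measurable_imp_lebesgue_on) measurable

lemma w_abs_integrable:
 assumes "local_lipschitz x dl M" "al <= x - dl" "x + dl <= be"
 shows "w al be x absolutely_integrable_on {a 2..a 4}"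
 by (rule measurable_bounded_by_integrable_imp_absolutely_integrable[OF w_measurable _ w_bound_integrable w_bound[OF assms order_refl]]) auto

text \<open>Any approximation of the kernel $1/t$ that is dominated by it gives the same limit;
  truncation and displacement into the complex plane are the two instances.\<close>

lemma kernel_limit:
 fixes ka :: "nat => real => complex"
 assumes l: "local_lipschitz x dl M" "al <= x - dl" "x + dl <= be"
 and m: "!!n. ka n \<in> borel_measurable borel" and b: "!!n t. norm (ka n t)*(abs t) <= 1"
 and lim: "!!t. t ~= 0 ==> (%n. ka n t) \<longlonglongrightarrow> 1/of_real t"
 shows "(%n. integral {a 2..a 4} (%y. w al be x y*(of_real (y - x) * ka n (y - x)))) \<longlonglongrightarrow> integral {a 2..a 4} (w al be x)"
proof -
 have nb: "norm (w al be x y*(of_real (y - x) * ka n (y - x))) <= norm (w al be x y)" for n y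
 proof -
 have "norm (of_real (y - x) * ka n (y - x)) <= 1" using b[of n "y - x"] by (simp add: norm_mult mult.commute flip: of_real_diff)
 from mult_left_mono[OF this, of "norm (w al be x y)"] show ?thesis by (simp add: norm_mult)
 qed
 have wi: "(%y. norm (w al be x y)) integrable_on {a 2..a 4}" using w_abs_integrable[OF l] by (simp add: absolutely_integrable_on_def)
 have ai: "(%y. w al be x y*(of_real (y - x) * ka n (y - x))) absolutely_integrable_on {a 2..a 4}" for n
 proof (rule measurable_bounded_by_integrable_imp_absolutely_integrable[OF _ _ wi nb])
 have "(%y. ka n (y - x)) \<in> borel_measurable borel" using m[of n] by measurable
 then show "(%y. w al be x y*(of_real (y - x) * ka n (y - x))) \<in> borel_measurable (lebesgue_on {a 2..a 4})"
 by (intro borel_measurable_times w_measurable borel_measurable_imp_lebesgue_on) measurable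
 qed auto
 show "(%n. integral {a 2..a 4} (%y. w al be x y*(of_real (y - x) * ka n (y - x)))) \<longlonglongrightarrow> integral {a 2..a 4} (w al be x)"
 proof (rule dominated_convergence(2)[OF _ wi nb])
 show "(%y. w al be x y*(of_real (y - x) * ka n (y - x))) integrable_on {a 2..a 4}" for n
 using ai by (simp add: absolutely_integrable_on_def)
 fix y
 show "(%n. w al be x y*(of_real (y - x) * ka n (y - x))) \<longlonglongrightarrow> w al be x y"
 proof (cases "y = x")
 case False
 then have "(%n. w al be x y*(of_real (y - x) * ka n (y - x))) \<longlonglongrightarrow> w al be x y*(of_real (y - x)*(1/of_real (y - x)))"
 by (intro tendsto_intros lim) simp
 then show ?thesis using False by (simp flip: of_real_diff)
 qed (simp add: w_def)
 qed
qed

lemma kernel_split: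
 fixes ka :: "real => complex"
 assumes l: "local_lipschitz x dl M" "al <= x - dl" "x + dl <= be" "a 2 <= al" "be <= a 4"
 and m: "ka \<in> borel_measurable borel" and b: "!!t. norm (ka t)*(abs t) <= 1" and B: "!!t. norm (ka t) <= B"
 and I: "((%y. ka (y - x)) has_integral I) {al..be}"
 shows "integral {a 2..a 4} (%y. f y * ka (y - x))
 = integral {a 2..a 4} (%y. w al be x y*(of_real (y - x) * ka (y - x))) + f x * I"
proof -
 have dl: "0 < dl" using l by (simp add: local_lipschitz_def)
 have 1: "((%y. if y \<in> {al..be} then ka (y - x) else 0) has_integral I) {al..be}"
 by (rule has_integral_eq[OF _ I]) simp
 have "((%y. if y \<in> {al..be} then ka (y - x) else 0) has_integral I) {a 2..a 4}"
 by (rule has_integral_on_superset[OF 1]) (use l in auto)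
 then have "((%y. if al < y & y < be then ka (y - x) else 0) has_integral I) {a 2..a 4}"
 by (rule has_integral_spike[of "{al, be}", rotated 2]) auto
 from has_integral_mult_right[OF this, of "f x"]
 have J: "((%y. f x*(if al < y & y < be then ka (y - x) else 0)) has_integral f x * I) {a 2..a 4}" .
 have wi: "(%y. w al be x y*(of_real (y - x) * ka (y - x))) integrable_on {a 2..a 4}"
 proof -
 have wi: "(%y. norm (w al be x y)) integrable_on {a 2..a 4}" using w_abs_integrable[OF l(1-3)] by (simp add: absolutely_integrable_on_def)
 have "(%y. w al be x y*(of_real (y - x) * ka (y - x))) absolutely_integrable_on {a 2..a 4}"
 proof (rule measurable_bounded_by_integrable_imp_absolutely_integrable[OF _ _ wi])
 have "(%y. ka (y - x)) \<in> borel_measurable borel" using m by measurable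
 then show "(%y. w al be x y*(of_real (y - x) * ka (y - x))) \<in> borel_measurable (lebesgue_on {a 2..a 4})"
 by (intro borel_measurable_times w_measurable borel_measurable_imp_lebesgue_on) measurable
 fix y
 have "norm (of_real (y - x) * ka (y - x)) <= 1" using b[of "y - x"] by (simp add: norm_mult mult.commute flip: of_real_diff)
 from mult_left_mono[OF this, of "norm (w al be x y)"]
 show "norm (w al be x y*(of_real (y - x) * ka (y - x))) <= norm (w al be x y)" by (simp add: norm_mult)
 qed auto
 then show ?thesis by (simp add: absolutely_integrable_on_def)
 qed
 have "((%y. w al be x y*(of_real (y - x) * ka (y - x)) + f x*(if al < y & y < be then ka (y - x) else 0)) has_integral
 integral {a 2..a 4} (%y. w al be x y*(of_real (y - x) * ka (y - x))) + f x * I) {a 2..a 4}"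
 by (intro has_integral_add integrable_integral wi J)
 moreover have "w al be x y*(of_real (y - x) * ka (y - x)) + f x*(if al < y & y < be then ka (y - x) else 0) = f y * ka (y - x)" for y
 proof (cases "y = x")
 case True
 then have "al < y & y < be" using l dl by auto
 then show ?thesis using True by (simp add: w_def)
 next
 case False
 then have "w al be x y * of_real (y - x) = f y - (if al < y & y < be then f x else 0)" by (simp add: w_def flip: of_real_diff)
 then show ?thesis by (simp only: mult.assoc[symmetric]) (simp add: algebra_simps)
 qed
 ultimately show ?thesis by (simp add: integral_unique)
qed

text \<open>A representation of the principal value by an ordinary integral. The free choice of
  the interval is what makes it useful near the endpoints.\<close>

lemma HT_formula:
 assumes x: "a 2 < x" "x < a 3" and l: "local_lipschitz x dl M" "al <= x - dl" "x + dl <= be" "a 2 <= al" "be <= a 4"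
 shows "of_real pi * HT a f x = integral {a 2..a 4} (w al be x) + f x * of_real (ln ((be - x)/(x - al)))"
proof -
 define A where "A = integral {a 2..a 4} (w al be x) + f x * of_real (ln ((be - x)/(x - al)))"
 define T where "T e = (LINT y : {y \<in> {a 2..a 4}. \<bar>y - x\<bar> > e} | lebesgue. f y/of_real (y - x))" for e
 have dl: "0 < dl" using l by (simp add: local_lipschitz_def)
 define ka where "ka e t = complex_of_real (if e < (abs t) then 1/t else 0)" for e t :: real
 have kam: "ka e \<in> borel_measurable borel" for e unfolding ka_def[abs_def] by measurable
 have kab: "norm (ka e t)*(abs t) <= 1" for e t by (simp add: ka_def)
 have kaB: "norm (ka e t) <= 1/e" if "0 < e" for e t using that by (auto simp: ka_def frac_le)
 have T: "T e = integral {a 2..a 4} (%y. w al be x y*(of_real (y - x) * ka e (y - x))) + f x * of_real (ln ((be - x)/(x - al)))"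
 if e: "0 < e" "e < dl" for e
 proof -
 have S: "{y \<in> {a 2..a 4}. \<bar>y - x\<bar> > e} \<in> sets lebesgue"
 proof -
 have "{y \<in> {a 2..a 4}. \<bar>y - x\<bar> > e} = {a 2..a 4} \<inter> (%y. \<bar>y - x\<bar>) -` {e<..}" by auto
 also have "... \<in> sets lborel" by measurable
 finally show ?thesis by simp
 qed
 have m: "(%y. ka e (y - x)) \<in> borel_measurable borel" using kam[of e] by measurable
 have fk: "(%y. f y * ka e (y - x)) absolutely_integrable_on {a 2..a 4}"
 by (rule f_kernel_abs_integrable[OF m kaB[OF e(1)]])
 have "T e = set_lebesgue_integral lebesgue {a 2..a 4} (%y. f y * ka e (y - x))"
 unfolding T_def set_lebesgue_integral_def
 by (intro Bochner_Integration.integral_cong) (auto simp: ka_def indicator_def)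
 also have "... = integral {a 2..a 4} (%y. f y * ka e (y - x))"
 by (rule set_lebesgue_integral_eq_integral(2)[OF fk])
 also have "... = integral {a 2..a 4} (%y. w al be x y*(of_real (y - x) * ka e (y - x))) + f x * of_real (ln ((be - x)/(x - al)))"
 proof (rule kernel_split[OF l kam kab kaB[OF e(1)]])
 show "((%y. ka e (y - x)) has_integral of_real (ln ((be - x)/(x - al)))) {al..be}"
 unfolding ka_def by (rule truncated_reciprocal_integral) (use e l in auto)
 qed
 finally show ?thesis .
 qed
 have "(T \<longlongrightarrow> A) (at_right 0)"
 proof (rule tendsto_at_right_sequentially[OF dl])
 fix S :: "nat => real"
 assume S: "!!n. 0 < S n" "!!n. S n < dl" "S \<longlonglongrightarrow> 0"
 have lim: "(%n. ka (S n) t) \<longlonglongrightarrow> 1/of_real t" if "t ~= 0" for t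
 proof (rule tendsto_eventually)
 have "\<forall>\<^sub>F n in sequentially. S n < (abs t)" using order_tendstoD(2)[OF S(3), of "(abs t)"] that by simp
 then show "\<forall>\<^sub>F n in sequentially. ka (S n) t = 1/of_real t" by eventually_elim (simp add: ka_def)
 qed
 have "(%n. integral {a 2..a 4} (%y. w al be x y*(of_real (y - x) * ka (S n) (y - x))) + f x * of_real (ln ((be - x)/(x - al)))) \<longlonglongrightarrow> A"
 unfolding A_def by (intro tendsto_add tendsto_const kernel_limit[OF l(1-3) kam kab lim])
 then show "(%n. T (S n)) \<longlonglongrightarrow> A" using T S by simp
 qed
 then have "Lim (at_right 0) T = A" by (intro tendsto_Lim) simp_all
 then have "HT a f x = of_real (1/pi) * A" unfolding HT_def T_def by simp
 then show ?thesis unfolding A_def[symmetric] by simp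
qed

definition cauchy where "cauchy z = integral {a 2..a 4} (%y. f y/(of_real y - z))"

lemma cauchy_split:
 assumes l: "local_lipschitz x dl M" "a 2 <= x - dl" "x + dl <= a 4" and ep: "ep ~= 0"
 shows "cauchy (of_real x + \<i> * of_real ep) =
 integral {a 2..a 4} (%y. w (x - dl) (x + dl) x y*(of_real (y - x)*(1/(of_real (y - x) - \<i> * of_real ep)))) + f x*(\<i> * of_real (2 * arctan (dl/ep)))"
proof -
 have dl: "0 < dl" using l by (simp add: local_lipschitz_def)
 have "cauchy (of_real x + \<i> * of_real ep) = integral {a 2..a 4} (%y. f y*(1/(of_real (y - x) - \<i> * of_real ep)))"
 unfolding cauchy_def by (intro integral_cong) (simp add: algebra_simps)
 also have "... = integral {a 2..a 4} (%y. w (x - dl) (x + dl) x y*(of_real (y - x)*(1/(of_real (y - x) - \<i> * of_real ep)))) + f x*(\<i> * of_real (2 * arctan (dl/ep)))"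
 proof (rule kernel_split[OF l(1) order_refl order_refl l(2,3) _ cauchy_kernel_bound(2)[OF ep] cauchy_kernel_bound(1)[OF ep]])
 show "((%y. 1/(of_real (y - x) - \<i> * of_real ep)) has_integral \<i> * of_real (2 * arctan (dl/ep))) {x - dl..x + dl}"
 using cauchy_kernel_integral[OF ep, of "x - dl" "x + dl" x] dl by (simp add: arctan_minus)
 show "(%t. 1/(complex_of_real t - \<i> * of_real ep)) \<in> borel_measurable borel" by measurable
 qed
 finally show ?thesis .
qed

text \<open>The averages of the Cauchy transform above and below the axis converge to the
  principal value: the jumps $\pm\pi i f(x)$ cancel.\<close>

lemma cauchy_plemelj:
 assumes x: "a 2 < x" "x < a 3" and ep: "!!n. 0 < ep n" "ep \<longlonglongrightarrow> 0"
 shows "(%n. cauchy (of_real x + \<i> * of_real (ep n)) + cauchy (of_real x + \<i> * of_real (- ep n))) \<longlonglongrightarrow> 2*(of_real pi * HT a f x)"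
proof -
 obtain dl M where l: "0 < dl" "a 2 < x - dl" "x + dl < a 3" "local_lipschitz x dl M"
 using compact_local_lipschitz[of x x] x by (metis order_refl)
 have b: "a 2 <= x - dl" "x + dl <= a 4" using l a34 by auto
 have lim: "(%n. 1/(complex_of_real t - \<i> * of_real (s * ep n))) \<longlonglongrightarrow> 1/of_real t" if "t ~= 0" for t s
 proof -
 have "(%n. 1/(complex_of_real t - \<i> * of_real (s * ep n))) \<longlonglongrightarrow> 1/(of_real t - \<i> * of_real (s*0))"
 using that by (intro tendsto_intros ep) auto
 then show ?thesis by simp
 qed
 have c: "(%n. integral {a 2..a 4} (%y. w (x - dl) (x + dl) x y*(of_real (y - x)*(1/(of_real (y - x) - \<i> * of_real (s * ep n))))))
 \<longlonglongrightarrow> integral {a 2..a 4} (w (x - dl) (x + dl) x)" if s: "s ~= 0" for s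
 proof (rule kernel_limit[OF l(4) order_refl order_refl])
 show "(%t. 1/(complex_of_real t - \<i> * of_real (s * ep n))) \<in> borel_measurable borel" for n by measurable
 show "norm (1/(complex_of_real t - \<i> * of_real (s * ep n)))*(abs t) <= 1" for n t
 using cauchy_kernel_bound(2)[of "s * ep n" t] s ep(1)[of n] by simp
 qed (use lim in auto)
 have e: "cauchy (of_real x + \<i> * of_real (ep n)) + cauchy (of_real x + \<i> * of_real (- ep n))
 = integral {a 2..a 4} (%y. w (x - dl) (x + dl) x y*(of_real (y - x)*(1/(of_real (y - x) - \<i> * of_real (1 * ep n)))))
 + integral {a 2..a 4} (%y. w (x - dl) (x + dl) x y*(of_real (y - x)*(1/(of_real (y - x) - \<i> * of_real (- 1 * ep n)))))" for n
 using cauchy_split[OF l(4) b, of "ep n"] cauchy_split[OF l(4) b, of "- ep n"] ep(1)[of n]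
 by (simp add: arctan_minus)
 have "of_real pi * HT a f x = integral {a 2..a 4} (w (x - dl) (x + dl) x)"
 using HT_formula[OF x l(4) order_refl order_refl b] l(1) by simp
 then show ?thesis unfolding e using tendsto_add[OF c[of 1] c[of "- 1"]] by simp
qed

lemma cauchy_bounded:
 assumes cd: "a 2 < c" "c <= d" "d < a 3"
 obtains B where "!!x ep. c <= x ==> x <= d ==> ep ~= 0 ==> norm (cauchy (of_real x + \<i> * of_real ep)) <= B"
proof -
 obtain dl M F where l: "0 < dl" "a 2 < c - dl" "d + dl < a 3" "!!x. c <= x ==> x <= d ==> local_lipschitz x dl M"
 "0 <= F" "!!x. c <= x ==> x <= d ==> norm (f x) <= F"
 using compact_local_lipschitz[OF cd] by metis
 define B where "B = integral {a 2..a 4} (%y. M + (norm (f y) + F)/dl) + F * pi"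
 show thesis
 proof (rule that[of B])
 fix x ep :: real assume x: "c <= x" "x <= d" and ep: "ep ~= 0"
 have b: "a 2 <= x - dl" "x + dl <= a 4" using l(2,3) x a34 by auto
 have "norm (integral {a 2..a 4} (%y. w (x - dl) (x + dl) x y*(of_real (y - x)*(1/(of_real (y - x) - \<i> * of_real ep)))))
 <= integral {a 2..a 4} (%y. M + (norm (f y) + F)/dl)"
 proof (rule integral_norm_bound_integral[OF _ w_bound_integrable])
 have "(%y. w (x - dl) (x + dl) x y*(of_real (y - x)*(1/(of_real (y - x) - \<i> * of_real ep)))) absolutely_integrable_on {a 2..a 4}"
 proof (rule measurable_bounded_by_integrable_imp_absolutely_integrable[OF _ _ w_bound_integrable[of M F dl]])
 show "(%y. w (x - dl) (x + dl) x y*(of_real (y - x)*(1/(of_real (y - x) - \<i> * of_real ep)))) \<in> borel_measurable (lebesgue_on {a 2..a 4})"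
 by (intro borel_measurable_times w_measurable borel_measurable_imp_lebesgue_on) measurable
 next
 fix y
 have n: "norm (of_real (y - x)*(1/(of_real (y - x) - \<i> * of_real ep))) <= 1"
 using cauchy_kernel_bound(2)[OF ep, of "y - x"] by (simp only: norm_mult norm_of_real mult.commute)
 show "norm (w (x - dl) (x + dl) x y*(of_real (y - x)*(1/(of_real (y - x) - \<i> * of_real ep)))) <= M + (norm (f y) + F)/dl"
 using order_trans[OF mult_left_mono[OF n norm_ge_zero[of "w (x - dl) (x + dl) x y"], unfolded mult_1_right]
 w_bound[OF l(4)[OF x] order_refl order_refl l(6)[OF x], of y]]
 by (simp only: norm_mult)
 qed auto
 then show "(%y. w (x - dl) (x + dl) x y*(of_real (y - x)*(1/(of_real (y - x) - \<i> * of_real ep)))) integrable_on {a 2..a 4}"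
 by (simp add: absolutely_integrable_on_def)
 fix y
 have n: "norm (of_real (y - x)*(1/(of_real (y - x) - \<i> * of_real ep))) <= 1"
 using cauchy_kernel_bound(2)[OF ep, of "y - x"] by (simp only: norm_mult norm_of_real mult.commute)
 show "norm (w (x - dl) (x + dl) x y*(of_real (y - x)*(1/(of_real (y - x) - \<i> * of_real ep)))) <= M + (norm (f y) + F)/dl"
 using order_trans[OF mult_left_mono[OF n norm_ge_zero[of "w (x - dl) (x + dl) x y"], unfolded mult_1_right]
 w_bound[OF l(4)[OF x] order_refl order_refl l(6)[OF x], of y]]
 by (simp only: norm_mult)
 qed
 moreover have "norm (f x*(\<i> * of_real (2 * arctan (dl/ep)))) <= F * pi"
 proof -
 have "\<bar>2 * arctan (dl/ep)\<bar> <= pi" using arctan_bounded[of "dl/ep"] by (simp add: abs_le_iff)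
 then show ?thesis unfolding norm_mult using l(5) l(6)[OF x] by (intro mult_mono) auto
 qed
 ultimately show "norm (cauchy (of_real x + \<i> * of_real ep)) <= B"
 unfolding cauchy_split[OF l(4)[OF x] b ep] B_def by (intro norm_triangle_le add_mono)
 qed
qed

end

section \<open>The Cauchy transform of an eigenfunction solves the same equation\<close>

lemma has_integral_of_limits:
 fixes Phi ph :: "real => complex"
 assumes lr: "l < r" and d: "!!x. l < x ==> x < r ==> (Phi has_vector_derivative ph x) (at x)"
 and A: "(Phi \<longlongrightarrow> A) (at_right l)" and B: "(Phi \<longlongrightarrow> B) (at_left r)"
 shows "(ph has_integral (B - A)) {l..r}"
proof -
 define G where "G x = (if x <= l then A else if r <= x then B else Phi x)" for x
 have dG: "(G has_vector_derivative ph x) (at x)" if "x \<in> {l<..<r}" for x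
 by (rule has_vector_derivative_transform_within_open[OF d, of _ "{l<..<r}"]) (use that in \<open>auto simp: G_def\<close>)
 have "continuous_on {l..r} G"
 unfolding continuous_on_eq_continuous_within
 proof
 fix x assume x: "x \<in> {l..r}"
 consider "x = l" | "x = r" | "x \<in> {l<..<r}" using x by force
 then show "continuous (at x within {l..r}) G"
 proof cases
 case 1
 have "(G \<longlongrightarrow> A) (at_right l)"
 by (rule Lim_transform_eventually[OF A]) (use lr in \<open>auto simp: G_def eventually_at_right[OF lr] intro!: exI[of _ r]\<close>)
 then show ?thesis using 1 lr by (simp add: continuous_within at_within_Icc_at_right G_def)
 next
 case 2
 have "(G \<longlongrightarrow> B) (at_left r)"
 by (rule Lim_transform_eventually[OF B]) (use lr in \<open>auto simp: G_def eventually_at_left[OF lr] intro!: exI[of _ l]\<close>)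
 then show ?thesis using 2 lr by (simp add: continuous_within at_within_Icc_at_left G_def)
 next
 case 3
 then show ?thesis using dG[OF 3] by (auto intro: continuous_at_imp_continuous_at_within has_vector_derivative_continuous)
 qed
 qed
 from fundamental_theorem_of_calculus_interior[OF less_imp_le[OF lr] this dG]
 have "(ph has_integral (G r - G l)) {l..r}" .
 then show ?thesis using lr by (simp add: G_def)
qed

lemma reciprocal_increment_bounds:
 fixes zet h :: complex
 assumes e: "0 < e" and z: "e <= norm zet" "e <= norm (zet - h)"
 shows "norm (1/(zet - h) - 1/zet - h/zet\<^sup>2) <= (norm h)\<^sup>2/e ^ 3"
 "norm (1/(zet - h)\<^sup>2 - 1/zet\<^sup>2 - h*(2/zet ^ 3)) <= 3*(norm h)\<^sup>2/e ^ 4"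
proof -
 have nz: "zet ~= 0" "zet - h ~= 0" using assms by auto
 have pw: "e ^ (m + n) <= norm zet ^ m * norm (zet - h) ^ n" for m n
 unfolding power_add using assms by (intro mult_mono power_mono) auto
 have "1/(zet - h) - 1/zet - h/zet\<^sup>2 = h\<^sup>2/(zet\<^sup>2*(zet - h) ^ 1)"
 using nz by (simp add: divide_simps) (simp add: algebra_simps power2_eq_square)
 then have "norm (1/(zet - h) - 1/zet - h/zet\<^sup>2) = (norm h)\<^sup>2/(norm zet ^ 2 * norm (zet - h) ^ 1)"
 by (simp add: norm_divide norm_mult norm_power)
 also have "... <= (norm h)\<^sup>2/e ^ 3" using pw[of 2 1] e by (intro divide_left_mono) (auto intro!: mult_pos_pos simp: nz)
 finally show "norm (1/(zet - h) - 1/zet - h/zet\<^sup>2) <= (norm h)\<^sup>2/e ^ 3" .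
 have "1/(zet - h)\<^sup>2 - 1/zet\<^sup>2 - h*(2/zet ^ 3) = h\<^sup>2/(zet\<^sup>2*(zet - h)\<^sup>2) + 2*(h\<^sup>2/(zet ^ 3*(zet - h) ^ 1))"
 proof -
 define u where "u = zet - h"
 have "h = zet - u" "u ~= 0" using nz by (auto simp: u_def)
 then show ?thesis using nz(1)
 by (simp add: divide_simps) (simp add: algebra_simps power2_eq_square power3_eq_cube)
 qed
 then have "norm (1/(zet - h)\<^sup>2 - 1/zet\<^sup>2 - h*(2/zet ^ 3))
 <= (norm h)\<^sup>2/(norm zet ^ 2 * norm (zet - h) ^ 2) + 2*((norm h)\<^sup>2/(norm zet ^ 3 * norm (zet - h) ^ 1))"
 using norm_triangle_ineq[of "h\<^sup>2/(zet\<^sup>2*(zet - h)\<^sup>2)" "2*(h\<^sup>2/(zet ^ 3*(zet - h) ^ 1))"]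
 by (simp add: norm_divide norm_mult norm_power)
 also have "... <= (norm h)\<^sup>2/e ^ 4 + 2*((norm h)\<^sup>2/e ^ 4)"
 using pw[of 2 2] pw[of 3 1] e by (intro add_mono mult_left_mono divide_left_mono) (auto intro!: mult_pos_pos simp: nz)
 finally show "norm (1/(zet - h)\<^sup>2 - 1/zet\<^sup>2 - h*(2/zet ^ 3)) <= 3*(norm h)\<^sup>2/e ^ 4" by simp
qed

context eigenfunction
begin

definition cauchy1 where "cauchy1 z = integral {a 2..a 4} (%y. f y*(1/(of_real y - z)\<^sup>2))"
definition cauchy2 where "cauchy2 z = integral {a 2..a 4} (%y. f y*(2/(of_real y - z) ^ 3))"

lemma kernel_norm_ge: "Im z ~= 0 ==> \<bar>Im z\<bar> <= norm (complex_of_real y - z)"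
 using abs_Im_le_cmod[of "complex_of_real y - z"] by simp

lemma f_cauchy_integrable:
 assumes "Im z ~= 0"
 shows "(%y. f y*(1/(of_real y - z) ^ n)) integrable_on {a 2..a 4}"
proof -
 have "(%y. f y*(1/(of_real y - z) ^ n)) absolutely_integrable_on {a 2..a 4}"
 proof (rule f_kernel_abs_integrable)
 show "(%y. 1/(complex_of_real y - z) ^ n) \<in> borel_measurable borel" by measurable
 show "norm (1/(complex_of_real y - z) ^ n) <= 1/\<bar>Im z\<bar> ^ n" for y
 unfolding norm_divide norm_power using kernel_norm_ge[OF assms, of y] assms
 by (intro frac_le power_mono) auto
 qed
 then show ?thesis by (simp add: absolutely_integrable_on_def)
qed

lemma integral_f_kernel_deriv:
 fixes k0 k1 :: "real => real => complex"
 assumes i0: "!!x. (%y. f y * k0 x y) integrable_on {a 2..a 4}" and i1: "(%y. f y * k1 x y) integrable_on {a 2..a 4}"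
 and b: "!!h y. norm (k0 (x + h) y - k0 x y - of_real h * k1 x y) <= C * h\<^sup>2"
 shows "((%x. integral {a 2..a 4} (%y. f y * k0 x y)) has_vector_derivative integral {a 2..a 4} (%y. f y * k1 x y)) (at x)"
proof -
 define I where "I = integral {a 2..a 4} (%y. norm (f y))"
 have fi: "(%y. norm (f y)) integrable_on {a 2..a 4}" using f_abs_integrable by (simp add: absolutely_integrable_on_def)
 have I: "0 <= I" unfolding I_def by (intro integral_nonneg fi) simp
 have C: "0 <= C" using order_trans[OF norm_ge_zero b[of 1 0]] by simp
 define F where "F x = integral {a 2..a 4} (%y. f y * k0 x y)" for x
 define D where "D = integral {a 2..a 4} (%y. f y * k1 x y)"
 have est: "norm (F (x + h) - F x - of_real h * D) <= C * h\<^sup>2 * I" for h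
 proof -
 have "((%y. f y * k0 (x + h) y - f y * k0 x y - of_real h*(f y * k1 x y)) has_integral F (x + h) - F x - of_real h * D) {a 2..a 4}"
 unfolding F_def D_def by (intro has_integral_diff has_integral_mult_right integrable_integral i0 i1)
 then have hi: "((%y. f y*(k0 (x + h) y - k0 x y - of_real h * k1 x y)) has_integral F (x + h) - F x - of_real h * D) {a 2..a 4}"
 by (rule has_integral_eq[rotated]) (simp add: algebra_simps)
 have "norm (integral {a 2..a 4} (%y. f y*(k0 (x + h) y - k0 x y - of_real h * k1 x y))) <= integral {a 2..a 4} (%y. C * h\<^sup>2 * norm (f y))"
 proof (rule integral_norm_bound_integral)
 show "(%y. C * h\<^sup>2 * norm (f y)) integrable_on {a 2..a 4}" by (rule integrable_on_mult_right[OF fi])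
 show "norm (f y*(k0 (x + h) y - k0 x y - of_real h * k1 x y)) <= C * h\<^sup>2 * norm (f y)" for y
 unfolding norm_mult using mult_left_mono[OF b[of h y] norm_ge_zero[of "f y"]] by (simp add: mult.commute)
 qed (use hi in blast)
 also have "... = C * h\<^sup>2 * I" unfolding I_def by (rule integral_mult_right)
 finally show ?thesis using integral_unique[OF hi] by simp
 qed
 have "(F has_vector_derivative D) (at x)"
 unfolding has_vector_derivative_def has_derivative_at_alt
 proof (intro conjI allI impI bounded_linear_scaleR_left)
 fix e :: real assume e: "0 < e"
 define dl where "dl = e/(C * I + 1)"
 have pos: "0 < C * I + 1" using C I by (simp add: add_nonneg_pos)
 show "\<exists>d>0. \<forall>y. norm (y - x) < d --> norm (F y - F x - (y - x) *\<^sub>R D) <= e * norm (y - x)"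
 proof (intro exI[of _ dl] conjI allI impI)
 show "0 < dl" using e pos by (simp add: dl_def)
 fix y assume y: "norm (y - x) < dl"
 have "norm (F y - F x - (y - x) *\<^sub>R D) <= C*(y - x)\<^sup>2 * I" using est[of "y - x"] by (simp add: scaleR_conv_of_real)
 also have "... = (C * I * \<bar>y - x\<bar>) * \<bar>y - x\<bar>" by (simp add: power2_eq_square)
 also have "... <= e * \<bar>y - x\<bar>"
 proof (rule mult_right_mono)
 have "C * I * \<bar>y - x\<bar> <= (C * I + 1) * dl" using y C I by (intro mult_mono) auto
 then show "C * I * \<bar>y - x\<bar> <= e" using pos by (simp add: dl_def)
 qed simp
 finally show "norm (F y - F x - (y - x) *\<^sub>R D) <= e * norm (y - x)" by simp
 qed
 qed
 then show ?thesis unfolding F_def D_def .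
qed

lemma cauchy_derivs:
 assumes ep: "ep ~= 0"
 shows "((%x. cauchy (of_real x + \<i> * of_real ep)) has_vector_derivative cauchy1 (of_real x + \<i> * of_real ep)) (at x)"
 "((%x. cauchy1 (of_real x + \<i> * of_real ep)) has_vector_derivative cauchy2 (of_real x + \<i> * of_real ep)) (at x)"
proof -
 let ?z = "%x. complex_of_real x + \<i> * of_real ep"
 have im: "Im (?z x) ~= 0" "\<bar>Im (?z x)\<bar> = (abs ep)" for x using ep by auto
 have ge: "(abs ep) <= norm (of_real y - ?z x)" for x y using kernel_norm_ge[OF im(1)] im(2) by metis
 have sh: "of_real y - ?z (x + h) = (of_real y - ?z x) - of_real h" for h y by simp
 have e: "0 < (abs ep)" using ep by simp
 have ge': "(abs ep) <= norm ((of_real y - ?z x) - of_real h)" for h y using ge[of y "x + h"] unfolding sh .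
 have b1: "norm (1/(of_real y - ?z (x + h)) ^ 1 - 1/(of_real y - ?z x) ^ 1 - of_real h*(1/(of_real y - ?z x)\<^sup>2)) <= 1/(abs ep) ^ 3 * h\<^sup>2" for h y
 using reciprocal_increment_bounds(1)[OF e ge[of y x] ge'[of y h]] unfolding sh by simp
 have "((%x. integral {a 2..a 4} (%y. f y*(1/(of_real y - ?z x) ^ 1))) has_vector_derivative integral {a 2..a 4} (%y. f y*(1/(of_real y - ?z x)\<^sup>2))) (at x)"
 using integral_f_kernel_deriv[where ?k0.0="%x y. 1/(of_real y - ?z x) ^ 1" and ?k1.0="%x y. 1/(of_real y - ?z x)\<^sup>2" and x=x, OF f_cauchy_integrable[OF im(1)] f_cauchy_integrable[OF im(1)] b1] .
 then show "((%x. cauchy (?z x)) has_vector_derivative cauchy1 (?z x)) (at x)"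
 by (simp add: cauchy_def cauchy1_def)
 have b2: "norm (1/(of_real y - ?z (x + h))\<^sup>2 - 1/(of_real y - ?z x)\<^sup>2 - of_real h*(2/(of_real y - ?z x) ^ 3)) <= 3/(abs ep) ^ 4 * h\<^sup>2" for h y
 using reciprocal_increment_bounds(2)[OF e ge[of y x] ge'[of y h]] unfolding sh by simp
 have i2: "(%y. f y*(2/(of_real y - ?z x) ^ 3)) integrable_on {a 2..a 4}"
 using integrable_on_mult_right[OF f_cauchy_integrable[OF im(1), of x 3], of 2] by (simp add: mult_ac)
 show "((%x. cauchy1 (?z x)) has_vector_derivative cauchy2 (?z x)) (at x)"
 unfolding cauchy1_def cauchy2_def
 using integral_f_kernel_deriv[where ?k0.0="%x y. 1/(of_real y - ?z x)\<^sup>2" and ?k1.0="%x y. 2/(of_real y - ?z x) ^ 3" and x=x, OF f_cauchy_integrable[OF im(1)] i2 b2] .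
qed

definition Pc :: "complex => complex" where
 "Pc z = (z - of_real (a 1))*(z - of_real (a 2))*(z - of_real (a 3))*(z - of_real (a 4))"
definition Pc' :: "complex => complex" where
 "Pc' z = (z - of_real (a 2))*(z - of_real (a 3))*(z - of_real (a 4)) + (z - of_real (a 1))*(z - of_real (a 3))*(z - of_real (a 4))
 + (z - of_real (a 1))*(z - of_real (a 2))*(z - of_real (a 4)) + (z - of_real (a 1))*(z - of_real (a 2))*(z - of_real (a 3))"
definition Vc :: "complex => complex" where "Vc z = 2*(z - of_real (mean4 a))\<^sup>2"

lemma of_real_coeffs: "of_real (PP a x) = Pc (of_real x)" "of_real (P' x) = Pc' (of_real x)" "of_real (V x) = Vc (of_real x)"
 by (simp_all add: PP_eq Pc_def P'_def Pc'_def V_def Vc_def)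

lemma mean4_eq: "mean4 a = (a 1 + a 2 + a 3 + a 4)/4"
proof -
 have "{1..4::nat} = {1, 2, 3, 4}" by auto
 then show ?thesis by (simp add: mean4_def)
qed

text \<open>The algebraic reason why the finite Hilbert transform commutes with the differential
  operator: \<open>P\<close> is quartic, and the potential is adjusted to its mean root.\<close>

lemma commutation_polynomial:
 "2*(Pc y - Pc z) - (Pc' y + Pc' z)*(y - z) + (Vc y - Vc z)*(y - z)\<^sup>2 = 0"
proof -
 define m where "m = (of_real (mean4 a) :: complex)"
 have m: "of_real (a 4) = 4 * m - of_real (a 1) - of_real (a 2) - of_real (a 3)"
 unfolding m_def mean4_eq by (simp add: field_simps)
 show ?thesis unfolding Pc_def Pc'_def Vc_def m_def[symmetric] m
 by (simp add: algebra_simps power2_eq_square)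
qed

lemma commutation_kernel:
 assumes "y ~= z"
 shows "2 * Pc z/(y - z) ^ 3 + Pc' z/(y - z)\<^sup>2 + (Vc z - \<mu>)/(y - z)
 = 2 * Pc y/(y - z) ^ 3 - Pc' y/(y - z)\<^sup>2 + (Vc y - \<mu>)/(y - z)"
proof -
 have nz: "y - z ~= 0" using assms by simp
 have gen: "(2 * p/d ^ 3 - p'/d\<^sup>2 + A/d) - (2 * r/d ^ 3 + r'/d\<^sup>2 + B/d)
 = (2*(p - r) - (p' + r') * d + (A - B) * d\<^sup>2)/d ^ 3" if "d ~= 0" for p p' r r' A B d :: complex
 using that by (simp add: divide_simps) (simp add: algebra_simps eval_nat_numeral)
 have "(2 * Pc y/(y - z) ^ 3 - Pc' y/(y - z)\<^sup>2 + (Vc y - \<mu>)/(y - z)) - (2 * Pc z/(y - z) ^ 3 + Pc' z/(y - z)\<^sup>2 + (Vc z - \<mu>)/(y - z)) = 0"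
 unfolding gen[OF nz] using commutation_polynomial[of y z] by simp
 then show ?thesis by simp
qed

end

context eigenfunction
begin

lemma f_vanishing_at_singularities:
 "((%y. f y * of_real (y - a 2)) \<longlongrightarrow> 0) (at_right (a 2))"
 "((%y. f y * of_real (y - a 3)) \<longlongrightarrow> 0) (at (a 3))"
 "((%y. f y * of_real (y - a 4)) \<longlongrightarrow> 0) (at_left (a 4))"
proof -
 obtain ta C f2 where ta: "0 < ta" and C: "0 <= C" and b: "!!t. 0 < t ==> t <= ta ==> norm (f (a 2 + t) - f2) <= C * sqrt t"
 using expansion_a2 by metis
 show "((%y. f y * of_real (y - a 2)) \<longlongrightarrow> 0) (at_right (a 2))"
 proof (rule Lim_null_comparison)
 show "((%y. (norm f2 + C * sqrt ta) * \<bar>y - a 2\<bar>) \<longlongrightarrow> 0) (at_right (a 2))"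
 by (rule tendsto_eq_intros | simp)+
 show "\<forall>\<^sub>F y in at_right (a 2). norm (f y * of_real (y - a 2)) <= (norm f2 + C * sqrt ta) * \<bar>y - a 2\<bar>"
 unfolding eventually_at_right_field
 proof (intro exI[of _ "a 2 + ta"] conjI allI impI)
 show "a 2 < a 2 + ta" using ta by simp
 fix y assume y: "a 2 < y" "y < a 2 + ta"
 have "norm (f y - f2) <= C * sqrt (y - a 2)" using b[of "y - a 2"] y by simp
 also have "... <= C * sqrt ta" using y C by (intro mult_left_mono) auto
 finally have "norm (f y) <= norm f2 + C * sqrt ta" using norm_triangle_sub[of "f y" f2] by linarith
 then show "norm (f y * of_real (y - a 2)) <= (norm f2 + C * sqrt ta) * \<bar>y - a 2\<bar>"
 unfolding norm_mult norm_of_real by (rule mult_right_mono) simp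
 qed
 qed
 obtain ta4 C4 where ta4: "0 < ta4" and b4: "!!t. 0 < t ==> t <= ta4 ==> norm (f (a 4 - t)) <= C4"
 using expansion_a4 by metis
 show "((%y. f y * of_real (y - a 4)) \<longlongrightarrow> 0) (at_left (a 4))"
 proof (rule Lim_null_comparison)
 show "((%y. C4 * \<bar>y - a 4\<bar>) \<longlongrightarrow> 0) (at_left (a 4))" by (rule tendsto_eq_intros | simp)+
 show "\<forall>\<^sub>F y in at_left (a 4). norm (f y * of_real (y - a 4)) <= C4 * \<bar>y - a 4\<bar>"
 unfolding eventually_at_left_field
 proof (intro exI[of _ "a 4 - ta4"] conjI allI impI)
 show "a 4 - ta4 < a 4" using ta4 by simp
 fix y assume y: "a 4 - ta4 < y" "y < a 4"
 have "norm (f y) <= C4" using b4[of "a 4 - y"] y by simp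
 then show "norm (f y * of_real (y - a 4)) <= C4 * \<bar>y - a 4\<bar>"
 unfolding norm_mult norm_of_real by (rule mult_right_mono) simp
 qed
 qed
 obtain rh C3 c where rh: "0 < rh" and C3: "0 <= C3" and b3: "!!y. 0 < \<bar>y - a 3\<bar> ==> \<bar>y - a 3\<bar> <= rh ==> norm (f y - d3 * of_real (ln \<bar>y - a 3\<bar>) - c) <= C3 * sqrt \<bar>y - a 3\<bar>"
 using expansion_a3 by metis
 show "((%y. f y * of_real (y - a 3)) \<longlongrightarrow> 0) (at (a 3))"
 proof (rule Lim_null_comparison)
 show "((%y. (2 * norm d3 + norm c + C3) * sqrt \<bar>y - a 3\<bar>) \<longlongrightarrow> 0) (at (a 3))" by (rule tendsto_eq_intros | simp)+
 show "\<forall>\<^sub>F y in at (a 3). norm (f y * of_real (y - a 3)) <= (2 * norm d3 + norm c + C3) * sqrt \<bar>y - a 3\<bar>"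
 unfolding eventually_at
 proof (intro exI[of _ "min rh 1"] conjI ballI impI)
 show "0 < min rh 1" using rh by simp
 fix y assume y: "y ~= a 3 & dist y (a 3) < min rh 1"
 define u where "u = \<bar>y - a 3\<bar>"
 have u: "0 < u" "u <= rh" "u <= 1" using y by (auto simp: u_def dist_real_def)
 have "ln (1/sqrt u) <= 1/sqrt u - 1" using u by (intro ln_le_minus_one) simp
 then have l: "\<bar>ln u\<bar> <= 2/sqrt u" using u by (simp add: ln_div ln_sqrt)
 have su: "sqrt u <= 1" using u by simp
 have us: "u = sqrt u * sqrt u" using u by simp
 have ul: "u <= sqrt u"
 using mult_left_mono[OF su, of "sqrt u"] us u by (metis mult.right_neutral real_sqrt_ge_zero less_imp_le)
 have "\<bar>ln u\<bar> * u <= 2/sqrt u * u" using l u by (intro mult_right_mono) auto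
 also have "... = 2 * sqrt u" using us u by (simp add: field_simps)
 finally have lu: "\<bar>ln u\<bar> * u <= 2 * sqrt u" .
 have fb: "norm (f y) <= norm d3 * \<bar>ln u\<bar> + norm c + C3"
 proof -
 have "norm (f y - d3 * of_real (ln u) - c) <= C3 * sqrt u" using b3[of y] u by (simp add: u_def)
 also have "... <= C3" using C3 su by (simp add: mult_left_le)
 finally have "norm (f y - d3 * of_real (ln u) - c) <= C3" .
 moreover have "norm (f y) <= norm (f y - d3 * of_real (ln u) - c) + norm (d3 * of_real (ln u)) + norm c"
 using norm_triangle_ineq[of "f y - d3 * of_real (ln u) - c" "d3 * of_real (ln u) + c"] norm_triangle_ineq[of "d3 * of_real (ln u)" c] by simp
 ultimately show ?thesis by (simp add: norm_mult)
 qed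
 have "norm (f y * of_real (y - a 3)) = norm (f y) * u" unfolding norm_mult norm_of_real u_def by simp
 also have "... <= (norm d3 * \<bar>ln u\<bar> + norm c + C3) * u" using fb u by (intro mult_right_mono) auto
 also have "... = norm d3*(\<bar>ln u\<bar> * u) + (norm c + C3) * u" by (simp add: algebra_simps)
 also have "... <= norm d3*(2 * sqrt u) + (norm c + C3) * sqrt u"
 using lu ul C3 by (intro add_mono mult_left_mono) auto
 finally show "norm (f y * of_real (y - a 3)) <= (2 * norm d3 + norm c + C3) * sqrt \<bar>y - a 3\<bar>" by (simp add: u_def algebra_simps)
 qed
 qed
qed

lemma f_PP_tendsto_0:
 assumes F: "F <= at e" and e: "PP a e = 0" and l: "((%y. f y * of_real (y - e)) \<longlongrightarrow> 0) F"
 shows "((%y. f y * of_real (PP a y)) \<longlongrightarrow> 0) F"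
proof -
 have "((%y. (PP a y - PP a e)/(y - e)) \<longlongrightarrow> P' e) (at e)"
 using PP_deriv[of e] by (simp add: has_field_derivative_iff)
 then have "((%y. PP a y/(y - e)) \<longlongrightarrow> P' e) F" using tendsto_mono[OF F] e by simp
 then have "((%y. complex_of_real (PP a y/(y - e))) \<longlongrightarrow> of_real (P' e)) F" by (rule tendsto_of_real)
 from tendsto_mult[OF l this] have l2: "((%y. f y * of_real (y - e) * of_real (PP a y/(y - e))) \<longlongrightarrow> 0) F" by simp
 have ev: "\<forall>\<^sub>F y in F. f y * of_real (y - e) * of_real (PP a y/(y - e)) = f y * of_real (PP a y)"
 proof (rule filter_leD[OF F])
 show "\<forall>\<^sub>F y in at e. f y * of_real (y - e) * of_real (PP a y/(y - e)) = f y * of_real (PP a y)"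
 unfolding eventually_at by (intro exI[of _ 1]) (auto simp flip: of_real_mult of_real_diff)
 qed
 show ?thesis by (rule Lim_transform_eventually[OF l2 ev])
qed

text \<open>Two integrations by parts move the operator from the Cauchy kernel to the
  eigenfunction. The boundary terms vanish at $a_2$ and $a_4$, and the two contributions at $a_3$
  cancel by the transmission condition.\<close>

lemma cauchy_ode:
 assumes z: "Im z ~= 0"
 shows "Pc z * cauchy2 z + Pc' z * cauchy1 z = (of_real La - Vc z) * cauchy z"
proof -
 have nz: "complex_of_real y ~= z" for y using z by auto
 define G where "G zet = - Pc zet/(zet - z)\<^sup>2" for zet
 define G' where "G' zet = 2 * Pc zet/(zet - z) ^ 3 - Pc' zet/(zet - z)\<^sup>2" for zet
 define Psi where "Psi y = f y * G (of_real y) - q y*(1/(of_real y - z))" for y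
 define k where "k y = 2 * Pc z/(of_real y - z) ^ 3 + Pc' z/(of_real y - z)\<^sup>2 + (Vc z - of_real La)/(of_real y - z)" for y :: real
 have dG: "(G has_field_derivative G' zet) (at zet)" if "zet ~= z" for zet
 proof -
 have nz': "zet - z ~= 0" using that by simp
 have dP: "(Pc has_field_derivative Pc' zet) (at zet)"
 unfolding Pc_def[abs_def] Pc'_def by (auto intro!: derivative_eq_intros simp: algebra_simps)
 have alg: "(- r * d\<^sup>2 - - p*(2 * d))/(d\<^sup>2 * d\<^sup>2) = 2 * p/d ^ 3 - r/d\<^sup>2" if "d ~= 0" for r p d :: complex
 using that by (simp add: divide_simps) (simp add: algebra_simps eval_nat_numeral)
 have "((%zet. - Pc zet/(zet - z)\<^sup>2) has_field_derivative (- Pc' zet*(zet - z)\<^sup>2 - - Pc zet*(2*(zet - z)))/((zet - z)\<^sup>2*(zet - z)\<^sup>2)) (at zet)"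
 by (rule DERIV_divide[OF DERIV_minus[OF dP]]) (use nz' in \<open>auto intro!: derivative_eq_intros\<close>)
 then show ?thesis unfolding alg[OF nz'] G'_def G_def[abs_def] .
 qed
 have dH: "((%zet. 1/(zet - z)) has_field_derivative - 1/(zet - z)\<^sup>2) (at zet)" if "zet ~= z" for zet
 using that by (auto intro!: derivative_eq_intros simp: power2_eq_square)
 have d: "(Psi has_vector_derivative f y * k y) (at y)" if y: "a 2 < y" "y < a 4" "y ~= a 3" for y
 proof -
 let ?Y = "complex_of_real y"
 have P: "Pc ?Y ~= 0" using PP_nonzero[OF y] unfolding of_real_coeffs(1)[symmetric] by simp
 have "(Psi has_vector_derivative (f y * G' ?Y + q y/of_real (PP a y) * G ?Y) - (q y*(- 1/(?Y - z)\<^sup>2) + of_real (La - V y) * f y*(1/(?Y - z)))) (at y)"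
 unfolding Psi_def
 by (intro has_vector_derivative_diff has_vector_derivative_mult eigenfunction_ode[OF y] has_vector_derivative_real_field dG dH nz)
 moreover have "(f y * G' ?Y + q y/of_real (PP a y) * G ?Y) - (q y*(- 1/(?Y - z)\<^sup>2) + of_real (La - V y) * f y*(1/(?Y - z))) = f y * k y"
 proof -
 have "q y/of_real (PP a y) * G ?Y = - q y/(?Y - z)\<^sup>2" unfolding of_real_coeffs(1) G_def using P by simp
 then have "(f y * G' ?Y + q y/of_real (PP a y) * G ?Y) - (q y*(- 1/(?Y - z)\<^sup>2) + of_real (La - V y) * f y*(1/(?Y - z)))
 = f y*(2 * Pc ?Y/(?Y - z) ^ 3 - Pc' ?Y/(?Y - z)\<^sup>2 + (Vc ?Y - of_real La)/(?Y - z))"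
 unfolding G'_def of_real_diff of_real_coeffs(3) by (simp add: algebra_simps diff_divide_distrib add_divide_distrib)
 also have "... = f y * k y" unfolding k_def commutation_kernel[OF nz] ..
 finally show ?thesis .
 qed
 ultimately show ?thesis by simp
 qed
 have lim: "(Psi \<longlongrightarrow> - (Q*(1/(of_real e - z)))) F"
 if F: "F <= at e" and e: "PP a e = 0" and l: "((%y. f y * of_real (y - e)) \<longlongrightarrow> 0) F" and Q: "(q \<longlongrightarrow> Q) F" for F e Q
 proof -
 have y: "((%y. complex_of_real y) \<longlongrightarrow> of_real e) F" using tendsto_mono[OF F tendsto_ident_at] by (rule tendsto_of_real)
 have "((%y. f y * of_real (PP a y)*(- 1/(of_real y - z)\<^sup>2) - q y*(1/(of_real y - z))) \<longlongrightarrow> 0*(- 1/(of_real e - z)\<^sup>2) - Q*(1/(of_real e - z))) F"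
 by (intro tendsto_intros f_PP_tendsto_0[OF F e l] y Q) (use nz in auto)
 then show ?thesis by (simp add: Psi_def[abs_def] G_def of_real_coeffs)
 qed
 have le: "at_right e <= at e" "at_left e <= at e" for e :: real by (auto intro: at_le)
 have l1: "(Psi \<longlongrightarrow> 0) (at_right (a 2))" using lim[OF le(1) roots(1) f_vanishing_at_singularities(1) q_limits(1)] by simp
 have l2: "(Psi \<longlongrightarrow> - (q3*(1/(of_real (a 3) - z)))) (at_left (a 3))" by (rule lim[OF le(2) roots(2) tendsto_mono[OF le(2) f_vanishing_at_singularities(2)] q3(1)])
 have l3: "(Psi \<longlongrightarrow> - (q3*(1/(of_real (a 3) - z)))) (at_right (a 3))" by (rule lim[OF le(1) roots(2) tendsto_mono[OF le(1) f_vanishing_at_singularities(2)] q3(2)])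
 have l4: "(Psi \<longlongrightarrow> 0) (at_left (a 4))" using lim[OF le(2) roots(3) f_vanishing_at_singularities(3) q_limits(2)] by simp
 have J1: "((%y. f y * k y) has_integral (- (q3*(1/(of_real (a 3) - z))) - 0)) {a 2..a 3}"
 using a23 a34 by (intro has_integral_of_limits[OF a23 d l1 l2]) auto
 have J2: "((%y. f y * k y) has_integral (0 - - (q3*(1/(of_real (a 3) - z))))) {a 3..a 4}"
 using a23 a34 by (intro has_integral_of_limits[OF a34 d l3 l4]) auto
 from has_integral_combine[OF less_imp_le[OF a23] less_imp_le[OF a34] J1 J2]
 have 0: "((%y. f y * k y) has_integral 0) {a 2..a 4}" by simp
 have i2: "(%y. f y*(2/(of_real y - z) ^ 3)) integrable_on {a 2..a 4}"
 using integrable_on_mult_right[OF f_cauchy_integrable[OF z, of 3], of 2] by (simp add: mult_ac)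
 have i1: "(%y. f y*(1/(of_real y - z)\<^sup>2)) integrable_on {a 2..a 4}" by (rule f_cauchy_integrable[OF z])
 have i0: "(%y. f y/(of_real y - z)) integrable_on {a 2..a 4}" using f_cauchy_integrable[OF z, of 1] by simp
 have "((%y. Pc z*(f y*(2/(of_real y - z) ^ 3)) + Pc' z*(f y*(1/(of_real y - z)\<^sup>2)) + (Vc z - of_real La)*(f y/(of_real y - z)))
 has_integral Pc z * cauchy2 z + Pc' z * cauchy1 z + (Vc z - of_real La) * cauchy z) {a 2..a 4}"
 unfolding cauchy_def cauchy1_def cauchy2_def
 by (intro has_integral_add has_integral_mult_right integrable_integral i0 i1 i2)
 then have "((%y. f y * k y) has_integral Pc z * cauchy2 z + Pc' z * cauchy1 z + (Vc z - of_real La) * cauchy z) {a 2..a 4}"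
 by (rule has_integral_eq[rotated]) (simp add: k_def algebra_simps)
 from has_integral_unique[OF this 0] show ?thesis by (simp add: algebra_simps add_eq_0_iff)
qed

end

section \<open>A weak form of the commutation\<close>

text \<open>A test function that vanishes to second order at both ends of $[-1,1]$.\<close>

definition bump :: "real => real" where "bump w = (1 - w\<^sup>2) ^ 3"
definition bump1 :: "real => real" where "bump1 w = - 6 * w*(1 - w\<^sup>2)\<^sup>2"
definition bump2 :: "real => real" where "bump2 w = - 6*(1 - w\<^sup>2)\<^sup>2 + 24 * w\<^sup>2*(1 - w\<^sup>2)"

lemma bump_derivs:
 "(bump has_real_derivative bump1 w) (at w)" "(bump1 has_real_derivative bump2 w) (at w)"
proof -
 show "(bump has_real_derivative bump1 w) (at w)"
 unfolding bump_def[abs_def] bump1_def by (auto intro!: derivative_eq_intros)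
 show "(bump1 has_real_derivative bump2 w) (at w)"
 unfolding bump1_def[abs_def] bump2_def by (auto intro!: derivative_eq_intros simp: power2_eq_square algebra_simps)
qed

context four_points
begin

text \<open>In the variable \<open>s\<close>, which runs over the whole line, both logarithmic
  singularities become linear growth.\<close>

definition X where "X s = (a 2 + a 3 * exp s)/(1 + exp s)"
definition om where "om x = (x - a 2)*(a 3 - x)/(a 3 - a 2)"
definition om' where "om' x = (a 2 + a 3 - 2 * x)/(a 3 - a 2)"
definition kk where "kk x = (a 3 - a 2)*(x - a 1)*(a 4 - x)"
definition kk' where "kk' x = (a 3 - a 2)*((a 4 - x) - (x - a 1))"

lemma X_minus: "X s - a 2 = (a 3 - a 2) * exp s/(1 + exp s)" "a 3 - X s = (a 3 - a 2)/(1 + exp s)"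
proof -
 have "1 + exp s ~= 0" using exp_gt_zero[of s] by linarith
 then show "X s - a 2 = (a 3 - a 2) * exp s/(1 + exp s)" "a 3 - X s = (a 3 - a 2)/(1 + exp s)"
 by (simp_all add: X_def field_simps)
qed

lemma X_bounds: "a 2 < X s" "X s < a 3"
proof -
 have "0 < 1 + exp s" using exp_gt_zero[of s] by linarith
 then have "0 < X s - a 2" "0 < a 3 - X s" unfolding X_minus using a23 by simp_all
 then show "a 2 < X s" "X s < a 3" by simp_all
qed

lemma om_X: "om (X s) = (a 3 - a 2) * exp s/(1 + exp s)\<^sup>2"
 unfolding om_def X_minus using a23 by (simp add: power2_eq_square)

lemma X_deriv: "(X has_real_derivative om (X s)) (at s)"
proof -
 have "1 + exp s ~= 0" using exp_gt_zero[of s] by linarith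
 then have "(X has_real_derivative ((a 3 * exp s)*(1 + exp s) - (a 2 + a 3 * exp s) * exp s)/((1 + exp s)*(1 + exp s))) (at s)"
 unfolding X_def[abs_def] by (auto intro!: derivative_eq_intros)
 then show ?thesis unfolding om_X by (simp add: power2_eq_square algebra_simps)
qed

lemma om_pos: "a 2 < x ==> x < a 3 ==> 0 < om x" using a23 by (simp add: om_def)

lemma om_deriv: "(om has_real_derivative om' x) (at x)"
proof -
 have "((%x. (x - a 2)*(a 3 - x)) has_real_derivative a 2 + a 3 - 2 * x) (at x)"
 by (auto intro!: derivative_eq_intros simp: algebra_simps)
 from DERIV_cdivide[OF this, of "a 3 - a 2"] show ?thesis unfolding om_def[abs_def] om'_def .
qed

lemma PP_kk: "PP a x = kk x * om x"
 unfolding PP_eq kk_def om_def using a23 by (simp add: field_simps)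

lemma P'_kk: "P' x = kk' x * om x + kk x * om' x"
proof -
 have "(kk has_real_derivative kk' x) (at x)"
 unfolding kk_def[abs_def] kk'_def by (auto intro!: derivative_eq_intros simp: algebra_simps)
 from DERIV_mult[OF this om_deriv] have "((%x. kk x * om x) has_real_derivative kk' x * om x + kk x * om' x) (at x)"
 by (simp add: mult.commute)
 then have "(PP a has_real_derivative kk' x * om x + kk x * om' x) (at x)" unfolding PP_kk[abs_def] .
 with PP_deriv show ?thesis by (rule DERIV_unique)
qed

end

context eigenfunction
begin

definition weak_density where
 "weak_density T v = HT a f (X (T * v))*(2 * q (X (T * v)) * of_real (bump1 v)
 + f (X (T * v)) * of_real (kk (X (T * v)) * bump2 v/T + kk' (X (T * v)) * om (X (T * v)) * bump1 v))"

text \<open>Pairing the equation of the Cauchy transform off the axis with the eigenfunction times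
  a slowly varying cutoff leaves only terms with derivatives of the cutoff, since the
  eigenfunction solves the same equation. The average over the two sides of the axis passes to the
  limit and gives the Hilbert transform.\<close>

lemma weak_identity:
 assumes T: "0 < T"
 shows "(weak_density T has_integral 0) {-1..1}"
proof -
 define x where "x w = X (T * w)" for w
 have xb: "a 2 < x w" "x w < a 3" "x w < a 4" "x w ~= a 3" for w using X_bounds[of "T * w"] a34 by (auto simp: x_def)
 define m where "m w = T * om (x w)" for w
 have m0: "m w ~= 0" for w using om_pos[OF xb(1,2), of w] T by (simp add: m_def)
 have om0: "om (x w) ~= 0" for w using om_pos[OF xb(1,2), of w] by simp
 have P0: "PP a (x w) ~= 0" for w using PP_pos[OF xb(1,2), of w] by simp
 have dx: "(x has_real_derivative m w) (at w)" for w
 proof -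
 have "((%w. X (T * w)) has_real_derivative om (X (T * w)) * T) (at w)"
 by (rule DERIV_chain2[OF X_deriv]) (auto intro!: derivative_eq_intros)
 then show ?thesis by (simp add: x_def[abs_def] m_def mult.commute)
 qed
 have chain: "((%w. F (x w)) has_vector_derivative of_real (m w) * F') (at w)"
 if "(F has_vector_derivative F') (at (x w))" for F :: "real => complex" and F' w
 using vector_diff_chain_at[OF dx[of w, unfolded has_real_derivative_iff_has_vector_derivative] that]
 by (simp add: o_def scaleR_conv_of_real)
 define F where "F w = f (x w)" for w
 define Q where "Q w = q (x w)" for w
 have dF: "(F has_vector_derivative of_real (m w)*(Q w/of_real (PP a (x w)))) (at w)" for w
 unfolding F_def Q_def by (rule chain[OF eigenfunction_ode(1)]) (rule xb)+
 have dQ: "(Q has_vector_derivative of_real (m w)*(of_real (La - V (x w)) * F w)) (at w)" for w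
 unfolding F_def Q_def by (rule chain[OF eigenfunction_ode(2)]) (rule xb)+
 define e1 where "e1 w = bump w/PP a (x w)" for w
 define e1' where "e1' w = (bump1 w * PP a (x w) - bump w*(P' (x w) * m w))/(PP a (x w) * PP a (x w))" for w
 define e2 where "e2 w = bump1 w/m w" for w
 define e2' where "e2' w = (bump2 w * m w - bump1 w*(T*(om' (x w) * m w)))/(m w * m w)" for w
 have de1: "(e1 has_real_derivative e1' w) (at w)" for w
 unfolding e1_def[abs_def] e1'_def by (rule DERIV_divide[OF bump_derivs(1) DERIV_chain2[OF PP_deriv dx] P0])
 have dm: "(m has_real_derivative T*(om' (x w) * m w)) (at w)" for w
 unfolding m_def[abs_def] by (rule DERIV_cmult[OF DERIV_chain2[OF om_deriv dx, unfolded m_def]])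
 have de2: "(e2 has_real_derivative e2' w) (at w)" for w
 unfolding e2_def[abs_def] e2'_def by (rule DERIV_divide[OF bump_derivs(2) dm m0])
 define tht where "tht w = Q w * of_real (e1 w) + F w * of_real (e2 w)" for w
 define tht' where "tht' w = (Q w * of_real (e1' w) + of_real (m w)*(of_real (La - V (x w)) * F w) * of_real (e1 w))
 + (F w * of_real (e2' w) + of_real (m w)*(Q w/of_real (PP a (x w))) * of_real (e2 w))" for w
 have dtht: "(tht has_vector_derivative tht' w) (at w)" for w
 unfolding tht_def[abs_def] tht'_def
 by (intro has_vector_derivative_add has_vector_derivative_mult has_vector_derivative_of_real dF dQ de1 de2)
 define z where "z ep w = of_real (x w) + \<i> * complex_of_real ep" for ep w
 (* the coefficient of the Cauchy transform; at height 0 all terms without bump1 or bump2 cancel *)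
 define c where "c ep w = Pc (z ep w) * tht' w + of_real (m w) * Pc' (z ep w) * tht w
 + of_real (m w)*(Vc (z ep w) - of_real La)*(F w * of_real (bump w))" for ep w
 have mtht: "of_real (m w) * tht w = of_real (m w)*(Q w/of_real (PP a (x w))) * of_real (bump w) + F w * of_real (bump1 w)" for w
 unfolding tht_def e1_def e2_def using m0[of w] by (simp add: algebra_simps)
 have contF: "continuous_on S F" "continuous_on S Q" "continuous_on S x" "continuous_on S m" for S
 by (auto intro!: continuous_at_imp_continuous_on has_vector_derivative_continuous dF dQ DERIV_isCont[OF dx] DERIV_isCont[OF dm])
 have pos: "((%w. cauchy (z ep w) * c ep w) has_integral 0) {-1..1}" if ep: "ep ~= 0" for ep
 proof -
 define Psi where "Psi w = Pc (z ep w)*(cauchy (z ep w) * tht w - cauchy1 (z ep w)*(F w * of_real (bump w)))" for w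
 have im: "Im (z ep w) ~= 0" for w using ep by (simp add: z_def)
 have dP: "((%w. Pc (z ep w)) has_vector_derivative of_real (m w) * Pc' (z ep w)) (at w)" for w
 proof -
 have "((%zet. Pc (zet + \<i> * of_real ep)) has_field_derivative Pc' (of_real (x w) + \<i> * of_real ep)) (at (of_real (x w)))"
 unfolding Pc_def[abs_def] Pc'_def by (auto intro!: derivative_eq_intros simp: algebra_simps)
 from chain[OF has_vector_derivative_real_field[OF this]] show ?thesis by (simp add: z_def)
 qed
 have du: "((%w. cauchy (z ep w)) has_vector_derivative of_real (m w) * cauchy1 (z ep w)) (at w)"
 "((%w. cauchy1 (z ep w)) has_vector_derivative of_real (m w) * cauchy2 (z ep w)) (at w)" for w
 unfolding z_def by (rule chain[OF cauchy_derivs(1)[OF ep]], rule chain[OF cauchy_derivs(2)[OF ep]])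
 have dPsi: "(Psi has_vector_derivative cauchy (z ep w) * c ep w) (at w)" for w
 proof -
 let ?z = "z ep w" and ?m = "complex_of_real (m w)"
 have "(Psi has_vector_derivative Pc ?z*((cauchy ?z * tht' w + ?m * cauchy1 ?z * tht w) -
 (cauchy1 ?z*(F w * of_real (bump1 w) + ?m*(Q w/of_real (PP a (x w))) * of_real (bump w)) + ?m * cauchy2 ?z*(F w * of_real (bump w))))
 + ?m * Pc' ?z*(cauchy ?z * tht w - cauchy1 ?z*(F w * of_real (bump w)))) (at w)"
 unfolding Psi_def[abs_def]
 by (intro has_vector_derivative_diff has_vector_derivative_mult has_vector_derivative_of_real dP du dtht dF bump_derivs)
 moreover have "Pc ?z*((cauchy ?z * tht' w + ?m * cauchy1 ?z * tht w) -
 (cauchy1 ?z*(F w * of_real (bump1 w) + ?m*(Q w/of_real (PP a (x w))) * of_real (bump w)) + ?m * cauchy2 ?z*(F w * of_real (bump w))))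
 + ?m * Pc' ?z*(cauchy ?z * tht w - cauchy1 ?z*(F w * of_real (bump w))) = cauchy ?z * c ep w"
 proof -
 have alg: "p*((u * t' + mm * u1 * t) - (u1*(fb1 + mqb) + mm * u2 * fb)) + mm * p'*(u * t - u1 * fb)
 = u*(p * t' + mm * p' * t + mm*(v - l) * fb)"
 if ode: "p * u2 + p' * u1 = (l - v) * u" and mt: "mm * t = mqb + fb1"
 for p u t' mm u1 t fb1 mqb u2 fb p' v l :: complex
 proof -
 have "p*((u * t' + mm * u1 * t) - (u1*(fb1 + mqb) + mm * u2 * fb)) + mm * p'*(u * t - u1 * fb)
 - u*(p * t' + mm * p' * t + mm*(v - l) * fb)
 = p * u1*(mm * t - (mqb + fb1)) - mm * fb*((p * u2 + p' * u1) - (l - v) * u)"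
 by (simp add: algebra_simps)
 also have "... = 0" using ode mt by simp
 finally show ?thesis by simp
 qed
 show ?thesis unfolding c_def by (rule alg[OF cauchy_ode[OF im] mtht])
 qed
 ultimately show ?thesis by simp
 qed
 have "((%w. cauchy (z ep w) * c ep w) has_integral Psi 1 - Psi (-1)) {-1..1}"
 by (rule fundamental_theorem_of_calculus) (auto intro: has_vector_derivative_at_within dPsi)
 moreover have "Psi 1 = 0" "Psi (-1) = 0" by (simp_all add: Psi_def tht_def e1_def e2_def bump_def bump1_def)
 ultimately show ?thesis by simp
 qed
 have c0: "c 0 w = 2 * Q w * of_real (bump1 w) + F w * of_real (kk (x w) * bump2 w/T + kk' (x w) * om (x w) * bump1 w)" for w
 proof -
 have Pe1: "PP a (x w) * e1' w + m w * P' (x w) * e1 w = bump1 w"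
 using P0[of w] by (simp add: e1'_def e1_def field_simps)
 have Pe2: "PP a (x w) * e2' w + m w * P' (x w) * e2 w = kk (x w) * bump2 w/T + kk' (x w) * om (x w) * bump1 w"
 proof -
 have alg: "k * o'*((b2*(T * o') - b1*(T*(d*(T * o'))))/(T * o'*(T * o'))) + T * o'*(k' * o' + k * d)*(b1/(T * o')) = k * b2/T + k' * o' * b1"
 if "o' ~= 0" "T ~= 0" for k o' b2 b1 d T k' :: real
 using that by (simp add: divide_simps) (simp add: algebra_simps)
 show ?thesis unfolding e2'_def e2_def PP_kk P'_kk m_def by (rule alg) (use om0 T in auto)
 qed
 have Pm: "PP a (x w)*(m w/PP a (x w)) * e2 w = bump1 w" using P0[of w] m0[of w] by (simp add: e2_def)
 have Pb: "PP a (x w) * e1 w = bump w" using P0[of w] by (simp add: e1_def)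
 define p where "p = complex_of_real (PP a (x w))"
 define r where "r = complex_of_real (P' (x w))"
 define v where "v = complex_of_real (V (x w))"
 define mm where "mm = complex_of_real (m w)"
 define E1 E1' E2 E2' b b1 where E: "E1 = complex_of_real (e1 w)" "E1' = complex_of_real (e1' w)" "E2 = complex_of_real (e2 w)" "E2' = complex_of_real (e2' w)"
 "b = complex_of_real (bump w)" "b1 = complex_of_real (bump1 w)"
 define R where "R = complex_of_real (kk (x w) * bump2 w/T + kk' (x w) * om (x w) * bump1 w)"
 have h1: "p * E1' + mm * r * E1 = b1" unfolding p_def r_def mm_def E using arg_cong[OF Pe1, of complex_of_real] by simp
 have h2: "p * E2' + mm * r * E2 = R" unfolding p_def r_def mm_def E R_def using arg_cong[OF Pe2, of complex_of_real] by simp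
 have h3: "mm * E2 = b1" unfolding mm_def E e2_def using m0[of w] by simp
 have h4: "p * E1 = b" unfolding p_def E using arg_cong[OF Pb, of complex_of_real] by simp
 have p0: "p ~= 0" using P0 by (simp add: p_def)
 have "c 0 w = p*((Q w * E1' + mm*((of_real La - v) * F w) * E1) + (F w * E2' + mm*(Q w/p) * E2))
 + mm * r*(Q w * E1 + F w * E2) + mm*(v - of_real La)*(F w * b)"
 unfolding c_def z_def tht'_def tht_def p_def r_def v_def mm_def E by (simp add: of_real_coeffs)
 also have "... = Q w*(p * E1' + mm * r * E1) + F w*(p * E2' + mm * r * E2) + mm*(of_real La - v) * F w*(p * E1 - b) + (p*(Q w/p))*(mm * E2)"
 by (simp add: algebra_simps)
 also have "... = 2 * Q w * b1 + F w * R" unfolding h1 h2 h3 h4 using p0 by simp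
 finally show ?thesis by (simp add: E R_def)
 qed
 define K where "K = {-1..1::real} \<times> {-1..1::real}"
 have co: "continuous_on S e1" "continuous_on S e2" "continuous_on S tht" for S
 by (auto intro!: continuous_at_imp_continuous_on has_vector_derivative_continuous dtht DERIV_isCont[OF de1] DERIV_isCont[OF de2])
 have cP: "continuous_on S (%w. PP a (x w))" "continuous_on S (%w. P' (x w))" "continuous_on S (%w. om' (x w))" "continuous_on S (%w. V (x w))"
 "continuous_on S bump" "continuous_on S bump1" "continuous_on S bump2" for S
 unfolding PP_eq[abs_def] P'_def om'_def V_def bump_def[abs_def] bump1_def[abs_def] bump2_def[abs_def] using a23
 by (auto intro!: continuous_intros contF)
 have ctht': "continuous_on S tht'" for S
 unfolding tht'_def[abs_def] e1'_def e2'_def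
 by (intro continuous_intros contF co cP) (auto simp: P0 m0)
 have comp2: "continuous_on K (%p. g (snd p))" if "!!S. continuous_on S g" for g :: "real => 'x::topological_space"
 by (rule continuous_on_compose2[OF that[of UNIV]]) (auto intro: continuous_intros)
 have cc: "continuous_on K (%p. c (fst p) (snd p))"
 unfolding c_def z_def Pc_def Pc'_def Vc_def
 by (intro continuous_intros comp2 ctht' co contF cP)
 have "compact ((%p. c (fst p) (snd p)) ` K)" by (rule compact_continuous_image[OF cc]) (auto simp: K_def intro: compact_Times)
 then have "bounded ((%p. c (fst p) (snd p)) ` K)" by (rule compact_imp_bounded)
 then obtain Bc where Bc0: "\<forall>y \<in> (%p. c (fst p) (snd p)) ` K. norm y <= Bc" unfolding bounded_iff by (elim exE)
 have Bc: "norm (c (fst p) (snd p)) <= Bc" if "p \<in> K" for p using Bc0 that by (auto simp del: fst_conv snd_conv)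
 have cb: "norm (c ep w) <= Bc" if "(abs ep) <= 1" "w \<in> {-1..1}" for ep w
 using Bc[of "(ep, w)"] that by (auto simp: K_def abs_le_iff)
 have cl: "((%ep. c ep w) \<longlongrightarrow> c 0 w) (at 0)" for w
 proof -
 have "continuous_on UNIV (%ep. c ep w)" unfolding c_def z_def Pc_def Pc'_def Vc_def by (intro continuous_intros)
 then show ?thesis by (simp add: continuous_on_eq_continuous_at isCont_def)
 qed
 obtain B where B: "!!w ep. w \<in> {-1..1} ==> ep ~= 0 ==> norm (cauchy (z ep w)) <= B"
 proof -
 have co: "compact (x ` {-1..1})" by (rule compact_continuous_image[OF contF(3)]) simp
 have ne: "x ` {-1..1} ~= {}" by simp
 obtain cl where cl: "cl \<in> x ` {-1..1}" "\<forall>y\<in>x ` {-1..1}. cl <= y" using compact_attains_inf[OF co ne] by (elim bexE)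
 obtain cu where cu: "cu \<in> x ` {-1..1}" "\<forall>y\<in>x ` {-1..1}. y <= cu" using compact_attains_sup[OF co ne] by (elim bexE)
 have b1: "a 2 < cl" "cu < a 3" using cl(1) cu(1) xb by auto
 have b2: "cl <= cu" using cl(1) cu(2) by blast
 obtain B where B: "!!x ep. cl <= x ==> x <= cu ==> ep ~= 0 ==> norm (cauchy (of_real x + \<i> * of_real ep)) <= B"
 using cauchy_bounded[OF b1(1) b2 b1(2)] by blast
 show thesis
 proof (rule that)
 fix w ep :: real assume "w \<in> {-1..1}" "ep ~= 0"
 then show "norm (cauchy (z ep w)) <= B" unfolding z_def using cl(2) cu(2) by (intro B) blast+
 qed
 qed
 define ep :: "nat => real" where "ep n = 1/(real n + 1)" for n
 have ep0: "0 < ep n" "ep n <= 1" for n by (auto simp: ep_def)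
 have ep1: "ep \<longlonglongrightarrow> 0" unfolding ep_def[abs_def] by real_asymp
 define I where "I n w = cauchy (z (ep n) w) * c (ep n) w + cauchy (z (- ep n) w) * c (- ep n) w" for n w
 define L where "L w = 2*(of_real pi * HT a f (x w)) * c 0 w" for w
 have I0: "(I n has_integral 0) {-1..1}" for n
 using has_integral_add[OF pos[of "ep n"] pos[of "- ep n"]] ep0(1)[of n] unfolding I_def[abs_def] by simp
 have Ib: "norm (I n w) <= 2*(B * Bc)" if w: "w \<in> {-1..1}" for n w
 proof -
 have "norm (cauchy (z e w) * c e w) <= B * Bc" if "e ~= 0" "(abs e) <= 1" for e
 unfolding norm_mult using B[OF w that(1)] cb[OF that(2) w] by (intro mult_mono) (auto intro: order_trans[OF norm_ge_zero])
 from this[of "ep n"] this[of "- ep n"] show ?thesis unfolding I_def using ep0[of n]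
 norm_triangle_ineq[of "cauchy (z (ep n) w) * c (ep n) w" "cauchy (z (- ep n) w) * c (- ep n) w"] by simp
 qed
 have Il: "(%n. I n w) \<longlonglongrightarrow> L w" if w: "w \<in> {-1..1}" for w
 proof -
 have p: "(%n. cauchy (z (ep n) w) + cauchy (z (- ep n) w)) \<longlonglongrightarrow> 2*(of_real pi * HT a f (x w))"
 unfolding z_def by (rule cauchy_plemelj[OF xb(1,2) ep0(1) ep1])
 have null: "(%n. cauchy (z (tht * ep n) w)*(c (tht * ep n) w - c 0 w)) \<longlonglongrightarrow> 0" if tht: "(abs tht) = 1" for tht :: real
 proof (rule Lim_null_comparison)
 have ne: "tht * ep n ~= 0" for n using tht ep0(1)[of n] by auto
 show "\<forall>\<^sub>F n in sequentially. norm (cauchy (z (tht * ep n) w)*(c (tht * ep n) w - c 0 w)) <= B * norm (c (tht * ep n) w - c 0 w)"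
 unfolding norm_mult using B[OF w ne] by (intro always_eventually allI mult_right_mono) auto
 have "filterlim (%n. tht * ep n) (at 0) sequentially"
 unfolding filterlim_at using ne tendsto_mult_right_zero[OF ep1, of tht] by simp
 then have "(%n. c (tht * ep n) w) \<longlonglongrightarrow> c 0 w" by (rule filterlim_compose[OF cl])
 then have "(%n. B * norm (c (tht * ep n) w - c 0 w)) \<longlonglongrightarrow> B * norm (c 0 w - c 0 w)" by (intro tendsto_intros)
 then show "(%n. B * norm (c (tht * ep n) w - c 0 w)) \<longlonglongrightarrow> 0" by simp
 qed
 have "(%n. (cauchy (z (ep n) w) + cauchy (z (- ep n) w)) * c 0 w + (cauchy (z (1 * ep n) w)*(c (1 * ep n) w - c 0 w) + cauchy (z (- 1 * ep n) w)*(c (- 1 * ep n) w - c 0 w)))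
 \<longlonglongrightarrow> 2*(of_real pi * HT a f (x w)) * c 0 w + (0 + 0)"
 by (intro tendsto_add tendsto_mult p null tendsto_const) auto
 moreover have "(cauchy (z (ep n) w) + cauchy (z (- ep n) w)) * c 0 w + (cauchy (z (1 * ep n) w)*(c (1 * ep n) w - c 0 w) + cauchy (z (- 1 * ep n) w)*(c (- 1 * ep n) w - c 0 w)) = I n w" for n
 by (simp add: I_def algebra_simps)
 ultimately show ?thesis unfolding L_def by simp
 qed
 have Ii: "I n integrable_on {-1..1}" for n using I0 by (rule has_integral_integrable)
 have Li: "L integrable_on {-1..1}"
 by (rule dominated_convergence(1)[OF Ii integrable_const_ivl Ib Il])
 have "(%n. integral {-1..1} (I n)) \<longlonglongrightarrow> integral {-1..1} L"
 by (rule dominated_convergence(2)[OF Ii integrable_const_ivl Ib Il])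
 then have "(%n::nat. 0) \<longlonglongrightarrow> integral {-1..1} L" unfolding integral_unique[OF I0] .
 then have "integral {-1..1} L = 0" using LIMSEQ_unique[OF tendsto_const] by metis
 then have "(L has_integral 0) {-1..1}" using integrable_integral[OF Li] by simp
 then have "((%w. 1/of_real (2 * pi) * L w) has_integral 1/of_real (2 * pi)*0) {-1..1}" by (rule has_integral_mult_right)
 then show ?thesis
 by (rule has_integral_eq_rhs[OF has_integral_eq[rotated]]) (auto simp: L_def c0 weak_density_def x_def F_def Q_def)
qed

end

section \<open>Boundary behaviour of the Hilbert transform\<close>

lemma abs_ln_le:
 assumes "0 < u" shows "\<bar>ln u\<bar> <= 2 * \<bar>u - 1\<bar> / sqrt u"
proof -
 define v where "v = sqrt u"
 have v: "0 < v" and u: "u = v * v" using assms by (auto simp: v_def)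
 have l: "ln u = 2 * ln v" unfolding u using v by (simp add: ln_mult)
 have su: "sqrt u = v" by (simp add: v_def)
 have b1: "ln v <= v - 1" using v by (rule ln_le_minus_one)
 have b2: "- ln v <= 1/v - 1" using ln_le_minus_one[of "1/v"] v by (simp add: ln_div)
 have b2': "- ln v * v <= 1 - v" using mult_right_mono[OF b2, of v] v by (simp add: algebra_simps)
 show ?thesis
 proof (cases "1 <= v")
 case True
 have "1*1 <= v * v" using True by (intro mult_mono) auto
 then have "\<bar>u - 1\<bar> = (v - 1)*(v + 1)" unfolding u by (simp add: algebra_simps)
 moreover have "(v - 1) * v <= (v - 1)*(v + 1)" using True by (intro mult_left_mono) auto
 moreover have "ln v * v <= (v - 1) * v" using b1 v by (intro mult_right_mono) auto
 ultimately have "ln v * v <= \<bar>u - 1\<bar>" by linarith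
 then show ?thesis using True v unfolding su l by (simp add: pos_le_divide_eq abs_mult)
 next
 case False
 have "v * v <= 1 * v" using False v by (intro mult_right_mono) auto
 then have "\<bar>u - 1\<bar> = (1 - v)*(1 + v)" unfolding u using False by (simp add: algebra_simps)
 moreover have "(1 - v)*1 <= (1 - v)*(1 + v)" using False v by (intro mult_left_mono) auto
 ultimately have "1 - v <= \<bar>u - 1\<bar>" by simp
 then have "- ln v * v <= \<bar>u - 1\<bar>" by (rule order_trans[OF b2'])
 moreover have "ln v <= 0" using False v by simp
 ultimately show ?thesis using v unfolding su l by (simp add: pos_le_divide_eq abs_mult mult.commute)
 qed
qed

lemma inv_sqrt_has_integral:
 assumes x: "l <= x" "x <= r"
 shows "((%y. 1/sqrt \<bar>y - x\<bar>) has_integral 2 * sqrt (x - l) + 2 * sqrt (r - x)) {l..r}"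
proof -
 have 1: "((%y. 1/sqrt \<bar>y - x\<bar>) has_integral (- 2 * sqrt (x - x) - (- 2 * sqrt (x - l)))) {l..x}"
 by (rule fundamental_theorem_of_calculus_interior[OF x(1)])
 (auto intro!: continuous_intros derivative_eq_intros simp: has_real_derivative_iff_has_vector_derivative[symmetric] divide_simps)
 have 2: "((%y. 1/sqrt \<bar>y - x\<bar>) has_integral (2 * sqrt (r - x) - 2 * sqrt (x - x))) {x..r}"
 by (rule fundamental_theorem_of_calculus_interior[OF x(2)])
 (auto intro!: continuous_intros derivative_eq_intros simp: has_real_derivative_iff_has_vector_derivative[symmetric] divide_simps)
 show ?thesis using has_integral_combine[OF x 1 2] by simp
qed

lemma mono_bounded_limit:
 fixes J :: "real => real"
 assumes m: "!!x y. 0 <= x ==> x <= y ==> J x <= J y" and b: "!!x. 0 <= x ==> J x <= B"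
 shows "\<exists>l. (J \<longlongrightarrow> l) at_top"
proof -
 define l where "l = (SUP x\<in>{0..}. J x)"
 have bdd: "bdd_above (J ` {0..})" using b by (intro bdd_aboveI[of _ B]) auto
 have "(J \<longlongrightarrow> l) at_top"
 proof (rule order_tendstoI)
 fix u assume "u < l"
 then obtain x where x: "0 <= x" "u < J x" unfolding l_def using less_cSUP_iff[OF _ bdd, of u] by auto
 have "u < J y" if "x <= y" for y using less_le_trans[OF x(2) m[OF x(1) that]] .
 then show "\<forall>\<^sub>F y in at_top. u < J y" unfolding eventually_at_top_linorder by (intro exI[of _ x] allI impI)
 next
 fix u assume u: "l < u"
 have "J y < u" if "0 <= y" for y
 proof -
 have "J y <= l" unfolding l_def using that bdd by (intro cSUP_upper) auto
 then show ?thesis using u by simp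
 qed
 then show "\<forall>\<^sub>F y in at_top. J y < u" unfolding eventually_at_top_linorder by (intro exI[of _ 0] allI impI)
 qed
 then show ?thesis by (rule exI)
qed

text \<open>Truncations symmetric about $0$ are needed, because the kernel is not absolutely
  integrable at infinity. After folding, the integrand has one sign and is dominated by the
  derivative of $8\arctan\sqrt u$.\<close>

lemma log_cauchy_kernel_limit:
 obtains G :: "real => real" and G0 :: real where "!!R. 0 < R ==> ((%u. ln (abs u)/(u + 1)) has_integral G R) {-R..R}" "(G \<longlongrightarrow> G0) at_top"
proof -
 let ?g = "%u::real. ln (abs u)/(u + 1)"
 have gb: "\<bar>?g u\<bar> <= 2*(1/sqrt \<bar>u - 0\<bar>)" for u
 proof (cases "u = 0")
 case False
 have l: "\<bar>ln (abs u)\<bar> <= 2 * \<bar>(abs u) - 1\<bar> / sqrt (abs u)" using abs_ln_le[of "(abs u)"] False by simp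
 have "\<bar>?g u\<bar> = \<bar>ln (abs u)\<bar> / \<bar>u + 1\<bar>" by (simp add: abs_divide)
 also have "... <= 2 * \<bar>(abs u) - 1\<bar> / sqrt (abs u)/\<bar>u + 1\<bar>" using l by (rule divide_right_mono) simp
 also have "... = 2*(1/sqrt (abs u))*(\<bar>(abs u) - 1\<bar> / \<bar>u + 1\<bar>)" by simp
 also have "... <= 2*(1/sqrt (abs u))*1"
 proof (rule mult_left_mono)
 show "\<bar>(abs u) - 1\<bar> / \<bar>u + 1\<bar> <= 1" by (cases "u + 1 = 0") (auto simp: divide_le_eq_1)
 qed simp
 finally show ?thesis by simp
 qed simp
 have int: "?g integrable_on {l..r}" if "l <= 0" "0 <= r" for l r :: real
 proof (rule measurable_bounded_by_integrable_imp_integrable_real)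
 show "?g \<in> borel_measurable (lebesgue_on {l..r})"
 by (rule borel_measurable_imp_lebesgue_on) measurable
 show "(%u. 2*(1/sqrt \<bar>u - 0\<bar>)) integrable_on {l..r}"
 using inv_sqrt_has_integral[OF that] by (intro integrable_on_mult_right) blast
 show "!!u. u \<in> {l..r} ==> \<bar>?g u\<bar> <= 2*(1/sqrt \<bar>u - 0\<bar>)" using gb by simp
 qed auto
 define j where "j u = - (?g u + ?g (- u))" for u
 have refl: "((%u. ?g (- u)) has_integral integral {-R..0} ?g) {0..R}" if "0 <= R" for R
 using integrable_integral[OF int[of "- R" 0]] that has_integral_reflect_real[of ?g _ 0 "- R"] by (simp only: minus_minus minus_zero)
 have jint: "(j has_integral - integral {-R..R} ?g) {0..R}" if "0 <= R" for R
 proof -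
 have "((%u. ?g u + ?g (- u)) has_integral integral {0..R} ?g + integral {-R..0} ?g) {0..R}"
 using integrable_integral[OF int[of 0 R]] refl[OF that] that by (intro has_integral_add) auto
 moreover have "integral {0..R} ?g + integral {-R..0} ?g = integral {-R..R} ?g"
 using Henstock_Kurzweil_Integration.integral_combine[of "- R" 0 R ?g] int[of "- R" R] that by simp
 ultimately show ?thesis unfolding j_def[abs_def] by (intro has_integral_neg) simp
 qed
 have jeq: "j u = - (ln u*2)/((1 - u)*(1 + u))" if "0 <= u" "u ~= 1" for u
 using that by (simp add: j_def divide_simps) (simp add: algebra_simps)
 have j1: "j 1 = 0" by (simp add: j_def)
 have j0: "0 <= j u & j u <= 4*(1/(sqrt u*(1 + u)))" if u: "0 <= u" for u
 proof (cases "u = 1 \<or> u = 0")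
 case True then show ?thesis using j1 by (auto simp: jeq)
 next
 case False
 then have u: "0 < u" "u ~= 1" using u by auto
 have sg: "0 <= j u"
 proof (cases "u < 1")
 case True
 then have "0 <= - (ln u*2)" "0 <= (1 - u)*(1 + u)" using u by auto
 then have "0 <= - (ln u*2)/((1 - u)*(1 + u))" by (rule divide_nonneg_nonneg)
 then show ?thesis using jeq u by simp
 next
 case False
 then have "(1 - u)*(1 + u) <= 0" "- (ln u*2) <= 0" using u by (auto intro!: mult_nonpos_nonneg)
 then have "0 <= - (ln u*2)/((1 - u)*(1 + u))" by (intro divide_nonpos_nonpos)
 then show ?thesis using jeq u by simp
 qed
 have "j u = \<bar>j u\<bar>" using sg by simp
 also have "... = \<bar>ln u\<bar> * 2/(\<bar>1 - u\<bar> * (1 + u))" using u by (simp add: jeq abs_mult abs_divide)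
 also have "... <= (2 * \<bar>u - 1\<bar> / sqrt u)*2/(\<bar>1 - u\<bar> * (1 + u))"
 using abs_ln_le[OF u(1)] u by (intro divide_right_mono mult_right_mono) auto
 also have "... = 4*(1/(sqrt u*(1 + u)))" using u by (simp add: abs_minus_commute)
 finally show ?thesis using sg by simp
 qed
 have bnd: "((%u. 4*(1/(sqrt u*(1 + u)))) has_integral 8 * arctan (sqrt R)) {0..R}" if R: "0 <= R" for R
 proof -
 have "((%u. 4*(1/(sqrt u*(1 + u)))) has_integral 8 * arctan (sqrt R) - 8 * arctan (sqrt 0)) {0..R}"
 proof (rule fundamental_theorem_of_calculus_interior[OF R])
 show "continuous_on {0..R} (%u. 8 * arctan (sqrt u))" by (intro continuous_intros)
 fix u assume u: "u \<in> {0<..<R}"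
 have "((%u. 8 * arctan (sqrt u)) has_real_derivative 8*(inverse (1 + (sqrt u)\<^sup>2)*(inverse (sqrt u)/2))) (at u)"
 using u by (auto intro!: derivative_eq_intros)
 moreover have "8*(inverse (1 + (sqrt u)\<^sup>2)*(inverse (sqrt u)/2)) = 4*(1/(sqrt u*(1 + u)))" using u by (simp add: divide_simps)
 ultimately show "((%u. 8 * arctan (sqrt u)) has_vector_derivative 4*(1/(sqrt u*(1 + u)))) (at u)"
 by (simp add: has_real_derivative_iff_has_vector_derivative)
 qed
 then show ?thesis by simp
 qed
 define J where "J R = - integral {-R..R} ?g" for R
 have "\<exists>l. (J \<longlongrightarrow> l) at_top"
 proof (rule mono_bounded_limit)
 fix x y :: real assume xy: "0 <= x" "x <= y"
 show "J x <= J y" unfolding J_def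
 by (rule has_integral_subset_le[OF _ jint jint]) (use xy j0 in auto)
 next
 fix x :: real assume x: "0 <= x"
 have "J x <= 8 * arctan (sqrt x)" unfolding J_def
 by (rule has_integral_le[OF jint[OF x] bnd[OF x]]) (use j0 in auto)
 also have "... <= 8*(pi/2)" using arctan_ubound[of "sqrt x"] by simp
 finally show "J x <= 8*(pi/2)" .
 qed
 then obtain l where "(J \<longlongrightarrow> l) at_top" by (elim exE)
 then have lim: "((%R. integral {-R..R} ?g) \<longlongrightarrow> - l) at_top" unfolding J_def[abs_def] using tendsto_minus by fastforce
 show thesis
 by (rule that[OF _ lim]) (rule integrable_integral, rule int, auto)
qed

context eigenfunction
begin

lemma local_lipschitz_mono: "local_lipschitz x dl M ==> 0 < dl' ==> dl' <= dl ==> local_lipschitz x dl' M"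
 by (simp add: local_lipschitz_def)

lemma local_lipschitz_at:
 assumes x: "a 2 < x" "x < a 3" and ka: "0 < ka"
 obtains dl M where "dl <= ka" "a 2 < x - dl" "x + dl < a 3" "local_lipschitz x dl M"
proof -
 obtain dl M where dl: "0 < dl" "a 2 < x - dl" "x + dl < a 3" and l: "local_lipschitz x dl M"
 using compact_local_lipschitz[OF x(1) order_refl x(2)] by (metis order_refl)
 show thesis
 by (rule that[of "min dl ka", OF _ _ _ local_lipschitz_mono[OF l]]) (use dl ka in auto)
qed

definition f2 where "f2 = Lim (at_right (a 2)) f"

text \<open>The Cauchy integral of a function with a jump has a logarithmic singularity; here the
  function is $f_2$ to the right of $a_2$ and zero to the left.\<close>

lemma near_a2:
 obtains ta C where "0 < ta" "ta <= half_gap" "0 <= C"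
 "!!t. 0 < t ==> t <= ta ==> norm (q (a 2 + t)) <= C * sqrt t"
 "!!t. 0 < t ==> t <= ta ==> norm (f (a 2 + t) - f2) <= C * sqrt t"
 "!!t. 0 < t ==> t <= ta ==> norm (of_real pi * HT a f (a 2 + t) + f2 * of_real (ln t)) <= C"
proof -
 obtain ta0 C0 F2 where ta0: "0 < ta0" "ta0 <= half_gap" and C0: "0 <= C0"
 and bq: "!!t. 0 < t ==> t <= ta0 ==> norm (q (a 2 + t)) <= C0 * sqrt t"
 and hol: "!!s t. 0 < s ==> 0 < t ==> s <= ta0 ==> t <= ta0 ==> norm (f (a 2 + t) - f (a 2 + s)) <= C0 * sqrt \<bar>t - s\<bar>"
 and bf: "!!t. 0 < t ==> t <= ta0 ==> norm (f (a 2 + t) - F2) <= C0 * sqrt t"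
 using expansion_a2 by metis
 have "(f \<longlongrightarrow> F2) (at_right (a 2))"
 proof (rule LIM_zero_cancel, rule Lim_null_comparison)
 show "((%y. C0 * sqrt \<bar>y - a 2\<bar>) \<longlongrightarrow> 0) (at_right (a 2))" by (rule tendsto_eq_intros | simp)+
 show "\<forall>\<^sub>F y in at_right (a 2). norm (f y - F2) <= C0 * sqrt \<bar>y - a 2\<bar>"
 unfolding eventually_at_right_field
 proof (intro exI[of _ "a 2 + ta0"] conjI allI impI)
 fix y assume "a 2 < y" "y < a 2 + ta0"
 then show "norm (f y - F2) <= C0 * sqrt \<bar>y - a 2\<bar>" using bf[of "y - a 2"] by simp
 qed (use ta0 in simp)
 qed
 then have F2: "f2 = F2" unfolding f2_def by (intro tendsto_Lim) simp_all
 define ta where "ta = min (ta0/2) 1"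
 have ta: "0 < ta" "ta <= 1" "2 * ta <= ta0" using ta0 by (auto simp: ta_def)
 define be where "be = a 2 + ta0"
 have be: "a 2 < be" "be < a 3" using ta0 half_gap by (auto simp: be_def)
 define I where "I = integral {a 2..a 4} (%y. norm (f y))"
 have fi: "(%y. norm (f y)) integrable_on {a 2..a 4}" using f_abs_integrable by (simp add: absolutely_integrable_on_def)
 define D where "D = C0*(4 * sqrt ta0) + I/ta"
 have I0: "0 <= I" unfolding I_def by (intro integral_nonneg fi) simp
 have D0: "0 <= D" unfolding D_def using C0 I0 ta ta0 by auto
 have wD: "norm (integral {a 2..a 4} (w (a 2) be x)) <= D"
 if t: "0 < t" "t <= ta" and x: "x = a 2 + t" and l: "local_lipschitz x dl M" "a 2 <= x - dl" "x + dl <= be" for t x dl M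
 proof -
 have xb: "a 2 <= x" "x <= be" using t ta by (auto simp: x be_def)
 define g where "g y = C0*(if y \<in> {a 2..be} then 1/sqrt \<bar>y - x\<bar> else 0) + norm (f y)/ta" for y
 have S: "((%y. if y \<in> {a 2..be} then 1/sqrt \<bar>y - x\<bar> else 0) has_integral 2 * sqrt (x - a 2) + 2 * sqrt (be - x)) {a 2..a 4}"
 using inv_sqrt_has_integral[OF xb] be a34 by (subst has_integral_restrict) auto
 have g: "(g has_integral C0*(2 * sqrt (x - a 2) + 2 * sqrt (be - x)) + I/ta) {a 2..a 4}"
 unfolding g_def[abs_def] I_def by (intro has_integral_add has_integral_mult_right[OF S] has_integral_divide integrable_integral fi)
 define g' where "g' y = (if y = a 2 then norm (w (a 2) be x y) else g y)" for y
 have g': "(g' has_integral C0*(2 * sqrt (x - a 2) + 2 * sqrt (be - x)) + I/ta) {a 2..a 4}"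
 by (rule has_integral_spike_finite[OF _ _ g, of "{a 2}"]) (auto simp: g'_def)
 have wi: "w (a 2) be x integrable_on {a 2..a 4}" using w_abs_integrable[OF l] by (simp add: absolutely_integrable_on_def)
 have "norm (integral {a 2..a 4} (w (a 2) be x)) <= integral {a 2..a 4} g'"
 proof (rule integral_norm_bound_integral[OF wi])
 show "g' integrable_on {a 2..a 4}" using g' by blast
 fix y assume y: "y \<in> {a 2..a 4}"
 show "norm (w (a 2) be x y) <= g' y"
 proof (cases "y = a 2 \<or> y = x")
 case True
 moreover have "0 <= g x" using C0 ta unfolding g_def by (intro add_nonneg_nonneg mult_nonneg_nonneg divide_nonneg_nonneg) auto
 ultimately show ?thesis using t by (auto simp: g'_def w_def x)
 next
 case False
 have n: "norm (w (a 2) be x y) = norm (f y - (if a 2 < y & y < be then f x else 0))/\<bar>y - x\<bar>" by (simp only: w_def norm_divide norm_of_real real_norm_def)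
 show ?thesis
 proof (cases "y < be")
 case True
 have "norm (f (a 2 + (y - a 2)) - f (a 2 + t)) <= C0 * sqrt \<bar>(y - a 2) - t\<bar>"
 using True False y t ta ta0 by (intro hol) (auto simp: be_def)
 then have "norm (f y - f x) <= C0 * sqrt \<bar>y - x\<bar>" by (simp add: x algebra_simps)
 then have "norm (w (a 2) be x y) <= C0 * sqrt \<bar>y - x\<bar> / \<bar>y - x\<bar>" unfolding n using True False y by (simp add: divide_right_mono)
 also have "... = C0*(1/sqrt \<bar>y - x\<bar>)"
 using real_div_sqrt[of "\<bar>y - x\<bar>"] real_sqrt_mult_self[of "\<bar>y - x\<bar>"] False by (simp add: divide_simps)
 also have "... <= g y" unfolding g_def using True y C0 ta by simp
 finally show ?thesis using False by (simp add: g'_def)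
 next
 case f: False
 then have "ta <= \<bar>y - x\<bar>" using t ta by (auto simp: be_def x)
 then have "norm (w (a 2) be x y) <= norm (f y)/ta" unfolding n using f ta by (auto intro!: divide_left_mono mult_pos_pos)
 also have "... <= g y" unfolding g_def using C0 by simp
 finally show ?thesis using False by (simp add: g'_def)
 qed
 qed
 qed
 also have "... = C0*(2 * sqrt (x - a 2) + 2 * sqrt (be - x)) + I/ta" by (rule integral_unique[OF g'])
 also have "... <= D"
 proof -
 have "sqrt (x - a 2) <= sqrt ta0" "sqrt (be - x) <= sqrt ta0" using t ta by (auto simp: x be_def)
 then have "2 * sqrt (x - a 2) + 2 * sqrt (be - x) <= 4 * sqrt ta0" by linarith
 then show ?thesis unfolding D_def using C0 by (intro add_right_mono mult_left_mono) auto
 qed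
 finally show ?thesis .
 qed
 define E where "E = D + (norm f2 + C0)*(\<bar>ln ta0\<bar> + \<bar>ln (ta0/2)\<bar>) + C0*2"
 have main: "norm (of_real pi * HT a f (a 2 + t) + f2 * of_real (ln t)) <= E" if t: "0 < t" "t <= ta" for t
 proof -
 define x where "x = a 2 + t"
 have x: "a 2 < x" "x < a 3" using t ta be by (auto simp: x_def be_def)
 obtain dl M where dl: "dl <= ta" "a 2 < x - dl" and l: "local_lipschitz x dl M" using local_lipschitz_at[OF x ta(1)] by metis
 have J: "a 2 <= x - dl" "x + dl <= be" "a 2 <= a 2" "be <= a 4" using dl t ta be a34 by (auto simp: x_def be_def)
 have st: "sqrt t <= 1" using t ta by simp
 have ft: "norm (f x - f2) <= C0 * sqrt t" using bf[of t] t ta ta0 by (simp add: x_def F2)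
 also have "... <= C0" using C0 st by (simp add: mult_left_le)
 finally have fx: "norm (f x) <= norm f2 + C0" using norm_triangle_sub[of "f x" f2] by linarith
 have lt: "sqrt t * \<bar>ln t\<bar> <= 2"
 proof -
 have "sqrt t * \<bar>ln t\<bar> <= sqrt t*(2 * \<bar>t - 1\<bar> / sqrt t)" using abs_ln_le[OF t(1)] by (rule mult_left_mono) (use t in simp)
 also have "... = 2 * \<bar>t - 1\<bar>" using t by simp
 finally show ?thesis using t ta by auto
 qed
 have bx: "be - x = ta0 - t" "x - a 2 = t" by (simp_all add: be_def x_def)
 have lb: "\<bar>ln (ta0 - t)\<bar> <= \<bar>ln ta0\<bar> + \<bar>ln (ta0/2)\<bar>"
 proof -
 have "ln (ta0 - t) <= ln ta0" "ln (ta0/2) <= ln (ta0 - t)" using t ta ta0 by (subst ln_le_cancel_iff; simp)+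
 then show ?thesis by linarith
 qed
 have "of_real pi * HT a f x + f2 * of_real (ln t) = integral {a 2..a 4} (w (a 2) be x) + f x * of_real (ln (ta0 - t)) - (f x - f2) * of_real (ln t)"
 unfolding HT_formula[OF x l J] bx using t ta ta0 by (simp add: ln_div algebra_simps)
 also have "norm ... <= norm (integral {a 2..a 4} (w (a 2) be x)) + norm (f x * of_real (ln (ta0 - t))) + norm ((f x - f2) * of_real (ln t))"
 by (rule order_trans[OF norm_triangle_ineq4 add_right_mono[OF norm_triangle_ineq]])
 also have "... <= D + (norm f2 + C0)*(\<bar>ln ta0\<bar> + \<bar>ln (ta0/2)\<bar>) + C0*2"
 proof (intro add_mono)
 show "norm (integral {a 2..a 4} (w (a 2) be x)) <= D" by (rule wD[OF t x_def l J(1,2)])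
 show "norm (f x * of_real (ln (ta0 - t))) <= (norm f2 + C0)*(\<bar>ln ta0\<bar> + \<bar>ln (ta0/2)\<bar>)"
 unfolding norm_mult norm_of_real using fx lb C0 by (intro mult_mono) auto
 have "norm ((f x - f2) * of_real (ln t)) <= (C0 * sqrt t) * \<bar>ln t\<bar>"
 unfolding norm_mult norm_of_real using ft by (intro mult_right_mono) auto
 also have "... <= C0*2" using mult_left_mono[OF lt C0] by (simp add: mult_ac)
 finally show "norm ((f x - f2) * of_real (ln t)) <= C0*2" .
 qed
 finally show ?thesis by (simp add: x_def E_def)
 qed
 have EC: "0 <= E" using D0 C0 unfolding E_def by auto
 show thesis
 proof (rule that[of ta "C0 + E"])
 fix t assume t: "0 < t" "t <= ta"
 then have t0: "t <= ta0" using ta by linarith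
 have "C0 * sqrt t <= (C0 + E) * sqrt t" using EC t by (intro mult_right_mono) auto
 then show "norm (q (a 2 + t)) <= (C0 + E) * sqrt t" "norm (f (a 2 + t) - f2) <= (C0 + E) * sqrt t"
 using bq[OF t(1) t0] bf[OF t(1) t0] by (auto simp: F2)
 show "norm (of_real pi * HT a f (a 2 + t) + f2 * of_real (ln t)) <= C0 + E" using main[OF t] C0 by linarith
 qed (use ta ta0 C0 EC in auto)
qed

end

context eigenfunction
begin

text \<open>The density has a logarithmic singularity at $a_3$, but it is symmetric, so its
  principal value stays bounded. The regular part is translated and the logarithmic part is
  scaled, so that each converges with a fixed dominating function.\<close>

lemma HT_limit_exists_a3: "\<exists>h. (HT a f \<longlongrightarrow> h) (at_left (a 3))"
proof -
 obtain rh C c where rh: "0 < rh" "rh < half_gap" "rh < a 4 - a 3" and C: "0 <= C"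
 and bf: "!!y. 0 < \<bar>y - a 3\<bar> ==> \<bar>y - a 3\<bar> <= rh ==> norm (f y - d3 * of_real (ln \<bar>y - a 3\<bar>) - c) <= C * sqrt \<bar>y - a 3\<bar>"
 and hol0: "!!x y. 0 < \<bar>x - a 3\<bar> ==> \<bar>x - a 3\<bar> <= rh ==> 0 < \<bar>y - a 3\<bar> ==> \<bar>y - a 3\<bar> <= rh ==>
 norm ((f y - d3 * of_real (ln \<bar>y - a 3\<bar>)) - (f x - d3 * of_real (ln \<bar>x - a 3\<bar>))) <= C * sqrt \<bar>y - x\<bar>"
 using expansion_a3 by metis
 define r where "r y = (if y = a 3 then c else f y - d3 * of_real (ln \<bar>y - a 3\<bar>))" for y
 have hol: "norm (r y - r x) <= C * sqrt \<bar>y - x\<bar>" if "\<bar>x - a 3\<bar> <= rh" "\<bar>y - a 3\<bar> <= rh" for x y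
 proof (cases "x = a 3 \<or> y = a 3")
 case True
 then show ?thesis
 proof (elim disjE)
 assume "x = a 3" then show ?thesis using bf[of y] that by (cases "y = a 3") (simp_all add: r_def)
 next
 assume "y = a 3" then show ?thesis using bf[of x] that by (cases "x = a 3") (simp_all add: r_def norm_minus_commute abs_minus_commute)
 qed
 next
 case False then show ?thesis using hol0[of x y] that by (simp add: r_def)
 qed
 define al be where ab: "al = a 3 - rh" "be = a 3 + rh"
 have ab': "a 2 < al" "be < a 4" using rh half_gap by (auto simp: ab)
 obtain G :: "real => real" and G0 :: real where G: "!!R. 0 < R ==> ((%u. ln (abs u)/(u + 1)) has_integral G R) {-R..R}" and G0: "(G \<longlongrightarrow> G0) at_top"
 by (rule log_cauchy_kernel_limit, rule that)
 (* outside the interval; the logarithm, to be scaled; the regular part, to be translated *)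
 define kO where "kO x y = (if al < y & y < be then 0 else 1/complex_of_real (y - x))" for x y
 define kL where "kL x y = ln (\<bar>y - a 3\<bar> / (a 3 - x))/(y - x)" for x y
 define kR where "kR x y = (r y - r x)/of_real (y - x)" for x y
 define KR where "KR x v = (if v \<in> {al - x..be - x} & (abs v) ~= rh then (r (v + x) - r x)/of_real v else 0)" for x v
 have kL: "(kL x has_integral G (rh/(a 3 - x))) {al..be}" if x: "x < a 3" for x
 proof -
 define s where "s = a 3 - x"
 have s: "0 < s" using x by (simp add: s_def)
 have "((%y. ln \<bar>(1/s) *\<^sub>R y + - a 3/s\<bar> / ((1/s) *\<^sub>R y + - a 3/s + 1)) has_integral G (rh/s) /\<^sub>R (1/s) ^ DIM(real))
 (cbox ((- (rh/s) - - a 3/s) /\<^sub>R (1/s)) ((rh/s - - a 3/s) /\<^sub>R (1/s)))"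
 using has_integral_affinity'[of "%u. ln (abs u)/(u + 1)" "G (rh/s)" "- (rh/s)" "rh/s" "1/s" "- a 3/s"] G[of "rh/s"] s rh
 by simp
 moreover have "(- (rh/s) - - a 3/s) /\<^sub>R (1/s) = al" "(rh/s - - a 3/s) /\<^sub>R (1/s) = be" using s by (simp_all add: ab field_simps)
 ultimately have "((%y. ln \<bar>(1/s) *\<^sub>R y + - a 3/s\<bar> / ((1/s) *\<^sub>R y + - a 3/s + 1)) has_integral s * G (rh/s)) {al..be}"
 by simp
 then have "((%y. 1/s*(ln \<bar>(1/s) *\<^sub>R y + - a 3/s\<bar> / ((1/s) *\<^sub>R y + - a 3/s + 1))) has_integral 1/s*(s * G (rh/s))) {al..be}"
 by (rule has_integral_mult_right)
 moreover have "1/s*(ln \<bar>(1/s) *\<^sub>R y + - a 3/s\<bar> / ((1/s) *\<^sub>R y + - a 3/s + 1)) = kL x y" for y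
 proof -
 have e: "(1/s) *\<^sub>R y + - a 3/s = (y - a 3)/s" using s by (simp add: field_simps)
 have "s*((y - a 3)/s + 1) = y - x" using s by (simp add: field_simps s_def)
 then show ?thesis unfolding e kL_def s_def[symmetric] using s by (simp add: abs_divide)
 qed
 ultimately show ?thesis using s by (simp add: s_def)
 qed
 have formula: "of_real pi * HT a f x = integral {a 2..a 4} (%y. f y * kO x y) + d3 * of_real (G (rh/(a 3 - x))) + integral {-2*rh..2*rh} (KR x)
 + f x * of_real (ln ((be - x)/(x - al)))"
 and iO: "(%y. f y * kO x y) integrable_on {a 2..a 4}" and iR: "KR x integrable_on {-2*rh..2*rh}"
 and kOb: "!!y. norm (kO x y) <= 2/rh"
 if x: "a 3 - rh/2 < x" "x < a 3" for x
 proof -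
 have x': "a 2 < x" using x ab' rh by (simp add: ab)
 have "0 < rh/2" using rh by simp
 then obtain dl M where dl: "dl <= rh/2" and l: "local_lipschitz x dl M" using local_lipschitz_at[OF x' x(2)] by metis
 have J: "al <= x - dl" "x + dl <= be" "a 2 <= al" "be <= a 4" using dl x ab' rh by (auto simp: ab)
 show kOb: "norm (kO x y) <= 2/rh" for y
 proof (cases "al < y & y < be")
 case False
 then have "rh/2 <= \<bar>y - x\<bar>" using x rh by (auto simp: ab)
 then have "1/\<bar>y - x\<bar> <= 1/(rh/2)" using rh by (intro divide_left_mono) (auto intro!: mult_pos_pos)
 moreover have "norm (kO x y) = 1/\<bar>y - x\<bar>" using False by (simp only: kO_def norm_divide norm_of_real if_False norm_one)
 ultimately show ?thesis by simp
 qed (use rh in \<open>simp add: kO_def\<close>)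
 have kOm: "kO x \<in> borel_measurable borel" unfolding kO_def[abs_def] by measurable
 show iO: "(%y. f y * kO x y) integrable_on {a 2..a 4}"
 using f_kernel_abs_integrable[OF kOm kOb] by (simp add: absolutely_integrable_on_def)
 have wi: "w al be x integrable_on {a 2..a 4}" using w_abs_integrable[OF l J(1,2)] by (simp add: absolutely_integrable_on_def)
 have "((%y. w al be x y - f y * kO x y) has_integral integral {a 2..a 4} (w al be x) - integral {a 2..a 4} (%y. f y * kO x y)) {a 2..a 4}"
 by (intro has_integral_diff integrable_integral wi iO)
 then have "((%y. if y \<in> {al..be} then d3 * of_real (kL x y) + kR x y else 0) has_integral integral {a 2..a 4} (w al be x) - integral {a 2..a 4} (%y. f y * kO x y)) {a 2..a 4}"
 proof (rule has_integral_spike_finite[rotated 2])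
 show "finite {a 3, al, be}" by simp
 fix y assume y: "y \<in> {a 2..a 4} - {a 3, al, be}"
 show "(if y \<in> {al..be} then d3 * of_real (kL x y) + kR x y else 0) = w al be x y - f y * kO x y"
 proof (cases "al < y & y < be")
 case True
 have L: "ln (\<bar>y - a 3\<bar> / (a 3 - x)) = ln \<bar>y - a 3\<bar> - ln (a 3 - x)" using y x by (simp add: ln_div)
 have "f y - f x = (r y - r x) + d3 * of_real (ln (\<bar>y - a 3\<bar> / (a 3 - x)))"
 unfolding L using y x by (simp add: r_def algebra_simps)
 then have "w al be x y = d3 * of_real (kL x y) + kR x y" using True unfolding w_def kL_def kR_def by (simp add: add_divide_distrib)
 then show ?thesis using True by (simp add: kO_def)
 next
 case False
 then show ?thesis using y by (auto simp: w_def kO_def)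
 qed
 qed
 then have "((%y. d3 * of_real (kL x y) + kR x y) has_integral integral {a 2..a 4} (w al be x) - integral {a 2..a 4} (%y. f y * kO x y)) {al..be}"
 using J by (subst (asm) has_integral_restrict) auto
 from has_integral_diff[OF this has_integral_mult_right[OF has_integral_of_real[OF kL[OF x(2)]], of d3]]
 have "(kR x has_integral integral {a 2..a 4} (w al be x) - integral {a 2..a 4} (%y. f y * kO x y) - d3 * of_real (G (rh/(a 3 - x)))) {al..be}"
 by simp
 from has_integral_shift_real_ivl[OF this, of x]
 have "((%v. kR x (v + x)) has_integral integral {a 2..a 4} (w al be x) - integral {a 2..a 4} (%y. f y * kO x y) - d3 * of_real (G (rh/(a 3 - x)))) {al - x..be - x}" .
 moreover have "{al - x..be - x} \<subseteq> {-2*rh..2*rh}" using x rh by (auto simp: ab)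
 ultimately have "((%v. if v \<in> {al - x..be - x} then kR x (v + x) else 0) has_integral integral {a 2..a 4} (w al be x) - integral {a 2..a 4} (%y. f y * kO x y) - d3 * of_real (G (rh/(a 3 - x)))) {-2*rh..2*rh}"
 by (subst has_integral_restrict) auto
 then have K: "(KR x has_integral integral {a 2..a 4} (w al be x) - integral {a 2..a 4} (%y. f y * kO x y) - d3 * of_real (G (rh/(a 3 - x)))) {-2*rh..2*rh}"
 by (rule has_integral_spike_finite[rotated 2, where S="{- rh, rh}"]) (auto simp: KR_def kR_def)
 then show "KR x integrable_on {-2*rh..2*rh}" by blast
 show "of_real pi * HT a f x = integral {a 2..a 4} (%y. f y * kO x y) + d3 * of_real (G (rh/(a 3 - x))) + integral {-2*rh..2*rh} (KR x)
 + f x * of_real (ln ((be - x)/(x - al)))"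
 unfolding HT_formula[OF x' x(2) l J] integral_unique[OF K] by simp
 qed
 define K0 where "K0 v = (if (abs v) < rh then (r (v + a 3) - r (a 3))/of_real v else 0)" for v
 define h where "h = (integral {a 2..a 4} (%y. f y * kO (a 3) y) + d3 * of_real G0 + integral {-2*rh..2*rh} K0)/of_real pi"
 have "(HT a f \<longlongrightarrow> h) (at_left (a 3))"
 proof (rule tendsto_at_left_sequentially)
 show "a 3 - rh/2 < a 3" using rh by simp
 fix x assume x: "!!n::nat. x n < a 3" "!!n. a 3 - rh/2 < x n" and lim: "x \<longlonglongrightarrow> a 3"
 have rlim: "(%n. r (v + x n)) \<longlonglongrightarrow> r (v + a 3)" if v: "(abs v) < rh" for v
 proof (rule LIM_zero_cancel, rule Lim_null_comparison)
 have vl: "(%n. v + x n - a 3) \<longlonglongrightarrow> v" using tendsto_diff[OF tendsto_add[OF tendsto_const[of v] lim] tendsto_const[of "a 3"]] by simp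
 have "\<forall>\<^sub>F n in sequentially. \<bar>v + x n - a 3\<bar> < rh" using order_tendstoD(2)[OF tendsto_rabs[OF vl] v] .
 then show "\<forall>\<^sub>F n in sequentially. norm (r (v + x n) - r (v + a 3)) <= C * sqrt \<bar>x n - a 3\<bar>"
 proof (rule eventually_mono)
 fix n assume "\<bar>v + x n - a 3\<bar> < rh"
 then show "norm (r (v + x n) - r (v + a 3)) <= C * sqrt \<bar>x n - a 3\<bar>"
 using hol[of "v + a 3" "v + x n"] v by (simp add: algebra_simps)
 qed
 have "(%n. C * sqrt \<bar>x n - a 3\<bar>) \<longlonglongrightarrow> C * sqrt \<bar>a 3 - a 3\<bar>" by (intro tendsto_intros lim)
 then show "(%n. C * sqrt \<bar>x n - a 3\<bar>) \<longlonglongrightarrow> 0" by simp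
 qed
 have tO: "(%n. integral {a 2..a 4} (%y. f y * kO (x n) y)) \<longlonglongrightarrow> integral {a 2..a 4} (%y. f y * kO (a 3) y)"
 proof (rule dominated_convergence(2)[where h="%y. norm (f y)*(2/rh)"])
 show "(%y. f y * kO (x n) y) integrable_on {a 2..a 4}" for n by (rule iO[OF x(2) x(1)])
 show "(%y. norm (f y)*(2/rh)) integrable_on {a 2..a 4}"
 using f_abs_integrable by (intro integrable_on_mult_left) (simp add: absolutely_integrable_on_def)
 show "norm (f y * kO (x n) y) <= norm (f y)*(2/rh)" for n y
 unfolding norm_mult by (intro mult_left_mono kOb[OF x(2) x(1)]) simp
 show "(%n. f y * kO (x n) y) \<longlonglongrightarrow> f y * kO (a 3) y" for y
 proof (cases "al < y & y < be")
 case False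
 then have "complex_of_real (y - a 3) ~= 0" using rh by (auto simp: ab simp del: of_real_diff)
 then have "(%n. f y*(1/complex_of_real (y - x n))) \<longlonglongrightarrow> f y*(1/complex_of_real (y - a 3))" by (intro tendsto_intros lim)
 moreover have k: "kO x' y = 1/complex_of_real (y - x')" for x' unfolding kO_def by (rule if_not_P[OF False])
 ultimately show ?thesis unfolding k by simp
 qed (simp add: kO_def)
 qed
 have tR: "(%n. integral {-2*rh..2*rh} (KR (x n))) \<longlonglongrightarrow> integral {-2*rh..2*rh} K0"
 proof (rule dominated_convergence(2)[where h="%v. C*(1/sqrt \<bar>v - 0\<bar>)"])
 show "KR (x n) integrable_on {-2*rh..2*rh}" for n by (rule iR[OF x(2) x(1)])
 show "(%v. C*(1/sqrt \<bar>v - 0\<bar>)) integrable_on {-2*rh..2*rh}"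
 by (intro integrable_on_mult_right has_integral_integrable[OF inv_sqrt_has_integral]) (use rh in auto)
 show "norm (KR (x n) v) <= C*(1/sqrt \<bar>v - 0\<bar>)" for n v
 proof (cases "v \<in> {al - x n..be - x n} & (abs v) ~= rh & v ~= 0")
 case True
 then have "norm (r (v + x n) - r (x n)) <= C * sqrt (abs v)"
 using hol[of "x n" "v + x n"] x(1)[of n] x(2)[of n] rh by (auto simp: ab)
 then have "norm (KR (x n) v) <= C * sqrt (abs v)/(abs v)" using True by (simp add: KR_def norm_divide divide_right_mono)
 also have "... = C*(1/sqrt \<bar>v - 0\<bar>)"
 using real_sqrt_mult_self[of "(abs v)"] True by (simp add: divide_simps)
 finally show ?thesis .
 next
 case False then have "KR (x n) v = 0" by (auto simp: KR_def)
 then show ?thesis using C by simp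
 qed
 show "(%n. KR (x n) v) \<longlonglongrightarrow> K0 v" for v
 proof -
 have la: "(%n. al - x n) \<longlonglongrightarrow> - rh" "(%n. be - x n) \<longlonglongrightarrow> rh"
 using tendsto_diff[OF tendsto_const lim, of al] tendsto_diff[OF tendsto_const lim, of be] by (simp_all add: ab)
 consider "(abs v) = rh" | "(abs v) < rh" | "rh < v" | "v < - rh" by linarith
 then show ?thesis
 proof cases
 case 1 then show ?thesis by (simp add: KR_def K0_def)
 next
 case 2
 have "\<forall>\<^sub>F n in sequentially. al - x n < v" by (rule order_tendstoD(2)[OF la(1)]) (use 2 in linarith)
 moreover have "\<forall>\<^sub>F n in sequentially. v < be - x n" by (rule order_tendstoD(1)[OF la(2)]) (use 2 in linarith)
 ultimately have ev: "\<forall>\<^sub>F n in sequentially. (r (v + x n) - r (x n))/of_real v = KR (x n) v"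
 by eventually_elim (use 2 in \<open>simp add: KR_def\<close>)
 have "(%n. r (x n)) \<longlonglongrightarrow> r (a 3)" using rlim[of 0] rh by simp
 then have "(%n. (r (v + x n) - r (x n))/of_real v) \<longlonglongrightarrow> (r (v + a 3) - r (a 3))/of_real v"
 using rlim[OF 2] by (cases "v = 0") (auto intro!: tendsto_intros)
 from Lim_transform_eventually[OF this ev] show ?thesis using 2 by (simp add: K0_def)
 next
 case 3
 have "\<forall>\<^sub>F n in sequentially. be - x n < v" by (rule order_tendstoD(2)[OF la(2) 3])
 then have "\<forall>\<^sub>F n in sequentially. 0 = KR (x n) v" by eventually_elim (simp add: KR_def)
 from Lim_transform_eventually[OF tendsto_const this] show ?thesis using 3 rh by (simp add: K0_def)
 next
 case 4
 have "\<forall>\<^sub>F n in sequentially. v < al - x n" by (rule order_tendstoD(1)[OF la(1) 4])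
 then have "\<forall>\<^sub>F n in sequentially. 0 = KR (x n) v" by eventually_elim (simp add: KR_def)
 from Lim_transform_eventually[OF tendsto_const this] show ?thesis using 4 rh by (simp add: K0_def)
 qed
 qed
 qed
 have sl: "filterlim (%n. a 3 - x n) (at_right 0) sequentially"
 unfolding filterlim_at using tendsto_diff[OF tendsto_const[of "a 3"] lim] x(1) by (simp add: less_imp_neq[THEN not_sym])
 have tG: "(%n. complex_of_real (G (rh/(a 3 - x n)))) \<longlonglongrightarrow> of_real G0"
 proof (rule tendsto_of_real, rule filterlim_compose[OF G0])
 have "filterlim (%s. rh/s) at_top (at_right 0)" using rh by real_asymp
 then show "filterlim (%n. rh/(a 3 - x n)) at_top sequentially" using sl by (rule filterlim_compose)
 qed
 have tf: "(%n. f (x n) * of_real (ln ((be - x n)/(x n - al)))) \<longlonglongrightarrow> 0"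
 proof -
 have xl: "filterlim x (at (a 3)) sequentially" unfolding filterlim_at using lim x(1) by (simp add: less_imp_neq)
 have 1: "(%n. f (x n) * of_real (x n - a 3)) \<longlonglongrightarrow> 0" by (rule filterlim_compose[OF f_vanishing_at_singularities(2) xl])
 have "((%s. ln ((rh + s)/(rh - s))/s) \<longlongrightarrow> 2/rh) (at_right 0)" using rh by real_asymp (simp add: field_simps)
 from filterlim_compose[OF this sl] have "(%n. complex_of_real (ln ((rh + (a 3 - x n))/(rh - (a 3 - x n)))/(a 3 - x n))) \<longlonglongrightarrow> of_real (2/rh)" by (rule tendsto_of_real)
 from tendsto_minus[OF tendsto_mult[OF 1 this]]
 have "(%n. - (f (x n) * of_real (x n - a 3) * of_real (ln ((rh + (a 3 - x n))/(rh - (a 3 - x n)))/(a 3 - x n)))) \<longlonglongrightarrow> 0" by simp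
 moreover have "- (f (x n) * of_real (x n - a 3) * of_real (ln ((rh + (a 3 - x n))/(rh - (a 3 - x n)))/(a 3 - x n))) = f (x n) * of_real (ln ((be - x n)/(x n - al)))" for n
 proof -
 have nz: "complex_of_real (a 3 - x n) ~= 0" using x(1)[of n] by (simp del: of_real_diff)
 have e1: "complex_of_real (x n - a 3) = - of_real (a 3 - x n)" by simp
 have e2: "(rh + (a 3 - x n))/(rh - (a 3 - x n)) = (be - x n)/(x n - al)" by (simp add: ab algebra_simps)
 have alg: "- (g * - S*(L/S)) = g * L" if "S ~= 0" for g S L :: complex using that by simp
 show ?thesis unfolding e1 e2 of_real_divide[of "ln ((be - x n)/(x n - al))"] by (rule alg[OF nz])
 qed
 ultimately show ?thesis by simp
 qed
 have "(%n. (integral {a 2..a 4} (%y. f y * kO (x n) y) + d3 * of_real (G (rh/(a 3 - x n))) + integral {-2*rh..2*rh} (KR (x n))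
 + f (x n) * of_real (ln ((be - x n)/(x n - al))))/of_real pi) \<longlonglongrightarrow>
 (integral {a 2..a 4} (%y. f y * kO (a 3) y) + d3 * of_real G0 + integral {-2*rh..2*rh} K0 + 0)/of_real pi"
 by (intro tendsto_intros tO tG tR tf) simp
 then have "(%n. of_real pi * HT a f (x n)/of_real pi) \<longlonglongrightarrow> h" unfolding formula[OF x(2) x(1), symmetric] h_def by simp
 then show "(%n. HT a f (x n)) \<longlonglongrightarrow> h" by simp
 qed
 then show ?thesis by (rule exI)
qed

definition h3 where "h3 = Lim (at_left (a 3)) (HT a f)"

lemma h3: "(HT a f \<longlongrightarrow> h3) (at_left (a 3))"
proof -
 obtain h where h: "(HT a f \<longlongrightarrow> h) (at_left (a 3))" using HT_limit_exists_a3 by (elim exE)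
 then have "h3 = h" unfolding h3_def by (intro tendsto_Lim) simp_all
 with h show ?thesis by simp
qed

lemma near_a3:
 obtains rh C where "0 < rh" "rh < half_gap" "rh <= 1" "rh < a 4 - a 3" "0 <= C"
 "!!y. 0 < \<bar>y - a 3\<bar> ==> \<bar>y - a 3\<bar> <= rh ==> norm (f y - d3 * of_real (ln \<bar>y - a 3\<bar>)) <= C"
 "!!t. 0 < t ==> t <= rh ==> norm (HT a f (a 3 - t)) <= C"
 "!!t. 0 < t ==> t <= rh ==> norm (q (a 3 - t)) <= C"
proof -
 obtain rh0 C0 c where rh0: "0 < rh0" "rh0 < half_gap" "rh0 < a 4 - a 3" and C0: "0 <= C0"
 and bq: "!!y. 0 < \<bar>y - a 3\<bar> ==> \<bar>y - a 3\<bar> <= rh0 ==> norm (q y - q3) <= C0 * sqrt \<bar>y - a 3\<bar>"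
 and bf: "!!y. 0 < \<bar>y - a 3\<bar> ==> \<bar>y - a 3\<bar> <= rh0 ==> norm (f y - d3 * of_real (ln \<bar>y - a 3\<bar>) - c) <= C0 * sqrt \<bar>y - a 3\<bar>"
 using expansion_a3 by metis
 have "\<forall>\<^sub>F x in at_left (a 3). dist (HT a f x) h3 < 1" using tendstoD[OF h3, of 1] by simp
 then obtain b where b: "b < a 3" "!!y. b < y ==> y < a 3 ==> dist (HT a f y) h3 < 1" unfolding eventually_at_left_field by blast
 define rh where "rh = min (min rh0 1) ((a 3 - b)/2)"
 have rh: "0 < rh" "rh <= rh0" "rh <= 1" using rh0 b by (auto simp: rh_def)
 have "rh <= (a 3 - b)/2" unfolding rh_def by (rule min.cobounded2)
 note rh = rh this
 show thesis
 proof (rule that[of rh "norm c + C0 + norm h3 + 1 + norm q3"])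
 fix y assume y: "0 < \<bar>y - a 3\<bar>" "\<bar>y - a 3\<bar> <= rh"
 have "norm (f y - d3 * of_real (ln \<bar>y - a 3\<bar>) - c) <= C0 * sqrt \<bar>y - a 3\<bar>" using bf y rh by simp
 also have "... <= C0" using y rh C0 by (simp add: mult_left_le)
 finally show "norm (f y - d3 * of_real (ln \<bar>y - a 3\<bar>)) <= norm c + C0 + norm h3 + 1 + norm q3"
 using norm_triangle_sub[of "f y - d3 * of_real (ln \<bar>y - a 3\<bar>)" c] norm_ge_zero[of h3] norm_ge_zero[of q3] by linarith
 next
 fix t assume t: "0 < t" "t <= rh"
 have "0 < a 3 - b" using b(1) by simp
 then have "(a 3 - b)/2 < a 3 - b" by simp
 from le_less_trans[OF order_trans[OF t(2) rh(4)] this] have "b < a 3 - t" by simp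
 then have "norm (HT a f (a 3 - t) - h3) < 1" using b(2)[of "a 3 - t"] t(1) by (simp add: dist_norm)
 then show "norm (HT a f (a 3 - t)) <= norm c + C0 + norm h3 + 1 + norm q3"
 using norm_triangle_sub[of "HT a f (a 3 - t)" h3] norm_ge_zero[of c] norm_ge_zero[of q3] C0 by linarith
 next
 fix t assume t: "0 < t" "t <= rh"
 have "norm (q (a 3 - t) - q3) <= C0 * sqrt t" using bq[of "a 3 - t"] t rh by simp
 also have "... <= C0" using t rh C0 by (simp add: mult_left_le)
 finally show "norm (q (a 3 - t)) <= norm c + C0 + norm h3 + 1 + norm q3"
 using norm_triangle_sub[of "q (a 3 - t)" q3] norm_ge_zero[of c] norm_ge_zero[of h3] by linarith
 qed (use rh rh0 C0 in auto)
qed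

end

section \<open>The product of the two boundary values\<close>

context four_points
begin

lemma X_filterlims: "filterlim X (at_right (a 2)) at_bot" "filterlim X (at_left (a 3)) at_top"
proof -
 have "((%s::real. (a 3 - a 2) * exp s/(1 + exp s)) \<longlongrightarrow> 0) at_bot" by real_asymp
 then have "((%s. X s - a 2) \<longlongrightarrow> 0) at_bot" unfolding X_minus .
 then have "(X \<longlongrightarrow> a 2) at_bot" by (rule LIM_zero_cancel)
 then show "filterlim X (at_right (a 2)) at_bot" unfolding filterlim_at using X_bounds(1) by (simp add: less_imp_neq[THEN not_sym])
 have "((%s::real. (a 3 - a 2)/(1 + exp s)) \<longlongrightarrow> 0) at_top" by real_asymp
 then have "((%s. a 3 - X s) \<longlongrightarrow> 0) at_top" unfolding X_minus .
 from tendsto_diff[OF tendsto_const[of "a 3"] this] have "(X \<longlongrightarrow> a 3) at_top" by simp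
 then show "filterlim X (at_left (a 3)) at_top" unfolding filterlim_at using X_bounds(2) by (simp add: less_imp_neq)
qed

lemma ln_X_minus: "ln (X s - a 2) = ln (a 3 - a 2) + s - ln (1 + exp s)" "ln (a 3 - X s) = ln (a 3 - a 2) - ln (1 + exp s)"
proof -
 have p: "0 < a 3 - a 2" "0 < exp s" "0 < 1 + exp s" using a23 exp_gt_zero[of s] by linarith+
 show "ln (X s - a 2) = ln (a 3 - a 2) + s - ln (1 + exp s)"
 unfolding X_minus using ln_divide_pos[OF mult_pos_pos[OF p(1,2)] p(3)] ln_mult_pos[OF p(1,2)] by simp
 show "ln (a 3 - X s) = ln (a 3 - a 2) - ln (1 + exp s)"
 unfolding X_minus using ln_divide_pos[OF p(1,3)] by simp
qed

lemma ln_X_bound: "\<bar>ln (X s - a 2)\<bar> <= \<bar>ln (a 3 - a 2)\<bar> + 1 + (abs s)" "\<bar>ln (a 3 - X s)\<bar> <= \<bar>ln (a 3 - a 2)\<bar> + 1 + (abs s)"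
proof -
 have l0: "0 <= ln (1 + exp s)" by simp
 have l1: "ln (1 + exp s) <= 1 + max s 0"
 proof -
 have m: "exp s <= exp (max s 0)" "1 <= exp (max s 0)" by auto
 have e2: "2 <= exp (1::real)" using exp_ge_add_one_self[of 1] by simp
 have "1 + exp s <= 2 * exp (max s 0)" using m by linarith
 also have "... <= exp 1 * exp (max s 0)" using e2 by (intro mult_right_mono) auto
 also have "... = exp (1 + max s 0)" by (simp add: exp_add)
 finally have "ln (1 + exp s) <= ln (exp (1 + max s 0))" by (subst ln_le_cancel_iff) (auto simp: add_pos_pos)
 then show ?thesis by simp
 qed
 have l2: "s <= ln (1 + exp s)"
 proof -
 have "ln (exp s) <= ln (1 + exp s)" by (subst ln_le_cancel_iff) (auto simp: add_pos_pos)
 then show ?thesis by simp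
 qed
 show "\<bar>ln (X s - a 2)\<bar> <= \<bar>ln (a 3 - a 2)\<bar> + 1 + (abs s)" "\<bar>ln (a 3 - X s)\<bar> <= \<bar>ln (a 3 - a 2)\<bar> + 1 + (abs s)"
 unfolding ln_X_minus using l0 l1 l2 by (auto simp: max_def split: if_splits)
qed

lemma om_X_decay: "0 <= om (X s)" "(1 + (abs s)) * om (X s) <= a 3 - a 2"
proof -
 show "0 <= om (X s)" using om_pos[OF X_bounds] by (rule less_imp_le)
 have e: "exp s * exp (abs s) <= (1 + exp s)\<^sup>2"
 proof (cases "0 <= s")
 case True
 have "exp s * exp s <= (1 + exp s)*(1 + exp s)" by (intro mult_mono) auto
 then show ?thesis using True by (simp add: power2_eq_square)
 next
 case False
 have "exp s * exp (- s) = 1" by (simp add: exp_minus)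
 moreover have "1*1 <= (1 + exp s)*(1 + exp s)" by (intro mult_mono) auto
 ultimately show ?thesis using False by (simp add: power2_eq_square)
 qed
 have "1 + (abs s) <= exp (abs s)" by (rule exp_ge_add_one_self)
 then have "(1 + (abs s)) * exp s <= exp (abs s) * exp s" by (rule mult_right_mono) simp
 from order_trans[OF this e[unfolded mult.commute[of "exp s"]]] have "(1 + (abs s)) * exp s <= (1 + exp s)\<^sup>2" .
 then have "(1 + (abs s)) * exp s/(1 + exp s)\<^sup>2 <= 1" by (simp add: divide_le_eq_1 add_pos_pos)
 from mult_left_mono[OF this, of "a 3 - a 2"] show "(1 + (abs s)) * om (X s) <= a 3 - a 2"
 unfolding om_X using a23 by (simp add: mult_ac)
qed

lemma om_X_decay_limits:
 "((%s. (1 + (abs s)) * om (X s)) \<longlongrightarrow> 0) at_bot" "((%s. (1 + (abs s)) * om (X s)) \<longlongrightarrow> 0) at_top"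
 unfolding om_X by real_asymp+

lemma kk_bounds: "a 2 <= x ==> x <= a 3 ==> \<bar>kk x\<bar> <= (a 4 - a 1) ^ 3" "a 2 <= x ==> x <= a 3 ==> \<bar>kk' x\<bar> <= (a 4 - a 1) ^ 2"
proof -
 assume x: "a 2 <= x" "x <= a 3"
 have "\<bar>kk x\<bar> = \<bar>a 3 - a 2\<bar> * \<bar>x - a 1\<bar> * \<bar>a 4 - x\<bar>" by (simp add: kk_def abs_mult)
 also have "... <= (a 4 - a 1)*(a 4 - a 1)*(a 4 - a 1)" using x a12 a23 a34 by (intro mult_mono) auto
 finally show "\<bar>kk x\<bar> <= (a 4 - a 1) ^ 3" by (simp add: power3_eq_cube)
 have "\<bar>kk' x\<bar> = \<bar>a 3 - a 2\<bar> * \<bar>(a 4 - x) - (x - a 1)\<bar>" by (simp add: kk'_def abs_mult)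
 also have "... <= (a 4 - a 1)*(a 4 - a 1)" using x a12 a23 a34 by (intro mult_mono) auto
 finally show "\<bar>kk' x\<bar> <= (a 4 - a 1) ^ 2" by (simp add: power2_eq_square)
qed

lemma kk_ends: "kk (a 2) = P' (a 2)" "kk (a 3) = - P' (a 3)"
 unfolding P'_a2 P'_a3 kk_def by (simp_all add: mult_ac)

end

lemma bump_bounds: "(abs w) <= 1 ==> \<bar>bump1 w\<bar> <= 6" "(abs w) <= 1 ==> \<bar>bump2 w\<bar> <= 30"
proof -
 assume w: "(abs w) <= 1"
 have w2: "0 <= w\<^sup>2" "w\<^sup>2 <= 1" using w by (auto simp: abs_square_le_1)
 then have m: "0 <= 1 - w\<^sup>2" "1 - w\<^sup>2 <= 1" by auto
 have s: "0 <= (1 - w\<^sup>2)\<^sup>2" "(1 - w\<^sup>2)\<^sup>2 <= 1" using power_le_one[OF m, of 2] by auto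
 have "\<bar>bump1 w\<bar> = 6*((abs w)*(1 - w\<^sup>2)\<^sup>2)" by (simp add: bump1_def abs_mult)
 also have "... <= 6*(1*1)" using w s by (intro mult_left_mono mult_mono) auto
 finally show "\<bar>bump1 w\<bar> <= 6" by simp
 have p: "0 <= w\<^sup>2*(1 - w\<^sup>2)" "w\<^sup>2*(1 - w\<^sup>2) <= 1" by (rule mult_nonneg_nonneg[OF w2(1) m(1)], rule mult_le_one[OF w2(2) m])
 have "bump2 w = - 6*(1 - w\<^sup>2)\<^sup>2 + 24*(w\<^sup>2*(1 - w\<^sup>2))" by (simp add: bump2_def)
 then show "\<bar>bump2 w\<bar> <= 30" using p s by linarith
qed

context eigenfunction
begin

text \<open>At each end only one of the two factors grows, and only logarithmically; the
  quasi-derivative compensates the growth of the Hilbert transform at $a_2$.\<close>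

lemma growth_bounds:
 obtains C where "0 <= C" "!!s. norm (f (X s)) * norm (HT a f (X s)) <= C*(1 + (abs s))"
 "!!s. norm (q (X s)) * norm (HT a f (X s)) <= C"
proof -
 obtain ta C1 where ta: "0 < ta" "ta <= half_gap" and C1: "0 <= C1"
 and q2: "!!t. 0 < t ==> t <= ta ==> norm (q (a 2 + t)) <= C1 * sqrt t"
 and f2: "!!t. 0 < t ==> t <= ta ==> norm (f (a 2 + t) - f2) <= C1 * sqrt t"
 and H2: "!!t. 0 < t ==> t <= ta ==> norm (of_real pi * HT a f (a 2 + t) + f2 * of_real (ln t)) <= C1"
 by (rule near_a2, rule that)
 obtain rh C2 where rh: "0 < rh" "rh < half_gap" and C2: "0 <= C2"
 and f3: "!!y. 0 < \<bar>y - a 3\<bar> ==> \<bar>y - a 3\<bar> <= rh ==> norm (f y - d3 * of_real (ln \<bar>y - a 3\<bar>)) <= C2"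
 and H3: "!!t. 0 < t ==> t <= rh ==> norm (HT a f (a 3 - t)) <= C2"
 and q3: "!!t. 0 < t ==> t <= rh ==> norm (q (a 3 - t)) <= C2"
 using near_a3 by metis
 define c d where cd: "c = a 2 + ta" "d = a 3 - rh"
 have cd': "a 2 < c" "c <= d" "d < a 3" using ta rh half_gap by (auto simp: cd)
 have cont: "continuous_on {c..d} f" "continuous_on {c..d} q"
 by (rule continuous_at_imp_continuous_on, intro ballI has_vector_derivative_continuous, rule eigenfunction_ode, use cd' a34 in auto)+
 obtain Bf where Bf0: "0 <= Bf" "!!x. x \<in> {c..d} ==> norm (f x) <= Bf" by (rule continuous_on_Icc_bound[OF cont(1)], rule that)
 have Bf: "0 <= Bf" "!!x. c <= x ==> x <= d ==> norm (f x) <= Bf" using Bf0 by auto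
 obtain Bq where Bq0: "0 <= Bq" "!!x. x \<in> {c..d} ==> norm (q x) <= Bq" by (rule continuous_on_Icc_bound[OF cont(2)], rule that)
 have Bq: "0 <= Bq" "!!x. c <= x ==> x <= d ==> norm (q x) <= Bq" using Bq0 by auto
 obtain BH where BH: "!!x. c <= x ==> x <= d ==> norm (HT a f x) <= BH"
 proof -
 obtain B where B: "!!x ep. c <= x ==> x <= d ==> ep ~= 0 ==> norm (cauchy (of_real x + \<i> * of_real ep)) <= B"
 using cauchy_bounded[OF cd'] by blast
 show thesis
 proof (rule that[of "B/pi"])
 fix x assume x: "c <= x" "x <= d"
 define ep :: "nat => real" where "ep n = 1/(real n + 1)" for n
 have ep0: "0 < ep n" for n by (auto simp: ep_def)
 have ep1: "ep \<longlonglongrightarrow> 0" unfolding ep_def[abs_def] by real_asymp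
 have x': "a 2 < x" "x < a 3" using x cd' by auto
 have "norm (2*(of_real pi * HT a f x)) <= 2 * B"
 proof (rule LIMSEQ_le_const2[OF tendsto_norm[OF cauchy_plemelj[OF x' ep0 ep1]]], intro exI allI impI)
 fix n :: nat
 have "norm (cauchy (of_real x + \<i> * of_real (ep n))) <= B" by (rule B[OF x]) (use ep0[of n] in simp)
 moreover have "norm (cauchy (of_real x + \<i> * of_real (- ep n))) <= B" by (rule B[OF x]) (use ep0[of n] in simp)
 ultimately show "norm (cauchy (of_real x + \<i> * of_real (ep n)) + cauchy (of_real x + \<i> * of_real (- ep n))) <= 2 * B"
 using norm_triangle_ineq[of "cauchy (of_real x + \<i> * of_real (ep n))" "cauchy (of_real x + \<i> * of_real (- ep n))"] by linarith
 qed
 then show "norm (HT a f x) <= B/pi" by (simp add: norm_mult pos_le_divide_eq mult.commute)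
 qed
 qed
 have BH0: "0 <= BH" using order_trans[OF norm_ge_zero BH[OF order_refl cd'(2)]] .
 define L where "L = \<bar>ln (a 3 - a 2)\<bar> + 1"
 have L: "1 <= L" by (simp add: L_def)
 define A where "A = norm f2 + C1 * sqrt ta"
 have A: "0 <= A" using C1 ta by (simp add: A_def)
 define K1 where "K1 = A*((C1 + norm f2 * L)/pi)"
 define K2 where "K2 = (C2 + norm d3 * L) * C2"
 define K3 where "K3 = C1*((C1 * sqrt ta + norm f2*(2*(1 + ta)))/pi)"
 have K: "0 <= K1" "0 <= K2" "0 <= K3"
 unfolding K1_def K2_def K3_def using A C1 C2 L ta by (auto intro!: mult_nonneg_nonneg add_nonneg_nonneg divide_nonneg_nonneg)
 have sL: "L + (abs s) <= L*(1 + (abs s))" for s using mult_right_mono[OF L, of "(abs s)"] by (simp add: algebra_simps)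
 have nn: "0 <= Bf * BH" "0 <= Bq * BH" "0 <= C2 * C2" using Bf(1) Bq(1) BH0 C2 by simp_all
 define S where "S = K1 + K2 + K3 + Bf * BH + Bq * BH + C2 * C2"
 have S: "0 <= S" "K1 <= S" "K2 <= S" "K3 <= S" "Bf * BH <= S" "Bq * BH <= S" "C2 * C2 <= S"
 unfolding S_def using K nn by simp_all
 have up: "x <= S*(1 + (abs s))" if "x <= S" for x s
 using that mult_left_mono[OF _ S(1), of 1 "1 + (abs s)"] by simp
 show thesis
 proof (rule that[of S])
 show "0 <= S" by (rule S(1))
 fix s
 define x where "x = X s"
 have x: "a 2 < x" "x < a 3" using X_bounds by (auto simp: x_def)
 consider (left) "x < c" | (mid) "c <= x" "x <= d" | (right) "d < x" by linarith
 then have "norm (f x) * norm (HT a f x) <= S*(1 + (abs s)) & norm (q x) * norm (HT a f x) <= S"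
 proof cases
 case left
 define t where "t = x - a 2"
 have t: "0 < t" "t <= ta" and xt: "x = a 2 + t" using left x by (auto simp: t_def cd)
 have st: "sqrt t <= sqrt ta" using t by simp
 have "C1 * sqrt t <= C1 * sqrt ta" using st C1 by (rule mult_left_mono)
 then have fA: "norm (f x) <= A" using f2[OF t] norm_triangle_sub[of "f x" f2] by (simp add: A_def xt)
 have "norm (of_real pi * HT a f x) <= C1 + norm (f2 * of_real (ln t))"
 using H2[OF t] norm_triangle_ineq4[of "of_real pi * HT a f x + f2 * of_real (ln t)" "f2 * of_real (ln t)"] by (simp add: xt)
 then have piH: "pi * norm (HT a f x) <= C1 + norm f2 * \<bar>ln t\<bar>" by (simp add: norm_mult)
 then have Hb: "norm (HT a f x) <= (C1 + norm f2 * \<bar>ln t\<bar>)/pi" by (simp add: pos_le_divide_eq mult.commute)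
 have lt: "\<bar>ln t\<bar> <= L*(1 + (abs s))" using ln_X_bound(1)[of s] sL[of s] by (simp add: t_def x_def L_def)
 have "norm (HT a f x) <= (C1*(1 + (abs s)) + norm f2*(L*(1 + (abs s))))/pi"
 proof (rule order_trans[OF Hb divide_right_mono])
 have "C1*1 <= C1*(1 + (abs s))" using C1 by (intro mult_left_mono) auto
 then show "C1 + norm f2 * \<bar>ln t\<bar> <= C1*(1 + (abs s)) + norm f2*(L*(1 + (abs s)))"
 using mult_left_mono[OF lt norm_ge_zero[of f2]] by linarith
 qed simp
 then have "norm (f x) * norm (HT a f x) <= A*((C1*(1 + (abs s)) + norm f2*(L*(1 + (abs s))))/pi)"
 using fA A by (intro mult_mono) auto
 also have "... = K1*(1 + (abs s))" by (simp add: K1_def algebra_simps add_divide_distrib)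
 also have "... <= S*(1 + (abs s))" using S by (intro mult_right_mono) auto
 finally have 1: "norm (f x) * norm (HT a f x) <= S*(1 + (abs s))" .
 have sl: "sqrt t * \<bar>ln t\<bar> <= 2*(1 + ta)"
 proof -
 have "sqrt t * \<bar>ln t\<bar> <= sqrt t*(2 * \<bar>t - 1\<bar> / sqrt t)" using abs_ln_le[OF t(1)] by (rule mult_left_mono) (use t in simp)
 also have "... = 2 * \<bar>t - 1\<bar>" using t by simp
 also have "... <= 2*(1 + ta)"
 proof (rule mult_left_mono)
 show "\<bar>t - 1\<bar> <= 1 + ta" unfolding abs_le_iff using t by linarith
 qed simp
 finally show ?thesis .
 qed
 have "norm (q x) * norm (HT a f x) <= (C1 * sqrt t)*((C1 + norm f2 * \<bar>ln t\<bar>)/pi)"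
 using q2[OF t] Hb C1 t by (intro mult_mono) (auto simp: xt)
 also have "... = C1*((C1 * sqrt t + norm f2*(sqrt t * \<bar>ln t\<bar>))/pi)" by (simp add: algebra_simps)
 also have "... <= K3" unfolding K3_def using sl st C1 by (intro mult_left_mono divide_right_mono add_mono) auto
 finally have "norm (q x) * norm (HT a f x) <= K3" .
 then show ?thesis using 1 S order_trans by blast
 next
 case mid
 have "norm (f x) * norm (HT a f x) <= Bf * BH" "norm (q x) * norm (HT a f x) <= Bq * BH"
 using Bf(2)[OF mid] Bq(2)[OF mid] BH[OF mid] Bf(1) Bq(1) by (auto intro!: mult_mono)
 then show ?thesis using up[of "norm (f x) * norm (HT a f x)" s] S(5,6) by (auto dest: order_trans)
 next
 case right
 define t where "t = a 3 - x"
 have t: "0 < t" "t <= rh" and xt: "x = a 3 - t" using right x by (auto simp: t_def cd)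
 have Hb: "norm (HT a f x) <= C2" "norm (q x) <= C2" using H3[OF t] q3[OF t] by (simp_all add: xt)
 have lt: "\<bar>ln t\<bar> <= L*(1 + (abs s))" using ln_X_bound(2)[of s] sL[of s] by (simp add: t_def x_def L_def)
 have "norm (f x - d3 * of_real (ln t)) <= C2" using f3[of x] t by (simp add: xt)
 then have "norm (f x) <= C2 + norm (d3 * of_real (ln t))" using norm_triangle_sub[of "f x" "d3 * of_real (ln t)"] by linarith
 also have "... = C2 + norm d3 * \<bar>ln t\<bar>" by (simp add: norm_mult)
 also have "... <= C2*(1 + (abs s)) + norm d3*(L*(1 + (abs s)))"
 using C2 lt by (intro add_mono mult_left_mono) (auto simp: algebra_simps)
 finally have "norm (f x) <= (C2 + norm d3 * L)*(1 + (abs s))" by (simp add: algebra_simps)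
 then have "norm (f x) * norm (HT a f x) <= ((C2 + norm d3 * L)*(1 + (abs s))) * C2"
 using Hb C2 L by (intro mult_mono) auto
 also have "... = K2*(1 + (abs s))" by (simp add: K2_def)
 also have "... <= S*(1 + (abs s))" using S by (intro mult_right_mono) auto
 finally have 1: "norm (f x) * norm (HT a f x) <= S*(1 + (abs s))" .
 have "norm (q x) * norm (HT a f x) <= C2 * C2" using Hb C2 by (intro mult_mono) auto
 then show ?thesis using 1 S order_trans by blast
 qed
 then show "norm (f (X s)) * norm (HT a f (X s)) <= S*(1 + (abs s))"
 "norm (q (X s)) * norm (HT a f (X s)) <= S" by (simp_all add: x_def)
 qed
qed

lemma limits_at_bot:
 "((%s. f (X s)) \<longlongrightarrow> f2) at_bot" "((%s. q (X s) * HT a f (X s)) \<longlongrightarrow> 0) at_bot"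
 "((%s. HT a f (X s)/of_real s) \<longlongrightarrow> - f2/of_real pi) at_bot"
proof -
 obtain ta C where ta: "0 < ta" "ta <= half_gap" and C: "0 <= C"
 and q2: "!!t. 0 < t ==> t <= ta ==> norm (q (a 2 + t)) <= C * sqrt t"
 and f2: "!!t. 0 < t ==> t <= ta ==> norm (f (a 2 + t) - f2) <= C * sqrt t"
 and H2: "!!t. 0 < t ==> t <= ta ==> norm (of_real pi * HT a f (a 2 + t) + f2 * of_real (ln t)) <= C"
 by (rule near_a2, rule that)
 define t where "t s = X s - a 2" for s
 have tl: "(t \<longlongrightarrow> 0) at_bot" unfolding t_def X_minus by real_asymp
 have t0: "0 < t s" for s using X_bounds(1)[of s] by (simp add: t_def)
 have xt: "X s = a 2 + t s" for s by (simp add: t_def)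
 have ev: "\<forall>\<^sub>F s in at_bot. t s < ta" by (rule order_tendstoD(2)[OF tl ta(1)])
 have tr: "filterlim t (at_right 0) at_bot" unfolding filterlim_at using tl t0 by (simp add: less_imp_neq[THEN not_sym])
 show "((%s. f (X s)) \<longlongrightarrow> f2) at_bot"
 proof (rule LIM_zero_cancel, rule Lim_null_comparison)
 show "\<forall>\<^sub>F s in at_bot. norm (f (X s) - f2) <= C * sqrt (t s)"
 using ev by eventually_elim (use f2 t0 in \<open>simp add: xt\<close>)
 have "((%s. C * sqrt (t s)) \<longlongrightarrow> C * sqrt 0) at_bot" by (intro tendsto_intros tl)
 then show "((%s. C * sqrt (t s)) \<longlongrightarrow> 0) at_bot" by simp
 qed
 have HB: "pi * norm (HT a f (X s)) <= C + norm f2 * \<bar>ln (t s)\<bar>" if "t s < ta" for s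
 proof -
 have "norm (of_real pi * HT a f (X s)) <= C + norm (f2 * of_real (ln (t s)))"
 using H2[OF t0, of s] that norm_triangle_ineq4[of "of_real pi * HT a f (X s) + f2 * of_real (ln (t s))" "f2 * of_real (ln (t s))"] by (simp add: xt)
 then show ?thesis by (simp add: norm_mult)
 qed
 show "((%s. q (X s) * HT a f (X s)) \<longlongrightarrow> 0) at_bot"
 proof (rule Lim_null_comparison)
 show "\<forall>\<^sub>F s in at_bot. norm (q (X s) * HT a f (X s)) <= (C * C/pi) * sqrt (t s) + (C * norm f2/pi)*(sqrt (t s) * \<bar>ln (t s)\<bar>)"
 using ev
 proof eventually_elim
 case (elim s)
 have "norm (HT a f (X s)) <= (C + norm f2 * \<bar>ln (t s)\<bar>)/pi" using HB[OF elim] by (simp add: pos_le_divide_eq mult.commute)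
 then have "norm (q (X s) * HT a f (X s)) <= (C * sqrt (t s))*((C + norm f2 * \<bar>ln (t s)\<bar>)/pi)"
 unfolding norm_mult using q2[OF t0, of s] elim C t0[of s] by (intro mult_mono) (auto simp: xt)
 then show ?case by (simp add: algebra_simps add_divide_distrib)
 qed
 have "((%s. (C * C/pi) * sqrt (t s) + (C * norm f2/pi)*(sqrt (t s) * \<bar>ln (t s)\<bar>)) \<longlongrightarrow> (C * C/pi) * sqrt 0 + 0) at_bot"
 by (intro tendsto_intros tl filterlim_compose[OF tendsto_sqrt_ln_at_right tr])
 then show "((%s. (C * C/pi) * sqrt (t s) + (C * norm f2/pi)*(sqrt (t s) * \<bar>ln (t s)\<bar>)) \<longlongrightarrow> 0) at_bot" by simp
 qed
 have 1: "((%s. (of_real pi * HT a f (X s) + f2 * of_real (ln (t s)))/of_real s) \<longlongrightarrow> 0) at_bot"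
 proof (rule Lim_null_comparison)
 show "\<forall>\<^sub>F s in at_bot. norm ((of_real pi * HT a f (X s) + f2 * of_real (ln (t s)))/of_real s) <= C/(abs s)"
 using ev
 proof eventually_elim
 case (elim s)
 then show ?case using divide_right_mono[OF H2[OF t0, of s], of "(abs s)"] by (simp add: xt norm_divide)
 qed
 show "((%s::real. C/(abs s)) \<longlongrightarrow> 0) at_bot" by real_asymp
 qed
 have "((%s. (ln (a 3 - a 2) + s - ln (1 + exp s))/s) \<longlongrightarrow> 1) at_bot" by real_asymp
 then have "((%s. complex_of_real (ln (t s)/s)) \<longlongrightarrow> of_real 1) at_bot" unfolding t_def ln_X_minus by (rule tendsto_of_real)
 then have 2: "((%s. ((of_real pi * HT a f (X s) + f2 * of_real (ln (t s)))/of_real s - f2 * complex_of_real (ln (t s)/s))/of_real pi) \<longlongrightarrow> (0 - f2 * of_real 1)/of_real pi) at_bot"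
 by (intro tendsto_divide[OF tendsto_diff[OF 1 tendsto_mult[OF tendsto_const]] tendsto_const]) simp_all
 have eq: "((of_real pi * HT a f (X s) + f2 * of_real (ln (t s)))/of_real s - f2 * complex_of_real (ln (t s)/s))/of_real pi = HT a f (X s)/of_real s" for s
 by (simp add: add_divide_distrib)
 show "((%s. HT a f (X s)/of_real s) \<longlongrightarrow> - f2/of_real pi) at_bot" using 2 unfolding eq by simp
qed

lemma limits_at_top:
 "((%s. HT a f (X s)) \<longlongrightarrow> h3) at_top" "((%s. q (X s)) \<longlongrightarrow> q3) at_top"
 "((%s. f (X s)/of_real s) \<longlongrightarrow> - d3) at_top"
proof -
 show "((%s. HT a f (X s)) \<longlongrightarrow> h3) at_top" "((%s. q (X s)) \<longlongrightarrow> q3) at_top"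
 by (rule filterlim_compose[OF h3 X_filterlims(2)], rule filterlim_compose[OF q3(1) X_filterlims(2)])
 obtain rh C where rh: "0 < rh" "rh < half_gap" and C: "0 <= C"
 and f3: "!!y. 0 < \<bar>y - a 3\<bar> ==> \<bar>y - a 3\<bar> <= rh ==> norm (f y - d3 * of_real (ln \<bar>y - a 3\<bar>)) <= C"
 using near_a3 by metis
 define t where "t s = a 3 - X s" for s
 have tl: "(t \<longlongrightarrow> 0) at_top" unfolding t_def X_minus by real_asymp
 have t0: "0 < t s" for s using X_bounds(2)[of s] by (simp add: t_def)
 have ev: "\<forall>\<^sub>F s in at_top. t s < rh" by (rule order_tendstoD(2)[OF tl rh(1)])
 have 1: "((%s. (f (X s) - d3 * of_real (ln (t s)))/of_real s) \<longlongrightarrow> 0) at_top"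
 proof (rule Lim_null_comparison)
 show "\<forall>\<^sub>F s in at_top. norm ((f (X s) - d3 * of_real (ln (t s)))/of_real s) <= C/(abs s)"
 using ev
 proof eventually_elim
 case (elim s)
 have "\<bar>X s - a 3\<bar> = t s" using t0[of s] by (simp add: t_def)
 then show ?case using divide_right_mono[OF f3[of "X s"], of "(abs s)"] elim t0[of s] by (simp add: norm_divide)
 qed
 show "((%s::real. C/(abs s)) \<longlongrightarrow> 0) at_top" by real_asymp
 qed
 have "((%s. (ln (a 3 - a 2) - ln (1 + exp s))/s) \<longlongrightarrow> - 1) at_top" by real_asymp
 then have "((%s. complex_of_real (ln (t s)/s)) \<longlongrightarrow> of_real (- 1)) at_top" unfolding t_def ln_X_minus by (rule tendsto_of_real)
 then have 2: "((%s. (f (X s) - d3 * of_real (ln (t s)))/of_real s + d3 * complex_of_real (ln (t s)/s)) \<longlongrightarrow> 0 + d3 * of_real (- 1)) at_top"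
 by (rule tendsto_add[OF 1 tendsto_mult[OF tendsto_const]])
 have eq: "(f (X s) - d3 * of_real (ln (t s)))/of_real s + d3 * complex_of_real (ln (t s)/s) = f (X s)/of_real s" for s
 by (simp add: diff_divide_distrib)
 show "((%s. f (X s)/of_real s) \<longlongrightarrow> - d3) at_top" using 2 unfolding eq by simp
qed

end

context eigenfunction
begin

text \<open>The pointwise limit of the weak densities when the cutoff is stretched over the whole
  logarithmic scale: the negative half of $[-1,1]$ sees $a_2$, the positive half $a_3$.\<close>

definition limit_density :: "real => complex" where
 "limit_density v = (if v < 0 then - (f2\<^sup>2 * of_real (P' (a 2))/of_real pi) * of_real (v * bump2 v)
 else h3 * q3 * of_real (2 * bump1 v + v * bump2 v))"

lemma limit_density_integral:
 "(limit_density has_integral f2\<^sup>2 * of_real (P' (a 2))/of_real pi - h3 * q3) {-1..1}"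
proof -
 have 1: "((%v. v * bump2 v) has_integral (0 * bump1 0 - bump 0) - ((-1) * bump1 (-1) - bump (-1))) {-1..0}"
 proof (rule fundamental_theorem_of_calculus)
 fix v :: real assume "v \<in> {-1..0}"
 have "((%v. v * bump1 v - bump v) has_real_derivative (v * bump2 v)) (at v)"
 by (rule derivative_eq_intros bump_derivs refl)+ simp
 then show "((%v. v * bump1 v - bump v) has_vector_derivative v * bump2 v) (at v within {-1..0})"
 by (auto simp: has_real_derivative_iff_has_vector_derivative intro: has_vector_derivative_at_within)
 qed simp
 have 2: "((%v. 2 * bump1 v + v * bump2 v) has_integral (1 * bump1 1 + bump 1) - (0 * bump1 0 + bump 0)) {0..1}"
 proof (rule fundamental_theorem_of_calculus)
 fix v :: real assume "v \<in> {0..1}"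
 have "((%v. v * bump1 v + bump v) has_real_derivative (2 * bump1 v + v * bump2 v)) (at v)"
 by (rule derivative_eq_intros bump_derivs refl)+ simp
 then show "((%v. v * bump1 v + bump v) has_vector_derivative 2 * bump1 v + v * bump2 v) (at v within {0..1})"
 by (auto simp: has_real_derivative_iff_has_vector_derivative intro: has_vector_derivative_at_within)
 qed simp
 have v: "bump1 (-1) = 0" "bump1 1 = 0" "bump (-1) = 0" "bump 1 = 0" "bump 0 = 1" "bump1 0 = 0" by (simp_all add: bump_def bump1_def)
 define \<gamma> where "\<gamma> = f2\<^sup>2 * of_real (P' (a 2))/of_real pi"
 have "((%v. - \<gamma> * of_real (v * bump2 v)) has_integral - \<gamma> * of_real (- 1)) {-1..0}"
 using has_integral_mult_right[OF has_integral_of_real[OF 1], of "- \<gamma>"] by (simp add: v)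
 then have I1: "(limit_density has_integral - \<gamma> * of_real (- 1)) {-1..0}"
 by (rule has_integral_spike_finite[rotated 2, where S="{0}"]) (auto simp: limit_density_def \<gamma>_def)
 have "((%v. h3 * q3 * of_real (2 * bump1 v + v * bump2 v)) has_integral h3 * q3 * of_real (- 1)) {0..1}"
 using has_integral_mult_right[OF has_integral_of_real[OF 2], of "h3 * q3"] by (simp add: v)
 then have I2: "(limit_density has_integral h3 * q3 * of_real (- 1)) {0..1}"
 by (rule has_integral_eq[rotated]) (auto simp: limit_density_def)
 have "(limit_density has_integral (- \<gamma> * of_real (- 1) + h3 * q3 * of_real (- 1))) {-1..1}"
 by (rule has_integral_combine[OF _ _ I1 I2]) auto
 then show ?thesis by (simp add: \<gamma>_def)
qed

lemma weak_density_bound: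
 obtains B where "!!T v. 1 <= T ==> (abs v) <= 1 ==> norm (weak_density T v) <= B"
proof -
 obtain C where C: "0 <= C" and fH: "!!s. norm (f (X s)) * norm (HT a f (X s)) <= C*(1 + (abs s))"
 and qH: "!!s. norm (q (X s)) * norm (HT a f (X s)) <= C"
 by (rule growth_bounds, rule that)
 define A where "A = (a 4 - a 1) ^ 3"
 define A' where "A' = (a 4 - a 1) ^ 2"
 have A: "0 <= A" "0 <= A'" using a12 a23 a34 by (simp_all add: A_def A'_def)
 show thesis
 proof (rule that[of "2 * C*6 + (C*2 * A*30 + C*(a 3 - a 2) * A'*6)"])
 fix T v :: real assume T: "1 <= T" and v: "(abs v) <= 1"
 define s where "s = T * v"
 have s: "1 + (abs s) <= 2 * T"
 proof -
 have "(abs s) = T*(abs v)" using T by (simp add: s_def abs_mult)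
 also have "... <= T*1" using T v by (intro mult_left_mono) auto
 finally show ?thesis using T by simp
 qed
 define k where "k = kk (X s) * bump2 v/T"
 define k' where "k' = kk' (X s) * om (X s) * bump1 v"
 have w: "weak_density T v = 2*(q (X s) * HT a f (X s)) * of_real (bump1 v) + f (X s) * HT a f (X s) * of_real (k + k')"
 by (simp add: weak_density_def s_def k_def k'_def algebra_simps)
 have 1: "norm (2*(q (X s) * HT a f (X s)) * of_real (bump1 v)) <= 2 * C*6"
 unfolding norm_mult norm_of_real using qH[of s] bump_bounds(1)[OF v] C by (intro mult_mono) auto
 have xs: "a 2 <= X s" "X s <= a 3" using X_bounds[of s] by auto
 have kb: "(1 + (abs s))*(abs k) <= 2 * A*30"
 proof -
 have "(1 + (abs s))*(abs k) <= (2 * T)*(A*30/T)"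
 proof (rule mult_mono[OF s])
 have "(abs k) = \<bar>kk (X s)\<bar> * \<bar>bump2 v\<bar> / T" using T by (simp add: k_def abs_mult)
 also have "... <= A*30/T" unfolding A_def using kk_bounds(1)[OF xs] bump_bounds(2)[OF v] T a12 a23 a34
 by (intro divide_right_mono mult_mono) auto
 finally show "(abs k) <= A*30/T" .
 qed (use T in auto)
 also have "... = 2 * A*30" using T by simp
 finally show ?thesis .
 qed
 have kb': "(1 + (abs s))*(abs k') <= (a 3 - a 2) * A'*6"
 proof -
 have "(1 + (abs s))*(abs k') = ((1 + (abs s)) * om (X s)) * \<bar>kk' (X s)\<bar> * \<bar>bump1 v\<bar>"
 using om_X_decay(1)[of s] by (simp add: k'_def abs_mult)
 also have "... <= (a 3 - a 2) * A'*6" unfolding A'_def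
 using om_X_decay[of s] kk_bounds(2)[OF xs] bump_bounds(1)[OF v] a23 by (intro mult_mono) (auto intro!: mult_nonneg_nonneg)
 finally show ?thesis .
 qed
 have "norm (f (X s) * HT a f (X s) * of_real (k + k')) <= (C*(1 + (abs s)))*((abs k) + (abs k'))"
 unfolding norm_mult norm_of_real using C by (intro mult_mono[OF fH[of s] abs_triangle_ineq]) auto
 also have "... = C*((1 + (abs s))*(abs k) + (1 + (abs s))*(abs k'))" by (simp add: algebra_simps)
 also have "... <= C*(2 * A*30 + (a 3 - a 2) * A'*6)" using kb kb' C by (intro mult_left_mono add_mono)
 also have "... = C*2 * A*30 + C*(a 3 - a 2) * A'*6" by (simp add: algebra_simps)
 finally show "norm (weak_density T v) <= 2 * C*6 + (C*2 * A*30 + C*(a 3 - a 2) * A'*6)"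
 unfolding w by (intro order_trans[OF norm_triangle_ineq] add_mono 1)
 qed
qed

lemma om_f_HT_limit:
 assumes "((%s. (1 + (abs s)) * om (X s)) \<longlongrightarrow> 0) F"
 shows "((%s. f (X s) * HT a f (X s) * of_real (om (X s))) \<longlongrightarrow> 0) F"
proof -
 obtain C where C: "0 <= C" and fH: "!!s. norm (f (X s)) * norm (HT a f (X s)) <= C*(1 + (abs s))"
 by (rule growth_bounds, rule that)
 show ?thesis
 proof (rule Lim_null_comparison)
 show "((%s. C*((1 + (abs s)) * om (X s))) \<longlongrightarrow> 0) F" using tendsto_mult[OF tendsto_const assms, of C] by simp
 show "\<forall>\<^sub>F s in F. norm (f (X s) * HT a f (X s) * of_real (om (X s))) <= C*((1 + (abs s)) * om (X s))"
 proof (intro always_eventually allI)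
 fix s
 show "norm (f (X s) * HT a f (X s) * of_real (om (X s))) <= C*((1 + (abs s)) * om (X s))"
 using mult_right_mono[OF fH[of s] om_X_decay(1)[of s]] om_X_decay(1)[of s] by (simp add: norm_mult mult_ac)
 qed
 qed
qed

lemma kk_limits: "((%s. kk (X s)) \<longlongrightarrow> P' (a 2)) at_bot" "((%s. kk (X s)) \<longlongrightarrow> - P' (a 3)) at_top"
 "((%s. kk' (X s)) \<longlongrightarrow> kk' (a 2)) at_bot" "((%s. kk' (X s)) \<longlongrightarrow> kk' (a 3)) at_top"
proof -
 have l: "(X \<longlongrightarrow> a 2) at_bot" "(X \<longlongrightarrow> a 3) at_top"
 using X_filterlims unfolding filterlim_at by auto
 show "((%s. kk (X s)) \<longlongrightarrow> P' (a 2)) at_bot" "((%s. kk (X s)) \<longlongrightarrow> - P' (a 3)) at_top"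
 "((%s. kk' (X s)) \<longlongrightarrow> kk' (a 2)) at_bot" "((%s. kk' (X s)) \<longlongrightarrow> kk' (a 3)) at_top"
 unfolding kk_ends[symmetric] unfolding kk_def kk'_def by (intro tendsto_intros l)+
qed

lemma weak_density_limit:
 fixes T :: "nat => real"
 assumes T: "filterlim T at_top sequentially" "!!n. 0 < T n" and v: "v ~= 0"
 shows "(%n. weak_density (T n) v) \<longlonglongrightarrow> limit_density v"
proof -
 define s where "s n = T n * v" for n
 define R where "R n = f (X (s n)) * HT a f (X (s n)) * of_real (om (X (s n))) * of_real (kk' (X (s n)) * bump1 v)" for n
 have snz: "complex_of_real (s n) ~= 0" for n using T(2)[of n] v by (simp add: s_def)
 have Tv: "1/T n = v/s n" for n using T(2)[of n] v by (simp add: s_def)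
 show ?thesis
 proof (cases "v < 0")
 case True
 have sl: "filterlim s at_bot sequentially"
 unfolding s_def[abs_def] using filterlim_tendsto_neg_mult_at_bot[OF tendsto_const True T(1)] by (simp add: mult.commute)
 note L = limits_at_bot[THEN filterlim_compose, OF sl]
 have "R \<longlonglongrightarrow> 0 * of_real (kk' (a 2) * bump1 v)"
 unfolding R_def by (intro tendsto_mult tendsto_of_real tendsto_const filterlim_compose[OF om_f_HT_limit[OF om_X_decay_limits(1)] sl] filterlim_compose[OF kk_limits(3) sl])
 then have "(%n. 2*(q (X (s n)) * HT a f (X (s n))) * of_real (bump1 v) + f (X (s n))*(HT a f (X (s n))/of_real (s n)) * of_real (kk (X (s n))*(v * bump2 v)) + R n)
 \<longlonglongrightarrow> 2*0 * of_real (bump1 v) + f2*(- f2/of_real pi) * of_real (P' (a 2)*(v * bump2 v)) + 0 * of_real (kk' (a 2) * bump1 v)"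
 by (intro tendsto_add tendsto_mult tendsto_of_real tendsto_const L filterlim_compose[OF kk_limits(1) sl])
 moreover have "2*(q (X (s n)) * HT a f (X (s n))) * of_real (bump1 v) + f (X (s n))*(HT a f (X (s n))/of_real (s n)) * of_real (kk (X (s n))*(v * bump2 v)) + R n = weak_density (T n) v" for n
 proof -
 have "kk (X (s n)) * bump2 v/T n = kk (X (s n)) * bump2 v * (1/T n)" by simp
 also have "... = kk (X (s n))*(v * bump2 v)/s n" unfolding Tv by simp
 finally have k: "kk (X (s n)) * bump2 v/T n = kk (X (s n))*(v * bump2 v)/s n" .
 show ?thesis unfolding weak_density_def s_def[symmetric] k R_def by (simp add: algebra_simps)
 qed
 ultimately show ?thesis using True by (simp add: limit_density_def power2_eq_square mult_ac)
 next
 case False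
 then have v0: "0 < v" using v by simp
 have sl: "filterlim s at_top sequentially"
 unfolding s_def[abs_def] using filterlim_tendsto_pos_mult_at_top[OF tendsto_const v0 T(1)] by (simp add: mult.commute)
 note L = limits_at_top[THEN filterlim_compose, OF sl]
 have "R \<longlonglongrightarrow> 0 * of_real (kk' (a 3) * bump1 v)"
 unfolding R_def by (intro tendsto_mult tendsto_of_real tendsto_const filterlim_compose[OF om_f_HT_limit[OF om_X_decay_limits(2)] sl] filterlim_compose[OF kk_limits(4) sl])
 then have "(%n. 2*(q (X (s n)) * HT a f (X (s n))) * of_real (bump1 v) + (f (X (s n))/of_real (s n)) * HT a f (X (s n)) * of_real (kk (X (s n))*(v * bump2 v)) + R n)
 \<longlonglongrightarrow> 2*(q3 * h3) * of_real (bump1 v) + (- d3) * h3 * of_real (- P' (a 3)*(v * bump2 v)) + 0 * of_real (kk' (a 3) * bump1 v)"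
 by (intro tendsto_add tendsto_mult tendsto_of_real tendsto_const L filterlim_compose[OF kk_limits(2) sl])
 moreover have "2*(q (X (s n)) * HT a f (X (s n))) * of_real (bump1 v) + (f (X (s n))/of_real (s n)) * HT a f (X (s n)) * of_real (kk (X (s n))*(v * bump2 v)) + R n = weak_density (T n) v" for n
 proof -
 have "kk (X (s n)) * bump2 v/T n = kk (X (s n)) * bump2 v * (1/T n)" by simp
 also have "... = kk (X (s n))*(v * bump2 v)/s n" unfolding Tv by simp
 finally have k: "kk (X (s n)) * bump2 v/T n = kk (X (s n))*(v * bump2 v)/s n" .
 show ?thesis unfolding weak_density_def s_def[symmetric] k R_def by (simp add: algebra_simps)
 qed
 moreover have "2*(q3 * h3) * of_real (bump1 v) + (- d3) * h3 * of_real (- P' (a 3)*(v * bump2 v)) + 0 * of_real (kk' (a 3) * bump1 v) = limit_density v"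
 using False roots(5) by (simp add: limit_density_def d3_def algebra_simps)
 ultimately show ?thesis by simp
 qed
qed

text \<open>A conserved quantity: the commutation makes the contributions of the two ends equal.
  It links the limit of the Hilbert transform at $a_3$ to the boundary values of the
  eigenfunction.\<close>

lemma product_identity: "h3 * q3 = f2\<^sup>2 * of_real (P' (a 2))/of_real pi"
proof -
 obtain B where B: "!!T v. 1 <= T ==> (abs v) <= 1 ==> norm (weak_density T v) <= B" by (rule weak_density_bound, rule that)
 define T where "T n = real n + 1" for n
 have T: "1 <= T n" "0 < T n" for n by (auto simp: T_def)
 have Tl: "filterlim T at_top sequentially" unfolding T_def[abs_def] by real_asymp
 define D where "D n v = (if v = 0 then 0 else weak_density (T n) v)" for n v
 have DI: "(D n has_integral 0) {-1..1}" for n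
 by (rule has_integral_spike_finite[OF _ _ weak_identity[OF T(2)], of "{0}"]) (auto simp: D_def)
 have Di: "D n integrable_on {-1..1}" for n using DI by (rule has_integral_integrable)
 have B0: "0 <= B" using order_trans[OF norm_ge_zero B[of 1 0]] by simp
 have Db: "norm (D n v) <= B" if "v \<in> {-1..1}" for n v using B[OF T(1), of v n] B0 that by (auto simp: D_def abs_le_iff)
 have Dl: "(%n. D n v) \<longlonglongrightarrow> limit_density v" for v
 proof (cases "v = 0")
 case False then show ?thesis using weak_density_limit[OF Tl T(2) False] by (simp add: D_def)
 qed (simp add: D_def limit_density_def bump1_def)
 have "(%n. integral {-1..1} (D n)) \<longlonglongrightarrow> integral {-1..1} limit_density"
 by (rule dominated_convergence(2)[OF Di integrable_const_ivl Db Dl])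
 then have "(%n::nat. 0) \<longlonglongrightarrow> integral {-1..1} limit_density" unfolding integral_unique[OF DI] .
 then have "integral {-1..1} limit_density = 0" using LIMSEQ_unique[OF tendsto_const] by metis
 then show ?thesis unfolding integral_unique[OF limit_density_integral] by simp
qed

end

section \<open>Boundary value of the singular function by duality\<close>

lemma x_ln_x_limit: "((%t::real. t * ln t) \<longlongrightarrow> 0) (at_right 0)" by real_asymp

lemma reflect_at_left: "filterlim (%x. c - x) (at_right 0) (at_left (c::real))"
proof -
 have "((%x. c - x) \<longlongrightarrow> c - c) (at_left c)" by (intro tendsto_intros)
 then show ?thesis unfolding filterlim_at by (auto simp: eventually_at_filter)
qed

lemma shift_at_right: "filterlim (%x. x - c) (at_right 0) (at_right (c::real))"
proof -
 have "((%x. x - c) \<longlongrightarrow> c - c) (at_right c)" by (intro tendsto_intros)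
 then show ?thesis unfolding filterlim_at by (auto simp: eventually_at_filter)
qed

lemma log_has_integral:
 fixes s c :: real
 assumes s: "0 < s"
 shows "((%y. complex_of_real (ln (y - c))) has_integral of_real (s * ln s - s)) {c..c + s}"
proof -
 let ?Phi = "%y. complex_of_real ((y - c) * ln (y - c) - (y - c))"
 have "((%y. complex_of_real (ln (y - c))) has_integral (of_real ((c + s - c) * ln (c + s - c) - (c + s - c)) - of_real (0 - (c - c)))) {c..c + s}"
 proof (rule has_integral_of_limits)
 fix y assume y: "c < y" "y < c + s"
 have "((%y. (y - c) * ln (y - c) - (y - c)) has_real_derivative ln (y - c)) (at y)"
 using y by (auto intro!: derivative_eq_intros)
 then show "(?Phi has_vector_derivative of_real (ln (y - c))) (at y)" by (rule has_vector_derivative_of_real)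
 next
 show "(?Phi \<longlongrightarrow> of_real (0 - (c - c))) (at_right c)"
 by (intro tendsto_of_real tendsto_diff filterlim_compose[OF x_ln_x_limit shift_at_right] tendsto_ident_at tendsto_const)
 show "(?Phi \<longlongrightarrow> of_real ((c + s - c) * ln (c + s - c) - (c + s - c))) (at_left (c + s))"
 using s by (intro tendsto_intros) auto
 qed (use s in simp)
 then show ?thesis by simp
qed

lemma dual_kernel_has_integral:
 fixes s ka c :: real
 assumes s: "0 < s" and ka: "0 < ka"
 shows "((%x. ln (1 + s/(c - x))) has_integral ((ka + s) * ln (ka + s) - ka * ln ka - s * ln s)) {c - ka..c}"
proof -
 let ?Phi = "%x. complex_of_real ((c - x) * ln (c - x) - (c - x + s) * ln (c - x + s))"
 have "((%x. complex_of_real (ln (1 + s/(c - x)))) has_integral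
 (of_real (0 - (c - c + s) * ln (c - c + s)) - of_real ((c - (c - ka)) * ln (c - (c - ka)) - (c - (c - ka) + s) * ln (c - (c - ka) + s)))) {c - ka..c}"
 proof (rule has_integral_of_limits)
 fix x assume x: "c - ka < x" "x < c"
 have p: "0 < c - x" "0 < c - x + s" using x s by auto
 have e: "1 + s/(c - x) = (c - x + s)/(c - x)" using p by (simp add: field_simps)
 have l: "ln (1 + s/(c - x)) = ln (c - x + s) - ln (c - x)" unfolding e by (rule ln_divide_pos[OF p(2,1)])
 have "((%x. (c - x) * ln (c - x) - (c - x + s) * ln (c - x + s)) has_real_derivative ln (1 + s/(c - x))) (at x)"
 unfolding l using p by (auto intro!: derivative_eq_intros)
 then show "(?Phi has_vector_derivative of_real (ln (1 + s/(c - x)))) (at x)" by (rule has_vector_derivative_of_real)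
 next
 show "(?Phi \<longlongrightarrow> of_real ((c - (c - ka)) * ln (c - (c - ka)) - (c - (c - ka) + s) * ln (c - (c - ka) + s))) (at_right (c - ka))"
 using s ka by (intro tendsto_intros) auto
 have A: "((%x. c - x + s) \<longlongrightarrow> c - c + s) (at_left c)" by (intro tendsto_intros)
 show "(?Phi \<longlongrightarrow> of_real (0 - (c - c + s) * ln (c - c + s))) (at_left c)"
 by (rule tendsto_of_real[OF tendsto_diff[OF filterlim_compose[OF x_ln_x_limit reflect_at_left] tendsto_mult[OF A tendsto_ln[OF A]]]]) (use s in simp)
 qed (use ka in simp)
 from has_integral_linear[OF this bounded_linear_Re] show ?thesis by (simp add: o_def algebra_simps)
qed

lemma HT_indicator:
 assumes s: "0 < s" "a 3 + s <= a 4" and a: "a 2 < a 3" and x: "x < a 3"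
 shows "HT a (%y. if y \<in> {a 3..a 3 + s} then 1 else 0) x = of_real (1/pi) * of_real (ln (1 + s/(a 3 - x)))"
proof -
 let ?J = "{a 3..a 3 + s}"
 have p: "0 < a 3 - x" "0 < a 3 + s - x" using s x by auto
 have hi: "((%y. 1/complex_of_real (y - x)) has_integral (of_real (ln (a 3 + s - x)) - of_real (ln (a 3 - x)))) ?J"
 proof (rule fundamental_theorem_of_calculus)
 fix y assume y: "y \<in> ?J"
 have "((%y. ln (y - x)) has_real_derivative 1/(y - x)) (at y)" using y x by (auto intro!: derivative_eq_intros)
 then have d: "((%y. complex_of_real (ln (y - x))) has_vector_derivative of_real (1/(y - x))) (at y)" by (rule has_vector_derivative_of_real)
 from has_vector_derivative_at_within[OF d, of ?J]
 show "((%y. complex_of_real (ln (y - x))) has_vector_derivative 1/of_real (y - x)) (at y within ?J)" by simp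
 qed (use s in simp)
 have e: "1 + s/(a 3 - x) = (a 3 + s - x)/(a 3 - x)" using p by (simp add: field_simps)
 have l: "of_real (ln (a 3 + s - x)) - of_real (ln (a 3 - x)) = complex_of_real (ln (1 + s/(a 3 - x)))"
 unfolding e ln_divide_pos[OF p(2,1)] by simp
 have ai: "(%y. 1/complex_of_real (y - x)) absolutely_integrable_on ?J"
 by (rule absolutely_integrable_continuous_real) (use x in \<open>auto intro!: continuous_intros simp del: of_real_diff\<close>)
 have i: "integrable (lebesgue_on ?J) (%y. 1/complex_of_real (y - x))"
 by (rule absolutely_integrable_imp_integrable[OF ai]) simp
 have L: "(LINT y : {y \<in> {a 2..a 4}. \<bar>y - x\<bar> > e} | lebesgue. (if y \<in> ?J then 1 else 0)/complex_of_real (y - x)) = of_real (ln (1 + s/(a 3 - x)))"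
 if e: "0 < e" "e < a 3 - x" for e
 proof -
 have "(LINT y : {y \<in> {a 2..a 4}. \<bar>y - x\<bar> > e} | lebesgue. (if y \<in> ?J then 1 else 0)/complex_of_real (y - x))
 = integral\<^sup>L lebesgue (%y. if y \<in> ?J then 1/complex_of_real (y - x) else 0)"
 unfolding set_lebesgue_integral_def
 by (rule Bochner_Integration.integral_cong) (use e s a x in \<open>auto simp: indicator_def simp del: of_real_diff\<close>)
 also have "... = integral\<^sup>L (lebesgue_on ?J) (%y. 1/complex_of_real (y - x))"
 by (rule Lebesgue_Measure.integral_restrict_UNIV) simp
 also have "... = integral ?J (%y. 1/complex_of_real (y - x))" by (rule lebesgue_integral_eq_integral[OF i]) simp
 also have "... = of_real (ln (1 + s/(a 3 - x)))" unfolding integral_unique[OF hi] l ..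
 finally show ?thesis .
 qed
 have "((%e. LINT y : {y \<in> {a 2..a 4}. \<bar>y - x\<bar> > e} | lebesgue. (if y \<in> ?J then 1 else 0)/complex_of_real (y - x)) \<longlongrightarrow> of_real (ln (1 + s/(a 3 - x)))) (at_right 0)"
 proof (rule tendsto_eventually)
 show "\<forall>\<^sub>F e in at_right 0. (LINT y : {y \<in> {a 2..a 4}. \<bar>y - x\<bar> > e} | lebesgue. (if y \<in> ?J then 1 else 0)/complex_of_real (y - x)) = of_real (ln (1 + s/(a 3 - x)))"
 unfolding eventually_at_right_field by (intro exI[of _ "a 3 - x"] conjI allI impI L) (use p in auto)
 qed
 from tendsto_Lim[OF _ this] show ?thesis unfolding HT_def by simp
qed

text \<open>An eigenfunction together with its partner under the Hilbert transform and the adjoint.\<close>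

locale singular_pair = eigenfunction +
 fixes g :: "real => complex" and \<sigma> :: real
 assumes g_L2: "g \<in> L2_on {a 1..a 3}" and \<sigma>: "0 < \<sigma>"
 and HT_eq: "L2_eq_on {a 1..a 3} (HT a f) (%x. of_real \<sigma> * g x)"
 and adjoint: "L2_adjoint_eq {a 2..a 4} {a 1..a 3} (HT a) g (%y. of_real \<sigma> * f y)"
begin

lemma exceptional_negligible: "negligible {x \<in> {a 1..a 3}. HT a f x ~= of_real \<sigma> * g x}"
 using sets_AE_lebesgue_on_negligible[OF HT_eq[unfolded L2_eq_on_def]] by simp

text \<open>Testing the adjoint relation with an indicator function avoids computing the adjoint.\<close>

lemma duality_with_indicator:
 assumes s: "0 < s" "a 3 + s <= a 4" and N: "negligible N"
 and g1: "!!x. x \<in> {a 1..a 3} - N ==> g1 x = g x" and a3N: "a 3 \<in> N"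
 and ai: "(%x. of_real (ln (1 + s/(a 3 - x))) * g1 x) absolutely_integrable_on {a 1..a 3}"
 shows "integral {a 1..a 3} (%x. of_real (ln (1 + s/(a 3 - x))) * g1 x) = of_real (pi * \<sigma>) * integral {a 3..a 3 + s} f"
proof -
 let ?J = "{a 3..a 3 + s}" and ?S = "{a 1..a 3}"
 define ind where "ind y = (if y \<in> ?J then 1 else (0 :: complex))" for y
 have indm: "ind \<in> borel_measurable borel" unfolding ind_def[abs_def] by measurable
 have indb: "norm (ind y) <= 1" for y by (simp add: ind_def)
 have "(%y. (norm (ind y))\<^sup>2) absolutely_integrable_on {a 2..a 4}"
 proof (rule measurable_bounded_by_integrable_imp_absolutely_integrable)
 show "(%y. (norm (ind y))\<^sup>2) \<in> borel_measurable (lebesgue_on {a 2..a 4})"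
 by (rule borel_measurable_imp_lebesgue_on) (use indm in measurable)
 show "(%y. 1::real) integrable_on {a 2..a 4}" by (rule integrable_const_ivl)
 show "!!y. y \<in> {a 2..a 4} ==> norm ((norm (ind y))\<^sup>2) <= (1::real)" by (simp add: ind_def)
 qed auto
 then have "integrable (lebesgue_on {a 2..a 4}) (%y. (norm (ind y))\<^sup>2)" by (rule absolutely_integrable_imp_integrable) simp
 then have indL2: "ind \<in> L2_on {a 2..a 4}" using borel_measurable_imp_lebesgue_on[OF indm] by (simp add: L2_on_def)
 define F where "F x = of_real (ln (1 + s/(a 3 - x))) * g1 x" for x
 define T where "T z = complex_of_real (1/pi) * cnj z" for z
 have Tb: "bounded_linear T" unfolding T_def[abs_def] by (rule bounded_linear_compose[OF bounded_linear_mult_right bounded_linear_cnj])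
 have Fi: "F absolutely_integrable_on ?S" using ai by (simp add: F_def[abs_def])
 have eq: "HT a ind x * cnj (g x) = (T \<circ> F) x" if "x \<in> ?S - N" for x
 proof -
 have "x < a 3" using that a3N by (cases "x = a 3") auto
 then have H: "HT a ind x = of_real (1/pi) * of_real (ln (1 + s/(a 3 - x)))" unfolding ind_def[abs_def] by (rule HT_indicator[OF s a23])
 show ?thesis unfolding H o_def T_def F_def g1[OF that] by simp
 qed
 have TF: "(T \<circ> F) absolutely_integrable_on ?S" by (rule absolutely_integrable_linear[OF Fi Tb])
 have "(%x. HT a ind x * cnj (g x)) absolutely_integrable_on ?S"
 by (rule absolutely_integrable_spike[OF TF N eq])
 then have "L2_inner_on ?S (HT a ind) g = integral ?S (%x. HT a ind x * cnj (g x))"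
 unfolding L2_inner_on_def by (intro lebesgue_integral_eq_integral absolutely_integrable_imp_integrable) auto
 also have "... = integral ?S (T \<circ> F)" by (rule integral_spike[OF N]) (use eq in metis)
 also have "... = T (integral ?S F)" using Fi by (intro integral_linear Tb) (simp add: absolutely_integrable_on_def)
 finally have 1: "L2_inner_on ?S (HT a ind) g = T (integral ?S F)" .
 define T' where "T' z = complex_of_real \<sigma> * cnj z" for z
 have Tb': "bounded_linear T'" unfolding T'_def[abs_def] by (rule bounded_linear_compose[OF bounded_linear_mult_right bounded_linear_cnj])
 have find: "(%y. f y * ind y) absolutely_integrable_on {a 2..a 4}" by (rule f_kernel_abs_integrable[OF indm indb])
 have eq': "ind y * cnj (of_real \<sigma> * f y) = (T' \<circ> (%y. f y * ind y)) y" for y by (simp add: ind_def T'_def)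
 have "L2_inner_on {a 2..a 4} ind (%y. of_real \<sigma> * f y) = integral {a 2..a 4} (T' \<circ> (%y. f y * ind y))"
 unfolding L2_inner_on_def eq'
 by (intro lebesgue_integral_eq_integral absolutely_integrable_imp_integrable absolutely_integrable_linear[OF find Tb']) auto
 also have "... = T' (integral {a 2..a 4} (%y. f y * ind y))"
 using find by (intro integral_linear Tb') (simp add: absolutely_integrable_on_def)
 also have "integral {a 2..a 4} (%y. f y * ind y) = integral ?J f"
 proof -
 have fi: "f integrable_on {a 2..a 4}" using f_abs_integrable by (simp add: absolutely_integrable_on_def)
 have "f integrable_on ?J" by (rule integrable_on_subinterval[OF fi]) (use s a23 in auto)
 then have "(f has_integral integral ?J f) ?J" by (rule integrable_integral)
 then have "((%y. if y \<in> ?J then f y else 0) has_integral integral ?J f) {a 2..a 4}"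
 using s a23 by (subst has_integral_restrict) auto
 moreover have "(%y. if y \<in> ?J then f y else 0) = (%y. f y * ind y)" by (rule ext) (simp add: ind_def)
 ultimately show ?thesis using integral_unique by metis
 qed
 finally have 2: "L2_inner_on {a 2..a 4} ind (%y. of_real \<sigma> * f y) = T' (integral ?J f)" .
 have "L2_inner_on ?S (HT a ind) g = L2_inner_on {a 2..a 4} ind (%y. of_real \<sigma> * f y)"
 using adjoint indL2 unfolding L2_adjoint_eq_def by blast
 then have "T (integral ?S F) = T' (integral ?J f)" unfolding 1 2 .
 then have "cnj (integral ?S F) = cnj (of_real (pi * \<sigma>) * integral ?J f)" by (simp add: T_def T'_def field_simps)
 then have "integral ?S F = of_real (pi * \<sigma>) * integral ?J f" by (simp only: complex_cnj_cancel_iff)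
 then show ?thesis by (simp add: F_def[abs_def])
qed

lemma dual_estimate:
 assumes ep: "0 < ep"
 obtains ka I where "0 < ka" "!!s. 0 < s ==> a 3 + s <= a 4 ==>
 norm (of_real (pi * \<sigma>) * integral {a 3..a 3 + s} f - h3/of_real \<sigma> * of_real ((ka + s) * ln (ka + s) - ka * ln ka - s * ln s))
 <= s * I + ep*((ka + s) * ln (ka + s) - ka * ln ka - s * ln s)"
proof -
 let ?S = "{a 1..a 3}"
 define G where "G = h3/of_real \<sigma>"
 have "((%x. HT a f x/of_real \<sigma>) \<longlongrightarrow> G) (at_left (a 3))" unfolding G_def using \<sigma> by (intro tendsto_intros h3) auto
 from tendstoD[OF this ep] obtain b where b: "b < a 3" "!!x. b < x ==> x < a 3 ==> dist (HT a f x/of_real \<sigma>) G < ep"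
 unfolding eventually_at_left_field by blast
 define ka where "ka = min (a 3 - b) (a 3 - a 2)"
 have ka: "0 < ka" "ka <= a 3 - b" "ka <= a 3 - a 2" using b(1) a23 by (auto simp: ka_def)
 define N where "N = {x \<in> ?S. HT a f x ~= of_real \<sigma> * g x} \<union> {a 3}"
 have N: "negligible N" unfolding N_def by (intro negligible_Un exceptional_negligible) simp
 (* after a change on a null set the estimates hold at every point *)
 define g1 where "g1 x = (if x \<in> N then (if a 3 - ka < x then G else 0) else g x)" for x
 have g1g: "g1 x = g x" if "x \<in> ?S - N" for x using that by (simp add: g1_def)
 have g1n: "norm (g1 x - G) <= ep" if "x \<in> ?S" "a 3 - ka < x" for x
 proof (cases "x \<in> N")
 case False
 then have x: "x < a 3" "HT a f x = of_real \<sigma> * g x" using that by (auto simp: N_def)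
 have "b < x" using that ka by linarith
 from b(2)[OF this x(1)] have "norm (g x - G) < ep" unfolding x(2) using \<sigma> by (simp add: dist_norm)
 then show ?thesis using False by (simp add: g1_def)
 qed (use ep that in \<open>simp add: g1_def\<close>)
 have g1i: "g1 absolutely_integrable_on ?S"
 by (rule absolutely_integrable_spike[OF L2_on_abs_integrable[OF g_L2] N g1g])
 have ng1i: "(%x. norm (g1 x)) integrable_on ?S" using g1i by (simp add: absolutely_integrable_on_def)
 define I where "I = integral ?S (%x. norm (g1 x))/ka"
 show thesis
 proof (rule that[OF ka(1), of I])
 fix s assume s: "0 < s" "a 3 + s <= a 4"
 define M where "M = (ka + s) * ln (ka + s) - ka * ln ka - s * ln s"
 define m where "m x = ln (1 + s/(a 3 - x))" for x
 define m1 where "m1 x = (if x \<in> {a 3 - ka..a 3} then m x else 0)" for x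
 have m0: "0 <= m x" if "x <= a 3" for x using s that by (simp add: m_def)
 have mI: "(m1 has_integral M) ?S"
 unfolding m1_def[abs_def] M_def m_def using dual_kernel_has_integral[OF s(1) ka(1), of "a 3"] ka a12 by (subst has_integral_restrict) auto
 have m1i: "m1 integrable_on ?S" using mI by blast
 have mf: "m x <= s/ka" if "x <= a 3 - ka" for x
 proof -
 have p: "0 < a 3 - x" using that ka by linarith
 have "m x <= s/(a 3 - x)" unfolding m_def using s p by (intro ln_add_one_self_le_self) simp
 also have "... <= s/ka" using that ka s by (intro divide_left_mono) auto
 finally show ?thesis .
 qed
 have D: "norm (of_real (m x) * g1 x - G * of_real (m1 x)) <= s/ka * norm (g1 x) + ep * m1 x" if x: "x \<in> ?S - {a 3 - ka}" for x
 proof (cases "a 3 - ka < x")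
 case True
 then have m1: "m1 x = m x" using x by (simp add: m1_def)
 have "norm (of_real (m x) * g1 x - G * of_real (m1 x)) = norm (of_real (m x)*(g1 x - G))" unfolding m1 by (simp add: algebra_simps)
 also have "... = m x * norm (g1 x - G)" using m0[of x] x by (simp add: norm_mult)
 also have "... <= m x * ep" using g1n[of x] True x m0[of x] by (intro mult_left_mono) auto
 also have "... <= s/ka * norm (g1 x) + ep * m1 x" unfolding m1 using s ka by (simp add: mult.commute)
 finally show ?thesis .
 next
 case False
 then have m1: "m1 x = 0" and xk: "x <= a 3 - ka" using x by (auto simp: m1_def)
 have "norm (of_real (m x) * g1 x - G * of_real (m1 x)) = m x * norm (g1 x)" unfolding m1 using m0[of x] x by (simp add: norm_mult)
 also have "... <= s/ka * norm (g1 x)" by (rule mult_right_mono[OF mf[OF xk]]) simp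
 finally show ?thesis by (simp add: m1)
 qed
 have mm: "(%x. complex_of_real (m x) * g1 x) \<in> borel_measurable (lebesgue_on ?S)"
 proof (rule borel_measurable_times)
 show "(%x. complex_of_real (m x)) \<in> borel_measurable (lebesgue_on ?S)"
 unfolding m_def[abs_def] by (rule borel_measurable_imp_lebesgue_on) measurable
 show "g1 \<in> borel_measurable (lebesgue_on ?S)"
 by (rule borel_measurable_integrable[OF absolutely_integrable_imp_integrable[OF g1i]]) simp
 qed
 define bd where "bd x = (if x = a 3 - ka then norm (of_real (m x) * g1 x) + norm (of_real (m x) * g1 x - G * of_real (m1 x)) else s/ka * norm (g1 x) + ep * m1 x + norm G * m1 x)" for x
 have bdi: "bd integrable_on ?S"
 proof (rule integrable_spike_finite[of "{a 3 - ka}"])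
 show "(%x. s/ka * norm (g1 x) + ep * m1 x + norm G * m1 x) integrable_on ?S"
 by (intro integrable_add integrable_on_mult_right ng1i m1i)
 qed (auto simp: bd_def)
 have m1n: "0 <= m1 x" if "x \<in> ?S" for x using m0[of x] that by (simp add: m1_def)
 have bnd: "norm (of_real (m x) * g1 x) <= bd x" if x: "x \<in> ?S" for x
 proof (cases "x = a 3 - ka")
 case False
 have "norm (of_real (m x) * g1 x) <= norm (of_real (m x) * g1 x - G * of_real (m1 x)) + norm (G * of_real (m1 x))"
 using norm_triangle_sub[of "of_real (m x) * g1 x" "G * of_real (m1 x)"] by linarith
 also have "... <= s/ka * norm (g1 x) + ep * m1 x + norm G * m1 x"
 using D[of x] x False m1n[OF x] by (intro add_mono) (auto simp: norm_mult)
 finally show ?thesis using False by (simp add: bd_def)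
 qed (simp add: bd_def)
 have ai: "(%x. of_real (m x) * g1 x) absolutely_integrable_on ?S"
 by (rule measurable_bounded_by_integrable_imp_absolutely_integrable[OF mm _ bdi bnd]) auto
 have dual: "integral ?S (%x. of_real (m x) * g1 x) = of_real (pi * \<sigma>) * integral {a 3..a 3 + s} f"
 unfolding m_def by (rule duality_with_indicator[OF s N g1g _ ai[unfolded m_def]]) (auto simp: N_def)
 define DD where "DD x = (if x = a 3 - ka then 0 else of_real (m x) * g1 x - G * of_real (m1 x))" for x
 have DDi: "(DD has_integral (of_real (pi * \<sigma>) * integral {a 3..a 3 + s} f - G * of_real M)) ?S"
 proof (rule has_integral_spike_finite[of "{a 3 - ka}"])
 show "((%x. of_real (m x) * g1 x - G * of_real (m1 x)) has_integral (of_real (pi * \<sigma>) * integral {a 3..a 3 + s} f - G * of_real M)) ?S"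
 unfolding dual[symmetric] using ai
 by (intro has_integral_diff has_integral_mult_right has_integral_of_real[OF mI] integrable_integral) (simp add: absolutely_integrable_on_def)
 qed (auto simp: DD_def)
 have "norm (integral ?S DD) <= integral ?S (%x. s/ka * norm (g1 x) + ep * m1 x)"
 proof (rule integral_norm_bound_integral)
 show "DD integrable_on ?S" using DDi by blast
 show "(%x. s/ka * norm (g1 x) + ep * m1 x) integrable_on ?S" by (intro integrable_add integrable_on_mult_right ng1i m1i)
 fix x assume x: "x \<in> ?S"
 have "0 <= s/ka * norm (g1 x) + ep * m1 x" using s ka ep m1n[OF x] by simp
 moreover have "DD x = (if x = a 3 - ka then 0 else of_real (m x) * g1 x - G * of_real (m1 x))" by (rule DD_def)
 ultimately show "norm (DD x) <= s/ka * norm (g1 x) + ep * m1 x"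
 using D[of x] x by (cases "x = a 3 - ka") (simp_all only: if_True if_False norm_zero Diff_iff singleton_iff HOL.simp_thms)
 qed
 also have "... = s * I + ep * M"
 proof (rule integral_unique)
 have "((%x. s/ka * norm (g1 x) + ep * m1 x) has_integral s/ka * integral ?S (%x. norm (g1 x)) + ep * M) ?S"
 by (intro has_integral_add has_integral_mult_right mI integrable_integral ng1i)
 then show "((%x. s/ka * norm (g1 x) + ep * m1 x) has_integral s * I + ep * M) ?S" by (simp add: I_def)
 qed
 finally show "norm (of_real (pi * \<sigma>) * integral {a 3..a 3 + s} f - h3/of_real \<sigma> * of_real ((ka + s) * ln (ka + s) - ka * ln ka - s * ln s))
 <= s * I + ep*((ka + s) * ln (ka + s) - ka * ln ka - s * ln s)"
 unfolding integral_unique[OF DDi] by (simp add: G_def M_def)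
 qed
qed

lemma log_mass_near_a3:
 obtains rh C where "0 < rh" "!!s. 0 < s ==> s <= rh ==> a 3 + s <= a 4 & norm (integral {a 3..a 3 + s} f - d3 * of_real (s * ln s - s)) <= C * s"
proof -
 obtain rh C where rh: "0 < rh" "rh < a 4 - a 3" and C: "0 <= C"
 and f3: "!!y. 0 < \<bar>y - a 3\<bar> ==> \<bar>y - a 3\<bar> <= rh ==> norm (f y - d3 * of_real (ln \<bar>y - a 3\<bar>)) <= C"
 by (rule near_a3) (rule that)
 show thesis
 proof (rule that[OF rh(1), of C], rule conjI)
 fix s assume s: "0 < s" "s <= rh"
 show a4: "a 3 + s <= a 4" using s rh by linarith
 have fi: "f integrable_on {a 2..a 4}" using f_abs_integrable by (simp add: absolutely_integrable_on_def)
 have "f integrable_on {a 3..a 3 + s}" by (rule integrable_on_subinterval[OF fi]) (use a4 a23 in auto)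
 then have "((%y. f y - d3 * of_real (ln (y - a 3))) has_integral (integral {a 3..a 3 + s} f - d3 * of_real (s * ln s - s))) {a 3..a 3 + s}"
 by (intro has_integral_diff has_integral_mult_right log_has_integral[OF s(1)] integrable_integral)
 then have hi: "((%y. if y = a 3 then 0 else f y - d3 * of_real (ln (y - a 3))) has_integral (integral {a 3..a 3 + s} f - d3 * of_real (s * ln s - s))) {a 3..a 3 + s}"
 by (rule has_integral_spike_finite[rotated 2, where S="{a 3}"]) auto
 have "norm (integral {a 3..a 3 + s} f - d3 * of_real (s * ln s - s)) <= C * measure lborel {a 3..a 3 + s}"
 proof (rule has_integral_bound_real[OF C finite.emptyI hi])
 fix y assume y: "y \<in> {a 3..a 3 + s} - {}"
 show "norm (if y = a 3 then 0 else f y - d3 * of_real (ln (y - a 3))) <= C"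
 using f3[of y] y s C by (cases "y = a 3") auto
 qed
 then show "norm (integral {a 3..a 3 + s} f - d3 * of_real (s * ln s - s)) <= C * s" using s by simp
 qed
qed

text \<open>Both sides of the duality with the interval $[a_3,a_3+s]$ behave like a multiple of
  $s\ln(1/s)$, which picks out the boundary value of the partner on the left and the logarithmic
  coefficient of the eigenfunction on the right.\<close>

lemma dual_boundary_value: "h3/of_real \<sigma> = - (of_real (pi * \<sigma>) * d3)"
proof (rule ccontr)
 assume neq: "h3/of_real \<sigma> ~= - (of_real (pi * \<sigma>) * d3)"
 define G where "G = h3/of_real \<sigma>"
 define D where "D = of_real (pi * \<sigma>) * d3"
 define ep where "ep = norm (- D - G)/2"
 have ep: "0 < ep" using neq by (simp add: ep_def G_def D_def neg_eq_iff_add_eq_0 eq_neg_iff_add_eq_0 add.commute)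
 obtain ka I where ka: "0 < ka" and est: "!!s. 0 < s ==> a 3 + s <= a 4 ==>
 norm (of_real (pi * \<sigma>) * integral {a 3..a 3 + s} f - h3/of_real \<sigma> * of_real ((ka + s) * ln (ka + s) - ka * ln ka - s * ln s))
 <= s * I + ep*((ka + s) * ln (ka + s) - ka * ln ka - s * ln s)"
 by (rule dual_estimate[OF ep], rule that)
 obtain rh C where rh: "0 < rh" and mass: "!!s. 0 < s ==> s <= rh ==> a 3 + s <= a 4 & norm (integral {a 3..a 3 + s} f - d3 * of_real (s * ln s - s)) <= C * s"
 by (rule log_mass_near_a3, rule that)
 define M where "M s = (ka + s) * ln (ka + s) - ka * ln ka - s * ln s" for s
 define W where "W s = s * - ln s" for s :: real
 have lM: "((%s. M s/W s) \<longlongrightarrow> 1) (at_right 0)" unfolding M_def W_def using ka by real_asymp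
 have lL: "((%s. (s * ln s - s)/W s) \<longlongrightarrow> - 1) (at_right 0)" unfolding W_def by real_asymp
 have lS: "((%s. s/W s) \<longlongrightarrow> 0) (at_right 0)" unfolding W_def by real_asymp
 have "norm (D * of_real (- 1) - G * of_real 1) <= (I + pi * \<sigma> * C)*0 + ep*1"
 proof (rule tendsto_le)
 show "((%s. norm (D * of_real ((s * ln s - s)/W s) - G * of_real (M s/W s))) \<longlongrightarrow> norm (D * of_real (- 1) - G * of_real 1)) (at_right 0)"
 by (intro tendsto_norm tendsto_diff tendsto_mult tendsto_const tendsto_of_real lM lL)
 show "((%s. (I + pi * \<sigma> * C)*(s/W s) + ep*(M s/W s)) \<longlongrightarrow> (I + pi * \<sigma> * C)*0 + ep*1) (at_right 0)"
 by (intro tendsto_add tendsto_mult tendsto_const lS lM)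
 show "\<forall>\<^sub>F s in at_right 0. norm (D * of_real ((s * ln s - s)/W s) - G * of_real (M s/W s)) <= (I + pi * \<sigma> * C)*(s/W s) + ep*(M s/W s)"
 unfolding eventually_at_right_field
 proof (intro exI[of _ "min rh 1"] conjI allI impI)
 show "0 < min rh 1" using rh by simp
 fix s assume s: "0 < s" "s < min rh 1"
 have W: "0 < W s" unfolding W_def using s by (intro mult_pos_pos) auto
 have ms: "a 3 + s <= a 4" "norm (integral {a 3..a 3 + s} f - d3 * of_real (s * ln s - s)) <= C * s" using mass[OF s(1)] s by auto
 let ?J = "integral {a 3..a 3 + s} f"
 have "D * of_real (s * ln s - s) - G * of_real (M s) = (of_real (pi * \<sigma>) * ?J - G * of_real (M s)) - of_real (pi * \<sigma>)*(?J - d3 * of_real (s * ln s - s))"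
 by (simp add: D_def algebra_simps)
 then have "norm (D * of_real (s * ln s - s) - G * of_real (M s)) <= norm (of_real (pi * \<sigma>) * ?J - G * of_real (M s)) + norm (of_real (pi * \<sigma>)*(?J - d3 * of_real (s * ln s - s)))"
 using norm_triangle_ineq4 by metis
 also have "... <= (s * I + ep * M s) + pi * \<sigma> * (C * s)"
 proof (rule add_mono)
 show "norm (of_real (pi * \<sigma>) * ?J - G * of_real (M s)) <= s * I + ep * M s" unfolding G_def M_def by (rule est[OF s(1) ms(1)])
 have "norm (of_real (pi * \<sigma>)*(?J - d3 * of_real (s * ln s - s))) = pi * \<sigma> * norm (?J - d3 * of_real (s * ln s - s))"
 unfolding norm_mult norm_of_real using \<sigma> by simp
 also have "... <= pi * \<sigma> * (C * s)" using ms(2) \<sigma> by (intro mult_left_mono) auto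
 finally show "norm (of_real (pi * \<sigma>)*(?J - d3 * of_real (s * ln s - s))) <= pi * \<sigma> * (C * s)" .
 qed
 finally have main: "norm (D * of_real (s * ln s - s) - G * of_real (M s)) <= (I + pi * \<sigma> * C) * s + ep * M s" by (simp add: algebra_simps)
 have "D * of_real ((s * ln s - s)/W s) - G * of_real (M s/W s) = (D * of_real (s * ln s - s) - G * of_real (M s))/of_real (W s)"
 proof -
 have alg: "D*(z/W') - G*(m/W') = (D * z - G * m)/W'" for z m W' :: complex by (simp add: diff_divide_distrib)
 show ?thesis unfolding of_real_divide by (rule alg)
 qed
 then have "norm (D * of_real ((s * ln s - s)/W s) - G * of_real (M s/W s)) = norm (D * of_real (s * ln s - s) - G * of_real (M s))/W s"
 using W by (simp add: norm_divide)
 also have "... <= ((I + pi * \<sigma> * C) * s + ep * M s)/W s" using main W by (intro divide_right_mono) auto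
 finally show "norm (D * of_real ((s * ln s - s)/W s) - G * of_real (M s/W s)) <= (I + pi * \<sigma> * C)*(s/W s) + ep*(M s/W s)"
 by (simp add: add_divide_distrib)
 qed
 qed simp
 then have "norm (- D - G) <= ep" by simp
 then show False using ep unfolding ep_def by simp
qed

text \<open>Eliminating the boundary value of the Hilbert transform from the product identity and
  the duality relation.\<close>

lemma q3_squared: "(of_real (pi * \<sigma>) * q3)\<^sup>2 = of_real (- (P' (a 2) * P' (a 3))) * f2\<^sup>2"
proof -
 define P3 where "P3 = complex_of_real (P' (a 3))"
 have P3: "P3 ~= 0" using roots(5) by (simp add: P3_def)
 have s0: "complex_of_real \<sigma> ~= 0" using \<sigma> by simp
 have "h3 = of_real \<sigma> * (h3/of_real \<sigma>)" using s0 by simp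
 also have "... = - (of_real pi*(of_real \<sigma>)\<^sup>2 * q3/P3)" unfolding dual_boundary_value by (simp add: d3_def P3_def power2_eq_square)
 finally have h: "h3 = - (of_real pi*(of_real \<sigma>)\<^sup>2 * q3/P3)" .
 have e: "of_real pi*(h3 * q3) = f2\<^sup>2 * of_real (P' (a 2))" unfolding product_identity by simp
 have "(of_real (pi * \<sigma>) * q3)\<^sup>2 = - P3*(of_real pi*(h3 * q3))" unfolding h using P3 by (simp add: power2_eq_square)
 also have "... = of_real (- (P' (a 2) * P' (a 3))) * f2\<^sup>2" unfolding e by (simp add: P3_def mult_ac)
 finally show ?thesis .
qed

end

section \<open>Nonvanishing of the boundary values\<close>

context eigenfunction
begin

lemma real_part_ode:
 assumes y: "a 2 < y" "y < a 4" "y ~= a 3"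
 shows "((%y. Re (ka * f y)) has_real_derivative Re (ka * q y)/PP a y) (at y)"
 "((%y. Re (ka * q y)) has_real_derivative (La - V y) * Re (ka * f y)) (at y)"
proof -
 have bl: "bounded_linear (%z. Re (ka * z))" by (rule bounded_linear_compose[OF bounded_linear_Re bounded_linear_mult_right])
 have e1: "Re (ka*(q y/of_real (PP a y))) = Re (ka * q y)/PP a y"
 unfolding times_divide_eq_right Re_divide_of_real ..
 have e2: "Re (ka*(of_real (La - V y) * f y)) = (La - V y) * Re (ka * f y)"
 by (simp add: algebra_simps)
 show "((%y. Re (ka * f y)) has_real_derivative Re (ka * q y)/PP a y) (at y)"
 "((%y. Re (ka * q y)) has_real_derivative (La - V y) * Re (ka * f y)) (at y)"
 using bounded_linear.has_vector_derivative[OF bl eigenfunction_ode(1)[OF y]]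
 bounded_linear.has_vector_derivative[OF bl eigenfunction_ode(2)[OF y]]
 unfolding has_real_derivative_iff_has_vector_derivative e1 e2 by blast+
qed

lemma f_tendsto_f2: "(f \<longlongrightarrow> f2) (at_right (a 2))"
proof -
 obtain ta C where ta: "0 < ta" and b: "!!t. 0 < t ==> t <= ta ==> norm (f (a 2 + t) - f2) <= C * sqrt t"
 by (rule near_a2, rule that)
 show ?thesis
 proof (rule LIM_zero_cancel, rule Lim_null_comparison)
 show "((%y. C * sqrt \<bar>y - a 2\<bar>) \<longlongrightarrow> 0) (at_right (a 2))" by (rule tendsto_eq_intros | simp)+
 show "\<forall>\<^sub>F y in at_right (a 2). norm (f y - f2) <= C * sqrt \<bar>y - a 2\<bar>"
 unfolding eventually_at_right_field
 proof (intro exI[of _ "a 2 + ta"] conjI allI impI)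
 fix y assume "a 2 < y" "y < a 2 + ta"
 then show "norm (f y - f2) <= C * sqrt \<bar>y - a 2\<bar>" using b[of "y - a 2"] by simp
 qed (use ta in simp)
 qed
qed

lemma Re_tendsto: "(h \<longlongrightarrow> l) F ==> ((%y. Re (ka * h y)) \<longlongrightarrow> Re (ka * l)) F"
 by (intro tendsto_intros)

text \<open>Without a logarithm at $a_3$ the nonnegative and nondecreasing product of solution and
  quasi-derivative tends to zero there, so it vanishes and the solution is constant.\<close>

lemma f_zero_left:
 assumes "f2 = 0" "q3 = 0" and x: "a 2 < x" "x < a 3"
 shows "f x = 0"
proof -
 have d3: "d3 = 0" using assms by (simp add: d3_def)
 have zero: "Re (ka * f x) = 0" for ka
 proof -
 define ph p where "ph y = Re (ka * f y)" and "p y = Re (ka * q y)" for y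
 have o1: "(ph has_real_derivative p y/PP a y) (at y)" and o2: "(p has_real_derivative (La - V y) * ph y) (at y)"
 and o3: "V y <= La" if "a 2 < y" "y < a 3" for y
 using real_part_ode[of y ka] La[of y] that a34 by (auto simp: ph_def[abs_def] p_def[abs_def])
 have l1: "(ph \<longlongrightarrow> 0) (at_right (a 2))" using Re_tendsto[OF f_tendsto_f2, of ka] assms by (simp add: ph_def[abs_def])
 have l2: "(p \<longlongrightarrow> 0) (at_right (a 2))" using Re_tendsto[OF q_limits(1), of ka] by (simp add: p_def[abs_def])
 have en1: "0 <= ph y * p y" if "a 2 < y" "y < a 3" for y
 by (rule energy_nondecreasing(1)[OF o1 o2 o3 l1 l2 that])
 have en3: "ph y * p y <= ph u * p u" if "a 2 < y" "y <= u" "u < a 3" for y u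
 by (rule energy_nondecreasing(3)[OF o1 o2 o3 l1 l2 that])
 have lim: "((%y. ph y * p y) \<longlongrightarrow> 0) (at_left (a 3))"
 proof -
 obtain rh C where rh: "0 < rh" and fb: "!!y. 0 < \<bar>y - a 3\<bar> ==> \<bar>y - a 3\<bar> <= rh ==> norm (f y - d3 * of_real (ln \<bar>y - a 3\<bar>)) <= C"
 by (rule near_a3) (rule that)
 have pl: "(p \<longlongrightarrow> 0) (at_left (a 3))" using Re_tendsto[OF q3(1), of ka] assms by (simp add: p_def[abs_def])
 show ?thesis
 proof (rule Lim_null_comparison)
 show "((%y. (norm ka * C) * \<bar>p y\<bar>) \<longlongrightarrow> 0) (at_left (a 3))" using tendsto_mult[OF tendsto_const tendsto_rabs[OF pl], of "norm ka * C"] by simp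
 show "\<forall>\<^sub>F y in at_left (a 3). norm (ph y * p y) <= (norm ka * C) * \<bar>p y\<bar>"
 unfolding eventually_at_left_field
 proof (intro exI[of _ "a 3 - rh"] conjI allI impI)
 show "a 3 - rh < a 3" using rh by simp
 fix y assume y: "a 3 - rh < y" "y < a 3"
 have "norm (f y) <= C" using fb[of y] y d3 by simp
 then have "norm (ka * f y) <= norm ka * C" unfolding norm_mult by (rule mult_left_mono) simp
 then have "\<bar>ph y\<bar> <= norm ka * C" unfolding ph_def using abs_Re_le_cmod[of "ka * f y"] by linarith
 then show "norm (ph y * p y) <= (norm ka * C) * \<bar>p y\<bar>" by (simp add: abs_mult mult_right_mono)
 qed
 qed
 qed
 have z: "ph y * p y = 0" if y: "a 2 < y" "y < a 3" for y
 proof (rule antisym)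
 show "ph y * p y <= 0"
 proof (rule tendsto_le[OF _ lim tendsto_const])
 show "\<forall>\<^sub>F u in at_left (a 3). ph y * p y <= ph u * p u"
 unfolding eventually_at_left_field by (intro exI[of _ y] conjI allI impI en3) (use y in auto)
 qed simp
 show "0 <= ph y * p y" by (rule en1[OF y])
 qed
 have dsq: "((%y. (ph y)\<^sup>2) has_real_derivative 0) (at y)" if y: "a 2 < y" "y < a 3" for y
 proof -
 have d: "((%y. (ph y)\<^sup>2) has_real_derivative 2 * ph y*(p y/PP a y)) (at y)"
 using DERIV_power[OF o1[OF y], of 2] by (simp add: mult_ac)
 have eq: "2 * ph y*(p y/PP a y) = 2*(ph y * p y)/PP a y" by simp
 from d[unfolded eq z[OF y]] show ?thesis by simp
 qed
 have const: "(ph u)\<^sup>2 = (ph x)\<^sup>2" if u: "a 2 < u" "u < x" for u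
 by (rule DERIV_isconst_end[OF u(2), symmetric, THEN sym, THEN sym])
 (use u x dsq in \<open>auto intro!: continuous_at_imp_continuous_on DERIV_isCont[OF dsq]\<close>)
 have "(ph x)\<^sup>2 <= 0"
 proof (rule tendsto_le[OF _ _ tendsto_const])
 show "((%u. (ph u)\<^sup>2) \<longlongrightarrow> 0) (at_right (a 2))" using tendsto_power[OF l1, of 2] by simp
 show "\<forall>\<^sub>F u in at_right (a 2). (ph x)\<^sup>2 <= (ph u)\<^sup>2"
 unfolding eventually_at_right_field by (intro exI[of _ x] conjI allI impI) (use x const in auto)
 qed simp
 then show ?thesis by (simp add: ph_def)
 qed
 show ?thesis using zero[of 1] zero[of "- \<i>"] by (simp add: complex_eq_iff)
qed

text \<open>With $m = -P(\Lambda - V) > 0$, the quantity $\varphi^2 + p^2/m$ is nonincreasing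
  where \<open>m\<close> increases, which covers a neighbourhood of the singular point; away from
  it $p^2 + m\varphi^2$ obeys a Gronwall inequality.\<close>

lemma real_solution_zero_right:
 fixes ph p :: "real => real"
 assumes o1: "!!y. a 3 < y ==> y < a 4 ==> (ph has_real_derivative p y/PP a y) (at y)"
 and o2: "!!y. a 3 < y ==> y < a 4 ==> (p has_real_derivative (La - V y) * ph y) (at y)"
 and small: "!!y. a 3 < y ==> y <= a 3 + rh ==> \<bar>ph y\<bar> <= C * sqrt (y - a 3)" and rh: "0 < rh" "a 3 + rh < a 4" and C: "0 <= C"
 and p3: "(p \<longlongrightarrow> 0) (at_right (a 3))" and y: "a 3 < y" "y < a 4"
 shows "ph y = 0"
proof -
 define m where "m y = - PP a y*(La - V y)" for y
 define m' where "m' y = - P' y*(La - V y) + PP a y*(4*(y - mean4 a))" for y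
 have dm: "(m has_real_derivative m' y) (at y)" for y
 unfolding m_def[abs_def] m'_def
 by (rule DERIV_cong[OF DERIV_mult[OF DERIV_minus[OF PP_deriv] DERIV_diff[OF DERIV_const V_deriv]]]) (simp add: algebra_simps)
 have w: "0 < La - V y" if "a 3 < y" "y < a 4" for y using La[of y] that a23 by simp
 have PPn: "PP a y < 0" if "a 3 < y" "y < a 4" for y
 proof -
 have "0 < (y - a 1)*(y - a 2)*(y - a 3)" using that a12 a23 by (intro mult_pos_pos) auto
 then show ?thesis unfolding PP_eq using that by (intro mult_pos_neg) auto
 qed
 have m0: "0 < m y" if "a 3 < y" "y < a 4" for y unfolding m_def using PPn[OF that] w[OF that] by (intro mult_pos_pos) auto
 define M where "M = La"
 have wM: "\<bar>La - V y\<bar> <= M" if "a 3 < y" "y < a 4" for y using w[OF that] V_nonneg[of y] by (simp add: M_def)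
 have M0: "0 <= M" using w[of "a 3 + rh"] V_nonneg[of "a 3 + rh"] rh by (simp add: M_def)
 have pb: "\<bar>p y\<bar> <= M * C * sqrt (y - a 3)*(y - a 3)" if y: "a 3 < y" "y <= a 3 + rh" for y
 proof (rule tendsto_le[OF _ _ tendsto_const])
 show "((%u. \<bar>p u\<bar> + M * C * sqrt (y - a 3)*(y - u)) \<longlongrightarrow> M * C * sqrt (y - a 3)*(y - a 3)) (at_right (a 3))"
 using tendsto_add[OF tendsto_rabs[OF p3] tendsto_mult[OF tendsto_const tendsto_diff[OF tendsto_const tendsto_ident_at]], of "M * C * sqrt (y - a 3)" y] by simp
 show "\<forall>\<^sub>F u in at_right (a 3). \<bar>p y\<bar> <= \<bar>p u\<bar> + M * C * sqrt (y - a 3)*(y - u)"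
 unfolding eventually_at_right_field
 proof (intro exI[of _ y] conjI allI impI)
 show "a 3 < y" by (rule y)
 fix u assume u: "a 3 < u" "u < y"
 obtain z where z: "u < z" "z < y" "p y - p u = (y - u)*((La - V z) * ph z)"
 using MVT2[OF u(2), of p "%z. (La - V z) * ph z"] o2 u y rh by force
 have zz: "a 3 < z" "z < a 4" "z <= a 3 + rh" using z u y rh by auto
 have "\<bar>ph z\<bar> <= C * sqrt (z - a 3)" by (rule small[OF zz(1,3)])
 also have "... <= C * sqrt (y - a 3)" using z C by (intro mult_left_mono) auto
 finally have "\<bar>(La - V z) * ph z\<bar> <= M*(C * sqrt (y - a 3))" unfolding abs_mult using wM[OF zz(1,2)] M0 by (intro mult_mono) auto
 then have "(y - u) * \<bar>(La - V z) * ph z\<bar> <= (y - u)*(M*(C * sqrt (y - a 3)))" using u by (intro mult_left_mono) auto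
 then have "\<bar>p y - p u\<bar> <= M * C * sqrt (y - a 3)*(y - u)" unfolding z(3) using u by (simp add: abs_mult mult_ac)
 then show "\<bar>p y\<bar> <= \<bar>p u\<bar> + M * C * sqrt (y - a 3)*(y - u)" by linarith
 qed
 qed simp
 have m'a3: "0 < m' (a 3)" unfolding m'_def using P'_sign(2) roots(2) La[of "a 3"] a23 a34 by (simp add: mult_neg_pos)
 have "isCont m' (a 3)" unfolding m'_def[abs_def] P'_def V_def PP_eq by (intro continuous_intros)
 then have "(m' \<longlongrightarrow> m' (a 3)) (at_right (a 3))" by (simp add: isCont_def filterlim_at_split)
 from order_tendstoD(1)[OF this m'a3] obtain b where b: "a 3 < b" "!!y. a 3 < y ==> y < b ==> 0 < m' y"
 unfolding eventually_at_right_field by blast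
 (* up to b0 the weight m increases and the smallness assumption is available *)
 define b0 where "b0 = min b (a 3 + rh)"
 have b0: "a 3 < b0" "b0 <= a 3 + rh" "b0 <= b" "b0 < a 4" using b rh by (auto simp: b0_def)
 have mlow: "((%y. m y/(y - a 3)) \<longlongrightarrow> m' (a 3)) (at_right (a 3))"
 proof -
 have "m (a 3) = 0" using roots(2) by (simp add: m_def)
 then have "((%y. m y/(y - a 3)) \<longlongrightarrow> m' (a 3)) (at (a 3))" using dm[of "a 3"] by (simp add: has_field_derivative_iff)
 then show ?thesis by (simp add: filterlim_at_split)
 qed
 define R where "R y = (ph y)\<^sup>2 + (p y)\<^sup>2/m y" for y
 have dR: "(R has_real_derivative - m' y*(p y)\<^sup>2/(m y)\<^sup>2) (at y)" if yy: "a 3 < y" "y < a 4" for y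
 proof -
 have nz: "m y ~= 0" "PP a y ~= 0" "La - V y ~= 0" using m0[OF yy] PPn[OF yy] w[OF yy] by auto
 have "(R has_real_derivative (2*(p y/PP a y) * ph y + (2*((La - V y) * ph y) * p y * m y - (p y)\<^sup>2 * m' y)/(m y * m y))) (at y)"
 unfolding R_def[abs_def]
 proof (rule DERIV_add[OF _ DERIV_divide[OF _ dm nz(1)]])
 show "((%y. (ph y)\<^sup>2) has_real_derivative 2*(p y/PP a y) * ph y) (at y)"
 by (rule DERIV_cong[OF DERIV_power[OF o1[OF yy], of 2]]) simp
 show "((%y. (p y)\<^sup>2) has_real_derivative 2*((La - V y) * ph y) * p y) (at y)"
 by (rule DERIV_cong[OF DERIV_power[OF o2[OF yy], of 2]]) simp
 qed
 moreover have "2*(p y/PP a y) * ph y + (2*((La - V y) * ph y) * p y * m y - (p y)\<^sup>2 * m' y)/(m y * m y) = - m' y*(p y)\<^sup>2/(m y)\<^sup>2"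
 proof -
 have alg: "2*(s/P) * r + (2*(w * r) * s * mm - S * d)/(mm * mm) = - d * S/mm\<^sup>2"
 if "mm ~= 0" "P ~= 0" "mm = - P * w" for s P r w mm S d :: real
 proof -
 have "w * r/mm = - (r/P)" using that by (simp add: divide_simps)
 have "(2*(w * r) * s * mm - S * d)/(mm * mm) = 2 * s*(w * r/mm) - S * d/(mm * mm)" using that(1) by (simp add: field_simps power2_eq_square)
 then show ?thesis unfolding \<open>w * r/mm = - (r/P)\<close> by (simp add: power2_eq_square)
 qed
 show ?thesis by (rule alg[OF nz(1,2)]) (simp add: m_def)
 qed
 ultimately show ?thesis by simp
 qed
 have Rlim: "(R \<longlongrightarrow> 0) (at_right (a 3))"
 proof -
 have e1: "((%y. (ph y)\<^sup>2) \<longlongrightarrow> 0) (at_right (a 3))"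
 proof (rule Lim_null_comparison)
 show "((%y. C\<^sup>2*(y - a 3)) \<longlongrightarrow> 0) (at_right (a 3))" by (rule tendsto_eq_intros | simp)+
 show "\<forall>\<^sub>F y in at_right (a 3). norm ((ph y)\<^sup>2) <= C\<^sup>2*(y - a 3)"
 unfolding eventually_at_right_field
 proof (intro exI[of _ "a 3 + rh"] conjI allI impI)
 fix y assume y: "a 3 < y" "y < a 3 + rh"
 have "\<bar>ph y\<bar>\<^sup>2 <= (C * sqrt (y - a 3))\<^sup>2" using small[of y] y by (intro power_mono) auto
 then show "norm ((ph y)\<^sup>2) <= C\<^sup>2*(y - a 3)" using y by (simp add: power_mult_distrib)
 qed (use rh in simp)
 qed
 have e2: "((%y. (p y)\<^sup>2/(y - a 3)) \<longlongrightarrow> 0) (at_right (a 3))"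
 proof (rule Lim_null_comparison)
 show "((%y. (M * C)\<^sup>2*(y - a 3)\<^sup>2) \<longlongrightarrow> 0) (at_right (a 3))" by (rule tendsto_eq_intros | simp)+
 show "\<forall>\<^sub>F y in at_right (a 3). norm ((p y)\<^sup>2/(y - a 3)) <= (M * C)\<^sup>2*(y - a 3)\<^sup>2"
 unfolding eventually_at_right_field
 proof (intro exI[of _ "a 3 + rh"] conjI allI impI)
 fix y assume y: "a 3 < y" "y < a 3 + rh"
 have "\<bar>p y\<bar>\<^sup>2 <= (M * C * sqrt (y - a 3)*(y - a 3))\<^sup>2" using pb[of y] y by (intro power_mono) auto
 also have "... = (M * C)\<^sup>2*(y - a 3)\<^sup>2*(y - a 3)" using y by (simp add: power_mult_distrib)
 finally have "(p y)\<^sup>2 <= (M * C)\<^sup>2*(y - a 3)\<^sup>2*(y - a 3)" by simp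
 then have "(p y)\<^sup>2/(y - a 3) <= (M * C)\<^sup>2*(y - a 3)\<^sup>2" using y by (simp add: pos_divide_le_eq)
 then show "norm ((p y)\<^sup>2/(y - a 3)) <= (M * C)\<^sup>2*(y - a 3)\<^sup>2" using y by simp
 qed (use rh in simp)
 qed
 have "((%y. (ph y)\<^sup>2 + ((p y)\<^sup>2/(y - a 3))/(m y/(y - a 3))) \<longlongrightarrow> 0 + 0/m' (a 3)) (at_right (a 3))"
 using m'a3 by (intro tendsto_add tendsto_divide e1 e2 mlow) simp
 then have "((%y. (ph y)\<^sup>2 + ((p y)\<^sup>2/(y - a 3))/(m y/(y - a 3))) \<longlongrightarrow> 0) (at_right (a 3))" by simp
 moreover have "\<forall>\<^sub>F y in at_right (a 3). (ph y)\<^sup>2 + ((p y)\<^sup>2/(y - a 3))/(m y/(y - a 3)) = R y"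
 unfolding eventually_at_right_field by (intro exI[of _ "a 4"]) (use a34 in \<open>auto simp: R_def\<close>)
 ultimately show ?thesis by (rule Lim_transform_eventually)
 qed
 have near: "ph y = 0 & p y = 0" if yy: "a 3 < y" "y < b0" for y
 proof -
 have y4: "y < a 4" using yy b0 by linarith
 have "R y <= 0"
 proof (rule tendsto_le[OF _ Rlim tendsto_const])
 show "\<forall>\<^sub>F u in at_right (a 3). R y <= R u"
 unfolding eventually_at_right_field
 proof (intro exI[of _ y] conjI allI impI)
 fix u assume u: "a 3 < u" "u < y"
 show "R y <= R u"
 proof (rule DERIV_nonpos_imp_nonincreasing[OF less_imp_le[OF u(2)]])
 fix v assume v: "u <= v" "v <= y"
 have vv: "a 3 < v" "v < a 4" "v < b" using v u yy b0 y4 by auto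
 have "- m' v * (p v)\<^sup>2/(m v)\<^sup>2 <= 0" using b(2)[OF vv(1,3)] by (simp add: divide_nonpos_nonneg mult_nonpos_nonneg)
 then show "\<exists>D. (R has_real_derivative D) (at v) & D <= 0" using dR[OF vv(1,2)] by (intro exI conjI)
 qed
 qed (use yy in simp)
 qed simp
 moreover have "0 <= (ph y)\<^sup>2" "0 <= (p y)\<^sup>2/m y" using m0[OF yy(1) y4] by auto
 ultimately have "(ph y)\<^sup>2 = 0" "(p y)\<^sup>2/m y = 0" unfolding R_def by linarith+
 then show ?thesis using m0[OF yy(1) y4] by auto
 qed
 show ?thesis
 proof (cases "y < b0")
 case True then show ?thesis using near y by simp
 next
 case False
 define c where "c = (a 3 + b0)/2"
 have c: "a 3 < c" "c < b0" "c <= y" using b0 False by (auto simp: c_def)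
 have rng: "a 3 < v & v < a 4" if "v \<in> {c..y}" for v using that c y by auto
 have cm': "continuous_on {c..y} m'"
 unfolding m'_def[abs_def] P'_def V_def PP_eq by (intro continuous_intros)
 have cm: "continuous_on {c..y} m" by (intro continuous_at_imp_continuous_on ballI DERIV_isCont[OF dm])
 have mnz: "m v ~= 0" if "v \<in> {c..y}" for v using m0[of v] rng[OF that] by simp
 have cq: "continuous_on {c..y} (%v. m' v/m v)" by (rule continuous_on_divide[OF cm' cm]) (rule ballI, rule mnz)
 obtain K where K: "0 <= K" "!!v. v \<in> {c..y} ==> norm (m' v/m v) <= K" by (rule continuous_on_Icc_bound[OF cq], rule that)
 define G where "G v = ((p v)\<^sup>2 + m v * (ph v)\<^sup>2) * exp (- K * v)" for v
 have "G y <= G c"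
 proof (rule DERIV_nonpos_imp_nonincreasing[OF c(3)])
 fix v assume v: "c <= v" "v <= y"
 have vv: "a 3 < v" "v < a 4" using rng v by auto
 have nz: "PP a v ~= 0" using PPn[OF vv] by simp
 have dE: "((%v. (p v)\<^sup>2 + m v * (ph v)\<^sup>2) has_real_derivative m' v * (ph v)\<^sup>2) (at v)"
 proof -
 have "((%v. (p v)\<^sup>2 + m v * (ph v)\<^sup>2) has_real_derivative (2*((La - V v) * ph v) * p v + (m' v * (ph v)\<^sup>2 + 2*(p v/PP a v) * ph v * m v))) (at v)"
 proof (rule DERIV_add[OF _ DERIV_mult[OF dm]])
 show "((%v. (p v)\<^sup>2) has_real_derivative 2*((La - V v) * ph v) * p v) (at v)"
 by (rule DERIV_cong[OF DERIV_power[OF o2[OF vv], of 2]]) simp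
 show "((%v. (ph v)\<^sup>2) has_real_derivative 2*(p v/PP a v) * ph v) (at v)"
 by (rule DERIV_cong[OF DERIV_power[OF o1[OF vv], of 2]]) simp
 qed
 moreover have "2*(p v/PP a v) * ph v * m v = - (2*((La - V v) * ph v) * p v)" using nz by (simp add: m_def)
 ultimately show ?thesis by simp
 qed
 have dX: "((%v. exp (- K * v)) has_real_derivative exp (- K * v)*(- K)) (at v)" by (auto intro!: derivative_eq_intros)
 have dG: "(G has_real_derivative (m' v * (ph v)\<^sup>2 * exp (- K * v) + exp (- K * v)*(- K)*((p v)\<^sup>2 + m v * (ph v)\<^sup>2))) (at v)"
 unfolding G_def[abs_def] by (rule DERIV_mult[OF dE dX])
 have "m' v/m v <= norm (m' v/m v)" unfolding real_norm_def by (rule abs_ge_self)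
 also have "... <= K" by (rule K(2)) (use v in simp)
 finally have "m' v/m v <= K" .
 then have "m' v <= K * m v" using m0[OF vv] by (simp add: pos_divide_le_eq)
 then have "m' v * (ph v)\<^sup>2 <= K * m v * (ph v)\<^sup>2" by (rule mult_right_mono) simp
 moreover have "0 <= K*(p v)\<^sup>2" using K by simp
 ultimately have "m' v * (ph v)\<^sup>2 - K*((p v)\<^sup>2 + m v * (ph v)\<^sup>2) <= 0" by (simp add: algebra_simps)
 then have "exp (- K * v)*(m' v * (ph v)\<^sup>2 - K*((p v)\<^sup>2 + m v * (ph v)\<^sup>2)) <= 0" by (intro mult_nonneg_nonpos) auto
 then have "m' v * (ph v)\<^sup>2 * exp (- K * v) + exp (- K * v)*(- K)*((p v)\<^sup>2 + m v * (ph v)\<^sup>2) <= 0" by (simp add: algebra_simps)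
 with dG show "\<exists>D. (G has_real_derivative D) (at v) & D <= 0" by (intro exI conjI)
 qed
 also have "G c = 0" using near[OF c(1,2)] by (simp add: G_def)
 finally have "(p y)\<^sup>2 + m y*(ph y)\<^sup>2 <= 0" by (simp add: G_def mult_le_0_iff)
 moreover have "0 <= (p y)\<^sup>2" by simp
 ultimately have "m y*(ph y)\<^sup>2 <= 0" by linarith
 then show ?thesis using m0[OF y] by (simp add: mult_le_0_iff)
 qed
qed

text \<open>Otherwise the eigenfunction vanishes on the left interval, then its regular boundary
  data at $a_3$ vanish, and it vanishes on the right interval as well.\<close>

lemma boundary_value_nonzero: "f2 ~= 0 \<or> q3 ~= 0"
proof (rule ccontr)
 assume "\<not> (f2 ~= 0 \<or> q3 ~= 0)"
 then have z: "f2 = 0" "q3 = 0" by auto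
 have d3: "d3 = 0" using z by (simp add: d3_def)
 obtain rh C c where rh: "0 < rh" "rh < half_gap" "rh < a 4 - a 3" and C: "0 <= C"
 and fb: "!!y. 0 < \<bar>y - a 3\<bar> ==> \<bar>y - a 3\<bar> <= rh ==> norm (f y - d3 * of_real (ln \<bar>y - a 3\<bar>) - c) <= C * sqrt \<bar>y - a 3\<bar>"
 by (rule expansion_a3) (rule that)
 have "norm c <= 0"
 proof (rule tendsto_le[OF _ _ tendsto_const])
 show "((%y. C * sqrt \<bar>y - a 3\<bar>) \<longlongrightarrow> 0) (at_left (a 3))" by (rule tendsto_eq_intros | simp)+
 show "\<forall>\<^sub>F y in at_left (a 3). norm c <= C * sqrt \<bar>y - a 3\<bar>"
 unfolding eventually_at_left_field
 proof (intro exI[of _ "a 3 - rh"] conjI allI impI)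
 show "a 3 - rh < a 3" using rh by simp
 fix y assume y: "a 3 - rh < y" "y < a 3"
 have "f y = 0" by (rule f_zero_left[OF z]) (use y rh half_gap in auto)
 then show "norm c <= C * sqrt \<bar>y - a 3\<bar>" using fb[of y] y d3 by simp
 qed
 qed simp
 then have c: "c = 0" by simp
 have right: "f y = 0" if y: "a 3 < y" "y < a 4" for y
 proof -
 have "Re (ka * f y) = 0" if ka: "norm ka = 1" for ka
 proof (rule real_solution_zero_right[where ph="%y. Re (ka * f y)" and y=y and p="%y. Re (ka * q y)" and rh=rh and C=C])
 show "\<bar>Re (ka * f y)\<bar> <= C * sqrt (y - a 3)" if "a 3 < y" "y <= a 3 + rh" for y
 using fb[of y] that d3 c abs_Re_le_cmod[of "ka * f y"] ka by (simp add: norm_mult)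
 show "((%y. Re (ka * q y)) \<longlongrightarrow> 0) (at_right (a 3))" using Re_tendsto[OF q3(2), of ka] z by simp
 qed (use y rh C a23 real_part_ode[of _ ka] in auto)
 from this[of 1] this[of "- \<i>"] show ?thesis by (simp add: complex_eq_iff)
 qed
 have zero: "f y = 0" if "y \<in> {a 2..a 4} - {a 2, a 3, a 4}" for y
 using f_zero_left[OF z, of y] right[of y] that by (cases "y < a 3") auto
 have "L2_eq_on {a 2..a 4} f (%_. 0)"
 unfolding L2_eq_on_def
 proof (rule AE_I')
 have "negligible {a 2, a 3, a 4}" by (intro negligible_finite) simp
 then have "{a 2, a 3, a 4} \<in> null_sets lebesgue" unfolding negligible_iff_null_sets .
 then show "{a 2, a 3, a 4} \<in> null_sets (lebesgue_on {a 2..a 4})" using a23 a34 by (subst null_sets_restrict_space) auto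
 show "{y \<in> space (lebesgue_on {a 2..a 4}). \<not> f y = 0} \<subseteq> {a 2, a 3, a 4}" using zero by (auto simp: space_restrict_space)
 qed
 then show False using ef unfolding LS_eigenfunction_def by blast
qed

end

context singular_pair
begin

lemma f2_nonzero: "f2 ~= 0"
proof
 assume z: "f2 = 0"
 then have "(of_real (pi * \<sigma>) * q3)\<^sup>2 = 0" using q3_squared by simp
 then have "q3 = 0" using \<sigma> by simp
 then show False using boundary_value_nonzero z by simp
qed

lemma boundary_ratio:
 assumes r: "r = sqrt (P' (a 2) * - P' (a 3))/(pi * \<sigma>)"
 shows "q3/f2 = of_real r \<or> q3/f2 = of_real (- r)"
proof -
 have p: "0 < P' (a 2) * - P' (a 3)" using P'_sign by (intro mult_pos_pos) auto
 have s0: "complex_of_real (pi * \<sigma>) ~= 0" using \<sigma> by simp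
 have "(q3/f2)\<^sup>2 = (of_real (pi * \<sigma>) * q3)\<^sup>2/((of_real (pi * \<sigma>))\<^sup>2 * f2\<^sup>2)" using s0 by (simp add: power_divide power_mult_distrib)
 also have "... = of_real (- (P' (a 2) * P' (a 3)))/(of_real (pi * \<sigma>))\<^sup>2" unfolding q3_squared using f2_nonzero by simp
 also have "... = of_real (r\<^sup>2)" unfolding r using p by (simp add: power_divide)
 finally have "(q3/f2)\<^sup>2 = (of_real r)\<^sup>2" by simp
 then show ?thesis unfolding power2_eq_iff by simp
qed

end

lemma inverse_perturbation:
 fixes u et \<sigma> b :: real
 assumes "u = b/\<sigma> \<or> u = - b/\<sigma>" "0 < \<sigma>" "0 < b" "\<bar>u - 1\<bar> <= et" "et <= 1/2"
 shows "\<bar>\<sigma> / b - 1\<bar> <= 2 * et"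
proof -
 have u: "1/2 <= u" using assms by (auto simp: abs_le_iff)
 have "0 < b/\<sigma>" using assms by simp
 then have ub: "u = b/\<sigma>" using assms(1) u by auto
 have "\<sigma> / b - 1 = (1 - u)/u" unfolding ub using assms by (simp add: field_simps)
 then have "\<bar>\<sigma> / b - 1\<bar> = \<bar>u - 1\<bar> / u" using u by (simp add: abs_divide abs_minus_commute)
 also have "... <= et/u" using assms u by (intro divide_right_mono) auto
 also have "... <= et/(1/2)" using assms u by (intro divide_left_mono) auto
 finally show ?thesis by simp
qed

context four_points
begin

text \<open>The ratio of the boundary values is known in two ways: through the singular value, and
  through the growth of the regular solution. For a large eigenvalue the sign of the ratio is
  decided by the second.\<close>

theorem singular_value_asymptotics:
 obtains C La0 where "0 < La0" "!!f La g \<sigma>. La0 <= La ==> singular_pair a f La g \<sigma> ==> C * La powr (-1/4) <= 1/2 ==>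
 \<bar>\<sigma> / (2 * exp (- sqrt La * K_plus a)) - 1\<bar> <= 2*(C * La powr (-1/4))"
proof (rule connection_asymptotics)
 fix C La0 assume La0: "0 < La0" and "!!x. a 2 <= x ==> x <= a 3 ==> V x < La0" and conn:
 "!!La ph q W. La0 <= La ==>
 (!!x. a 2 < x ==> x < a 3 ==> (ph has_real_derivative q x/PP a x) (at x)) ==>
 (!!x. a 2 < x ==> x < a 3 ==> (q has_real_derivative (La - V x) * ph x) (at x)) ==>
 (ph \<longlongrightarrow> 1) (at_right (a 2)) ==> (q \<longlongrightarrow> 0) (at_right (a 2)) ==>
 (q \<longlongrightarrow> W) (at_left (a 3)) ==> ((%x. (a 3 - x) * ph x) \<longlongrightarrow> 0) (at_left (a 3)) ==>
 \<bar>2 * pi * exp (- sqrt La * K_plus a) * W/sqrt (P' (a 2) * - P' (a 3)) - 1\<bar> <= C * La powr (-1/4)"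
 show thesis
 proof (rule that[OF La0, of C])
 fix f La g \<sigma> assume L: "La0 <= La" and sp: "singular_pair a f La g \<sigma>" and small: "C * La powr (-1/4) <= 1/2"
 interpret S: singular_pair a f La g \<sigma> by (rule sp)
 define ka where "ka = 1/S.f2"
 define s where "s = sqrt (P' (a 2) * - P' (a 3))"
 have s: "0 < s" unfolding s_def using P'_sign by (simp add: mult_pos_neg)
 define b where "b = 2 * exp (- sqrt La * K_plus a)"
 have b: "0 < b" by (simp add: b_def)
 define W where "W = Re (ka * S.q3)"
 have conn': "\<bar>2 * pi * exp (- sqrt La * K_plus a) * W/s - 1\<bar> <= C * La powr (-1/4)"
 unfolding s_def
 proof (rule conn[OF L, where ph="%y. Re (ka * f y)" and q="%y. Re (ka * S.q y)"])
 show "((%y. Re (ka * f y)) has_real_derivative Re (ka * S.q x)/PP a x) (at x)" if "a 2 < x" "x < a 3" for x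
 using S.real_part_ode(1)[of x ka] that a34 by simp
 show "((%y. Re (ka * S.q y)) has_real_derivative (La - V x) * Re (ka * f x)) (at x)" if "a 2 < x" "x < a 3" for x
 using S.real_part_ode(2)[of x ka] that a34 by simp
 show "((%y. Re (ka * f y)) \<longlongrightarrow> 1) (at_right (a 2))"
 using S.Re_tendsto[OF S.f_tendsto_f2, of ka] S.f2_nonzero by (simp add: ka_def)
 show "((%y. Re (ka * S.q y)) \<longlongrightarrow> 0) (at_right (a 2))" using S.Re_tendsto[OF S.q_limits(1), of ka] by simp
 show "((%y. Re (ka * S.q y)) \<longlongrightarrow> W) (at_left (a 3))" unfolding W_def by (rule S.Re_tendsto[OF S.q3(1)])
 have le: "at_left (a 3) <= at (a 3)" by (rule at_le) simp
 have "((%y. - Re (ka*(f y * of_real (y - a 3)))) \<longlongrightarrow> - Re (ka*0)) (at_left (a 3))"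
 by (intro tendsto_minus S.Re_tendsto tendsto_mono[OF le S.f_vanishing_at_singularities(2)])
 moreover have "- Re (ka*(f y * of_real (y - a 3))) = (a 3 - y) * Re (ka * f y)" for y by (simp add: algebra_simps)
 ultimately show "((%y. (a 3 - y) * Re (ka * f y)) \<longlongrightarrow> 0) (at_left (a 3))" by simp
 qed
 have "S.q3/S.f2 = of_real (s/(pi * \<sigma>)) \<or> S.q3/S.f2 = of_real (- (s/(pi * \<sigma>)))"
 by (rule S.boundary_ratio) (simp add: s_def)
 then have W: "W = s/(pi * \<sigma>) \<or> W = - (s/(pi * \<sigma>))" unfolding W_def ka_def by auto
 have "\<bar>\<sigma> / b - 1\<bar> <= 2*(C * La powr (-1/4))"
 proof (rule inverse_perturbation[OF _ S.\<sigma> b conn' small])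
 have e: "2 * pi * exp (- sqrt La * K_plus a)*(s/(pi * \<sigma>))/s = b/\<sigma>" using s by (simp add: b_def)
 show "2 * pi * exp (- sqrt La * K_plus a) * W/s = b/\<sigma> \<or> 2 * pi * exp (- sqrt La * K_plus a) * W/s = - b/\<sigma>"
 using W
 proof
 assume "W = s/(pi * \<sigma>)" then show ?thesis using e by simp
 next
 assume "W = - (s/(pi * \<sigma>))" then show ?thesis using e by simp
 qed
 qed
 then show "\<bar>\<sigma> / (2 * exp (- sqrt La * K_plus a)) - 1\<bar> <= 2*(C * La powr (-1/4))" by (simp add: b_def)
 qed
qed

end

section \<open>Asymptotics of the singular values\<close>

lemma exp_minus_one_bound:
  fixes u :: real
  assumes "\<bar>u\<bar> <= 1 / 2"
  shows "\<bar>exp u - 1\<bar> <= 2 * \<bar>u\<bar>"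
proof -
  have "exp u <= 1 + 2 * \<bar>u\<bar>" using exp_bound_lemma[of u] assms by simp
  moreover have "1 + u <= exp u" by (rule exp_ge_add_one_self)
  ultimately show ?thesis by linarith
qed

context four_points
begin

lemma K_minus_nonneg: "0 <= K_minus a"
proof -
  have "0 <= indicator {a 1..a 2} x *\<^sub>R (1 / sqrt (- PP a x))" for x
  proof (cases "x \<in> {a 1..a 2}")
    case True
    then have "0 <= (x - a 1) * (x - a 2) * ((x - a 3) * (x - a 4)) * - 1"
      using a23 a34 by (intro mult_nonpos_nonpos mult_nonpos_nonneg mult_nonneg_nonpos) auto
    then have "0 <= - PP a x" unfolding PP_eq by (simp add: mult_ac)
    then show ?thesis by simp
  qed simp
  then show ?thesis unfolding K_minus_def set_lebesgue_integral_def by (intro Bochner_Integration.integral_nonneg)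
qed

end

theorem theorem3:
  fixes a :: "nat \<Rightarrow> real" and \<delta> :: real
    and f g :: "int \<Rightarrow> real \<Rightarrow> complex" and \<sigma> lam :: "int \<Rightarrow> real"
  assumes "a 1 < a 2" and "a 2 < a 3" and "a 3 < a 4"
    and "0 < \<delta>" and "\<delta> < 1 / 2"
    and "HT_singular_system a f g \<sigma>"
    and "\<And>n. LS_eigenfunction a (lam n) (f n)"
    and "(\<sigma> \<longlongrightarrow> 0) at_top" and "(\<sigma> \<longlongrightarrow> 1) at_bot"
    and "filterlim lam at_top at_top" and "filterlim lam at_bot at_bot"
    and "(\<lambda>n::nat. sqrt (lam (int n)) - real n * pi / K_minus a)
           \<in> O(\<lambda>n. real n powr (- 1 / 2 + \<delta>))"
  shows "\<exists>r :: nat \<Rightarrow> real. r \<in> O(\<lambda>n. real n powr (- 1 / 2 + \<delta>)) \<and>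
           (\<forall>\<^sub>F n in sequentially.
              \<sigma> (int n) = 2 * exp (- real n * pi * K_plus a / K_minus a) * (1 + r n))"
proof -
 interpret four_points a using assms(1-3) by unfold_locales
 define k where "k = K_minus a"
 define K where "K = K_plus a"
 define \<rho> where "\<rho> n = real n powr (- 1/2 + \<delta>)" for n :: nat
 define e where "e n = sqrt (lam (int n)) - real n * pi/k" for n :: nat
 define \<Lambda> where "\<Lambda> n = lam (int n)" for n :: nat
 have ilim: "filterlim int at_top sequentially" by (rule filterlim_int_sequentially)
 have \<Lambda>lim: "filterlim \<Lambda> at_top sequentially"
 unfolding \<Lambda>_def[abs_def] by (rule filterlim_compose[OF assms(10) ilim])
 have \<rho>lim: "\<rho> \<longlonglongrightarrow> 0" unfolding \<rho>_def[abs_def] by (rule tendsto_neg_powr[OF _ filterlim_real_sequentially]) (use assms(5) in simp)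
 have eO: "e \<in> O(\<rho>)" using assms(12) unfolding e_def[abs_def] \<rho>_def[abs_def] k_def .
 obtain c where c: "0 < c" and ec: "\<forall>\<^sub>F n in sequentially. norm (e n) <= c * norm (\<rho> n)" using eO by (rule landau_o.bigE)
 have \<rho>0: "0 <= \<rho> n" for n by (simp add: \<rho>_def)
 have e0: "e \<longlonglongrightarrow> 0"
 proof (rule Lim_null_comparison)
 show "\<forall>\<^sub>F n in sequentially. norm (e n) <= c * \<rho> n" using ec \<rho>0 by simp
 show "(%n. c * \<rho> n) \<longlonglongrightarrow> 0" using tendsto_mult[OF tendsto_const \<rho>lim, of c] by simp
 qed
 have k: "0 < k"
 proof (rule ccontr)
 assume "\<not> 0 < k"
 then have "k = 0" using K_minus_nonneg by (simp add: k_def)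
 then have "(%n. sqrt (\<Lambda> n)) \<longlonglongrightarrow> 0" using e0 by (simp add: e_def[abs_def] \<Lambda>_def)
 from order_tendstoD(2)[OF this, of 1] have "\<forall>\<^sub>F n in sequentially. sqrt (\<Lambda> n) < 1" by simp
 moreover have "\<forall>\<^sub>F n in sequentially. 1 <= \<Lambda> n" using \<Lambda>lim unfolding filterlim_at_top by blast
 ultimately have "\<forall>\<^sub>F n::nat in sequentially. False" by eventually_elim simp
 then show False by simp
 qed
 obtain C \<Lambda>0 where \<Lambda>0: "0 < \<Lambda>0" and asym: "!!f \<Lambda> g \<sigma>. \<Lambda>0 <= \<Lambda> ==> singular_pair a f \<Lambda> g \<sigma> ==> C * \<Lambda> powr (-1/4) <= 1/2 ==>
 \<bar>\<sigma> / (2 * exp (- sqrt \<Lambda> * K_plus a)) - 1\<bar> <= 2*(C * \<Lambda> powr (-1/4))"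
 by (rule singular_value_asymptotics) (rule that)
 have cV: "continuous_on {a 2..a 4} V" unfolding V_def[abs_def] by (intro continuous_intros)
 obtain B where B: "!!x. x \<in> {a 2..a 4} ==> norm (V x) <= B" by (rule continuous_on_Icc_bound[OF cV]) (rule that)
 have sp: "singular_pair a (f (int n)) (\<Lambda> n) (g (int n)) (\<sigma> (int n))" if "B < \<Lambda> n" for n
 proof unfold_locales
 show "LS_eigenfunction a (\<Lambda> n) (f (int n))" unfolding \<Lambda>_def by (rule assms(7))
 show "V x < \<Lambda> n" if "a 2 <= x" "x <= a 4" for x using B[of x] that \<open>B < \<Lambda> n\<close> by (auto simp: abs_le_iff)
 qed (use assms(6) in \<open>auto simp: HT_singular_system_def\<close>)
 have small: "(%n. C * \<Lambda> n powr (-1/4)) \<longlonglongrightarrow> 0"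
 proof -
 have "(%n. \<Lambda> n powr (-1/4)) \<longlonglongrightarrow> 0" by (rule tendsto_neg_powr[OF _ \<Lambda>lim]) simp
 from tendsto_mult[OF tendsto_const this, of C] show ?thesis by simp
 qed
 define c1 where "c1 = (pi/(2 * k)) powr (-1/2)"
 have c1: "0 <= c1" by (simp add: c1_def)
 (* half of the main term bounds the root from below once the error is at most the other half *)
 have pw: "\<Lambda> n powr (-1/4) <= c1 * \<rho> n" if n: "1 <= n" and en: "\<bar>e n\<bar> <= pi/(2 * k)" and L: "0 < \<Lambda> n" for n
 proof -
 have n1: "1 <= real n" using n by simp
 have "pi/(2 * k)*1 <= pi/(2 * k) * real n" using n1 k by (intro mult_left_mono) auto
 moreover have "real n * pi/k = pi/(2 * k) * real n + pi/(2 * k) * real n" using k by (simp add: field_simps)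
 moreover have "sqrt (\<Lambda> n) = e n + real n * pi/k" by (simp add: e_def \<Lambda>_def)
 ultimately have low: "pi/(2 * k) * real n <= sqrt (\<Lambda> n)" using en by linarith
 have "\<Lambda> n powr (-1/4) = (\<Lambda> n powr (1/2)) powr (-1/2)" by (simp add: powr_powr)
 also have "... = sqrt (\<Lambda> n) powr (-1/2)" using L by (simp add: powr_half_sqrt)
 also have "... <= (pi/(2 * k) * real n) powr (-1/2)" using low k n1 by (intro powr_mono2') auto
 also have "... = c1 * real n powr (-1/2)" unfolding c1_def by (subst powr_mult) (use k in auto)
 also have "... <= c1 * \<rho> n" unfolding \<rho>_def using c1 n1 assms(4) by (intro mult_left_mono powr_mono) auto
 finally show ?thesis .
 qed
 define r where "r n = \<sigma> (int n)/(2 * exp (- real n * pi * K/k)) - 1" for n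
 have eKlim: "(%n. e n * K) \<longlonglongrightarrow> 0" using tendsto_mult[OF e0 tendsto_const, of K] by simp
 have ev: "\<forall>\<^sub>F n in sequentially. norm (r n) <= (4 * \<bar>K\<bar> * c + 2 * \<bar>C\<bar> * c1) * norm (\<rho> n)"
 proof -
 have 1: "\<forall>\<^sub>F n in sequentially. max \<Lambda>0 (B + 1) <= \<Lambda> n" using \<Lambda>lim unfolding filterlim_at_top by blast
 have 2: "\<forall>\<^sub>F n in sequentially. C * \<Lambda> n powr (-1/4) < 1/2" by (rule order_tendstoD(2)[OF small]) simp
 have 3: "\<forall>\<^sub>F n in sequentially. \<bar>e n\<bar> < pi/(2 * k)" by (rule order_tendstoD(2)[OF tendsto_rabs[OF e0]]) (use k in simp)
 have 4: "\<forall>\<^sub>F n in sequentially. \<bar>e n * K\<bar> < 1/2" by (rule order_tendstoD(2)[OF tendsto_rabs[OF eKlim]]) simp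
 show ?thesis
 using 1 2 3 4 ec eventually_ge_at_top[of 1]
 proof eventually_elim
 case (elim n)
 have L: "\<Lambda>0 <= \<Lambda> n" "B < \<Lambda> n" "0 < \<Lambda> n" using elim(1) \<Lambda>0 by auto
 define \<theta> where "\<theta> = \<sigma> (int n)/(2 * exp (- sqrt (\<Lambda> n) * K)) - 1"
 have \<theta>: "\<bar>\<theta>\<bar> <= 2*(C * \<Lambda> n powr (-1/4))" unfolding \<theta>_def K_def using asym[OF L(1) sp[OF L(2)]] elim(2) by simp
 have \<theta>1: "\<bar>\<theta>\<bar> <= 1" using \<theta> elim(2) by linarith
 have en: "\<bar>e n\<bar> <= pi/(2 * k)" using elim(3) by simp
 have "C * \<Lambda> n powr (-1/4) <= \<bar>C\<bar> * \<Lambda> n powr (-1/4)" by (intro mult_right_mono) auto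
 also have "... <= \<bar>C\<bar> * (c1 * \<rho> n)" by (rule mult_left_mono[OF pw[OF elim(6) en L(3)]]) simp
 finally have \<theta>2: "\<bar>\<theta>\<bar> <= 2 * \<bar>C\<bar> * c1 * \<rho> n" using \<theta> by simp
 define u where "u = - (e n * K)"
 have u: "\<bar>u\<bar> <= 1/2" using elim(4) by (simp add: u_def)
 have "sqrt (\<Lambda> n) = e n + real n * pi/k" by (simp add: e_def \<Lambda>_def)
 then have "- sqrt (\<Lambda> n) * K = u + - real n * pi * K/k" by (simp add: u_def algebra_simps)
 then have E: "exp (- sqrt (\<Lambda> n) * K) = exp u * exp (- real n * pi * K/k)" by (simp only: exp_add)
 have "r n = (1 + \<theta>) * exp u - 1" unfolding r_def \<theta>_def E by simp
 also have "... = (1 + \<theta>)*(exp u - 1) + \<theta>" by (simp add: algebra_simps)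
 finally have r: "r n = (1 + \<theta>)*(exp u - 1) + \<theta>" .
 have "\<bar>(1 + \<theta>)*(exp u - 1)\<bar> <= 2*(2 * \<bar>u\<bar>)"
 unfolding abs_mult using \<theta>1 exp_minus_one_bound[OF u] by (intro mult_mono) auto
 moreover have "\<bar>u\<bar> <= \<bar>K\<bar> * (c * \<rho> n)"
 proof -
 have "\<bar>e n\<bar> <= c * \<rho> n" using elim(5) \<rho>0[of n] by simp
 then have "\<bar>e n\<bar> * \<bar>K\<bar> <= c * \<rho> n * \<bar>K\<bar>" by (rule mult_right_mono) simp
 then show ?thesis by (simp add: u_def abs_mult mult_ac)
 qed
 ultimately have "\<bar>r n\<bar> <= 4*(\<bar>K\<bar> * (c * \<rho> n)) + 2 * \<bar>C\<bar> * c1 * \<rho> n"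
 unfolding r using \<theta>2 abs_triangle_ineq[of "(1 + \<theta>)*(exp u - 1)" \<theta>] by linarith
 then show ?case using \<rho>0[of n] by (simp add: algebra_simps)
 qed
 qed
 have "r \<in> O(\<rho>)" using ev by (rule bigoI)
 moreover have "\<sigma> (int n) = 2 * exp (- real n * pi * K/k)*(1 + r n)" for n by (simp add: r_def)
 ultimately show ?thesis unfolding \<rho>_def[abs_def] K_def k_def by (intro exI[of _ r] conjI always_eventually allI)
qed

end
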